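(* Let $\Omega\subset\mathbb{R}^2$ be a bounded Lipschitz domain, $\epsilon\in(0,1]$, $\bm f=(f_1,f_2,f_3)\in (L^2(\Omega))^3$, and let $\bm u_h=(p_h,n_h,\psi_h)$ be the piecewise linear finite element approximation, on the triangulation $\mathcal T_h$, of the solution of the steady-state Poisson-Nernst-Planck system with Dirichlet boundary conditions. Then there exists a constant $C_7$, independent of $\bm u_h$, $\bm f$ and $\epsilon$, such that $$\|\bm F(\bm u_h)\|_{-\epsilon,\Omega}\le C_7(\eta+\varepsilon),$$ where $\eta:=\big(\sum_{T\in\mathcal T_h}\eta_T^2+\sum_{E\in\mathcal I_h}\eta_E^2\big)^{1/2}$, $\varepsilon:=\big(\sum_{T\in\mathcal T_h}\varepsilon_T^2\big)^{1/2}$, and $$\eta_T^2:=h_T^2\epsilon^{-1}\Big(\|\nabla\cdot(p_h\nabla\psi_h)+f_{T,1}\|_{L^2(T)}^2+\|\nabla\cdot(n_h\nabla\psi_h)-f_{T,2}\|_{L^2(T)}^2+\|n_h-p_h-f_{T,3}\|_{L^2(T)}^2\Big),$$ $$\eta_E^2:=h_E\epsilon^{-1}\Big(\|[\nabla p_h\cdot\bm n_E]+[p_h\nabla\psi_h\cdot\bm n_E]\|_{L^2(E)}^2+\|[\nabla n_h\cdot\bm n_E]-[n_h\nabla\psi_h\cdot\bm n_E]\|_{L^2(E)}^2+\|[\nabla\psi_h\cdot\bm n_E]\|_{L^2(E)}^2\Big),$$ $$\varepsilon_T^2:=h_T^2\epsilon^{-1}\sum_{i=1}^3\|f_i-f_{T,i}\|_{L^2(T)}^2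 .$$
   Context: The steady-state Poisson-Nernst-Planck system is $-\Delta p-\nabla\cdot(p\nabla\psi)=f_1$, $-\Delta n+\nabla\cdot(n\nabla\psi)=f_2$, $-\epsilon\Delta\psi=p-n+f_3$ in $\Omega$, with Dirichlet boundary conditions. The nonlinear operator $\bm F$ is defined, for $\bm u=(p,n,\psi)$ and $\bm v=(v_1,v_2,v_3)\in (H_0^1(\Omega))^3$, by $$\langle \bm F(\bm u),\bm v\rangle=\int_\Omega\big(\nabla p\cdot\nabla v_1+p\nabla\psi\cdot\nabla v_1+\nabla n\cdot\nabla v_2-n\nabla\psi\cdot\nabla v_2+\epsilon\nabla\psi\cdot\nabla v_3-pv_3+nv_3-f_1v_1-f_2v_2-f_3v_3\big)\,d\bm x .$$ Discretization: $\mathcal T_h$ is a regular, quasi-uniform triangulation of $\Omega$ with mesh size $0<h<1$; $V_h=\{v\in H_0^1(\Omega): v|_T\in\mathcal P_1(T)\ \forall T\in\mathcal T_h\}$; $p_h,n_h,\psi_h\in H^1(\Omega)$ are piecewise $\mathcal P_1$ on $\mathcal T_h$ with the prescribed boundary values of $p,n,\psi$ on $\partial\Omega$, and $\langle\bm F(\bm u_h),\bm v_h\rangle=0$ for all $\bm v_h\in (V_h)^3$. Notation: $\mathcal I_h$ is the set of interior edges of $\mathcal T_h$ (edges not on $\partial\Omega$); $h_B$ is the diameter of a set $B$; $f_{T,i}=|T|^{-1}\int_T f_i\,d\bm x$ is the mean of $f_i$ over $T$, $|T|$ being the area of $T$. For an edge $E=T\cap T'$ with $\bm n_E$ the unit normal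 to $E$ outward from $T$, the jump of a piecewise defined vector field $\bm w$ is $[\bm w\cdot\bm n_E]=\bm w\cdot\bm n_E|_T-\bm w\cdot\bm n_E|_{T'}$. Norms: $\|\phi\|_{\epsilon,\Omega}=(\|\phi\|_{L^2(\Omega)}^2+\epsilon\|\nabla\phi\|_{L^2(\Omega)}^2)^{1/2}$ for scalar $\phi\in H^1(\Omega)$; for a triple, $\|\bm v\|_{\epsilon,\Omega}=(\sum_{i=1}^3\|v_i\|_{\epsilon,\Omega}^2)^{1/2}$; and for a functional $\bm G$ in the dual of $(H_0^1(\Omega))^3$, $\|\bm G\|_{-\epsilon,\Omega}=\sup_{\bm v\in (H_0^1(\Omega))^3\setminus\{0\}}|\langle\bm G,\bm v\rangle|/\|\bm v\|_{\epsilon,\Omega}$. *)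

theory Defs
  imports "HOL-Analysis.Analysis"
begin

type_synonym point = "real ^ 2"
type_synonym scalar_field = "real ^ 2 \<Rightarrow> real"
type_synonym vector_field = "real ^ 2 \<Rightarrow> real ^ 2"
type_synonym triple = "scalar_field \<times> scalar_field \<times> scalar_field"


section \<open>Lipschitz domains\<close>

text \<open>Near each boundary point, and after a rigid motion, the domain is the region strictly
  above the graph of a Lipschitz function.\<close>

definition lipschitz_domain :: "point set \<Rightarrow> bool" where
  "lipschitz_domain \<Omega> \<longleftrightarrow> open \<Omega> \<and> connected \<Omega> \<and> \<Omega> \<noteq> {} \<and>
     (\<forall>x\<in>frontier \<Omega>. \<exists>r>0. \<exists>Q :: point \<Rightarrow> point. \<exists>L. \<exists>\<gamma> :: real \<Rightarrow> real.
        orthogonal_transformation Q \<and> L-lipschitz_on UNIV \<gamma> \<and>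
        \<Omega> \<inter> ball x r = {y \<in> ball x r. Q (y - x) $ 2 > \<gamma> (Q (y - x) $ 1)})"


section \<open>Classical derivatives\<close>

text \<open>Derivatives are taken within a set \<open>S\<close>. For a nondegenerate triangle \<open>S\<close> they are uniquely
  determined at every point of \<open>S\<close>, boundary included, and there they are the one-sided traces
  from \<open>S\<close>; for \<open>S = UNIV\<close> they are the usual ones.\<close>

definition grad_on :: "point set \<Rightarrow> scalar_field \<Rightarrow> vector_field" where
  "grad_on S u x = (\<chi> i. frechet_derivative u (at x within S) (axis i 1))"

definition div_on :: "point set \<Rightarrow> vector_field \<Rightarrow> scalar_field" where
  "div_on S w x = (\<Sum>i\<in>UNIV. frechet_derivative w (at x within S) (axis i 1) $ i)"

primrec C_k :: "nat \<Rightarrow> scalar_field \<Rightarrow> bool" where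
  "C_k 0 u \<longleftrightarrow> continuous_on UNIV u"
| "C_k (Suc k) u \<longleftrightarrow> (\<forall>x. u differentiable (at x)) \<and> (\<forall>i. C_k k (\<lambda>x. grad_on UNIV u x $ i))"

definition test_functions :: "point set \<Rightarrow> scalar_field set" where
  "test_functions \<Omega> = {\<phi>. (\<forall>k. C_k k \<phi>) \<and>
     compact (closure {x. \<phi> x \<noteq> 0}) \<and> closure {x. \<phi> x \<noteq> 0} \<subseteq> \<Omega>}"


section \<open>Sobolev spaces\<close>

text \<open>Elements are represented by functions on the whole plane; only their values on \<open>\<Omega>\<close>, up to
  null sets, matter.\<close>

definition L2 :: "point set \<Rightarrow> scalar_field set" where
  "L2 \<Omega> = {u. u \<in> borel_measurable (lebesgue_on \<Omega>) \<and> integrable (lebesgue_on \<Omega>) (\<lambda>x. (u x)\<^sup>2)}"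

definition L2_norm_sq :: "point set \<Rightarrow> scalar_field \<Rightarrow> real" where
  "L2_norm_sq S u = (LINT x|lebesgue_on S. (u x)\<^sup>2)"

definition is_weak_grad :: "point set \<Rightarrow> scalar_field \<Rightarrow> vector_field \<Rightarrow> bool" where
  "is_weak_grad \<Omega> u g \<longleftrightarrow> (\<forall>i. (\<lambda>x. g x $ i) \<in> L2 \<Omega>) \<and>
     (\<forall>\<phi>\<in>test_functions \<Omega>. \<forall>i.
        (LINT x|lebesgue_on \<Omega>. u x * grad_on UNIV \<phi> x $ i) =
        - (LINT x|lebesgue_on \<Omega>. g x $ i * \<phi> x))"

definition H1 :: "point set \<Rightarrow> scalar_field set" where
  "H1 \<Omega> = {u \<in> L2 \<Omega>. \<exists>g. is_weak_grad \<Omega> u g}"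

text \<open>The weak gradient is determined almost everywhere on \<open>\<Omega>\<close>; this picks a representative.\<close>

definition weak_grad :: "point set \<Rightarrow> scalar_field \<Rightarrow> vector_field" where
  "weak_grad \<Omega> u = (SOME g. is_weak_grad \<Omega> u g)"

definition norm_eps :: "real \<Rightarrow> point set \<Rightarrow> scalar_field \<Rightarrow> real" where
  "norm_eps \<epsilon> \<Omega> u =
     sqrt (L2_norm_sq \<Omega> u + \<epsilon> * (LINT x|lebesgue_on \<Omega>. (norm (weak_grad \<Omega> u x))\<^sup>2))"

text \<open>The closure of the test functions in the \<open>H\<^sup>1\<close> norm, which is \<^term>\<open>norm_eps 1 \<Omega>\<close>.\<close>

definition H10 :: "point set \<Rightarrow> scalar_field set" where
  "H10 \<Omega> = {v \<in> H1 \<Omega>. \<forall>e>0. \<exists>\<phi>\<in>test_functions \<Omega>. norm_eps 1 \<Omega> (\<lambda>x. v x - \<phi> x) < e}"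

definition same_boundary_values :: "point set \<Rightarrow> scalar_field \<Rightarrow> scalar_field \<Rightarrow> bool" where
  "same_boundary_values \<Omega> u g \<longleftrightarrow> (\<lambda>x. u x - g x) \<in> H10 \<Omega>"

fun norm_eps3 :: "real \<Rightarrow> point set \<Rightarrow> triple \<Rightarrow> real" where
  "norm_eps3 \<epsilon> \<Omega> (v1, v2, v3) =
     sqrt ((norm_eps \<epsilon> \<Omega> v1)\<^sup>2 + (norm_eps \<epsilon> \<Omega> v2)\<^sup>2 + (norm_eps \<epsilon> \<Omega> v3)\<^sup>2)"

text \<open>Being the zero element of \<open>(H\<^sup>1\<^sub>0)\<^sup>3\<close> means vanishing almost everywhere.\<close>

fun is_zero3 :: "point set \<Rightarrow> triple \<Rightarrow> bool" where
  "is_zero3 \<Omega> (v1, v2, v3) \<longleftrightarrow> (AE x in lebesgue_on \<Omega>. v1 x = 0 \<and> v2 x = 0 \<and> v3 x = 0)"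

text \<open>Extended real valued, so that a bound by a real number asserts boundedness of the functional.\<close>

definition dual_norm_eps :: "real \<Rightarrow> point set \<Rightarrow> (triple \<Rightarrow> real) \<Rightarrow> ereal" where
  "dual_norm_eps \<epsilon> \<Omega> G =
     (SUP v\<in>{v \<in> H10 \<Omega> \<times> H10 \<Omega> \<times> H10 \<Omega>. \<not> is_zero3 \<Omega> v}. ereal (\<bar>G v\<bar> / norm_eps3 \<epsilon> \<Omega> v))"


section \<open>The Poisson-Nernst-Planck operator\<close>

fun pnp_integrand :: "real \<Rightarrow> point set \<Rightarrow> triple \<Rightarrow> triple \<Rightarrow> triple \<Rightarrow> scalar_field" where
  "pnp_integrand \<epsilon> \<Omega> (f1, f2, f3) (p, n, \<psi>) (v1, v2, v3) x =
     weak_grad \<Omega> p x \<bullet> weak_grad \<Omega> v1 x + p x * (weak_grad \<Omega> \<psi> x \<bullet> weak_grad \<Omega> v1 x)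
     + weak_grad \<Omega> n x \<bullet> weak_grad \<Omega> v2 x - n x * (weak_grad \<Omega> \<psi> x \<bullet> weak_grad \<Omega> v2 x)
     + \<epsilon> * (weak_grad \<Omega> \<psi> x \<bullet> weak_grad \<Omega> v3 x) - p x * v3 x + n x * v3 x
     - f1 x * v1 x - f2 x * v2 x - f3 x * v3 x"

definition pnp_operator :: "real \<Rightarrow> point set \<Rightarrow> triple \<Rightarrow> triple \<Rightarrow> triple \<Rightarrow> real" where
  "pnp_operator \<epsilon> \<Omega> f u v = (LINT x|lebesgue_on \<Omega>. pnp_integrand \<epsilon> \<Omega> f u v x)"

fun same_boundary_values3 :: "point set \<Rightarrow> triple \<Rightarrow> triple \<Rightarrow> bool" where
  "same_boundary_values3 \<Omega> (p, n, \<psi>) (g1, g2, g3) \<longleftrightarrow>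
     same_boundary_values \<Omega> p g1 \<and> same_boundary_values \<Omega> n g2 \<and> same_boundary_values \<Omega> \<psi> g3"

text \<open>For \<open>p, \<psi>, v \<in> H\<^sup>1\<close> the product \<open>p \<nabla>\<psi> \<bullet> \<nabla>v\<close> need not be integrable. Integrability is therefore
  demanded of a weak solution: the Bochner integral of a non-integrable function is \<open>0\<close> by
  convention. The Dirichlet data are given by extensions \<open>g\<close> to \<open>\<Omega>\<close>.\<close>

definition pnp_weak_solution :: "real \<Rightarrow> point set \<Rightarrow> triple \<Rightarrow> triple \<Rightarrow> triple \<Rightarrow> bool" where
  "pnp_weak_solution \<epsilon> \<Omega> f g u \<longleftrightarrow>
     u \<in> H1 \<Omega> \<times> H1 \<Omega> \<times> H1 \<Omega> \<and> same_boundary_values3 \<Omega> u g \<and>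
     (\<forall>v \<in> H10 \<Omega> \<times> H10 \<Omega> \<times> H10 \<Omega>.
        integrable (lebesgue_on \<Omega>) (pnp_integrand \<epsilon> \<Omega> f u v) \<and> pnp_operator \<epsilon> \<Omega> f u v = 0)"


section \<open>Triangulations\<close>

definition mesh_of :: "point set \<Rightarrow> point set set \<Rightarrow> bool" where
  "mesh_of \<Omega> \<T> \<longleftrightarrow> triangulation \<T> \<and> (\<forall>T\<in>\<T>. 2 simplex T) \<and> \<Union>\<T> = closure \<Omega>"

definition mesh_size :: "point set set \<Rightarrow> real" where
  "mesh_size \<T> = Max (diameter ` \<T>)"

definition inball_diameter :: "point set \<Rightarrow> real" where
  "inball_diameter T = 2 * Sup {r. \<exists>x. cball x r \<subseteq> T}"

definition shape_regular :: "real \<Rightarrow> point set set \<Rightarrow> bool" where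
  "shape_regular \<sigma> \<T> \<longleftrightarrow> (\<forall>T\<in>\<T>. diameter T \<le> \<sigma> * inball_diameter T)"

definition quasi_uniform :: "real \<Rightarrow> point set set \<Rightarrow> bool" where
  "quasi_uniform \<tau> \<T> \<longleftrightarrow> (\<forall>T\<in>\<T>. mesh_size \<T> \<le> \<tau> * diameter T)"

definition interior_edges :: "point set \<Rightarrow> point set set \<Rightarrow> point set set" where
  "interior_edges \<Omega> \<T> = {E. (\<exists>T\<in>\<T>. E edge_of T) \<and> \<not> E \<subseteq> frontier \<Omega>}"

text \<open>Outwardness is expressed by \<open>T\<close> lying in the half plane below \<open>E\<close>; since \<open>E \<subseteq> T\<close>, this
  includes orthogonality to \<open>E\<close>.\<close>

definition outer_normal :: "point set \<Rightarrow> point set \<Rightarrow> point" where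
  "outer_normal T E = (THE \<nu>. norm \<nu> = 1 \<and> (\<forall>x\<in>E. \<forall>y\<in>T. \<nu> \<bullet> (y - x) \<le> 0))"

text \<open>A piecewise vector field is given by its one-sided version \<open>w T\<close> on each triangle \<open>T\<close>. The
  jump does not depend on the order in which the two triangles are chosen.\<close>

definition jump :: "point set set \<Rightarrow> point set \<Rightarrow> (point set \<Rightarrow> vector_field) \<Rightarrow> scalar_field" where
  "jump \<T> E w x =
     (let (T, T') = (SOME (T, T'). T \<in> \<T> \<and> T' \<in> \<T> \<and> T \<noteq> T' \<and> E = T \<inter> T')
      in w T x \<bullet> outer_normal T E - w T' x \<bullet> outer_normal T E)"

text \<open>Squared \<open>L\<^sup>2\<close> norm with respect to arc length on a segment, via a linear parametrisation;
  it does not depend on the order of the end points.\<close>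

definition edge_norm_sq :: "point set \<Rightarrow> scalar_field \<Rightarrow> real" where
  "edge_norm_sq E u =
     (let (a, b) = (SOME (a, b). E = closed_segment a b)
      in dist a b * (LINT t|lebesgue_on {0..1}. (u (linepath a b t))\<^sup>2))"


section \<open>Finite element approximation\<close>

definition piecewise_P1 :: "point set set \<Rightarrow> scalar_field \<Rightarrow> bool" where
  "piecewise_P1 \<T> v \<longleftrightarrow> (\<forall>T\<in>\<T>. \<exists>a b. \<forall>x\<in>T. v x = a + b \<bullet> x)"

definition V_h :: "point set \<Rightarrow> point set set \<Rightarrow> scalar_field set" where
  "V_h \<Omega> \<T> = {v \<in> H10 \<Omega>. piecewise_P1 \<T> v}"

definition S_h :: "point set \<Rightarrow> point set set \<Rightarrow> scalar_field set" where
  "S_h \<Omega> \<T> = {v \<in> H1 \<Omega>. piecewise_P1 \<T> v}"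

definition pnp_fem_solution ::
    "real \<Rightarrow> point set \<Rightarrow> point set set \<Rightarrow> triple \<Rightarrow> triple \<Rightarrow> triple \<Rightarrow> bool" where
  "pnp_fem_solution \<epsilon> \<Omega> \<T> f g u\<^sub>h \<longleftrightarrow>
     u\<^sub>h \<in> S_h \<Omega> \<T> \<times> S_h \<Omega> \<T> \<times> S_h \<Omega> \<T> \<and> same_boundary_values3 \<Omega> u\<^sub>h g \<and>
     (\<forall>v\<^sub>h \<in> V_h \<Omega> \<T> \<times> V_h \<Omega> \<T> \<times> V_h \<Omega> \<T>. pnp_operator \<epsilon> \<Omega> f u\<^sub>h v\<^sub>h = 0)"


section \<open>The a posteriori estimator\<close>

definition mean_on :: "point set \<Rightarrow> scalar_field \<Rightarrow> real" where
  "mean_on T f = (LINT x|lebesgue_on T. f x) / measure lebesgue T"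

fun eta_elem_sq :: "real \<Rightarrow> triple \<Rightarrow> triple \<Rightarrow> point set \<Rightarrow> real" where
  "eta_elem_sq \<epsilon> (f1, f2, f3) (p, n, \<psi>) T = (diameter T)\<^sup>2 * inverse \<epsilon> *
     (L2_norm_sq T (\<lambda>x. div_on T (\<lambda>y. p y *\<^sub>R grad_on T \<psi> y) x + mean_on T f1)
      + L2_norm_sq T (\<lambda>x. div_on T (\<lambda>y. n y *\<^sub>R grad_on T \<psi> y) x - mean_on T f2)
      + L2_norm_sq T (\<lambda>x. n x - p x - mean_on T f3))"

fun eta_edge_sq :: "real \<Rightarrow> point set set \<Rightarrow> triple \<Rightarrow> point set \<Rightarrow> real" where
  "eta_edge_sq \<epsilon> \<T> (p, n, \<psi>) E = diameter E * inverse \<epsilon> *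
     (edge_norm_sq E (\<lambda>x. jump \<T> E (\<lambda>T. grad_on T p) x
                          + jump \<T> E (\<lambda>T y. p y *\<^sub>R grad_on T \<psi> y) x)
      + edge_norm_sq E (\<lambda>x. jump \<T> E (\<lambda>T. grad_on T n) x
                            - jump \<T> E (\<lambda>T y. n y *\<^sub>R grad_on T \<psi> y) x)
      + edge_norm_sq E (jump \<T> E (\<lambda>T. grad_on T \<psi>)))"

fun osc_elem_sq :: "real \<Rightarrow> triple \<Rightarrow> point set \<Rightarrow> real" where
  "osc_elem_sq \<epsilon> (f1, f2, f3) T = (diameter T)\<^sup>2 * inverse \<epsilon> *
     (L2_norm_sq T (\<lambda>x. f1 x - mean_on T f1)
      + L2_norm_sq T (\<lambda>x. f2 x - mean_on T f2)
      + L2_norm_sq T (\<lambda>x. f3 x - mean_on T f3))"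

definition estimator :: "real \<Rightarrow> point set \<Rightarrow> point set set \<Rightarrow> triple \<Rightarrow> triple \<Rightarrow> real" where
  "estimator \<epsilon> \<Omega> \<T> f u\<^sub>h =
     sqrt ((\<Sum>T\<in>\<T>. eta_elem_sq \<epsilon> f u\<^sub>h T) + (\<Sum>E\<in>interior_edges \<Omega> \<T>. eta_edge_sq \<epsilon> \<T> u\<^sub>h E))"

definition oscillation :: "real \<Rightarrow> point set set \<Rightarrow> triple \<Rightarrow> real" where
  "oscillation \<epsilon> \<T> f = sqrt (\<Sum>T\<in>\<T>. osc_elem_sq \<epsilon> f T)"

end

theory Submission imports Defs begin

text \<open>By density it suffices to test the residual with smooth \<open>\<phi>\<close> of compact support in \<open>\<Omega>\<close>.
  Galerkin orthogonality allows replacing \<open>\<phi>\<close> by \<open>\<phi> - v\<close>, where \<open>v\<close> is the piecewise linear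
  function with nodal value at a vertex \<open>z\<close> a suitable constant approximating \<open>\<phi>\<close> on the ball of
  radius \<open>h\<close> about \<open>z\<close>, and \<open>0\<close> at boundary vertices. Integration by parts on each triangle
  turns the residual into element residuals and edge jumps, weighted by \<open>\<phi> - v\<close>.

  Because \<open>\<phi>\<close>, extended by zero, is smooth on the whole plane, the approximation of \<open>\<phi>\<close> by
  constants only needs a Poincare inequality on balls, which are not required to lie in \<open>\<Omega>\<close>. At a
  boundary vertex the Lipschitz property provides an exterior ball of comparable radius, where \<open>\<phi>\<close>
  vanishes, so that \<open>0\<close> is an admissible constant. The balls overlap finitely often because every
  triangle has area at least a constant times \<open>h\<^sup>2\<close>.\<close>

section \<open>Integration over triangles\<close>

text \<open>All three equations are instances of one scalar residual
  \<open>\<integral> A \<bullet> \<nabla>v + B v\<close>. On a triangle the discrete functions are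
  affine, so the flux \<open>A\<close> is an affine field there and its divergence a constant; this
  also makes the product \<open>p \<nabla>\<psi>\<close> bounded, although for general functions in
  \<open>H1\<close> it would not be square integrable. The gradient \<open>weak_grad\<close> is a
  chosen representative, so every statement about it passes through almost everywhere uniqueness.
  Conversely, the interpolant is only Lipschitz and has to be recognised as a limit of test
  functions before orthogonality can be applied to it. Nodal constants are values of \<phi> at a
  well chosen point, not averages. The Poincare inequality produces such a point inside any
  prescribed subset of substantial area, and this is what lets boundary vertices be treated like the
  others: the subset is the exterior ball, where the value is 0. The factor
  \<open>inverse \<epsilon>\<close> in the estimator turns into \<open>sqrt \<epsilon>\<close> in
  front of the gradient norm of the test function, which \<open>norm_eps\<close> dominates. All
  constants are functions of \<sigma>, \<tau> and \<kappa>.\<close>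

definition cross2 :: "real^2 \<Rightarrow> real^2 \<Rightarrow> real" where
  "cross2 u v = u$1 * v$2 - u$2 * v$1"

text \<open>Links the plane \<open>real^2\<close> with the product measure on pairs, which makes
  Fubini available. Since \<open>lborel\<close> is characterised by its values on boxes, comparing
  boxes is enough.\<close>

lemma lborel_vector2: "distr lborel borel (\<lambda>(s, t). vector [s, t]) = (lborel :: (real^2) measure)"
proof (rule sym, rule lborel_eqI)
  fix l u :: "real^2"
  assume le: "\<And>b. b \<in> Basis \<Longrightarrow> l \<bullet> b \<le> u \<bullet> b"
  have le': "l $ 1 \<le> u $ 1" "l $ 2 \<le> u $ 2"
    using le[of "axis 1 1"] le[of "axis 2 1"] by (auto simp: inner_axis Basis_vec_def)
  have "continuous_on UNIV (\<lambda>(s::real, t). (vector [s, t] :: real^2))"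
    by (subst continuous_on_componentwise)
      (auto simp: Basis_vec_def inner_axis UNIV_2 split_beta vector_2 intro!: continuous_intros)
  then have [measurable]: "(\<lambda>(s::real, t). (vector [s, t] :: real^2)) \<in> borel_measurable borel"
    by (rule borel_measurable_continuous_onI)
  have eq: "(\<lambda>(s::real, t). (vector [s, t] :: real^2)) -` box l u = box (l$1, l$2) (u$1, u$2)"
    unfolding set_eq_iff vimage_eq
    by (simp add: split_paired_all mem_box_cart forall_2 vector_2) (auto simp: mem_box Basis_prod_def)
  show "emeasure (distr lborel borel (\<lambda>(s, t). vector [s, t])) (box l u) = (\<Prod>b\<in>Basis. (u - l) \<bullet> b)"
    using le' by (simp add: emeasure_distr eq emeasure_lborel_box_eq Basis_prod_def)
      (auto simp: Basis_vec_def UNIV_2 inner_axis axis_eq_axis ennreal_mult)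
qed simp

text \<open>Affine change of variables, again compared on boxes: up to a translation a box is the
  image of its coordinate set \<open>S\<close> under a linear map whose determinant is
  \<open>cross2 u v\<close>.\<close>

lemma lborel_affine_plane:
  fixes a u v :: "real^2"
  assumes D: "cross2 u v \<noteq> 0"
  shows "lborel = density (distr lborel borel (\<lambda>(s, t). a + s *\<^sub>R u + t *\<^sub>R v)) (\<lambda>_. ennreal \<bar>cross2 u v\<bar>)"
proof (rule lborel_eqI)
  fix l w :: "real^2"
  assume le: "\<And>b. b \<in> Basis \<Longrightarrow> l \<bullet> b \<le> w \<bullet> b"
  define f :: "real^2 \<Rightarrow> real^2" where "f x = x$1 *\<^sub>R u + x$2 *\<^sub>R v" for x
  \<comment> \<open>Cramer's rule, giving the inverse of \<open>f\<close>.\<close>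
  define g :: "real^2 \<Rightarrow> real^2" where
    "g y = vector [cross2 y v / cross2 u v, cross2 u y / cross2 u v]" for y
  define S where "S = g ` ((+) (- a) ` box l w)"
  have lf: "linear f"
    by (rule linearI) (auto simp: f_def algebra_simps)
  have lg: "linear g"
    using D by (intro linearI) (simp_all add: g_def vec_eq_iff forall_2 vector_2 cross2_def divide_simps, simp_all add: algebra_simps)
  have fg: "f (g y) = y" for y
    using D by (simp add: f_def g_def vec_eq_iff forall_2 vector_2 cross2_def divide_simps)
      (simp add: algebra_simps)
  have gf: "g (f y) = y" for y
    using D by (simp add: f_def g_def vec_eq_iff forall_2 vector_2 cross2_def divide_simps)
      (simp add: algebra_simps)
  have Sm: "S \<in> lmeasurable"
    unfolding S_def by (intro measurable_linear_image lg measurable_translation) auto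
  have det: "det (matrix f) = cross2 u v"
    by (simp add: det_2 matrix_def f_def cross2_def axis_def)
  have "f ` S = (+) (- a) ` box l w"
    unfolding S_def image_image fg by simp
  then have m: "measure lebesgue (box l w) = \<bar>cross2 u v\<bar> * measure lebesgue S"
    using measure_linear_image[OF lf Sm] by (simp add: det measure_translation del: add_uminus_conv_diff uminus_add_conv_diff)
  define h where "h = (\<lambda>(s, t). a + s *\<^sub>R u + t *\<^sub>R v)"
  have [measurable]: "h \<in> borel_measurable borel"
    unfolding h_def split_beta by (intro borel_measurable_continuous_onI continuous_intros)
  have Veq: "h x = a + f (case x of (s,t) \<Rightarrow> vector [s,t])" for x
    by (auto simp: h_def f_def vector_2 split: prod.splits)
  have So: "S = {x. a + f x \<in> box l w}"
    unfolding S_def by (auto simp: image_iff fg) (metis add.commute diff_add_cancel gf uminus_add_conv_diff)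
  have contf: "continuous_on UNIV f" using lf linear_continuous_on linear_linear by blast
  then have "open S" unfolding So
    by (intro open_vimage[of "box l w" "\<lambda>x. a + f x", unfolded vimage_def] continuous_intros contf) auto
  then have Sb [measurable]: "S \<in> sets borel" by auto
  have "continuous_on UNIV (\<lambda>(s::real, t). (vector [s, t] :: real^2))"
    by (subst continuous_on_componentwise)
      (auto simp: Basis_vec_def inner_axis UNIV_2 split_beta vector_2 intro!: continuous_intros)
  then have Vm [measurable]: "(\<lambda>(s::real, t). (vector [s, t] :: real^2)) \<in> borel_measurable borel"
    by (rule borel_measurable_continuous_onI)
  have pre: "h -` box l w = (\<lambda>(s::real, t). (vector [s, t] :: real^2)) -` S"
    by (auto simp: So Veq)
  have "emeasure (distr lborel borel h) (box l w) = emeasure (distr lborel borel (\<lambda>(s::real, t). (vector [s, t] :: real^2))) S"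
    by (simp add: emeasure_distr pre)
  also have "\<dots> = ennreal (measure lebesgue S)"
    unfolding lborel_vector2 using Sm Sb
    using emeasure_eq_measure2[OF Sm] by simp
  finally have e: "emeasure (distr lborel borel h) (box l w) = ennreal (measure lebesgue S)" .
  have "(\<Prod>b\<in>Basis. (w - l) \<bullet> b) = measure lebesgue (box l w)"
    using le by (simp add: measure_lborel_box_eq)
  then show "emeasure (density (distr lborel borel (\<lambda>(s, t). a + s *\<^sub>R u + t *\<^sub>R v)) (\<lambda>_. ennreal \<bar>cross2 u v\<bar>)) (box l w)
      = (\<Prod>b\<in>Basis. (w - l) \<bullet> b)"
    unfolding h_def[symmetric] using e m
    by (simp add: emeasure_density nn_integral_cmult ennreal_mult)
qed simp

text \<open>An integral over the parameter, not over arc length: the factor \<open>dist a b\<close>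
  is left out because cross products with the edge vector already contain it.\<close>

definition seg_integral :: "(real^2 \<Rightarrow> real) \<Rightarrow> real^2 \<Rightarrow> real^2 \<Rightarrow> real" where
  "seg_integral g a b = (LINT t|lebesgue_on {0..1}. g (linepath a b t))"

lemma lebesgue_on_integral_lborel:
  fixes f :: "'a::euclidean_space \<Rightarrow> real"
  assumes "compact S" "continuous_on S f"
  shows "(LINT x|lebesgue_on S. f x) = (\<integral>x. indicator S x * f x \<partial>lborel)"
    and "integrable (lebesgue_on S) f"
proof -
  have b: "S \<in> sets borel" using assms(1) by (simp add: compact_imp_closed borel_closed)
  have m: "(\<lambda>x. indicator S x *\<^sub>R f x) \<in> borel_measurable borel"
    using assms(2) b by (rule borel_measurable_continuous_on_indicator[rotated])
  show "(LINT x|lebesgue_on S. f x) = (\<integral>x. indicator S x * f x \<partial>lborel)"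
    using b m by (simp add: integral_restrict_space integral_completion)
  show "integrable (lebesgue_on S) f"
    using borel_integrable_compact[OF assms] b m
    by (simp add: integrable_restrict_space integrable_completion)
qed

lemma integral_affine_plane:
  fixes F :: "real^2 \<Rightarrow> real"
  assumes D: "cross2 u v \<noteq> 0" and F: "F \<in> borel_measurable borel"
  shows "(\<integral>x. F x \<partial>lborel) = \<bar>cross2 u v\<bar> * (\<integral>p. F (a + fst p *\<^sub>R u + snd p *\<^sub>R v) \<partial>lborel)"
proof -
  have m: "(\<lambda>(s, t). a + s *\<^sub>R u + t *\<^sub>R v) \<in> borel_measurable (borel :: (real \<times> real) measure)"
    unfolding split_beta by (intro borel_measurable_continuous_onI continuous_intros)
  show ?thesis
    using F m
    by (subst lborel_affine_plane[OF D, of a])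
      (simp add: integral_density integral_distr split_beta)
qed

lemma triangle_coords:
  fixes a b c :: "real^2"
  assumes D: "cross2 (b - a) (c - a) \<noteq> 0"
  shows "a + s *\<^sub>R (b - a) + t *\<^sub>R (c - a) \<in> convex hull {a, b, c} \<longleftrightarrow> 0 \<le> s \<and> 0 \<le> t \<and> s + t \<le> 1"
proof
  assume "a + s *\<^sub>R (b - a) + t *\<^sub>R (c - a) \<in> convex hull {a, b, c}"
  then obtain s' t' where st: "0 \<le> s'" "0 \<le> t'" "s' + t' \<le> 1"
    and eq: "a + s *\<^sub>R (b - a) + t *\<^sub>R (c - a) = a + s' *\<^sub>R (b - a) + t' *\<^sub>R (c - a)"
    unfolding convex_hull_3_alt by auto
  define p q where "p = b - a" and "q = c - a"
  have eq': "s *\<^sub>R p + t *\<^sub>R q = s' *\<^sub>R p + t' *\<^sub>R q" using eq by (simp add: p_def q_def add.assoc)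
  have "cross2 (s *\<^sub>R p + t *\<^sub>R q) q = cross2 (s' *\<^sub>R p + t' *\<^sub>R q) q"
       "cross2 p (s *\<^sub>R p + t *\<^sub>R q) = cross2 p (s' *\<^sub>R p + t' *\<^sub>R q)"
    using eq' by auto
  then have "s * cross2 p q = s' * cross2 p q" "t * cross2 p q = t' * cross2 p q"
    by (auto simp: cross2_def algebra_simps)
  with D have "s = s'" "t = t'" by (auto simp: p_def q_def)
  with st show "0 \<le> s \<and> 0 \<le> t \<and> s + t \<le> 1" by auto
qed (auto simp: convex_hull_3_alt)

text \<open>Fubini in affine coordinates, then the fundamental theorem of calculus along the
  direction \<open>b - a\<close>. For fixed \<open>t\<close> the inner variable runs over
  \<open>{0..1 - t}\<close>, and its two ends trace the edges \<open>a c\<close> and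
  \<open>b c\<close>.\<close>

lemma triangle_derivative_integral:
  fixes a b c :: "real^2"
  assumes D: "cross2 (b - a) (c - a) \<noteq> 0"
    and g: "\<And>x. (g has_derivative g' x) (at x)"
    and cont: "continuous_on UNIV (\<lambda>x. g' x (b - a))"
  shows "(LINT x|lebesgue_on (convex hull {a, b, c}). g' x (b - a)) =
    \<bar>cross2 (b - a) (c - a)\<bar> * (seg_integral g b c - seg_integral g a c)"
proof -
  let ?T = "convex hull {a, b, c}"
  define P where "P s t = a + s *\<^sub>R (b - a) + t *\<^sub>R (c - a)" for s t
  define f where "f x = g' x (b - a)" for x
  define S where "S = {p :: real \<times> real. 0 \<le> fst p \<and> 0 \<le> snd p \<and> fst p + snd p \<le> 1}"
  have contg: "continuous_on UNIV g"
    using g has_derivative_continuous continuous_on_eq_continuous_within by fastforce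
  have contf: "continuous_on A f" for A using cont continuous_on_subset unfolding f_def by blast
  have cT: "compact ?T" by (simp add: compact_convex_hull)
  have cS: "compact S"
  proof -
    have "closed S" unfolding S_def by (intro closed_Collect_conj closed_Collect_le continuous_intros)
    moreover have "S \<subseteq> cbox (0,0) (1,1)" by (auto simp: S_def mem_box Basis_prod_def)
    ultimately show ?thesis using compact_eq_bounded_closed bounded_subset bounded_cbox by metis
  qed
  have "(LINT x|lebesgue_on ?T. f x) = (\<integral>x. indicator ?T x * f x \<partial>lborel)"
    by (rule lebesgue_on_integral_lborel[OF cT contf])
  also have "\<dots> = \<bar>cross2 (b - a) (c - a)\<bar> * (\<integral>p. indicator ?T (P (fst p) (snd p)) * f (P (fst p) (snd p)) \<partial>lborel)"
    unfolding P_def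
  proof (rule integral_affine_plane[OF D])
    show "(\<lambda>x. indicator ?T x * f x) \<in> borel_measurable borel"
      using borel_measurable_continuous_on_indicator[OF _ contf, of ?T] cT
      by (simp add: compact_imp_closed borel_closed)
  qed
  also have "(\<lambda>p. indicator ?T (P (fst p) (snd p)) * f (P (fst p) (snd p)))
     = (\<lambda>p. indicator S p *\<^sub>R f (P (fst p) (snd p)))"
    using triangle_coords[OF D] by (auto simp: fun_eq_iff P_def S_def indicator_def)
  also have "(\<integral>p. indicator S p *\<^sub>R f (P (fst p) (snd p)) \<partial>lborel)
      = (\<integral>t. (\<integral>s. indicator S (s, t) *\<^sub>R f (P s t) \<partial>lborel) \<partial>lborel)"
  proof -
    have "integrable lborel (\<lambda>p. indicator S p *\<^sub>R f (P (fst p) (snd p)))"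
      unfolding P_def
      by (intro borel_integrable_compact cS continuous_on_compose2[OF contf[of UNIV]] continuous_intros) auto
    then have "integrable (lborel \<Otimes>\<^sub>M lborel) (case_prod (\<lambda>s t. indicator S (s, t) *\<^sub>R f (P s t)))"
      by (simp add: lborel_prod case_prod_unfold)
    from lborel_pair.integral_snd[OF this] show ?thesis
      by (simp add: lborel_prod case_prod_unfold)
  qed
  also have "\<dots> = (\<integral>t. indicator {0..1} t * (g (linepath b c t) - g (linepath a c t)) \<partial>lborel)"
  proof (rule Bochner_Integration.integral_cong[OF refl])
    fix t :: real
    show "(\<integral>s. indicator S (s, t) *\<^sub>R f (P s t) \<partial>lborel) = indicator {0..1} t * (g (linepath b c t) - g (linepath a c t))"
    proof (cases "t \<in> {0..1}")
      case True
      have "(\<integral>s. indicator S (s, t) *\<^sub>R f (P s t) \<partial>lborel) = (\<integral>s. f (P s t) * indicator {0..1 - t} s \<partial>lborel)"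
        using True by (intro Bochner_Integration.integral_cong) (auto simp: S_def indicator_def)
      also have "\<dots> = g (P (1 - t) t) - g (P 0 t)"
      proof (rule integral_FTC_Icc_real)
        show "0 \<le> 1 - t" using True by auto
        fix s
        have "((\<lambda>s. g (P s t)) has_derivative (\<lambda>h. g' (P s t) (h *\<^sub>R (b - a)))) (at s)"
          unfolding P_def by (rule has_derivative_compose[OF _ g, unfolded o_def]) (auto intro!: derivative_eq_intros)
        moreover have "(\<lambda>h. g' (P s t) (h *\<^sub>R (b - a))) = (\<lambda>h. f (P s t) * h)"
          using g[of "P s t"] by (simp add: f_def has_derivative_linear linear_cmul fun_eq_iff)
        ultimately show "((\<lambda>s. g (P s t)) has_real_derivative f (P s t)) (at s)"
          unfolding has_field_derivative_def by simp
        show "isCont (\<lambda>s. f (P s t)) s"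
        proof -
          have "continuous_on UNIV (\<lambda>s. f (P s t))"
            unfolding P_def by (intro continuous_on_compose2[OF contf[of UNIV]] continuous_intros) auto
          then show ?thesis by (simp add: continuous_on_eq_continuous_at)
        qed
      qed
      also have "P (1 - t) t = linepath b c t" by (simp add: P_def linepath_def algebra_simps)
      also have "P 0 t = linepath a c t" by (simp add: P_def linepath_def algebra_simps)
      finally show ?thesis using True by simp
    next
      case False
      then have "indicator S (s, t) = (0::real)" for s by (auto simp: S_def)
      with False show ?thesis by simp
    qed
  qed
  also have "\<dots> = (LINT t|lebesgue_on {0..1}. g (linepath b c t) - g (linepath a c t))"
    by (intro lebesgue_on_integral_lborel(1)[symmetric] continuous_intros continuous_on_compose2[OF contg]) auto
  also have "\<dots> = seg_integral g b c - seg_integral g a c"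
    unfolding seg_integral_def
    by (intro Bochner_Integration.integral_diff lebesgue_on_integral_lborel(2) continuous_on_compose2[OF contg] continuous_intros) auto
  finally show ?thesis unfolding f_def .
qed

lemma seg_integral_swap: "seg_integral g a b = seg_integral g b a"
proof -
  have "(LINT t|lebesgue_on {0..1::real}. f t) = (LINT t|lebesgue_on {0..1}. f (1 - t))" for f :: "real \<Rightarrow> real"
  proof -
    have "(LINT t|lebesgue_on {0..1}. f t) = (\<integral>t. indicator {0..1} t * f t \<partial>lebesgue)"
      by (subst integral_restrict_space) auto
    also have "\<dots> = (\<integral>t. indicator {0..1} (1 - t) * f (1 - t) \<partial>lebesgue)"
      using lebesgue_integral_real_affine[of "-1" "\<lambda>t. indicator {0..1} t * f t" 1] by simp
    also have "\<dots> = (\<integral>t. indicator {0..1} t * f (1 - t) \<partial>lebesgue)"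
      by (intro Bochner_Integration.integral_cong) (auto simp: indicator_def)
    also have "\<dots> = (LINT t|lebesgue_on {0..1}. f (1 - t))"
      by (subst integral_restrict_space) auto
    finally show ?thesis .
  qed
  from this[of "\<lambda>t. g (linepath a b t)"] show ?thesis
    unfolding seg_integral_def by (simp add: linepath_def algebra_simps)
qed

lemma has_derivative_continuous_on_UNIV:
  assumes "\<And>x. (f has_derivative f' x) (at x)"
  shows "continuous_on A f"
  by (rule continuous_at_imp_continuous_on) (auto intro: has_derivative_continuous[OF assms])

lemma seg_integral_cong:
  assumes "\<And>x. x \<in> closed_segment a b \<Longrightarrow> f x = g x"
  shows "seg_integral f a b = seg_integral g a b"
  unfolding seg_integral_def
proof (rule Bochner_Integration.integral_cong[OF refl])
  fix t assume "t \<in> space (lebesgue_on {0..1::real})"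
  then show "f (linepath a b t) = g (linepath a b t)" by (intro assms linepath_in_path) simp
qed

lemma seg_integral_integrable:
  "continuous_on UNIV g \<Longrightarrow> integrable (lebesgue_on {0..1}) (\<lambda>t. g (linepath a b t) :: real)"
  by (rule lebesgue_on_integral_lborel(2))
    (rule compact_Icc, rule continuous_on_compose2[of UNIV g], auto simp: linepath_def intro!: continuous_intros)

lemma seg_integral_add:
  assumes "continuous_on UNIV f" "continuous_on UNIV g"
  shows "seg_integral (\<lambda>x. f x + g x) a b = seg_integral f a b + seg_integral g a b"
  unfolding seg_integral_def
  by (intro Bochner_Integration.integral_add seg_integral_integrable assms)

lemma seg_integral_cmult: "seg_integral (\<lambda>x. c * f x) a b = c * seg_integral f a b"
  unfolding seg_integral_def by simp

lemma seg_integral_zero: "(\<And>x. x \<in> closed_segment a b \<Longrightarrow> f x = 0) \<Longrightarrow> seg_integral f a b = 0"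
  using seg_integral_cong[of a b f "\<lambda>_. 0"] by (simp add: seg_integral_def)

text \<open>The trace is the infinitesimal change of the area form. Used to rewrite a divergence
  through derivatives along two edge directions instead of the coordinate axes.\<close>

lemma trace_cross2:
  assumes "linear M"
  shows "cross2 (M u) v + cross2 u (M v) = (\<Sum>i\<in>UNIV. M (axis i 1) $ i) * cross2 u v"
proof -
  have "M x = x$1 *\<^sub>R M (axis 1 1) + x$2 *\<^sub>R M (axis 2 1)" for x
  proof -
    have "x = x$1 *\<^sub>R axis 1 1 + x$2 *\<^sub>R axis 2 1"
      by (simp add: vec_eq_iff forall_2 axis_def)
    from arg_cong[OF this, of M] show ?thesis
      by (simp only: linear_add[OF assms] linear_cmul[OF assms])
  qed
  from this[of u] this[of v] show ?thesis
    by (simp add: cross2_def sum_2 algebra_simps)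
qed

text \<open>By \<open>trace_cross2\<close>, the determinant times the divergence is a derivative
  along \<open>b - a\<close> plus a derivative along \<open>c - a\<close>, and
  \<open>triangle_derivative_integral\<close> integrates each. The boundary densities pair
  \<open>W\<close> with the rotated edge vectors, so the orientation of the triangle enters as a
  sign.\<close>

lemma divergence_triangle:
  fixes a b c :: "real^2"
  assumes D: "cross2 (b - a) (c - a) \<noteq> 0"
    and W: "\<And>x. (W has_derivative W' x) (at x)"
    and cont: "\<And>e. continuous_on UNIV (\<lambda>x. W' x e)"
  shows "(LINT x|lebesgue_on (convex hull {a, b, c}). (\<Sum>i\<in>UNIV. W' x (axis i 1) $ i)) =
    sgn (cross2 (b - a) (c - a)) *
      (seg_integral (\<lambda>x. cross2 (W x) (b - a)) a b
       + seg_integral (\<lambda>x. cross2 (W x) (c - b)) b c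
       + seg_integral (\<lambda>x. cross2 (W x) (a - c)) c a)"
proof -
  let ?D = "cross2 (b - a) (c - a)" and ?T = "convex hull {a, b, c}"
  have bl: "bounded_linear (\<lambda>x. cross2 x v)" "bounded_linear (\<lambda>x. cross2 v x)" for v
    unfolding cross2_def
    by (intro bounded_linear_sub bounded_linear_mult_const bounded_linear_const_mult bounded_linear_vec_nth)+
  have contW: "continuous_on UNIV W"
    by (rule has_derivative_continuous_on_UNIV[OF W])
  have cc: "continuous_on UNIV (\<lambda>x. cross2 (W x) v)" "continuous_on UNIV (\<lambda>x. cross2 v (W x))" for v
    unfolding cross2_def by (intro continuous_intros contW)+
  have cd: "continuous_on S (\<lambda>x. cross2 (W' x e) v)" "continuous_on S (\<lambda>x. cross2 v (W' x e))" for S e v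
    unfolding cross2_def by (intro continuous_intros continuous_on_subset[OF cont] subset_UNIV)+
  have cT: "compact ?T" by (simp add: compact_convex_hull)
  define \<alpha> where "\<alpha> x = cross2 (W x) (c - a)" for x
  define \<beta> where "\<beta> x = cross2 (b - a) (W x)" for x
  have 1: "(LINT x|lebesgue_on ?T. cross2 (W' x (b - a)) (c - a)) =
    \<bar>?D\<bar> * (seg_integral \<alpha> b c - seg_integral \<alpha> a c)"
  proof (rule triangle_derivative_integral[OF D, where g' = "\<lambda>x e. cross2 (W' x e) (c - a)"])
    show "(\<alpha> has_derivative (\<lambda>e. cross2 (W' x e) (c - a))) (at x)" for x
      unfolding \<alpha>_def using bounded_linear.has_derivative[OF bl(1) W] .
    show "continuous_on UNIV (\<lambda>x. cross2 (W' x (b - a)) (c - a))" by (rule cd)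
  qed
  have "cross2 (c - a) (b - a) = - ?D" by (simp add: cross2_def)
  with D have D': "cross2 (c - a) (b - a) \<noteq> 0" and Dabs: "\<bar>cross2 (c - a) (b - a)\<bar> = \<bar>?D\<bar>"
    by auto
  \<comment> \<open>The second direction is the same lemma with \<open>b\<close> and
    \<open>c\<close> exchanged, which only flips the sign of the determinant.\<close>
  have 2: "(LINT x|lebesgue_on (convex hull {a, c, b}). cross2 (b - a) (W' x (c - a))) =
    \<bar>cross2 (c - a) (b - a)\<bar> * (seg_integral \<beta> c b - seg_integral \<beta> a b)"
  proof (rule triangle_derivative_integral[OF D', where g' = "\<lambda>x e. cross2 (b - a) (W' x e)"])
    show "(\<beta> has_derivative (\<lambda>e. cross2 (b - a) (W' x e))) (at x)" for x
      unfolding \<beta>_def using bounded_linear.has_derivative[OF bl(2) W] .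
    show "continuous_on UNIV (\<lambda>x. cross2 (b - a) (W' x (c - a)))" by (rule cd)
  qed
  have perm: "{a, c, b} = {a, b, c}" by auto
  have e1: "seg_integral \<alpha> b c + seg_integral \<beta> b c = seg_integral (\<lambda>x. cross2 (W x) (c - b)) b c"
    unfolding \<alpha>_def \<beta>_def seg_integral_add[OF cc, symmetric]
    by (rule seg_integral_cong) (simp add: cross2_def algebra_simps)
  have e2: "seg_integral \<alpha> c a = - seg_integral (\<lambda>x. cross2 (W x) (a - c)) c a"
  proof -
    have "seg_integral \<alpha> c a = seg_integral (\<lambda>x. - 1 * cross2 (W x) (a - c)) c a"
      by (rule seg_integral_cong) (simp add: \<alpha>_def cross2_def algebra_simps)
    then show ?thesis using seg_integral_cmult[of "-1"] by simp
  qed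
  have e3: "seg_integral \<beta> a b = - seg_integral (\<lambda>x. cross2 (W x) (b - a)) a b"
  proof -
    have "seg_integral \<beta> a b = seg_integral (\<lambda>x. - 1 * cross2 (W x) (b - a)) a b"
      by (rule seg_integral_cong) (simp add: \<beta>_def cross2_def algebra_simps)
    then show ?thesis using seg_integral_cmult[of "-1"] by simp
  qed
  have "?D * (LINT x|lebesgue_on ?T. (\<Sum>i\<in>UNIV. W' x (axis i 1) $ i))
      = (LINT x|lebesgue_on ?T. cross2 (W' x (b - a)) (c - a) + cross2 (b - a) (W' x (c - a)))"
  proof -
    have "?D * (\<Sum>i\<in>UNIV. W' x (axis i 1) $ i) = cross2 (W' x (b - a)) (c - a) + cross2 (b - a) (W' x (c - a))" for x
      using trace_cross2[OF has_derivative_linear[OF W[of x]], of "b - a" "c - a"]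
      by (subst mult.commute) (rule sym)
    then show ?thesis by (simp only: integral_mult_right_zero[symmetric])
  qed
  also have "\<dots> = (LINT x|lebesgue_on ?T. cross2 (W' x (b - a)) (c - a))
      + (LINT x|lebesgue_on ?T. cross2 (b - a) (W' x (c - a)))"
    by (rule Bochner_Integration.integral_add; rule lebesgue_on_integral_lborel(2)[OF cT]; rule cd)
  also have "\<dots> = \<bar>?D\<bar> * ((seg_integral \<alpha> b c + seg_integral \<beta> b c) - seg_integral \<alpha> c a - seg_integral \<beta> a b)"
    using 1 2 by (simp add: perm Dabs seg_integral_swap[of \<alpha> a c] seg_integral_swap[of \<beta> c b] algebra_simps)
  finally have "?D * (LINT x|lebesgue_on ?T. (\<Sum>i\<in>UNIV. W' x (axis i 1) $ i)) = ?D * (sgn ?D *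
      (seg_integral (\<lambda>x. cross2 (W x) (b - a)) a b
       + seg_integral (\<lambda>x. cross2 (W x) (c - b)) b c
       + seg_integral (\<lambda>x. cross2 (W x) (a - c)) c a))"
    unfolding e1 e2 e3 by (simp add: abs_sgn mult.assoc add_ac)
  then show ?thesis using D by simp
qed

text \<open>The integrand is the trace of the derivative of the product of \<open>w\<close> and
  \<open>A\<close>, so this is the divergence theorem for that product.\<close>

lemma ibp_triangle:
  fixes a b c :: "real^2"
  assumes D: "cross2 (b - a) (c - a) \<noteq> 0"
    and w: "\<And>x. (w has_derivative (\<lambda>e. G x \<bullet> e)) (at x)" and G: "continuous_on UNIV G"
    and A: "\<And>x. (A has_derivative A' x) (at x)" and A': "\<And>e. continuous_on UNIV (\<lambda>x. A' x e)"
  shows "(LINT x|lebesgue_on (convex hull {a, b, c}). A x \<bullet> G x + (\<Sum>i\<in>UNIV. A' x (axis i 1) $ i) * w x) =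
    sgn (cross2 (b - a) (c - a)) *
      (seg_integral (\<lambda>x. cross2 (A x) (b - a) * w x) a b
       + seg_integral (\<lambda>x. cross2 (A x) (c - b) * w x) b c
       + seg_integral (\<lambda>x. cross2 (A x) (a - c) * w x) c a)"
proof -
  have contA: "continuous_on UNIV A" and contw: "continuous_on UNIV w"
    by (rule has_derivative_continuous_on_UNIV[OF A] has_derivative_continuous_on_UNIV[OF w])+
  have "(LINT x|lebesgue_on (convex hull {a, b, c}).
      (\<Sum>i\<in>UNIV. ((\<lambda>e. w x *\<^sub>R A' x e + (G x \<bullet> e) *\<^sub>R A x) (axis i 1)) $ i)) =
    sgn (cross2 (b - a) (c - a)) *
      (seg_integral (\<lambda>x. cross2 (w x *\<^sub>R A x) (b - a)) a b
       + seg_integral (\<lambda>x. cross2 (w x *\<^sub>R A x) (c - b)) b c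
       + seg_integral (\<lambda>x. cross2 (w x *\<^sub>R A x) (a - c)) c a)"
  proof (rule divergence_triangle[OF D, where W' = "\<lambda>x e. w x *\<^sub>R A' x e + (G x \<bullet> e) *\<^sub>R A x"])
    show "((\<lambda>x. w x *\<^sub>R A x) has_derivative (\<lambda>e. w x *\<^sub>R A' x e + (G x \<bullet> e) *\<^sub>R A x)) (at x)" for x
      by (rule has_derivative_scaleR[OF w A])
    show "continuous_on UNIV (\<lambda>x. w x *\<^sub>R A' x e + (G x \<bullet> e) *\<^sub>R A x)" for e
      by (intro continuous_intros contw contA A' G)
  qed
  moreover have "cross2 (r *\<^sub>R u) v = cross2 u v * r" for r u v
    by (simp add: cross2_def algebra_simps)
  moreover have "(\<Sum>i\<in>UNIV. ((\<lambda>e. w x *\<^sub>R A' x e + (G x \<bullet> e) *\<^sub>R A x) (axis i 1)) $ i)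
     = A x \<bullet> G x + (\<Sum>i\<in>UNIV. A' x (axis i 1) $ i) * w x" for x
    by (simp add: sum_2 inner_axis inner_vec_def axis_def algebra_simps)
  ultimately show ?thesis by simp
qed

text \<open>The divergence theorem for the field \<open>w\<^sup>2 (x - a)\<close>, which is tangential to the two
  edges through \<open>a\<close>.\<close>

lemma trace_triangle:
  fixes a b c :: "real^2"
  assumes D: "cross2 (b - a) (c - a) \<noteq> 0"
    and w: "\<And>x. (w has_derivative (\<lambda>e. G x \<bullet> e)) (at x)" and G: "continuous_on UNIV G"
    and h: "\<And>x. x \<in> convex hull {a, b, c} \<Longrightarrow> dist x a \<le> h"
  shows "\<bar>cross2 (b - a) (c - a)\<bar> * seg_integral (\<lambda>x. (w x)\<^sup>2) b c
    \<le> 3 * (LINT x|lebesgue_on (convex hull {a, b, c}). (w x)\<^sup>2)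
      + h\<^sup>2 * (LINT x|lebesgue_on (convex hull {a, b, c}). (norm (G x))\<^sup>2)"
proof -
  let ?D = "cross2 (b - a) (c - a)" and ?T = "convex hull {a, b, c}"
  have contw: "continuous_on A w" for A
    by (rule has_derivative_continuous_on_UNIV[OF w])
  have contG: "continuous_on A G" for A using G continuous_on_subset by blast
  have cT: "compact ?T" by (simp add: compact_convex_hull)
  have "(LINT x|lebesgue_on ?T. (x - a) \<bullet> ((2 * w x) *\<^sub>R G x) + (\<Sum>i\<in>UNIV. (axis i (1::real) :: real^2) $ i) * (w x)\<^sup>2) =
    sgn ?D *
      (seg_integral (\<lambda>x. cross2 (x - a) (b - a) * (w x)\<^sup>2) a b
       + seg_integral (\<lambda>x. cross2 (x - a) (c - b) * (w x)\<^sup>2) b c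
       + seg_integral (\<lambda>x. cross2 (x - a) (a - c) * (w x)\<^sup>2) c a)"
    by (rule ibp_triangle[OF D, where A' = "\<lambda>x e. e"])
      (auto intro!: derivative_eq_intros w continuous_intros contw contG simp: power2_eq_square algebra_simps)
  also have "seg_integral (\<lambda>x. cross2 (x - a) (b - a) * (w x)\<^sup>2) a b = 0"
    by (rule seg_integral_zero) (auto simp: in_segment cross2_def, simp add: algebra_simps)
  also have "seg_integral (\<lambda>x. cross2 (x - a) (a - c) * (w x)\<^sup>2) c a = 0"
    by (rule seg_integral_zero) (auto simp: in_segment cross2_def, simp add: algebra_simps)
  also have "seg_integral (\<lambda>x. cross2 (x - a) (c - b) * (w x)\<^sup>2) b c = seg_integral (\<lambda>x. ?D * (w x)\<^sup>2) b c"
    by (rule seg_integral_cong) (clarsimp simp: in_segment cross2_def, simp add: algebra_simps)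
  finally have "\<bar>?D\<bar> * seg_integral (\<lambda>x. (w x)\<^sup>2) b c =
      (LINT x|lebesgue_on ?T. (x - a) \<bullet> ((2 * w x) *\<^sub>R G x) + 2 * (w x)\<^sup>2)"
    by (simp add: seg_integral_cmult abs_sgn mult.assoc mult.left_commute sum_2 axis_def)
  \<comment> \<open>Young's inequality on the mixed term: the field \<open>x - a\<close> has
    divergence 2, and one more square of \<open>w\<close> comes from \<open>2 w ((x - a) \<bullet>
    G) \<le> w\<^sup>2 + h\<^sup>2 |G|\<^sup>2\<close>. Hence the factor 3.\<close>
  also have "\<dots> \<le> (LINT x|lebesgue_on ?T. 3 * (w x)\<^sup>2 + h\<^sup>2 * (norm (G x))\<^sup>2)"
  proof (rule integral_mono)
    fix x assume "x \<in> space (lebesgue_on ?T)"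
    then have "dist x a \<le> h" using h by simp
    then have "norm (x - a) * norm (G x) \<le> h * norm (G x)"
      by (intro mult_right_mono) (auto simp: dist_norm)
    moreover have "\<bar>(x - a) \<bullet> G x\<bar> \<le> norm (x - a) * norm (G x)" by (rule Cauchy_Schwarz_ineq2)
    ultimately have "((x - a) \<bullet> G x)\<^sup>2 \<le> (h * norm (G x))\<^sup>2"
      by (simp add: abs_le_square_iff[symmetric])
    moreover have "0 \<le> (w x - (x - a) \<bullet> G x)\<^sup>2" by simp
    ultimately show "(x - a) \<bullet> ((2 * w x) *\<^sub>R G x) + 2 * (w x)\<^sup>2 \<le> 3 * (w x)\<^sup>2 + h\<^sup>2 * (norm (G x))\<^sup>2"
      unfolding power2_diff power_mult_distrib by (simp add: algebra_simps)
  qed (intro lebesgue_on_integral_lborel cT continuous_intros contw contG)+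
  also have "\<dots> = 3 * (LINT x|lebesgue_on ?T. (w x)\<^sup>2) + h\<^sup>2 * (LINT x|lebesgue_on ?T. (norm (G x))\<^sup>2)"
    by (subst Bochner_Integration.integral_add)
      (auto intro!: lebesgue_on_integral_lborel cT continuous_intros contw contG)
  finally show ?thesis .
qed

text \<open>Enclose the support in a large triangle and integrate by parts against the constant
  field \<open>e\<close>: only edge integrals remain, and \<open>w\<close> vanishes on the
  edges.\<close>

lemma integral_grad_compact_support:
  fixes w :: "real^2 \<Rightarrow> real"
  assumes w: "\<And>x. (w has_derivative (\<lambda>e. G x \<bullet> e)) (at x)" and G: "continuous_on UNIV G"
    and R: "\<And>x. w x \<noteq> 0 \<Longrightarrow> norm x < R"
  shows "integrable lborel (\<lambda>x. G x \<bullet> e)" "(\<integral>x. G x \<bullet> e \<partial>lborel) = 0"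
proof -
  \<comment> \<open>\<open>R\<close> may be negative. The shift by 1 yields a positive radius and a
    strict gap, so that \<open>w\<close> vanishes in a neighbourhood of every point with
    \<open>norm x \<ge> r\<close>, and there its gradient is zero.\<close>
  define r where "r = \<bar>R\<bar> + 1"
  have r: "r > 0" "R < r" by (auto simp: r_def)
  have G0: "G x = 0" if "norm x \<ge> r" for x
  proof -
    have "((\<lambda>x. 0) has_derivative (\<lambda>e. G x \<bullet> e)) (at x)"
    proof (rule has_derivative_transform_within_open[OF w])
      show "open {x. R < norm x}" by (intro open_Collect_less continuous_intros)
      show "x \<in> {x. R < norm x}" using that r by auto
      show "w y = 0" if "y \<in> {x. R < norm x}" for y using that R by fastforce
    qed
    then have "(\<lambda>e. G x \<bullet> e) = (\<lambda>e. 0)" by (rule has_derivative_unique) (rule has_derivative_const)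
    then have "G x \<bullet> G x = 0" by metis
    then show ?thesis by simp
  qed
  \<comment> \<open>Two edges lie on the lines where a coordinate equals \<open>-r\<close>, the
    third on the line where the coordinates sum to \<open>3 * r\<close>. All of them stay at
    distance at least \<open>r\<close> from the origin, and the triangle contains the square in
    which both coordinates are below \<open>r\<close> in modulus.\<close>
  define a b c :: "real^2" where "a = vector [-r, -r]" and "b = vector [4*r, -r]" and "c = vector [-r, 4*r]"
  have D: "cross2 (b - a) (c - a) = 25 * r * r" by (simp add: cross2_def a_def b_def c_def vector_2)
  with r have D0: "cross2 (b - a) (c - a) \<noteq> 0" by simp
  let ?T = "convex hull {a, b, c}"
  have cT: "compact ?T" by (simp add: compact_convex_hull)
  have contG: "continuous_on A G" for A using G continuous_on_subset by blast
  have out: "G x = 0" if "x \<notin> ?T" for x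
  proof (rule ccontr)
    assume "G x \<noteq> 0"
    then have "norm x < r" using G0 by force
    then have c: "\<bar>x$1\<bar> < r" "\<bar>x$2\<bar> < r" using component_le_norm_cart[of x] by (metis order_le_less_trans)+
    define s t where "s = (x$1 + r) / (5*r)" and "t = (x$2 + r) / (5*r)"
    have "x = a + s *\<^sub>R (b - a) + t *\<^sub>R (c - a)"
      using r by (simp add: vec_eq_iff forall_2 a_def b_def c_def vector_2 s_def t_def field_simps)
    moreover have "0 \<le> s" "0 \<le> t" "s + t \<le> 1"
      using c r unfolding s_def t_def by (auto simp: divide_simps)
    ultimately show False using that triangle_coords[OF D0] by metis
  qed
  have eq: "(\<lambda>x. indicator ?T x * (G x \<bullet> e)) = (\<lambda>x. G x \<bullet> e)"
    using out by (auto simp: fun_eq_iff indicator_def)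
  have "integrable lborel (\<lambda>x. indicator ?T x *\<^sub>R (G x \<bullet> e))"
    by (intro borel_integrable_compact cT continuous_intros contG)
  then show "integrable lborel (\<lambda>x. G x \<bullet> e)" using eq by simp
  have z: "w x = 0" if "norm x \<ge> r" for x using that R[of x] r by force
  have edge: "seg_integral (\<lambda>x. cross2 e v * w x) p q = 0" if "\<And>x. x \<in> closed_segment p q \<Longrightarrow> norm x \<ge> r" for v p q
    by (rule seg_integral_zero) (simp add: z that)
  have n: "norm x \<ge> r" if "x $ i = - r" for x :: "real^2" and i
    using component_le_norm_cart[of x i] that r by simp
  have "(\<integral>x. G x \<bullet> e \<partial>lborel) = (LINT x|lebesgue_on ?T. e \<bullet> G x + (\<Sum>i\<in>UNIV. (0::real^2) $ i) * w x)"
    using lebesgue_on_integral_lborel(1)[OF cT, of "\<lambda>x. G x \<bullet> e"] contG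
    by (simp add: eq[unfolded inner_commute[of _ e]] inner_commute[of _ e] continuous_intros)
  also have "\<dots> = sgn (cross2 (b - a) (c - a)) *
      (seg_integral (\<lambda>x. cross2 e (b - a) * w x) a b
       + seg_integral (\<lambda>x. cross2 e (c - b) * w x) b c
       + seg_integral (\<lambda>x. cross2 e (a - c) * w x) c a)"
    by (rule ibp_triangle[OF D0 w G, where A' = "\<lambda>x e. 0"]) auto
  also have "\<dots> = 0"
  proof -
    have "norm x \<ge> r" if "x \<in> closed_segment a b" for x
      using that by (intro n[of _ 2]) (clarsimp simp: in_segment a_def b_def vector_2, simp add: algebra_simps)
    moreover have "norm x \<ge> r" if "x \<in> closed_segment c a" for x
      using that by (intro n[of _ 1]) (clarsimp simp: in_segment a_def c_def vector_2, simp add: algebra_simps)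
    moreover have "norm x \<ge> r" if "x \<in> closed_segment b c" for x
    proof -
      have "x$1 + x$2 = 3 * r" using that by (clarsimp simp: in_segment b_def c_def vector_2) (simp add: algebra_simps)
      then show ?thesis using component_le_norm_cart[of x 1] component_le_norm_cart[of x 2] r by linarith
    qed
    ultimately show ?thesis by (simp add: edge)
  qed
  finally show "(\<integral>x. G x \<bullet> e \<partial>lborel) = 0" .
qed

section \<open>Mollification\<close>

lemma grad_on_UNIV_eq:
  "(u has_derivative u') (at x) \<Longrightarrow> grad_on UNIV u x = (\<chi> i. u' (axis i 1))"
  unfolding grad_on_def using frechet_derivative_at by metis

lemma linear_eq_inner_axis:
  fixes f :: "real^2 \<Rightarrow> real"
  assumes "linear f"
  shows "f e = (\<chi> i. f (axis i 1)) \<bullet> e"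
proof -
  have e: "e = (\<Sum>i\<in>UNIV. e $ i *\<^sub>R axis i 1)"
    by (simp add: vec_eq_iff forall_2 sum_2 axis_def)
  have "f e = (\<Sum>i\<in>UNIV. e $ i * f (axis i 1))"
    using arg_cong[OF e, of f] by (simp add: linear_sum[OF assms] linear_cmul[OF assms])
  then show ?thesis by (simp add: inner_vec_def mult.commute)
qed

lemma has_derivative_grad_on:
  assumes "u differentiable (at x)"
  shows "(u has_derivative (\<lambda>e. grad_on UNIV u x \<bullet> e)) (at x)"
proof -
  obtain u' where u': "(u has_derivative u') (at x)" using assms unfolding differentiable_def by (elim exE)
  have "u' = (\<lambda>e. grad_on UNIV u x \<bullet> e)"
    unfolding grad_on_UNIV_eq[OF u']
    by (intro ext linear_eq_inner_axis has_derivative_linear[OF u'])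
  with u' show ?thesis by simp
qed

lemma grad_on_eqI:
  assumes "(u has_derivative (\<lambda>e. g \<bullet> e)) (at x)"
  shows "grad_on UNIV u x = g"
  using grad_on_UNIV_eq[OF assms] by (simp add: inner_axis vec_eq_iff)

section \<open>Closure properties of smoothness and a smooth bump function\<close>

lemma C_k_continuous: "C_k k u \<Longrightarrow> continuous_on A u"
proof (cases k)
  case 0
  then show "C_k k u \<Longrightarrow> continuous_on A u" using continuous_on_subset by auto
next
  case (Suc m)
  then show "C_k k u \<Longrightarrow> continuous_on A u"
    by (auto intro: differentiable_at_imp_differentiable_on differentiable_imp_continuous_on)
qed

lemma C_k_SucD: "C_k (Suc k) u \<Longrightarrow> C_k k u"
proof (induction k arbitrary: u)
  case 0
  then show ?case using C_k_continuous[of "Suc 0" u UNIV] by (simp only: C_k.simps(1))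
next
  case (Suc k)
  have "\<forall>x. u differentiable at x" "\<forall>i. C_k (Suc k) (\<lambda>x. grad_on UNIV u x $ i)"
    using Suc.prems by (simp_all only: C_k.simps(2)) auto
  then show ?case using Suc.IH by (simp only: C_k.simps(2)) auto
qed

lemma C_k_add: "C_k k u \<Longrightarrow> C_k k v \<Longrightarrow> C_k k (\<lambda>x. u x + v x)"
proof (induction k arbitrary: u v)
  case 0
  then show ?case by (auto intro: continuous_intros)
next
  case (Suc k)
  have d: "u differentiable at x" "v differentiable at x" for x using Suc.prems by auto
  have "grad_on UNIV (\<lambda>x. u x + v x) x = grad_on UNIV u x + grad_on UNIV v x" for x
    by (rule grad_on_eqI)
      (auto intro!: derivative_eq_intros has_derivative_grad_on d simp: inner_add_left)
  with d Suc show ?case by (auto intro: differentiable_add)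
qed

lemma C_k_cmult: "C_k k u \<Longrightarrow> C_k k (\<lambda>x. c * u x)"
proof (induction k arbitrary: u)
  case 0
  then show ?case by (auto intro: continuous_intros)
next
  case (Suc k)
  have d: "u differentiable at x" for x using Suc.prems by auto
  have "grad_on UNIV (\<lambda>x. c * u x) x = c *\<^sub>R grad_on UNIV u x" for x
    by (rule grad_on_eqI) (auto intro!: derivative_eq_intros has_derivative_grad_on d)
  with d Suc show ?case by (auto intro!: differentiable_mult)
qed

lemma C_k_mult: "C_k k u \<Longrightarrow> C_k k v \<Longrightarrow> C_k k (\<lambda>x. u x * v x)"
proof (induction k arbitrary: u v)
  case 0
  then show ?case by (auto intro: continuous_intros)
next
  case (Suc k)
  have d: "u differentiable at x" "v differentiable at x" for x using Suc.prems by auto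
  have "grad_on UNIV (\<lambda>x. u x * v x) x = u x *\<^sub>R grad_on UNIV v x + v x *\<^sub>R grad_on UNIV u x" for x
    by (rule grad_on_eqI)
      (auto intro!: derivative_eq_intros has_derivative_grad_on d simp: inner_add_left)
  moreover have "C_k k u" "C_k k v" using Suc.prems C_k_SucD by blast+
  ultimately show ?case using d Suc
    by (auto intro!: differentiable_mult C_k_add Suc.IH)
qed

text \<open>The classical flat function \<open>exp (- 1 / t)\<close> with additional negative powers
  of \<open>t\<close>. With these powers the family is closed under differentiation up to linear
  combinations, as induction on the order of smoothness requires.\<close>

definition flat_exp :: "nat \<Rightarrow> real \<Rightarrow> real" where
  "flat_exp m t = (if t > 0 then exp (- inverse t) * inverse t ^ m else 0)"

lemma flat_exp_tendsto_0: "(flat_exp m \<longlongrightarrow> 0) (at 0)"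
proof (rule filterlim_split_at)
  have "((\<lambda>t::real. inverse t ^ m / exp (inverse t)) \<longlongrightarrow> 0) (at_right 0)"
    by (rule filterlim_compose[OF tendsto_power_div_exp_0 filterlim_inverse_at_top_right])
  then show "(flat_exp m \<longlongrightarrow> 0) (at_right 0)"
    by (rule Lim_transform_eventually)
      (auto simp: flat_exp_def eventually_at_filter exp_minus field_simps intro!: always_eventually)
  have "((\<lambda>t::real. 0::real) \<longlongrightarrow> 0) (at_left 0)" by simp
  then show "(flat_exp m \<longlongrightarrow> 0) (at_left 0)"
    by (rule Lim_transform_eventually)
      (auto simp: flat_exp_def eventually_at_filter intro!: always_eventually)
qed

lemma DERIV_flat_exp:
  "(flat_exp m has_real_derivative flat_exp (m + 2) t - of_nat m * flat_exp (m + 1) t) (at t)"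
proof (cases t "0::real" rule: linorder_cases)
  case less
  have "((\<lambda>_. 0) has_real_derivative 0) (at t)" by simp
  then have "(flat_exp m has_real_derivative 0) (at t)"
    by (rule has_field_derivative_transform_within_open[where S = "{..<0}"]) (use less in \<open>auto simp: flat_exp_def\<close>)
  with less show ?thesis by (simp add: flat_exp_def)
next
  case equal
  \<comment> \<open>For positive \<open>h\<close> the difference quotient at 0 is
    \<open>flat_exp (Suc m) h\<close>, so the limit proved for all exponents applies.\<close>
  have "((\<lambda>h. (flat_exp m (0 + h) - flat_exp m 0) / h) \<longlongrightarrow> 0) (at 0)"
    using flat_exp_tendsto_0[of "Suc m"]
    by (rule Lim_transform_eventually)
      (auto simp: flat_exp_def eventually_at_filter field_simps intro!: always_eventually)
  then show ?thesis unfolding equal DERIV_def by (simp add: flat_exp_def)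
next
  case greater
  have "((\<lambda>t. exp (- inverse t) * inverse t ^ m) has_real_derivative
      exp (- inverse t) * inverse t ^ (m + 2) - of_nat m * (exp (- inverse t) * inverse t ^ (m + 1))) (at t)"
  proof -
    have "((\<lambda>t. exp (- inverse t) * inverse t ^ m) has_real_derivative
        exp (- inverse t) * (inverse t)\<^sup>2 * inverse t ^ m
        + of_nat m * (inverse t ^ (m - 1) * - (inverse t)\<^sup>2) * exp (- inverse t)) (at t)"
      using greater by (auto intro!: derivative_eq_intros simp: power2_eq_square)
    then show ?thesis
      by (rule DERIV_cong) (cases m; simp add: power2_eq_square algebra_simps)
  qed
  then have "(flat_exp m has_real_derivative
      exp (- inverse t) * inverse t ^ (m + 2) - of_nat m * (exp (- inverse t) * inverse t ^ (m + 1))) (at t)"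
    by (rule has_field_derivative_transform_within_open[where S = "{0<..}"]) (use greater in \<open>auto simp: flat_exp_def\<close>)
  with greater show ?thesis by (simp add: flat_exp_def)
qed

lemma C_k_flat_exp: "C_k k (\<lambda>x. flat_exp m (a + b * x $ i))"
proof (induction k arbitrary: m)
  case 0
  have "isCont (flat_exp m) t" for t using DERIV_flat_exp DERIV_isCont by blast
  then have "continuous_on UNIV (flat_exp m)" by (simp add: continuous_at_imp_continuous_on)
  then show ?case by (auto intro!: continuous_on_compose2[of UNIV "flat_exp m"] continuous_intros)
next
  case (Suc k)
  let ?d = "\<lambda>x. flat_exp (m + 2) (a + b * x $ i) - of_nat m * flat_exp (m + 1) (a + b * x $ i)"
  have der: "((\<lambda>x. flat_exp m (a + b * x $ i)) has_derivative (\<lambda>e. (?d x * b) *\<^sub>R axis i 1 \<bullet> e)) (at x)" for x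
  proof -
    have 1: "((\<lambda>x::real^2. a + b * x $ i) has_derivative (\<lambda>e. b * e $ i)) (at x)"
      by (auto intro!: derivative_eq_intros bounded_linear_imp_has_derivative bounded_linear_vec_nth)
    have 2: "(flat_exp m has_derivative (\<lambda>h. ?d x * h)) (at (a + b * x $ i))"
      using DERIV_flat_exp[of m "a + b * x $ i"] by (simp add: has_field_derivative_def)
    from has_derivative_compose[OF 1 2] show ?thesis
      by (simp add: inner_axis' mult.assoc)
  qed
  have g: "grad_on UNIV (\<lambda>x. flat_exp m (a + b * x $ i)) x = (?d x * b) *\<^sub>R axis i 1" for x
    using der by (rule grad_on_eqI)
  have "C_k k (\<lambda>x. (axis i 1 $ j * b) * (flat_exp (m + 2) (a + b * x $ i) + (- of_nat m) * flat_exp (m + 1) (a + b * x $ i)))" for j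
    by (intro C_k_cmult C_k_add Suc.IH)
  then have "C_k k (\<lambda>x. ((?d x * b) *\<^sub>R axis i 1) $ j)" for j
    by (rule back_subst[of "C_k k"]) (auto simp: fun_eq_iff)
  then show ?case using der by (auto simp: g differentiable_def)
qed

lemma mollifier_exists:
  assumes "r > 0"
  obtains \<rho> :: "real^2 \<Rightarrow> real" where "\<And>k. C_k k \<rho>" "\<And>x. 0 \<le> \<rho> x"
    "\<And>x. \<rho> x \<noteq> 0 \<Longrightarrow> norm x < r" "integrable lborel \<rho>" "(\<integral>x. \<rho> x \<partial>lborel) = 1"
proof -
  \<comment> \<open>The bump below lives on an open square of half-width \<open>s\<close>; as the
    norm is at most the sum of the moduli of the coordinates, this square lies in the ball of radius
    \<open>r = 2 * s\<close>.\<close>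
  define s where "s = r / 2"
  have s: "s > 0" using assms by (simp add: s_def)
  define \<beta> :: "real^2 \<Rightarrow> real" where
    "\<beta> x = flat_exp 0 (s + 1 * x$1) * flat_exp 0 (s + (-1) * x$1) * (flat_exp 0 (s + 1 * x$2) * flat_exp 0 (s + (-1) * x$2))" for x
  have C: "C_k k \<beta>" for k unfolding \<beta>_def by (intro C_k_mult C_k_flat_exp)
  have nn: "0 \<le> \<beta> x" for x unfolding \<beta>_def flat_exp_def by auto
  have pos: "\<beta> x > 0 \<longleftrightarrow> \<bar>x$1\<bar> < s \<and> \<bar>x$2\<bar> < s" for x
    unfolding \<beta>_def flat_exp_def by (auto simp: zero_less_mult_iff)
  have supp: "norm x < r" if "\<beta> x \<noteq> 0" for x
  proof -
    have "\<bar>x$1\<bar> < s \<and> \<bar>x$2\<bar> < s" using that nn[of x] pos[of x] by force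
    then show ?thesis using norm_le_l1_cart[of x] by (simp add: sum_2 s_def)
  qed
  have cont: "continuous_on A \<beta>" for A using C_k_continuous[OF C] .
  have eq: "(\<lambda>x. indicator (cball 0 r) x *\<^sub>R \<beta> x) = \<beta>"
    using supp by (force simp: fun_eq_iff indicator_def)
  have int: "integrable lborel \<beta>"
    using borel_integrable_compact[OF compact_cball cont, of 0 r] eq by simp
  define I where "I = (\<integral>x. \<beta> x \<partial>lborel)"
  have "I \<noteq> 0"
  proof
    assume "I = 0"
    then have "AE x in lborel. \<beta> x = 0" using integral_nonneg_eq_0_iff_AE[OF int] nn by (simp add: I_def)
    then have "AE x in lborel. x \<notin> {x::real^2. \<bar>x$1\<bar> < s \<and> \<bar>x$2\<bar> < s}" by (rule eventually_mono) (use pos in force)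
    moreover have o: "open {x::real^2. \<bar>x$1\<bar> < s \<and> \<bar>x$2\<bar> < s}"
      by (intro open_Collect_conj open_Collect_less continuous_intros)
    ultimately have "{x::real^2. \<bar>x$1\<bar> < s \<and> \<bar>x$2\<bar> < s} \<in> null_sets lborel"
      using AE_iff_null_sets[of "{x::real^2. \<bar>x$1\<bar> < s \<and> \<bar>x$2\<bar> < s}" lborel] by auto
    then have "negligible {x::real^2. \<bar>x$1\<bar> < s \<and> \<bar>x$2\<bar> < s}"
      by (simp add: negligible_iff_null_sets null_sets_completionI)
    then show False using open_not_negligible[OF o] s by (metis (mono_tags) abs_zero emptyE mem_Collect_eq zero_index)
  qed
  moreover have "I \<ge> 0" unfolding I_def using nn by simp
  ultimately have I: "I > 0" by simp
  show ?thesis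
  proof (rule that[of "\<lambda>x. inverse I * \<beta> x"])
    show "C_k k (\<lambda>x. inverse I * \<beta> x)" for k by (intro C_k_cmult C)
    show "(\<integral>x. inverse I * \<beta> x \<partial>lborel) = 1" using I by (simp add: I_def)
  qed (use I nn supp int in auto)
qed

section \<open>Convolution and mollification of Lipschitz functions\<close>

lemma C_k_Suc_grad: "C_k (Suc k) u \<Longrightarrow> C_k k (\<lambda>x. grad_on UNIV u x $ i)"
  by simp

lemma C_k_Suc_has_derivative:
  "C_k (Suc k) u \<Longrightarrow> (u has_derivative (\<lambda>e. grad_on UNIV u x \<bullet> e)) (at x)"
  by (rule has_derivative_grad_on) simp

lemma C_k_continuous_grad:
  assumes "C_k (Suc k) u"
  shows "continuous_on A (grad_on UNIV u)"
proof -
  have "continuous_on A (\<lambda>x. \<chi> i. grad_on UNIV u x $ i)"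
    by (intro continuous_on_vec_lambda C_k_continuous[OF C_k_Suc_grad[OF assms]])
  then show ?thesis by simp
qed

text \<open>Differentiation under the integral puts every derivative on the kernel, so continuity of
  \<open>w\<close> is enough. The induction runs over all kernels, because the step replaces \<rho>
  by its partial derivatives.\<close>

lemma C_k_convolution:
  assumes \<rho>: "\<And>k. C_k k \<rho>" and w: "continuous_on UNIV w"
  shows "C_k k (\<lambda>x. integral (cbox a b) (\<lambda>y. \<rho> (x - y) * w y))"
  using \<rho>
proof (induction k arbitrary: \<rho>)
  have der: "((\<lambda>x. integral (cbox a b) (\<lambda>y. \<rho> (x - y) * w y)) has_derivative
      (\<lambda>e. integral (cbox a b) (\<lambda>y. w y *\<^sub>R grad_on UNIV \<rho> (x - y)) \<bullet> e)) (at x)"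
    if \<rho>: "\<And>k. C_k k \<rho>" for \<rho> and x
  proof -
    let ?G = "grad_on UNIV \<rho>"
    have cw: "continuous_on A w" for A using w continuous_on_subset by blast
    have cG: "continuous_on UNIV ?G" by (rule C_k_continuous_grad[OF \<rho>])
    have c\<rho>: "continuous_on UNIV \<rho>" by (rule C_k_continuous[OF \<rho>])
    have "((\<lambda>x. integral (cbox a b) (\<lambda>y. \<rho> (x - y) * w y)) has_derivative
      blinfun_apply (integral (cbox a b) (\<lambda>y. blinfun_inner_right (w y *\<^sub>R ?G (x - y))))) (at x within UNIV)"
    proof (rule leibniz_rule)
      show "((\<lambda>x. \<rho> (x - y) * w y) has_derivative blinfun_apply (blinfun_inner_right (w y *\<^sub>R ?G (x - y)))) (at x within UNIV)" for x y
      proof -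
        have "((\<lambda>x. \<rho> (x - y)) has_derivative (\<lambda>e. ?G (x - y) \<bullet> (e - 0))) (at x)"
          by (rule has_derivative_compose[OF _ C_k_Suc_has_derivative[OF \<rho>]]) (auto intro!: derivative_eq_intros)
        from has_derivative_mult_left[OF this, of "w y"]
        have "((\<lambda>x. \<rho> (x - y) * w y) has_derivative (\<lambda>e. (?G (x - y) \<bullet> (e - 0)) * w y)) (at x)" .
        moreover have "(\<lambda>e. (?G (x - y) \<bullet> (e - 0)) * w y) = blinfun_apply (blinfun_inner_right (w y *\<^sub>R ?G (x - y)))"
          by (simp add: fun_eq_iff)
        ultimately show ?thesis by simp
      qed
      show "(\<lambda>y. \<rho> (x - y) * w y) integrable_on cbox a b" for x
        by (intro integrable_continuous continuous_intros cw continuous_on_compose2[OF c\<rho>]) auto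
      have cw2: "continuous_on (UNIV \<times> cbox a b) (\<lambda>p. w (snd p))"
        by (rule continuous_on_compose2[OF w]) (auto intro: continuous_intros)
      have cG2: "continuous_on (UNIV \<times> cbox a b) (\<lambda>p. ?G (fst p - snd p))"
        by (rule continuous_on_compose2[OF cG]) (auto intro!: continuous_intros)
      show "continuous_on (UNIV \<times> cbox a b) (\<lambda>(x, y). blinfun_inner_right (w y *\<^sub>R ?G (x - y)))"
        unfolding split_beta
        by (intro bounded_linear.continuous_on[OF bounded_linear_blinfun_inner_right] continuous_on_scaleR cw2 cG2)
    qed auto
    also have "integral (cbox a b) (\<lambda>y. blinfun_inner_right (w y *\<^sub>R ?G (x - y)))
      = blinfun_inner_right (integral (cbox a b) (\<lambda>y. w y *\<^sub>R ?G (x - y)))"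
    proof -
      have "(\<lambda>y. w y *\<^sub>R ?G (x - y)) integrable_on cbox a b"
        by (intro integrable_continuous continuous_intros cw continuous_on_compose2[OF cG]) auto
      from integral_linear[OF this bounded_linear_blinfun_inner_right] show ?thesis by (simp add: o_def)
    qed
    finally show ?thesis by (simp add: blinfun_inner_right.rep_eq)
  qed
  {
    case 0
    show ?case using has_derivative_continuous_on_UNIV[OF der[OF 0]] by simp
  next
    case (Suc k)
    have "grad_on UNIV (\<lambda>x. integral (cbox a b) (\<lambda>y. \<rho> (x - y) * w y)) x $ i
      = integral (cbox a b) (\<lambda>y. grad_on UNIV \<rho> (x - y) $ i * w y)" for x i
    proof -
      have cG: "continuous_on UNIV (grad_on UNIV \<rho>)" by (rule C_k_continuous_grad[OF Suc.prems])
      have "(\<lambda>y. w y *\<^sub>R grad_on UNIV \<rho> (x - y)) integrable_on cbox a b"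
        using w by (intro integrable_continuous continuous_intros continuous_on_compose2[OF cG] continuous_on_subset[OF w]) auto
      from integral_linear[OF this bounded_linear_vec_nth, of i]
      have "integral (cbox a b) (\<lambda>y. w y *\<^sub>R grad_on UNIV \<rho> (x - y)) $ i
        = integral (cbox a b) (\<lambda>y. grad_on UNIV \<rho> (x - y) $ i * w y)"
        by (simp add: o_def mult.commute)
      then show ?thesis unfolding grad_on_eqI[OF der[OF Suc.prems]] .
    qed
    moreover have "C_k k (\<lambda>x. integral (cbox a b) (\<lambda>y. grad_on UNIV \<rho> (x - y) $ i * w y))" for i
      by (rule Suc.IH[OF C_k_Suc_grad[OF Suc.prems]])
    moreover have "(\<lambda>x. integral (cbox a b) (\<lambda>y. \<rho> (x - y) * w y)) differentiable at x" for x
      by (rule differentiableI[OF der[OF Suc.prems]])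
    ultimately show ?case by simp
  }
qed

text \<open>The last conclusion says that averaging reproduces an affine function as long as the
  averaging radius stays inside the region of affinity. Through it, gradients of mollified piecewise
  affine functions are known exactly, without any derivative of \<open>w\<close>.\<close>

lemma mollify:
  fixes w :: "real^2 \<Rightarrow> real"
  assumes L: "L-lipschitz_on UNIV w" and bd: "bounded {x. w x \<noteq> 0}" and r: "r > 0"
  obtains \<phi> where "\<And>k. C_k k \<phi>" "\<And>x. \<bar>\<phi> x - w x\<bar> \<le> L * r"
    "\<And>x. \<phi> x \<noteq> 0 \<Longrightarrow> \<exists>y. w y \<noteq> 0 \<and> dist x y < r" "L-lipschitz_on UNIV \<phi>"
    "\<And>x g s. r < s \<Longrightarrow> (\<And>y. y \<in> ball x s \<Longrightarrow> w y = w x + g \<bullet> (y - x)) \<Longrightarrow> grad_on UNIV \<phi> x = g"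
proof -
  obtain \<rho> :: "real^2 \<Rightarrow> real" where \<rho>: "\<And>k. C_k k \<rho>" "\<And>x. 0 \<le> \<rho> x"
    "\<And>x. \<rho> x \<noteq> 0 \<Longrightarrow> norm x < r" "integrable lborel \<rho>" "(\<integral>x. \<rho> x \<partial>lborel) = 1"
    using mollifier_exists[OF r] by blast
  have cw: "continuous_on A w" for A
    using lipschitz_on_continuous_on[OF L] continuous_on_subset by blast
  have c\<rho>: "continuous_on A \<rho>" for A by (rule C_k_continuous[OF \<rho>(1)])
  obtain a b where ab: "{x. w x \<noteq> 0} \<subseteq> cbox a b"
    using bounded_subset_cbox_symmetric[OF bd] by blast
  define \<phi> where "\<phi> x = (\<integral>z. \<rho> z * w (x - z) \<partial>lborel)" for x
  have int: "integrable lborel (\<lambda>z. \<rho> z * f z)" if f: "continuous_on UNIV f" for f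
  proof -
    have "(\<lambda>z. indicator (cball 0 r) z *\<^sub>R (\<rho> z * f z)) = (\<lambda>z. \<rho> z * f z)"
      using \<rho>(3) by (force simp: fun_eq_iff indicator_def)
    moreover have "integrable lborel (\<lambda>z. indicator (cball 0 r) z *\<^sub>R (\<rho> z * f z))"
      by (intro borel_integrable_compact continuous_intros c\<rho> continuous_on_subset[OF f]) auto
    ultimately show ?thesis by simp
  qed
  have cwx: "continuous_on UNIV (\<lambda>z. w (x - z))" for x
    by (intro continuous_on_compose2[OF cw[of UNIV]] continuous_intros) auto
  \<comment> \<open>Two forms of the same integral: with the shift on \<open>w\<close>, bounds on
    \<open>w\<close> pass to \<phi>; with the shift on the kernel, \<phi> is seen to be
    smooth.\<close>
  have conv: "\<phi> x = integral (cbox a b) (\<lambda>y. \<rho> (x - y) * w y)" for x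
  proof -
    have c: "continuous_on A (\<lambda>y. \<rho> (x - y) * w y)" for A
      by (intro continuous_intros cw continuous_on_compose2[OF c\<rho>[of UNIV]]) auto
    have "\<phi> x = (\<integral>y. \<rho> (x - y) * w y \<partial>lborel)"
    proof -
      have m: "(\<lambda>y. \<rho> (x - y) * w y) \<in> borel_measurable borel" "(-) x \<in> borel_measurable borel"
        by (intro borel_measurable_continuous_onI c continuous_intros)+
      show ?thesis
        using arg_cong[where f = "\<lambda>M. integral\<^sup>L M (\<lambda>y. \<rho> (x - y) * w y)", OF lborel_affine[of "-1" x]] m
        by (simp add: \<phi>_def integral_density[where g = "\<lambda>_. 1", simplified] integral_distr)
    qed
    also have "(\<lambda>y. \<rho> (x - y) * w y) = (\<lambda>y. indicator (cbox a b) y *\<^sub>R (\<rho> (x - y) * w y))"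
      using ab by (auto simp: fun_eq_iff indicator_def)
    also have "(\<integral>y. indicator (cbox a b) y *\<^sub>R (\<rho> (x - y) * w y) \<partial>lborel) = integral (cbox a b) (\<lambda>y. \<rho> (x - y) * w y)"
      using set_borel_integral_eq_integral(2)[of "cbox a b" "\<lambda>y. \<rho> (x - y) * w y"] borel_integrable_compact[OF compact_cbox c]
      by (simp add: set_integrable_def set_lebesgue_integral_def)
    finally show ?thesis .
  qed
  have C: "C_k k \<phi>" for k
    using C_k_convolution[OF \<rho>(1) cw, of k a b] unfolding conv[symmetric] .
  \<comment> \<open>A mean with weight \<rho> inherits every bound valid on the ball of radius
    \<open>r\<close>. The approximation error, the location of the support and the Lipschitz
    constant are three instances.\<close>
  have avg: "\<bar>(\<integral>z. \<rho> z * f z \<partial>lborel)\<bar> \<le> c"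
    if f: "continuous_on UNIV f" and fc: "\<And>z. norm z < r \<Longrightarrow> \<bar>f z\<bar> \<le> c" for f c
  proof -
    have "\<bar>(\<integral>z. \<rho> z * f z \<partial>lborel)\<bar> \<le> (\<integral>z. \<rho> z * c \<partial>lborel)"
    proof (rule order_trans[OF integral_abs_bound integral_mono])
      show "\<bar>\<rho> z * f z\<bar> \<le> \<rho> z * c" for z
        using \<rho>(2)[of z] \<rho>(3)[of z] fc[of z] by (cases "\<rho> z = 0") (auto simp: abs_mult intro: mult_left_mono)
    qed (use int[OF f] \<rho>(4) in auto)
    also have "\<dots> = c" using \<rho>(5) by simp
    finally show ?thesis .
  qed
  have L0: "L \<ge> 0" using L lipschitz_on_nonneg by blast
  have lip: "\<bar>w x - w y\<bar> \<le> L * dist x y" for x y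
    using lipschitz_onD[OF L, of x y] by (simp add: dist_real_def)
  have phi_c: "\<phi> x - c = (\<integral>z. \<rho> z * (w (x - z) - c) \<partial>lborel)" for x c
    using int[OF cwx, of x] \<rho>(4,5) by (simp add: \<phi>_def right_diff_distrib)
  show ?thesis
  proof (rule that[of \<phi>])
    show "C_k k \<phi>" for k by (rule C)
    show "\<bar>\<phi> x - w x\<bar> \<le> L * r" for x
      unfolding phi_c
    proof (rule avg)
      show "\<bar>w (x - z) - w x\<bar> \<le> L * r" if "norm z < r" for z
        using lip[of "x - z" x] that L0 by (simp add: dist_norm) (meson less_imp_le mult_left_mono order_trans)
    qed (intro continuous_intros cwx)
    show "\<exists>y. w y \<noteq> 0 \<and> dist x y < r" if "\<phi> x \<noteq> 0" for x
    proof (rule ccontr)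
      assume no: "\<not> (\<exists>y. w y \<noteq> 0 \<and> dist x y < r)"
      have "\<bar>\<phi> x\<bar> \<le> 0" unfolding \<phi>_def
      proof (rule avg[OF cwx])
        show "\<bar>w (x - z)\<bar> \<le> 0" if "norm z < r" for z
          using no that by (metis abs_zero diff_add_cancel dist_norm order_refl norm_minus_commute add_diff_cancel_left')
      qed
      with that show False by simp
    qed
    show "L-lipschitz_on UNIV \<phi>"
    proof (rule lipschitz_onI[OF _ L0])
      fix x y
      have "\<phi> x - \<phi> y = (\<integral>z. \<rho> z * (w (x - z) - w (y - z)) \<partial>lborel)"
        using int[OF cwx, of x] int[OF cwx, of y] by (simp add: \<phi>_def right_diff_distrib)
      also have "\<bar>\<dots>\<bar> \<le> L * dist x y"
      proof (rule avg)
        show "\<bar>w (x - z) - w (y - z)\<bar> \<le> L * dist x y" for z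
          using lip[of "x - z" "y - z"] by (simp add: dist_norm)
      qed (intro continuous_intros cwx)
      finally show "dist (\<phi> x) (\<phi> y) \<le> L * dist x y" by (simp add: dist_real_def)
    qed
    show "grad_on UNIV \<phi> x = g" if rs: "r < s" and aff: "\<And>y. y \<in> ball x s \<Longrightarrow> w y = w x + g \<bullet> (y - x)" for x g s
    proof (rule grad_on_eqI)
      have eq: "\<phi> y = \<phi> x + g \<bullet> (y - x)" if y: "y \<in> ball x (s - r)" for y
      proof -
        have "\<phi> y - \<phi> x = (\<integral>z. \<rho> z * (w (y - z) - w (x - z)) \<partial>lborel)"
          using int[OF cwx, of x] int[OF cwx, of y] by (simp add: \<phi>_def right_diff_distrib)
        also have "\<dots> = (\<integral>z. \<rho> z * (g \<bullet> (y - x)) \<partial>lborel)"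
        proof (rule Bochner_Integration.integral_cong[OF refl])
          fix z
          show "\<rho> z * (w (y - z) - w (x - z)) = \<rho> z * (g \<bullet> (y - x))"
          proof (cases "\<rho> z = 0")
            case False
            then have z: "norm z < r" by (rule \<rho>(3))
            have "dist x (y - z) \<le> dist x y + norm z"
              using norm_triangle_ineq[of "x - y" z] by (simp add: dist_norm algebra_simps)
            then have "y - z \<in> ball x s" using z y by simp
            moreover have "x - z \<in> ball x s" using z rs by (simp add: dist_norm)
            ultimately have "w (y - z) - w (x - z) = g \<bullet> (y - z - x) - g \<bullet> (x - z - x)"
              using aff[of "y - z"] aff[of "x - z"] by linarith
            also have "\<dots> = g \<bullet> (y - x)" by (simp add: inner_diff_right)
            finally show ?thesis by simp
          qed simp
        qed
        also have "\<dots> = g \<bullet> (y - x)" using \<rho>(5) by simp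
        finally show ?thesis by simp
      qed
      have "((\<lambda>y. \<phi> x + g \<bullet> (y - x)) has_derivative (\<lambda>e. g \<bullet> e)) (at x)"
        by (auto intro!: derivative_eq_intros)
      then show "(\<phi> has_derivative (\<lambda>e. g \<bullet> e)) (at x)"
        by (rule has_derivative_transform_within_open[of _ _ x UNIV "ball x (s - r)"]) (use rs in \<open>auto intro: eq[symmetric]\<close>)
    qed
  qed
qed

text \<open>Difference quotients in the direction of the gradient itself show that the square of its
  norm is at most \<open>L\<close> times its norm.\<close>

lemma lipschitz_grad_bound:
  assumes L: "L-lipschitz_on UNIV u" and d: "u differentiable at x"
  shows "norm (grad_on UNIV u x) \<le> L"
proof -
  let ?g = "grad_on UNIV u x"
  have L0: "L \<ge> 0" using L lipschitz_on_nonneg by blast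
  have "((\<lambda>t. u (x + t *\<^sub>R ?g)) has_derivative (\<lambda>t. ?g \<bullet> (t *\<^sub>R ?g))) (at 0)"
    by (rule has_derivative_compose[where g = u]) (auto intro!: derivative_eq_intros has_derivative_grad_on d)
  then have "((\<lambda>t. u (x + t *\<^sub>R ?g)) has_real_derivative (?g \<bullet> ?g)) (at 0)"
    unfolding has_field_derivative_def
    by (rule back_subst[of "\<lambda>D. ((\<lambda>t. u (x + t *\<^sub>R ?g)) has_derivative D) (at 0)"])
      (simp add: fun_eq_iff)
  then have lim: "((\<lambda>t. \<bar>(u (x + t *\<^sub>R ?g) - u x) / t\<bar>) \<longlongrightarrow> \<bar>?g \<bullet> ?g\<bar>) (at 0)"
    by (intro tendsto_rabs) (simp add: DERIV_def)
  have "\<bar>(u (x + t *\<^sub>R ?g) - u x) / t\<bar> \<le> L * norm ?g" if "t \<noteq> 0" for t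
    using lipschitz_onD[OF L, of "x + t *\<^sub>R ?g" x] that
    by (simp add: dist_real_def dist_norm divide_simps mult_ac)
  then have "\<bar>?g \<bullet> ?g\<bar> \<le> L * norm ?g"
    by (intro tendsto_upperbound[OF lim]) (auto simp: eventually_at_filter intro!: always_eventually)
  then have "norm ?g * norm ?g \<le> L * norm ?g" by (simp add: power2_norm_eq_inner[symmetric] power2_eq_square)
  then show ?thesis using L0 by (cases "norm ?g = 0") auto
qed

section \<open>Weak gradients\<close>

lemma integrable_mult_squares:
  fixes u v :: "'a \<Rightarrow> real"
  assumes [measurable]: "u \<in> borel_measurable M" "v \<in> borel_measurable M"
    and "integrable M (\<lambda>x. (u x)\<^sup>2)" "integrable M (\<lambda>x. (v x)\<^sup>2)"
  shows "integrable M (\<lambda>x. u x * v x)"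
proof (rule Bochner_Integration.integrable_bound)
  show "integrable M (\<lambda>x. (u x)\<^sup>2 + (v x)\<^sup>2)" using assms by auto
  show "AE x in M. norm (u x * v x) \<le> norm ((u x)\<^sup>2 + (v x)\<^sup>2)"
  proof (intro always_eventually allI)
    fix x
    have "0 \<le> (\<bar>u x\<bar> - \<bar>v x\<bar>)\<^sup>2" by simp
    then have "2 * (\<bar>u x\<bar> * \<bar>v x\<bar>) \<le> (u x)\<^sup>2 + (v x)\<^sup>2" by (simp add: power2_diff)
    moreover have "0 \<le> \<bar>u x\<bar> * \<bar>v x\<bar>" by simp
    ultimately have "\<bar>u x * v x\<bar> \<le> (u x)\<^sup>2 + (v x)\<^sup>2" unfolding abs_mult by linarith
    then show "norm (u x * v x) \<le> norm ((u x)\<^sup>2 + (v x)\<^sup>2)" by simp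
  qed
qed simp

lemma cauchy_schwarz_integral:
  fixes u v :: "'a \<Rightarrow> real"
  assumes m: "u \<in> borel_measurable M" "v \<in> borel_measurable M"
    and i: "integrable M (\<lambda>x. (u x)\<^sup>2)" "integrable M (\<lambda>x. (v x)\<^sup>2)"
  shows "\<bar>\<integral>x. u x * v x \<partial>M\<bar> \<le> sqrt (\<integral>x. (u x)\<^sup>2 \<partial>M) * sqrt (\<integral>x. (v x)\<^sup>2 \<partial>M)"
proof -
  define A B C where "A = (\<integral>x. (u x)\<^sup>2 \<partial>M)" and "B = (\<integral>x. u x * v x \<partial>M)" and "C = (\<integral>x. (v x)\<^sup>2 \<partial>M)"
  note iuv = integrable_mult_squares[OF m i]
  have q: "0 \<le> A - 2 * t * B + t\<^sup>2 * C" for t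
  proof -
    have "0 \<le> (\<integral>x. (u x - t * v x)\<^sup>2 \<partial>M)" by simp
    also have "\<dots> = (\<integral>x. (u x)\<^sup>2 - 2 * t * (u x * v x) + t\<^sup>2 * (v x)\<^sup>2 \<partial>M)"
      by (intro Bochner_Integration.integral_cong refl) (simp add: power2_diff power_mult_distrib)
    also have "\<dots> = A - 2 * t * B + t\<^sup>2 * C"
      using i iuv by (simp add: A_def B_def C_def)
    finally show ?thesis .
  qed
  have AC: "A \<ge> 0" "C \<ge> 0" by (auto simp: A_def C_def)
  have "B\<^sup>2 \<le> A * C"
  proof (cases "C = 0")
    case True
    have "B = 0"
    proof (rule ccontr)
      assume "B \<noteq> 0"
      \<comment> \<open>If \<open>C\<close> is 0 the nonnegative expression \<open>q\<close> is
        affine in \<open>t\<close>; at this \<open>t\<close> its value is -1.\<close>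
      then show False using q[of "(A + 1) / (2 * B)"] True by simp
    qed
    with True show ?thesis by simp
  next
    case False
    then have "0 \<le> A - B\<^sup>2 / C" using q[of "B / C"] by (simp add: power2_eq_square field_simps)
    then show ?thesis using False AC by (simp add: field_simps)
  qed
  then have "sqrt (B\<^sup>2) \<le> sqrt (A * C)" by (rule real_sqrt_le_mono)
  then show ?thesis by (simp add: A_def B_def C_def real_sqrt_mult)
qed

lemma L2D:
  assumes "u \<in> L2 \<Omega>"
  shows "u \<in> borel_measurable (lebesgue_on \<Omega>)" "integrable (lebesgue_on \<Omega>) (\<lambda>x. (u x)\<^sup>2)"
  using assms by (auto simp: L2_def)

lemma L2_mult_integrable:
  "u \<in> L2 \<Omega> \<Longrightarrow> v \<in> L2 \<Omega> \<Longrightarrow> integrable (lebesgue_on \<Omega>) (\<lambda>x. u x * v x)"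
  by (intro integrable_mult_squares L2D)

lemma L2_bounded:
  assumes "\<Omega> \<in> lmeasurable" "u \<in> borel_measurable (lebesgue_on \<Omega>)"
    and "AE x in lebesgue_on \<Omega>. \<bar>u x\<bar> \<le> B"
  shows "u \<in> L2 \<Omega>"
proof -
  interpret finite_measure "lebesgue_on \<Omega>" by (rule finite_measure_lebesgue_on) fact
  have "integrable (lebesgue_on \<Omega>) (\<lambda>x. (u x)\<^sup>2)"
  proof (rule integrable_const_bound[where B = "B\<^sup>2"])
    show "AE x in lebesgue_on \<Omega>. norm ((u x)\<^sup>2) \<le> B\<^sup>2"
      using assms(3) by (rule eventually_mono) (simp add: abs_le_square_iff[symmetric])
    show "(\<lambda>x. (u x)\<^sup>2) \<in> borel_measurable (lebesgue_on \<Omega>)" using assms(2) by measurable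
  qed
  with assms(2) show ?thesis by (simp add: L2_def)
qed

lemma L2_integrable:
  assumes "\<Omega> \<in> lmeasurable" "u \<in> L2 \<Omega>"
  shows "integrable (lebesgue_on \<Omega>) u"
proof -
  have "(\<lambda>x. 1) \<in> L2 \<Omega>" by (rule L2_bounded[OF assms(1), where B = 1]) auto
  from L2_mult_integrable[OF assms(2) this] show ?thesis by simp
qed

lemma L2_add:
  assumes "u \<in> L2 \<Omega>" "v \<in> L2 \<Omega>"
  shows "(\<lambda>x. u x + v x) \<in> L2 \<Omega>"
proof -
  have "integrable (lebesgue_on \<Omega>) (\<lambda>x. (u x)\<^sup>2 + 2 * (u x * v x) + (v x)\<^sup>2)"
    using L2D[OF assms(1)] L2D[OF assms(2)] L2_mult_integrable[OF assms] by auto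
  then have "integrable (lebesgue_on \<Omega>) (\<lambda>x. (u x + v x)\<^sup>2)"
    by (simp add: power2_sum algebra_simps)
  then show ?thesis using L2D[OF assms(1)] L2D[OF assms(2)] by (auto simp: L2_def)
qed

lemma L2_cmult: "u \<in> L2 \<Omega> \<Longrightarrow> (\<lambda>x. c * u x) \<in> L2 \<Omega>"
  by (auto simp: L2_def power_mult_distrib)

lemma L2_diff:
  assumes "u \<in> L2 \<Omega>" "v \<in> L2 \<Omega>"
  shows "(\<lambda>x. u x - v x) \<in> L2 \<Omega>"
  using L2_add[OF assms(1) L2_cmult[OF assms(2), of "-1"]] by simp

lemma continuous_borel_measurable_lebesgue_on:
  fixes f :: "'a::euclidean_space \<Rightarrow> 'b::euclidean_space"
  shows "continuous_on UNIV f \<Longrightarrow> S \<in> sets lebesgue \<Longrightarrow> f \<in> borel_measurable (lebesgue_on S)"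
  by (rule continuous_imp_measurable_on_sets_lebesgue) (rule continuous_on_subset[of UNIV], auto)

lemma L2_continuous:
  assumes "bounded S" "S \<in> sets lebesgue" "continuous_on UNIV u"
  shows "u \<in> L2 S"
proof -
  have "compact (u ` closure S)"
    using assms by (intro compact_continuous_image continuous_on_subset[OF assms(3)]) auto
  then have "bounded (u ` closure S)" by (rule compact_imp_bounded)
  then obtain B where "\<And>x. x \<in> closure S \<Longrightarrow> norm (u x) \<le> B"
    by (auto simp: bounded_iff)
  then have "AE x in lebesgue_on S. \<bar>u x\<bar> \<le> B"
    using closure_subset[of S] by (intro AE_I2) auto
  then show ?thesis
    by (rule L2_bounded[OF bounded_set_imp_lmeasurable[OF assms(1,2)]
          continuous_borel_measurable_lebesgue_on[OF assms(3,2)]])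
qed

section \<open>Test functions\<close>

lemma test_function_support:
  assumes "\<phi> \<in> test_functions \<Omega>" "x \<notin> closure {x. \<phi> x \<noteq> 0}"
  shows "\<phi> x = 0" "grad_on UNIV \<phi> x = 0"
proof -
  show "\<phi> x = 0" using assms(2) closure_subset[of "{x. \<phi> x \<noteq> 0}"] by auto
  have "(\<phi> has_derivative (\<lambda>e. 0 \<bullet> e)) (at x)"
  proof (rule has_derivative_transform_within_open[of "\<lambda>_. 0" _ x UNIV "- closure {x. \<phi> x \<noteq> 0}"])
    show "0 = \<phi> y" if "y \<in> - closure {x. \<phi> x \<noteq> 0}" for y
      using that closure_subset[of "{x. \<phi> x \<noteq> 0}"] by auto
  qed (use assms(2) in \<open>auto simp: open_Compl\<close>)
  then show "grad_on UNIV \<phi> x = 0" by (rule grad_on_eqI)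
qed

lemma test_functionD:
  assumes "\<phi> \<in> test_functions \<Omega>"
  shows "C_k k \<phi>" "x \<notin> \<Omega> \<Longrightarrow> \<phi> x = 0" "x \<notin> \<Omega> \<Longrightarrow> grad_on UNIV \<phi> x = 0"
    "(\<phi> has_derivative (\<lambda>e. grad_on UNIV \<phi> y \<bullet> e)) (at y)"
    "continuous_on A \<phi>" "continuous_on A (grad_on UNIV \<phi>)"
proof -
  have sub: "closure {x. \<phi> x \<noteq> 0} \<subseteq> \<Omega>" and C: "\<And>k. C_k k \<phi>"
    using assms by (auto simp: test_functions_def)
  show "C_k k \<phi>" by (rule C)
  show "\<phi> x = 0" "grad_on UNIV \<phi> x = 0" if "x \<notin> \<Omega>"
    using that sub test_function_support[OF assms, of x] by auto
  show "(\<phi> has_derivative (\<lambda>e. grad_on UNIV \<phi> y \<bullet> e)) (at y)" by (rule C_k_Suc_has_derivative[OF C])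
  show "continuous_on A \<phi>" "continuous_on A (grad_on UNIV \<phi>)"
    by (rule C_k_continuous[OF C] C_k_continuous_grad[OF C])+
qed

lemma test_function_L2:
  assumes "\<phi> \<in> test_functions \<Omega>" "S \<in> sets lebesgue" "bounded S"
  shows "\<phi> \<in> L2 S" "(\<lambda>x. grad_on UNIV \<phi> x $ i) \<in> L2 S"
  using test_functionD[OF assms(1)] assms(2,3) by (auto intro!: L2_continuous continuous_intros)

lemma test_functions_mono: "U \<subseteq> \<Omega> \<Longrightarrow> test_functions U \<subseteq> test_functions \<Omega>"
  by (auto simp: test_functions_def)

lemma mollify_test_function:
  assumes \<Omega>: "open \<Omega>" and L: "L-lipschitz_on UNIV w" and K: "compact K" "K \<subseteq> \<Omega>"
    and w: "\<And>x. w x \<noteq> 0 \<Longrightarrow> x \<in> K" and e: "e > 0"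
  obtains \<phi> where "\<phi> \<in> test_functions \<Omega>" "\<And>x. \<bar>\<phi> x - w x\<bar> \<le> e" "L-lipschitz_on UNIV \<phi>"
    "\<And>x g s. e \<le> s \<Longrightarrow> (\<And>y. y \<in> ball x s \<Longrightarrow> w y = w x + g \<bullet> (y - x)) \<Longrightarrow> grad_on UNIV \<phi> x = g"
proof -
  obtain d where d: "d > 0" "(\<Union>x\<in>K. cball x d) \<subseteq> \<Omega>"
    using compact_subset_open_imp_cball_epsilon_subset[OF K(1) \<Omega> K(2)] by blast
  have L0: "L \<ge> 0" using L lipschitz_on_nonneg by blast
  \<comment> \<open>The mollification radius below stays under two bounds: \<open>d\<close> keeps
    the enlarged support inside \<Omega>, and \<open>X\<close> gives both
    \<open>L * r \<le> e\<close> and \<open>r < e\<close>. The summand 1 covers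
    \<open>L = 0\<close>.\<close>
  define X where "X = e / (L + 1)"
  define r where "r = min d X / 2"
  have X: "X > 0" "X \<le> e" using e L0 by (auto simp: X_def divide_le_eq)
  then have r: "r > 0" "r \<le> d" using d by (auto simp: r_def)
  have r2: "r < X" using X(1) by (auto simp: r_def min_def)
  then have "r \<le> e / (L + 1)" by (simp add: X_def)
  then have "r * (L + 1) \<le> e" using L0 by (simp add: field_simps)
  then have Lr: "L * r \<le> e" using r by (simp add: field_simps)
  have re: "r < e" using r2 X by simp
  have "bounded {x. w x \<noteq> 0}" using w K(1) by (meson bounded_subset compact_imp_bounded mem_Collect_eq subsetI)
  from mollify[OF L this r(1)] obtain \<phi> where \<phi>: "\<And>k. C_k k \<phi>" "\<And>x. \<bar>\<phi> x - w x\<bar> \<le> L * r"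
    "\<And>x. \<phi> x \<noteq> 0 \<Longrightarrow> \<exists>y. w y \<noteq> 0 \<and> dist x y < r" "L-lipschitz_on UNIV \<phi>"
    "\<And>x g s. r < s \<Longrightarrow> (\<And>y. y \<in> ball x s \<Longrightarrow> w y = w x + g \<bullet> (y - x)) \<Longrightarrow> grad_on UNIV \<phi> x = g"
    by metis
  define K' where "K' = {x + y | x y. x \<in> K \<and> y \<in> cball 0 d}"
  have cK': "compact K'" unfolding K'_def by (intro compact_sums K compact_cball)
  have K'\<Omega>: "K' \<subseteq> \<Omega>" using d(2) by (fastforce simp: K'_def dist_norm)
  have "{x. \<phi> x \<noteq> 0} \<subseteq> K'"
  proof
    fix x assume "x \<in> {x. \<phi> x \<noteq> 0}"
    then obtain y where y: "w y \<noteq> 0" "dist x y < r" using \<phi>(3) by auto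
    then have "y \<in> K" "x - y \<in> cball 0 d" using w r by (auto simp: dist_norm norm_minus_commute)
    moreover have "x = y + (x - y)" by simp
    ultimately show "x \<in> K'" unfolding K'_def by blast
  qed
  then have sub: "closure {x. \<phi> x \<noteq> 0} \<subseteq> K'"
    by (rule closure_minimal) (rule compact_imp_closed[OF cK'])
  have "compact (closure {x. \<phi> x \<noteq> 0})"
    using sub cK' by (meson bounded_subset closed_closure compact_eq_bounded_closed)
  with sub K'\<Omega> \<phi>(1) have t: "\<phi> \<in> test_functions \<Omega>" by (auto simp: test_functions_def)
  show ?thesis
  proof (rule that[OF t])
    show "\<bar>\<phi> x - w x\<bar> \<le> e" for x using \<phi>(2)[of x] Lr by simp
    show "L-lipschitz_on UNIV \<phi>" by fact
    show "grad_on UNIV \<phi> x = g" if "e \<le> s" "\<And>y. y \<in> ball x s \<Longrightarrow> w y = w x + g \<bullet> (y - x)" for x g s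
      by (rule \<phi>(5)[of s]) (use that re in auto)
  qed
qed

text \<open>First enlargement of the class of test functions: a Lipschitz weight with compact
  support is a uniform limit of test functions, and \<open>g\<close> is integrable.\<close>

lemma integral_lipschitz_zero:
  assumes \<Omega>: "open \<Omega>" and g: "integrable (lebesgue_on \<Omega>) g"
    and test: "\<And>\<phi>. \<phi> \<in> test_functions \<Omega> \<Longrightarrow> (LINT x|lebesgue_on \<Omega>. g x * \<phi> x) = 0"
    and L: "L-lipschitz_on UNIV w" and K: "compact K" "K \<subseteq> \<Omega>" and w: "\<And>x. w x \<noteq> 0 \<Longrightarrow> x \<in> K"
  shows "(LINT x|lebesgue_on \<Omega>. g x * w x) = 0"
proof -
  have \<Omega>s: "\<Omega> \<in> sets lebesgue" using \<Omega> by auto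
  have gm: "g \<in> borel_measurable (lebesgue_on \<Omega>)" using g by simp
  have int: "integrable (lebesgue_on \<Omega>) (\<lambda>x. g x * f x)"
    if "continuous_on UNIV f" "\<And>x. \<bar>f x\<bar> \<le> B" for f B
  proof (rule Bochner_Integration.integrable_bound)
    show "integrable (lebesgue_on \<Omega>) (\<lambda>x. B * g x)" using g by simp
    show "(\<lambda>x. g x * f x) \<in> borel_measurable (lebesgue_on \<Omega>)"
      using gm continuous_borel_measurable_lebesgue_on[OF that(1) \<Omega>s] by measurable
    show "AE x in lebesgue_on \<Omega>. norm (g x * f x) \<le> norm (B * g x)"
    proof (intro always_eventually allI)
      fix x show "norm (g x * f x) \<le> norm (B * g x)"
        using that(2)[of x] by (simp add: abs_mult mult.commute[of _ "\<bar>g x\<bar>"]) (intro mult_left_mono, auto)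
    qed
  qed
  have cw: "continuous_on UNIV w" using lipschitz_on_continuous_on[OF L] .
  have "compact (w ` K)"
    by (rule compact_continuous_image[OF continuous_on_subset[OF cw] K(1)]) simp
  then have "bounded (w ` K)" by (rule compact_imp_bounded)
  then obtain B where "\<And>x. x \<in> K \<Longrightarrow> \<bar>w x\<bar> \<le> B"
    by (auto simp: bounded_iff)
  then have wB: "\<bar>w x\<bar> \<le> max B 0" for x using w[of x] by fastforce
  have "\<bar>LINT x|lebesgue_on \<Omega>. g x * w x\<bar> \<le> e * (LINT x|lebesgue_on \<Omega>. \<bar>g x\<bar>)" if e: "e > 0" for e
  proof -
    obtain \<phi> where \<phi>: "\<phi> \<in> test_functions \<Omega>" "\<And>x. \<bar>\<phi> x - w x\<bar> \<le> e"
      using mollify_test_function[OF \<Omega> L K w e] by metis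
    have c\<phi>: "continuous_on UNIV \<phi>" by (rule test_functionD[OF \<phi>(1)])
    have \<phi>B: "\<bar>\<phi> x\<bar> \<le> e + max B 0" for x using \<phi>(2)[of x] wB[of x] by linarith
    have "(LINT x|lebesgue_on \<Omega>. g x * w x) = (LINT x|lebesgue_on \<Omega>. g x * w x - g x * \<phi> x)"
      using test[OF \<phi>(1)] int[OF cw wB] int[OF c\<phi> \<phi>B] by simp
    also have "\<bar>\<dots>\<bar> \<le> (LINT x|lebesgue_on \<Omega>. e * \<bar>g x\<bar>)"
    proof (rule order_trans[OF integral_abs_bound integral_mono])
      show "integrable (lebesgue_on \<Omega>) (\<lambda>x. \<bar>g x * w x - g x * \<phi> x\<bar>)"
        using int[OF cw wB] int[OF c\<phi> \<phi>B] by simp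
      show "\<bar>g x * w x - g x * \<phi> x\<bar> \<le> e * \<bar>g x\<bar>" for x
      proof -
        have "\<bar>g x * w x - g x * \<phi> x\<bar> = \<bar>\<phi> x - w x\<bar> * \<bar>g x\<bar>"
          by (simp add: abs_mult[symmetric] algebra_simps abs_minus_commute)
        then show ?thesis using \<phi>(2)[of x] by (simp add: mult_right_mono)
      qed
    qed (use g in auto)
    finally show ?thesis by simp
  qed
  note bound = this
  define I J where "I = \<bar>LINT x|lebesgue_on \<Omega>. g x * w x\<bar>" and "J = (LINT x|lebesgue_on \<Omega>. \<bar>g x\<bar>)"
  have J: "J \<ge> 0" by (simp add: J_def)
  have "I \<le> 0"
  proof (rule ccontr)
    assume "\<not> I \<le> 0"
    then have "I / (2 * (J + 1)) > 0" using J by simp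
    then have "I \<le> I / (2 * (J + 1)) * J" unfolding I_def J_def by (rule bound)
    also have "\<dots> = I * (J / (2 * (J + 1)))" by simp
    also have "\<dots> < I * 1" using \<open>\<not> I \<le> 0\<close> J by (intro mult_strict_left_mono) auto
    finally show False by simp
  qed
  then show ?thesis by (simp add: I_def)
qed

text \<open>Second enlargement: the indicator of a compact set is the pointwise limit of Lipschitz
  cut-offs that decay ever faster with the distance to \<open>K\<close>; dominated convergence with
  majorant \<open>\<bar>g x\<bar>\<close> does the rest.\<close>

lemma integral_compact_zero:
  assumes \<Omega>: "open \<Omega>" and g: "integrable (lebesgue_on \<Omega>) g"
    and test: "\<And>\<phi>. \<phi> \<in> test_functions \<Omega> \<Longrightarrow> (LINT x|lebesgue_on \<Omega>. g x * \<phi> x) = 0"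
    and K: "compact K" "K \<subseteq> \<Omega>"
  shows "(LINT x|lebesgue_on \<Omega>. g x * indicator K x) = 0"
proof (cases "K = {}")
  case False
  obtain d where d: "d > 0" "(\<Union>x\<in>K. cball x d) \<subseteq> \<Omega>"
    using compact_subset_open_imp_cball_epsilon_subset[OF K(1) \<Omega> K(2)] by blast
  \<comment> \<open>With slope at least \<open>1 / d\<close> every cut-off vanishes at distance
    \<open>d\<close> from \<open>K\<close>, so that one compact subset of \<Omega> contains all the
    supports.\<close>
  define N where "N = 1 / d"
  have N: "N > 0" using d by (simp add: N_def)
  define w where "w n x = max 0 (1 - (N + real n) * infdist x K)" for n x
  have lip: "(N + real n)-lipschitz_on UNIV (w n)" for n
  proof (rule lipschitz_onI)
    fix x y
    have "(N + real n) * \<bar>infdist x K - infdist y K\<bar> \<le> (N + real n) * dist x y"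
      using infdist_triangle_abs[of x K y] N by (intro mult_left_mono) auto
    then have "\<bar>(N + real n) * infdist x K - (N + real n) * infdist y K\<bar> \<le> (N + real n) * dist x y"
      using N by (simp add: right_diff_distrib[symmetric] abs_mult)
    then show "dist (w n x) (w n y) \<le> (N + real n) * dist x y"
      unfolding w_def dist_real_def by linarith
  qed (use N in auto)
  define K' where "K' = {x + y | x y. x \<in> K \<and> y \<in> cball 0 d}"
  have cK': "compact K'" unfolding K'_def by (intro compact_sums K compact_cball)
  have K'\<Omega>: "K' \<subseteq> \<Omega>" using d(2) by (fastforce simp: K'_def dist_norm)
  have supp: "x \<in> K'" if "w n x \<noteq> 0" for n x
  proof -
    have "(N + real n) * infdist x K < 1" using that by (auto simp: w_def max_def split: if_splits)
    moreover have "N * infdist x K \<le> (N + real n) * infdist x K"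
      using infdist_nonneg by (intro mult_right_mono) auto
    ultimately have "infdist x K < d" using d by (simp add: N_def field_simps)
    moreover obtain y where "y \<in> K" "infdist x K = dist x y"
      using infdist_attains_inf[of K x] K(1) False compact_imp_closed by blast
    ultimately have "y \<in> K" "x - y \<in> cball 0 d" by (auto simp: dist_norm norm_minus_commute)
    moreover have "x = y + (x - y)" by simp
    ultimately show ?thesis unfolding K'_def by blast
  qed
  have zero: "(LINT x|lebesgue_on \<Omega>. g x * w n x) = 0" for n
    by (rule integral_lipschitz_zero[OF \<Omega> g test lip cK' K'\<Omega> supp])
  have \<Omega>s: "\<Omega> \<in> sets lebesgue" using \<Omega> by auto
  have gm: "g \<in> borel_measurable (lebesgue_on \<Omega>)" using g by simp
  have "(\<lambda>n. LINT x|lebesgue_on \<Omega>. g x * w n x) \<longlonglongrightarrow> (LINT x|lebesgue_on \<Omega>. g x * indicator K x)"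
  proof (rule integral_dominated_convergence[where w = "\<lambda>x. \<bar>g x\<bar>"])
    have "K \<in> sets lebesgue" using K(1) by (simp add: compact_imp_closed)
    then have "K \<in> sets (lebesgue_on \<Omega>)" using \<Omega>s K(2) by (simp add: sets_restrict_space_iff)
    then show "(\<lambda>x. g x * indicator K x) \<in> borel_measurable (lebesgue_on \<Omega>)"
      using gm by measurable
    show "(\<lambda>x. g x * w n x) \<in> borel_measurable (lebesgue_on \<Omega>)" for n
      using gm continuous_borel_measurable_lebesgue_on[OF lipschitz_on_continuous_on[OF lip] \<Omega>s, of n] by measurable
    show "AE x in lebesgue_on \<Omega>. norm (g x * w n x) \<le> \<bar>g x\<bar>" for n
    proof (intro always_eventually allI)
      fix x
      have "0 \<le> (N + real n) * infdist x K" using N infdist_nonneg[of x K] by simp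
      then have "\<bar>w n x\<bar> \<le> 1" by (auto simp: w_def)
      then show "norm (g x * w n x) \<le> \<bar>g x\<bar>" by (simp add: abs_mult mult_left_le)
    qed
    show "AE x in lebesgue_on \<Omega>. (\<lambda>n. g x * w n x) \<longlonglongrightarrow> g x * indicator K x"
    proof (intro always_eventually allI)
      fix x
      show "(\<lambda>n. g x * w n x) \<longlonglongrightarrow> g x * indicator K x"
      proof (cases "x \<in> K")
        case True
        then have "w n x = 1" for n by (simp add: w_def)
        with True show ?thesis by simp
      next
        case False
        then have pos: "infdist x K > 0"
          using \<open>K \<noteq> {}\<close> K(1) by (metis compact_imp_closed in_closed_iff_infdist_zero infdist_nonneg order_less_le)
        have "eventually (\<lambda>n. w n x = 0) sequentially"
        proof -
          have "eventually (\<lambda>n. real n \<ge> 1 / infdist x K) sequentially" by real_asymp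
          then show ?thesis
          proof (rule eventually_mono)
            fix n assume "real n \<ge> 1 / infdist x K"
            then have "1 \<le> real n * infdist x K" using pos by (simp add: field_simps)
            also have "\<dots> \<le> (N + real n) * infdist x K" using N pos by (intro mult_right_mono) auto
            finally show "w n x = 0" by (simp add: w_def)
          qed
        qed
        then have "eventually (\<lambda>n. g x * w n x = g x * indicator K x) sequentially"
          by (rule eventually_mono) (use False in auto)
        then show ?thesis by (rule tendsto_eventually)
      qed
    qed
  qed (use g in auto)
  then show ?thesis unfolding zero by (simp add: LIMSEQ_const_iff)
qed simp

text \<open>If \<open>g\<close> were positive on a set of positive measure, inner regularity would
  give a compact subset that is not null; but \<open>g\<close> integrates to 0 over it while being
  positive there. Applying this to \<open>g\<close> and to its negative gives the claim.\<close>

lemma fundamental_lemma: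
  assumes \<Omega>: "open \<Omega>" "bounded \<Omega>" and g: "integrable (lebesgue_on \<Omega>) g"
    and test: "\<And>\<phi>. \<phi> \<in> test_functions \<Omega> \<Longrightarrow> (LINT x|lebesgue_on \<Omega>. g x * \<phi> x) = 0"
  shows "AE x in lebesgue_on \<Omega>. g x = 0"
proof -
  have \<Omega>s: "\<Omega> \<in> sets lebesgue" using \<Omega> by auto
  have nonpos: "AE x in lebesgue_on \<Omega>. f x \<le> 0"
    if f: "integrable (lebesgue_on \<Omega>) f"
      and test: "\<And>\<phi>. \<phi> \<in> test_functions \<Omega> \<Longrightarrow> (LINT x|lebesgue_on \<Omega>. f x * \<phi> x) = 0" for f
  proof -
    define S where "S = {x \<in> \<Omega>. f x > 0}"
    have fm: "f \<in> borel_measurable (lebesgue_on \<Omega>)" using f by simp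
    have "{x \<in> space (lebesgue_on \<Omega>). f x > 0} \<in> sets (lebesgue_on \<Omega>)" using fm by measurable
    then have S': "S \<in> sets (lebesgue_on \<Omega>)" by (simp add: S_def)
    then have S: "S \<in> sets lebesgue" using \<Omega>s by (simp add: sets_restrict_space_iff)
    have "emeasure lebesgue S = 0"
    proof (rule ccontr)
      assume ne: "emeasure lebesgue S \<noteq> 0"
      have Sl: "S \<in> lmeasurable" using S bounded_subset[OF \<Omega>(2), of S]
        by (intro bounded_set_imp_lmeasurable) (auto simp: S_def)
      define m where "m = measure lebesgue S"
      have m: "emeasure lebesgue S = ennreal m" unfolding m_def by (rule emeasure_eq_measure2[OF Sl])
      with ne have m0: "m > 0" unfolding m_def by (metis ennreal_0 less_eq_real_def measure_nonneg)
      obtain T where T: "closed T" "T \<subseteq> S" "S - T \<in> lmeasurable" "emeasure lebesgue (S - T) < ennreal m"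
        using sets_lebesgue_inner_closed[OF S m0] by blast
      have cT: "compact T" using T(1,2) bounded_subset[OF \<Omega>(2), of T]
        by (auto simp: compact_eq_bounded_closed S_def)
      have T\<Omega>: "T \<subseteq> \<Omega>" using T(2) by (auto simp: S_def)
      have Ts: "T \<in> sets (lebesgue_on \<Omega>)" using T(1) T\<Omega> \<Omega>s by (simp add: sets_restrict_space_iff)
      have z: "(LINT x|lebesgue_on \<Omega>. f x * indicator T x) = 0"
        by (rule integral_compact_zero[OF \<Omega>(1) f test cT T\<Omega>])
      have "AE x in lebesgue_on \<Omega>. f x * indicator T x = 0"
      proof (subst integral_nonneg_eq_0_iff_AE[symmetric])
        show "integrable (lebesgue_on \<Omega>) (\<lambda>x. f x * indicator T x)"
          by (rule integrable_real_mult_indicator[OF Ts f])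
        show "AE x in lebesgue_on \<Omega>. 0 \<le> f x * indicator T x"
          using T(2) by (intro always_eventually) (auto simp: indicator_def S_def)
      qed (rule z)
      then have "AE x in lebesgue_on \<Omega>. x \<notin> T"
        by (rule eventually_mono) (use T(2) in \<open>auto simp: S_def indicator_def\<close>)
      then have "AE x in lebesgue. x \<in> \<Omega> \<longrightarrow> x \<notin> T" using \<Omega>s by (simp add: AE_restrict_space_iff)
      then have "AE x in lebesgue. x \<notin> T" by (rule eventually_mono) (use T\<Omega> in auto)
      then have "T \<in> null_sets lebesgue" using T(1) by (simp add: AE_iff_null_sets)
      then have "emeasure lebesgue (S - T) = emeasure lebesgue S"
        by (rule emeasure_Diff_null_set) (use S in auto)
      with T(4) m show False by simp
    qed
    then have "S \<in> null_sets lebesgue" using S by auto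
    then have "AE x in lebesgue. x \<notin> S" by (rule AE_not_in)
    then show ?thesis using \<Omega>s by (auto simp: AE_restrict_space_iff S_def elim!: eventually_mono)
  qed
  have "AE x in lebesgue_on \<Omega>. g x \<le> 0" by (rule nonpos[OF g test])
  moreover have "AE x in lebesgue_on \<Omega>. - g x \<le> 0"
    by (rule nonpos) (use g test in auto)
  ultimately show ?thesis by eventually_elim simp
qed

section \<open>Weak gradients: agreement with classical ones, uniqueness, locality\<close>

lemma lebesgue_on_integral_eq_lborel:
  fixes F :: "'a::euclidean_space \<Rightarrow> real"
  assumes "\<Omega> \<in> sets lebesgue" "F \<in> borel_measurable borel" "\<And>x. x \<notin> \<Omega> \<Longrightarrow> F x = 0"
  shows "(LINT x|lebesgue_on \<Omega>. F x) = (\<integral>x. F x \<partial>lborel)"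
    and "integrable (lebesgue_on \<Omega>) F \<longleftrightarrow> integrable lborel F"
proof -
  have e: "(\<lambda>x. indicator \<Omega> x *\<^sub>R F x) = F" using assms(3) by (auto simp: fun_eq_iff indicator_def)
  show "(LINT x|lebesgue_on \<Omega>. F x) = (\<integral>x. F x \<partial>lborel)"
    using assms(1,2) e by (simp add: integral_restrict_space integral_completion)
  show "integrable (lebesgue_on \<Omega>) F \<longleftrightarrow> integrable lborel F"
    using assms(1,2) e by (simp add: integrable_restrict_space integrable_completion)
qed

text \<open>The product of \<open>u\<close> and \<phi> is continuously differentiable and vanishes
  outside a bounded set, so its gradient has integral zero. No regularity of the boundary of
  \<Omega> enters.\<close>

lemma integral_by_parts_test_function:
  assumes \<Omega>: "open \<Omega>" "bounded \<Omega>" and \<phi>: "\<phi> \<in> test_functions \<Omega>"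
    and u: "\<And>x. (u has_derivative (\<lambda>e. G x \<bullet> e)) (at x)" and G: "continuous_on UNIV G"
  shows "(LINT x|lebesgue_on \<Omega>. u x * grad_on UNIV \<phi> x $ i) = - (LINT x|lebesgue_on \<Omega>. G x $ i * \<phi> x)"
proof -
  note t = test_functionD[OF \<phi>]
  have \<Omega>s: "\<Omega> \<in> sets lebesgue" using \<Omega> by auto
  have cu: "continuous_on UNIV u" by (rule has_derivative_continuous_on_UNIV[OF u])
  obtain R where R: "\<And>x. x \<in> \<Omega> \<Longrightarrow> norm x < R"
    using \<Omega>(2) unfolding bounded_pos_less by blast
  let ?H = "\<lambda>x. u x *\<^sub>R grad_on UNIV \<phi> x + \<phi> x *\<^sub>R G x"
  have H: "((\<lambda>x. u x * \<phi> x) has_derivative (\<lambda>e. ?H x \<bullet> e)) (at x)" for x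
    using has_derivative_mult[OF u[of x] t(4)[of x]] by (simp add: inner_add_left mult.commute)
  have cH: "continuous_on UNIV ?H" by (intro continuous_intros cu G t)
  have Hi: "?H x \<bullet> axis i 1 = u x * grad_on UNIV \<phi> x $ i + G x $ i * \<phi> x" for x
    by (simp add: inner_add_left inner_axis mult.commute)
  have nz: "norm x < R" if "u x * \<phi> x \<noteq> 0" for x using that t(2)[of x] R[of x] by auto
  have z: "(\<integral>x. u x * grad_on UNIV \<phi> x $ i + G x $ i * \<phi> x \<partial>lborel) = 0"
    using integral_grad_compact_support(2)[OF H cH nz, where e = "axis i 1"] unfolding Hi by simp
  have m: "(\<lambda>x. u x * grad_on UNIV \<phi> x $ i + G x $ i * \<phi> x) \<in> borel_measurable borel"
    by (intro borel_measurable_continuous_onI continuous_intros cu G t)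
  have s: "(LINT x|lebesgue_on \<Omega>. u x * grad_on UNIV \<phi> x $ i + G x $ i * \<phi> x) = 0"
    using lebesgue_on_integral_eq_lborel(1)[OF \<Omega>s m] t(2,3) z by simp
  have L: "u \<in> L2 \<Omega>" "(\<lambda>x. G x $ i) \<in> L2 \<Omega>"
    by (intro L2_continuous[OF \<Omega>(2) \<Omega>s] cu continuous_intros G)+
  note L\<phi> = test_function_L2[OF \<phi> \<Omega>s \<Omega>(2)]
  show ?thesis
    using s L2_mult_integrable[OF L(1) L\<phi>(2)[of i]] L2_mult_integrable[OF L(2) L\<phi>(1)] by simp
qed

lemma is_weak_grad_C1:
  assumes \<Omega>: "open \<Omega>" "bounded \<Omega>"
    and u: "\<And>x. (u has_derivative (\<lambda>e. G x \<bullet> e)) (at x)" and G: "continuous_on UNIV G"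
  shows "is_weak_grad \<Omega> u G"
  unfolding is_weak_grad_def
proof (intro conjI allI ballI)
  show "(\<lambda>x. G x $ i) \<in> L2 \<Omega>" for i
    using \<Omega> by (intro L2_continuous continuous_intros G) auto
qed (rule integral_by_parts_test_function[OF \<Omega> _ u G])

lemma is_weak_grad_test_function:
  "open \<Omega> \<Longrightarrow> bounded \<Omega> \<Longrightarrow> \<phi> \<in> test_functions \<Omega> \<Longrightarrow> is_weak_grad \<Omega> \<phi> (grad_on UNIV \<phi>)"
  by (rule is_weak_grad_C1) (auto intro: test_functionD)

lemma is_weak_gradD:
  assumes "is_weak_grad \<Omega> u g"
  shows "(\<lambda>x. g x $ i) \<in> L2 \<Omega>"
    "\<phi> \<in> test_functions \<Omega> \<Longrightarrow> (LINT x|lebesgue_on \<Omega>. u x * grad_on UNIV \<phi> x $ i) =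
        - (LINT x|lebesgue_on \<Omega>. g x $ i * \<phi> x)"
  using assms by (auto simp: is_weak_grad_def)

text \<open>The link between the chosen representative \<open>weak_grad\<close> and any gradient
  computed by hand: the difference, tested with smooth functions, falls under
  \<open>fundamental_lemma\<close>.\<close>

lemma is_weak_grad_unique:
  assumes \<Omega>: "open \<Omega>" "bounded \<Omega>" and g: "is_weak_grad \<Omega> u g" "is_weak_grad \<Omega> u g'"
  shows "AE x in lebesgue_on \<Omega>. g x = g' x"
proof -
  have \<Omega>s: "\<Omega> \<in> sets lebesgue" and \<Omega>l: "\<Omega> \<in> lmeasurable"
    using \<Omega> by (auto intro: lmeasurable_open)
  have "AE x in lebesgue_on \<Omega>. g x $ i - g' x $ i = 0" for i
  proof (rule fundamental_lemma[OF \<Omega>])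
    show "integrable (lebesgue_on \<Omega>) (\<lambda>x. g x $ i - g' x $ i)"
      by (intro L2_integrable[OF \<Omega>l] L2_diff is_weak_gradD(1)[OF g(1)] is_weak_gradD(1)[OF g(2)])
    show "(LINT x|lebesgue_on \<Omega>. (g x $ i - g' x $ i) * \<phi> x) = 0" if \<phi>: "\<phi> \<in> test_functions \<Omega>" for \<phi>
    proof -
      note L\<phi> = test_function_L2(1)[OF \<phi> \<Omega>s \<Omega>(2)]
      show ?thesis
        using is_weak_gradD(2)[OF g(1) \<phi>, of i] is_weak_gradD(2)[OF g(2) \<phi>, of i]
          L2_mult_integrable[OF is_weak_gradD(1)[OF g(1), of i] L\<phi>]
          L2_mult_integrable[OF is_weak_gradD(1)[OF g(2), of i] L\<phi>]
        by (simp add: left_diff_distrib)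
    qed
  qed
  then have "AE x in lebesgue_on \<Omega>. g x $ 1 - g' x $ 1 = 0" "AE x in lebesgue_on \<Omega>. g x $ 2 - g' x $ 2 = 0"
    by blast+
  then show ?thesis by eventually_elim (simp add: vec_eq_iff forall_2)
qed

lemma is_weak_grad_weak_grad: "is_weak_grad \<Omega> u g \<Longrightarrow> is_weak_grad \<Omega> u (weak_grad \<Omega> u)"
  unfolding weak_grad_def by (rule someI[of "is_weak_grad \<Omega> u"])

lemma H1_is_weak_grad: "u \<in> H1 \<Omega> \<Longrightarrow> is_weak_grad \<Omega> u (weak_grad \<Omega> u)"
  unfolding H1_def by (auto intro: is_weak_grad_weak_grad)

lemma weak_grad_eq_AE:
  assumes "open \<Omega>" "bounded \<Omega>" "is_weak_grad \<Omega> u g"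
  shows "AE x in lebesgue_on \<Omega>. weak_grad \<Omega> u x = g x"
  by (rule is_weak_grad_unique[OF assms(1,2) is_weak_grad_weak_grad[OF assms(3)] assms(3)])

lemma is_weak_grad_diff:
  assumes \<Omega>: "open \<Omega>" "bounded \<Omega>" and L: "u \<in> L2 \<Omega>" "v \<in> L2 \<Omega>"
    and g: "is_weak_grad \<Omega> u g" "is_weak_grad \<Omega> v g'"
  shows "is_weak_grad \<Omega> (\<lambda>x. u x - v x) (\<lambda>x. g x - g' x)"
  unfolding is_weak_grad_def
proof (intro conjI allI ballI)
  show "(\<lambda>x. (g x - g' x) $ i) \<in> L2 \<Omega>" for i
    using L2_diff[OF is_weak_gradD(1)[OF g(1), of i] is_weak_gradD(1)[OF g(2), of i]] by simp
  fix \<phi> i assume \<phi>: "\<phi> \<in> test_functions \<Omega>"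
  have \<Omega>s: "\<Omega> \<in> sets lebesgue" using \<Omega> by auto
  note L\<phi> = test_function_L2[OF \<phi> \<Omega>s \<Omega>(2)]
  show "(LINT x|lebesgue_on \<Omega>. (u x - v x) * grad_on UNIV \<phi> x $ i) = - (LINT x|lebesgue_on \<Omega>. (g x - g' x) $ i * \<phi> x)"
    using is_weak_gradD(2)[OF g(1) \<phi>, of i] is_weak_gradD(2)[OF g(2) \<phi>, of i]
      L2_mult_integrable[OF is_weak_gradD(1)[OF g(1), of i] L\<phi>(1)]
      L2_mult_integrable[OF is_weak_gradD(1)[OF g(2), of i] L\<phi>(1)]
      L2_mult_integrable[OF L(1) L\<phi>(2)[of i]] L2_mult_integrable[OF L(2) L\<phi>(2)[of i]]
    by (simp add: left_diff_distrib)
qed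

lemma lebesgue_on_integral_subset:
  fixes F :: "'a::euclidean_space \<Rightarrow> real"
  assumes "U \<in> sets lebesgue" "\<Omega> \<in> sets lebesgue" "U \<subseteq> \<Omega>" "\<And>x. x \<in> \<Omega> - U \<Longrightarrow> F x = 0"
  shows "(LINT x|lebesgue_on U. F x) = (LINT x|lebesgue_on \<Omega>. F x)"
proof -
  have "(\<lambda>x. indicator U x *\<^sub>R F x) = (\<lambda>x. indicator \<Omega> x *\<^sub>R F x)"
    using assms by (auto simp: fun_eq_iff indicator_def)
  then show ?thesis using assms by (simp add: integral_restrict_space)
qed

lemma measurable_lebesgue_on_subset:
  assumes "U \<in> sets lebesgue" "\<Omega> \<in> sets lebesgue" "U \<subseteq> \<Omega>" "f \<in> borel_measurable (lebesgue_on \<Omega>)"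
  shows "f \<in> borel_measurable (lebesgue_on U)"
  using measurable_restrict_mono[OF assms(4,3)] .

lemma L2_subset:
  assumes "U \<in> sets lebesgue" "\<Omega> \<in> sets lebesgue" "U \<subseteq> \<Omega>" "u \<in> L2 \<Omega>"
  shows "u \<in> L2 U"
proof -
  have "integrable lebesgue (\<lambda>x. indicator \<Omega> x *\<^sub>R (u x)\<^sup>2)"
    using L2D(2)[OF assms(4)] assms(2) by (simp add: integrable_restrict_space)
  then have "integrable lebesgue (\<lambda>x. indicator U x *\<^sub>R (indicator \<Omega> x *\<^sub>R (u x)\<^sup>2))"
    by (rule integrable_mult_indicator[OF assms(1)])
  moreover have "(\<lambda>x. indicator U x *\<^sub>R (indicator \<Omega> x *\<^sub>R (u x)\<^sup>2)) = (\<lambda>x. indicator U x *\<^sub>R (u x)\<^sup>2)"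
    using assms(3) by (auto simp: fun_eq_iff indicator_def)
  ultimately have "integrable (lebesgue_on U) (\<lambda>x. (u x)\<^sup>2)"
    using assms(1) by (simp add: integrable_restrict_space)
  then show ?thesis using measurable_lebesgue_on_subset[OF assms(1-3) L2D(1)[OF assms(4)]] by (simp add: L2_def)
qed

lemma is_weak_grad_subset:
  assumes U: "open U" "U \<subseteq> \<Omega>" "\<Omega> \<in> sets lebesgue" and g: "is_weak_grad \<Omega> u g"
  shows "is_weak_grad U u g"
  unfolding is_weak_grad_def
proof (intro conjI allI ballI)
  have Us: "U \<in> sets lebesgue" using U by auto
  show "(\<lambda>x. g x $ i) \<in> L2 U" for i by (rule L2_subset[OF Us U(3,2) is_weak_gradD(1)[OF g]])
  fix \<phi> i assume \<phi>: "\<phi> \<in> test_functions U"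
  then have \<phi>': "\<phi> \<in> test_functions \<Omega>" using test_functions_mono[OF U(2)] by blast
  have "(LINT x|lebesgue_on U. u x * grad_on UNIV \<phi> x $ i) = (LINT x|lebesgue_on \<Omega>. u x * grad_on UNIV \<phi> x $ i)"
    by (rule lebesgue_on_integral_subset[OF Us U(3,2)]) (use test_functionD(3)[OF \<phi>] in auto)
  moreover have "(LINT x|lebesgue_on U. g x $ i * \<phi> x) = (LINT x|lebesgue_on \<Omega>. g x $ i * \<phi> x)"
    by (rule lebesgue_on_integral_subset[OF Us U(3,2)]) (use test_functionD(2)[OF \<phi>] in auto)
  ultimately show "(LINT x|lebesgue_on U. u x * grad_on UNIV \<phi> x $ i) = - (LINT x|lebesgue_on U. g x $ i * \<phi> x)"
    using is_weak_gradD(2)[OF g \<phi>', of i] by simp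
qed

text \<open>Locality of weak gradients: on \<open>U\<close> both the restricted weak gradient and
  the constant \<open>b\<close> are weak gradients of \<open>u\<close>, hence equal almost
  everywhere.\<close>

lemma weak_grad_affine:
  assumes \<Omega>: "open \<Omega>" "bounded \<Omega>" and U: "open U" "U \<subseteq> \<Omega>" and u: "u \<in> H1 \<Omega>"
    and aff: "\<And>x. x \<in> U \<Longrightarrow> u x = a + b \<bullet> x"
  shows "AE x in lebesgue_on U. weak_grad \<Omega> u x = b"
proof (rule is_weak_grad_unique[OF U(1) bounded_subset[OF \<Omega>(2) U(2)]])
  show 1: "is_weak_grad U u (weak_grad \<Omega> u)"
    using \<Omega> by (intro is_weak_grad_subset[OF U _ H1_is_weak_grad[OF u]]) auto
  have "is_weak_grad U (\<lambda>x. a + b \<bullet> x) (\<lambda>_. b)"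
    by (rule is_weak_grad_C1[OF U(1) bounded_subset[OF \<Omega>(2) U(2)]]) (auto intro!: derivative_eq_intros)
  moreover have "(LINT x|lebesgue_on U. u x * f x) = (LINT x|lebesgue_on U. (a + b \<bullet> x) * f x)" for f
    by (intro Bochner_Integration.integral_cong) (auto simp: aff)
  ultimately show "is_weak_grad U u (\<lambda>_. b)" unfolding is_weak_grad_def by simp
qed

section \<open>The energy norm and the closure of the test functions\<close>

lemma norm_power2_vec2: "(norm (x :: real^2))\<^sup>2 = (x$1)\<^sup>2 + (x$2)\<^sup>2"
  unfolding power2_norm_eq_inner by (simp add: inner_vec_def sum_2 power2_eq_square)

lemma L2_norm_vec_integrable:
  assumes "\<And>i. (\<lambda>x. g x $ i) \<in> L2 \<Omega>"
  shows "integrable (lebesgue_on \<Omega>) (\<lambda>x. (norm (g x :: real^2))\<^sup>2)"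
  unfolding norm_power2_vec2 using L2D(2)[OF assms] by auto

lemma norm_eps_power2:
  assumes "0 \<le> \<epsilon>"
  shows "(norm_eps \<epsilon> \<Omega> u)\<^sup>2 = L2_norm_sq \<Omega> u + \<epsilon> * (LINT x|lebesgue_on \<Omega>. (norm (weak_grad \<Omega> u x))\<^sup>2)"
  unfolding norm_eps_def L2_norm_sq_def
  using assms by (intro real_sqrt_pow2 add_nonneg_nonneg mult_nonneg_nonneg) auto

lemma norm_eps_1_diff_test:
  assumes \<Omega>: "open \<Omega>" "bounded \<Omega>" and \<phi>: "\<phi> \<in> test_functions \<Omega>" and v: "v \<in> L2 \<Omega>" "is_weak_grad \<Omega> v g"
  shows "(norm_eps 1 \<Omega> (\<lambda>x. v x - \<phi> x))\<^sup>2 =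
    L2_norm_sq \<Omega> (\<lambda>x. v x - \<phi> x) + (LINT x|lebesgue_on \<Omega>. (norm (g x - grad_on UNIV \<phi> x))\<^sup>2)"
proof -
  have \<Omega>s: "\<Omega> \<in> sets lebesgue" using \<Omega> by auto
  have w: "is_weak_grad \<Omega> (\<lambda>x. v x - \<phi> x) (\<lambda>x. g x - grad_on UNIV \<phi> x)"
    by (intro is_weak_grad_diff is_weak_grad_test_function \<Omega> v test_function_L2(1)[OF \<phi> \<Omega>s] \<phi>)
  have w': "is_weak_grad \<Omega> (\<lambda>x. v x - \<phi> x) (weak_grad \<Omega> (\<lambda>x. v x - \<phi> x))"
    by (rule is_weak_grad_weak_grad[OF w])
  have m: "(\<lambda>x. norm (h x)) \<in> borel_measurable (lebesgue_on \<Omega>)" if "is_weak_grad \<Omega> u h" for u h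
  proof -
    have "(\<lambda>x. sqrt ((h x $ 1)\<^sup>2 + (h x $ 2)\<^sup>2)) \<in> borel_measurable (lebesgue_on \<Omega>)"
      using L2D(1)[OF is_weak_gradD(1)[OF that]] by measurable
    then show ?thesis by (simp add: norm_power2_vec2[symmetric])
  qed
  have "(LINT x|lebesgue_on \<Omega>. (norm (weak_grad \<Omega> (\<lambda>x. v x - \<phi> x) x))\<^sup>2)
      = (LINT x|lebesgue_on \<Omega>. (norm (g x - grad_on UNIV \<phi> x))\<^sup>2)"
  proof (rule integral_cong_AE)
    show "AE x in lebesgue_on \<Omega>. (norm (weak_grad \<Omega> (\<lambda>x. v x - \<phi> x) x))\<^sup>2 = (norm (g x - grad_on UNIV \<phi> x))\<^sup>2"
      using weak_grad_eq_AE[OF \<Omega> w] by (rule eventually_mono) simp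
  qed (use m[OF w] m[OF w'] in measurable)
  then show ?thesis by (simp add: norm_eps_power2)
qed

lemma H10_approx:
  assumes \<Omega>: "open \<Omega>" "bounded \<Omega>" and v: "v \<in> H10 \<Omega>" and e: "e > 0"
  obtains \<phi> where "\<phi> \<in> test_functions \<Omega>" "L2_norm_sq \<Omega> (\<lambda>x. v x - \<phi> x) < e"
    "(LINT x|lebesgue_on \<Omega>. (norm (weak_grad \<Omega> v x - grad_on UNIV \<phi> x))\<^sup>2) < e"
proof -
  have v1: "v \<in> H1 \<Omega>" using v by (simp add: H10_def)
  then have v2: "v \<in> L2 \<Omega>" by (simp add: H1_def)
  have "\<exists>\<phi>\<in>test_functions \<Omega>. norm_eps 1 \<Omega> (\<lambda>x. v x - \<phi> x) < e'" if "e' > 0" for e'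
    using v that by (simp add: H10_def)
  from this[of "sqrt e"] e
  obtain \<phi> where \<phi>: "\<phi> \<in> test_functions \<Omega>" "norm_eps 1 \<Omega> (\<lambda>x. v x - \<phi> x) < sqrt e"
    by auto
  have "0 \<le> norm_eps 1 \<Omega> (\<lambda>x. v x - \<phi> x)"
    unfolding norm_eps_def L2_norm_sq_def by simp
  then have "(norm_eps 1 \<Omega> (\<lambda>x. v x - \<phi> x))\<^sup>2 < (sqrt e)\<^sup>2"
    using \<phi>(2) by (intro power_strict_mono) auto
  then have *: "L2_norm_sq \<Omega> (\<lambda>x. v x - \<phi> x) + (LINT x|lebesgue_on \<Omega>. (norm (weak_grad \<Omega> v x - grad_on UNIV \<phi> x))\<^sup>2) < e"
    using norm_eps_1_diff_test[OF \<Omega> \<phi>(1) v2 H1_is_weak_grad[OF v1]] e by simp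
  have "0 \<le> L2_norm_sq \<Omega> (\<lambda>x. v x - \<phi> x)" "0 \<le> (LINT x|lebesgue_on \<Omega>. (norm (weak_grad \<Omega> v x - grad_on UNIV \<phi> x))\<^sup>2)"
    by (auto simp: L2_norm_sq_def)
  then show ?thesis using * that[OF \<phi>(1)] by linarith
qed

text \<open>For \<open>d \<ge> 0\<close> this is the shrinkage map, which moves \<open>t\<close> by
  \<open>d\<close> towards 0 and sends \<open>[-d, d]\<close> to 0. Written with \<open>max\<close>
  and \<open>min\<close>, its properties reduce to case distinctions in linear arithmetic.\<close>

definition soft_threshold :: "real \<Rightarrow> real \<Rightarrow> real" where
  "soft_threshold d t = max 0 (t - d) + min 0 (t + d)"

lemma soft_threshold_lipschitz: "0 \<le> d \<Longrightarrow> \<bar>soft_threshold d s - soft_threshold d t\<bar> \<le> \<bar>s - t\<bar>"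
  by (auto simp: soft_threshold_def max_def min_def)

lemma soft_threshold_diff: "0 \<le> d \<Longrightarrow> \<bar>soft_threshold d t - t\<bar> \<le> d"
  by (auto simp: soft_threshold_def max_def min_def)

lemma soft_threshold_eq_0: "0 \<le> d \<Longrightarrow> \<bar>t\<bar> \<le> d \<Longrightarrow> soft_threshold d t = 0"
  by (auto simp: soft_threshold_def max_def min_def)

text \<open>Soft thresholding moves the support of \<open>v\<close> into the interior of \<open>\<Omega>\<close>; mollifying the
  result yields approximating test functions.\<close>

lemma lipschitz_in_H10:
  fixes v :: "real^2 \<Rightarrow> real"
  assumes \<Omega>: "open \<Omega>" "bounded \<Omega>" and L: "L-lipschitz_on UNIV v"
    and v0: "\<And>x. x \<notin> \<Omega> \<Longrightarrow> v x = 0"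
    and gm: "\<And>i. (\<lambda>x. g x $ i) \<in> borel_measurable (lebesgue_on \<Omega>)"
    and aff: "AE x in lebesgue_on \<Omega>. (\<exists>s>0. \<forall>y\<in>ball x s. v y = v x + g x \<bullet> (y - x)) \<and> (v x \<noteq> 0 \<or> g x = 0)"
  shows "v \<in> H10 \<Omega>" "is_weak_grad \<Omega> v g"
proof -
  have \<Omega>s: "\<Omega> \<in> sets lebesgue" and \<Omega>l: "\<Omega> \<in> lmeasurable"
    using \<Omega> by (auto intro: lmeasurable_open)
  interpret finite_measure "lebesgue_on \<Omega>" by (rule finite_measure_lebesgue_on[OF \<Omega>l])
  have cv: "continuous_on UNIV v" using lipschitz_on_continuous_on[OF L] .
  have vL2: "v \<in> L2 \<Omega>" by (rule L2_continuous[OF \<Omega>(2) \<Omega>s cv])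
  have L0: "L \<ge> 0" using L lipschitz_on_nonneg by blast
  define d where "d n = 1 / (real n + 1)" for n
  have d: "d n > 0" for n by (simp add: d_def)
  have dlim: "d \<longlonglongrightarrow> 0" unfolding d_def by real_asymp
  define w where "w n x = soft_threshold (d n) (v x)" for n x
  have "\<exists>\<phi>. \<phi> \<in> test_functions \<Omega> \<and> (\<forall>x. \<bar>\<phi> x - w n x\<bar> \<le> d n) \<and> L-lipschitz_on UNIV \<phi> \<and>
    (\<forall>x g s. d n \<le> s \<longrightarrow> (\<forall>y \<in> ball x s. w n y = w n x + g \<bullet> (y - x)) \<longrightarrow> grad_on UNIV \<phi> x = g)" for n
  proof -
    \<comment> \<open>The thresholded function vanishes off \<open>K\<close>, and \<open>K\<close>
      is compact in \<Omega> because \<open>v\<close> is continuous and zero outside the bounded set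
      \<Omega>. Thus it can be mollified into a test function.\<close>
    define K where "K = {x. d n \<le> \<bar>v x\<bar>}"
    have "closed K" unfolding K_def by (intro closed_Collect_le continuous_intros cv)
    moreover have K\<Omega>: "K \<subseteq> \<Omega>" using v0 d[of n] by (force simp: K_def)
    ultimately have cK: "compact K" using bounded_subset[OF \<Omega>(2)] by (simp add: compact_eq_bounded_closed)
    have wl: "L-lipschitz_on UNIV (w n)"
    proof (rule lipschitz_onI[OF _ L0])
      fix x y
      have "\<bar>w n x - w n y\<bar> \<le> \<bar>v x - v y\<bar>" unfolding w_def using d[of n] by (intro soft_threshold_lipschitz) simp
      also have "\<dots> \<le> L * dist x y" using lipschitz_onD[OF L, of x y] by (simp add: dist_real_def)
      finally show "dist (w n x) (w n y) \<le> L * dist x y" by (simp add: dist_real_def)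
    qed
    have wK: "x \<in> K" if "w n x \<noteq> 0" for x
      using that soft_threshold_eq_0[of "d n" "v x"] d[of n] by (fastforce simp: w_def K_def)
    show ?thesis
      using mollify_test_function[OF \<Omega>(1) wl cK K\<Omega> wK d[of n]] by metis
  qed
  then obtain \<phi> where \<phi>: "\<And>n. \<phi> n \<in> test_functions \<Omega>" "\<And>n x. \<bar>\<phi> n x - w n x\<bar> \<le> d n"
    "\<And>n. L-lipschitz_on UNIV (\<phi> n)"
    "\<And>n x g s. d n \<le> s \<Longrightarrow> (\<forall>y \<in> ball x s. w n y = w n x + g \<bullet> (y - x)) \<Longrightarrow> grad_on UNIV (\<phi> n) x = g"
    by metis
  have \<phi>v: "\<bar>\<phi> n x - v x\<bar> \<le> 2 * d n" for n x
    using \<phi>(2)[of n x] soft_threshold_diff[of "d n" "v x"] d[of n] by (simp add: w_def)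
  have \<phi>lim: "(\<lambda>n. \<phi> n x) \<longlonglongrightarrow> v x" for x
  proof (rule LIM_zero_cancel, rule Lim_null_comparison)
    show "eventually (\<lambda>n. norm (\<phi> n x - v x) \<le> 2 * d n) sequentially" using \<phi>v by simp
    show "(\<lambda>n. 2 * d n) \<longlonglongrightarrow> 0" using tendsto_mult_left[OF dlim, of 2] by simp
  qed
  let ?G = "\<lambda>n. grad_on UNIV (\<phi> n)"
  have Gb: "norm (?G n x) \<le> L" for n x
    by (rule lipschitz_grad_bound[OF \<phi>(3)]) (rule differentiableI[OF test_functionD(4)[OF \<phi>(1)]])
  \<comment> \<open>Pointwise, the gradients are not merely convergent but eventually equal to
    \<open>g x\<close>. If \<open>v x = 0\<close> then \<open>g x = 0\<close>, and \<open>v\<close>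
    and its thresholded versions vanish near \<open>x\<close>. If \<open>v x\<close> is nonzero,
    \<open>v\<close> keeps its sign near \<open>x\<close> and thresholding subtracts a constant
    there, which leaves the gradient unchanged. Excluded is a zero of \<open>v\<close> with nonzero
    slope, which thresholding would flatten.\<close>
  have ev: "eventually (\<lambda>n. ?G n x = g x) sequentially"
    if s: "s > 0" "\<forall>y\<in>ball x s. v y = v x + g x \<bullet> (y - x)" and nz: "v x \<noteq> 0 \<or> g x = 0" for x s
  proof (cases "v x = 0")
    case True
    with nz have z: "v y = 0" if "y \<in> ball x s" for y using bspec[OF s(2) that] by simp
    have "eventually (\<lambda>n. d n < s) sequentially" using order_tendstoD(2)[OF dlim s(1)] .
    then show ?thesis
    proof (rule eventually_mono)
      fix n assume "d n < s"
      have w0: "w n y = 0" if "y \<in> ball x s" for y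
        using z[OF that] d[of n] by (simp add: w_def soft_threshold_eq_0)
      have g0: "g x = 0" using nz True by simp
      show "?G n x = g x"
      proof (rule \<phi>(4)[of n s])
        show "\<forall>y\<in>ball x s. w n y = w n x + g x \<bullet> (y - x)" using w0 s(1) g0 by simp
      qed (use \<open>d n < s\<close> in simp)
    qed
  next
    case False
    \<comment> \<open>On the ball of radius \<open>t\<close> the function \<open>v\<close> changes
      by at most half of \<open>\<bar>v x\<bar>\<close>; the summand 1 avoids dividing by a
      vanishing gradient.\<close>
    define t where "t = min s (\<bar>v x\<bar> / 2 / (norm (g x) + 1))"
    have gp: "norm (g x) + 1 > 0" using norm_ge_zero[of "g x"] by linarith
    have t: "t > 0" "t \<le> s" using s(1) False gp by (auto simp: t_def)
    have tn: "t * norm (g x) \<le> \<bar>v x\<bar> / 2"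
    proof -
      have "t \<le> \<bar>v x\<bar> / 2 / (norm (g x) + 1)" by (simp add: t_def)
      then have "t * (norm (g x) + 1) \<le> \<bar>v x\<bar> / 2" by (simp only: pos_le_divide_eq[OF gp])
      then show ?thesis using t by (simp add: distrib_left)
    qed
    have close: "\<bar>v y - v x\<bar> \<le> \<bar>v x\<bar> / 2" if "y \<in> ball x t" for y
    proof -
      have "v y = v x + g x \<bullet> (y - x)" by (rule bspec[OF s(2)]) (use that t in auto)
      then have "\<bar>v y - v x\<bar> = \<bar>g x \<bullet> (y - x)\<bar>" by linarith
      also have "\<dots> \<le> norm (g x) * norm (y - x)" by (rule Cauchy_Schwarz_ineq2)
      also have "\<dots> \<le> norm (g x) * t" using that by (intro mult_left_mono) (auto simp: dist_norm norm_minus_commute)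
      finally show ?thesis using tn by (simp add: mult.commute)
    qed
    have "eventually (\<lambda>n. d n < min t (\<bar>v x\<bar> / 2)) sequentially"
      using order_tendstoD(2)[OF dlim, of "min t (\<bar>v x\<bar> / 2)"] t False by simp
    then show ?thesis
    proof (rule eventually_mono)
      fix n assume n: "d n < min t (\<bar>v x\<bar> / 2)"
      have wy: "w n y = v y - sgn (v x) * d n" if "y \<in> ball x t" for y
        using close[OF that] n d[of n] False
        by (cases "v x > 0") (auto simp: w_def soft_threshold_def max_def min_def abs_if split: if_splits)
      show "?G n x = g x"
      proof (rule \<phi>(4)[of n t])
        show "\<forall>y\<in>ball x t. w n y = w n x + g x \<bullet> (y - x)"
        proof
          fix y assume y: "y \<in> ball x t"
          have "v y = v x + g x \<bullet> (y - x)" by (rule bspec[OF s(2)]) (use y t in auto)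
          then show "w n y = w n x + g x \<bullet> (y - x)"
            using wy[OF y] wy[of x] t by simp
        qed
      qed (use n in simp)
    qed
  qed
  have Glim: "AE x in lebesgue_on \<Omega>. eventually (\<lambda>n. ?G n x = g x) sequentially"
    using aff by (rule eventually_mono) (use ev in blast)
  have gb: "AE x in lebesgue_on \<Omega>. norm (g x) \<le> L"
    using Glim
  proof (rule eventually_mono)
    fix x assume "eventually (\<lambda>n. ?G n x = g x) sequentially"
    then obtain n where "?G n x = g x" by (auto simp: eventually_sequentially)
    then show "norm (g x) \<le> L" using Gb[of n x] by simp
  qed
  have gL2: "(\<lambda>x. g x $ i) \<in> L2 \<Omega>" for i
  proof (rule L2_bounded[OF \<Omega>l gm])
    show "AE x in lebesgue_on \<Omega>. \<bar>g x $ i\<bar> \<le> L"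
      using gb by (rule eventually_mono) (metis component_le_norm_cart order_trans)
  qed
  have m\<phi>: "\<phi> n \<in> borel_measurable (lebesgue_on \<Omega>)" "(\<lambda>x. ?G n x $ i) \<in> borel_measurable (lebesgue_on \<Omega>)" for n i
    using test_function_L2[OF \<phi>(1) \<Omega>s \<Omega>(2)] L2D(1) by blast+
  show wg: "is_weak_grad \<Omega> v g"
    unfolding is_weak_grad_def
  proof (intro conjI allI ballI)
    show "(\<lambda>x. g x $ i) \<in> L2 \<Omega>" for i by (rule gL2)
    fix \<psi> i assume \<psi>: "\<psi> \<in> test_functions \<Omega>"
    note L\<psi> = test_function_L2[OF \<psi> \<Omega>s \<Omega>(2)]
    have m\<psi>: "\<psi> \<in> borel_measurable (lebesgue_on \<Omega>)" "(\<lambda>x. grad_on UNIV \<psi> x $ i) \<in> borel_measurable (lebesgue_on \<Omega>)"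
      using L2D(1)[OF L\<psi>(1)] L2D(1)[OF L\<psi>(2)] by auto
    have mv: "v \<in> borel_measurable (lebesgue_on \<Omega>)" by (rule L2D[OF vL2])
    have 1: "(\<lambda>n. LINT x|lebesgue_on \<Omega>. \<phi> n x * grad_on UNIV \<psi> x $ i) \<longlonglongrightarrow> (LINT x|lebesgue_on \<Omega>. v x * grad_on UNIV \<psi> x $ i)"
    proof (rule integral_dominated_convergence[where w = "\<lambda>x. (\<bar>v x\<bar> + 2) * \<bar>grad_on UNIV \<psi> x $ i\<bar>"])
      have "integrable (lebesgue_on \<Omega>) (\<lambda>x. \<bar>v x * grad_on UNIV \<psi> x $ i\<bar> + 2 * \<bar>grad_on UNIV \<psi> x $ i\<bar>)"
        using L2_mult_integrable[OF vL2 L\<psi>(2)[of i]] L2_integrable[OF \<Omega>l L\<psi>(2)[of i]] by simp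
      then show "integrable (lebesgue_on \<Omega>) (\<lambda>x. (\<bar>v x\<bar> + 2) * \<bar>grad_on UNIV \<psi> x $ i\<bar>)"
        by (simp add: abs_mult distrib_right)
      show "AE x in lebesgue_on \<Omega>. norm (\<phi> n x * grad_on UNIV \<psi> x $ i) \<le> (\<bar>v x\<bar> + 2) * \<bar>grad_on UNIV \<psi> x $ i\<bar>" for n
      proof (intro always_eventually allI)
        fix x
        have "d n \<le> 1" by (simp add: d_def)
        then have "\<bar>\<phi> n x\<bar> \<le> \<bar>v x\<bar> + 2" using \<phi>v[of n x] by linarith
        then show "norm (\<phi> n x * grad_on UNIV \<psi> x $ i) \<le> (\<bar>v x\<bar> + 2) * \<bar>grad_on UNIV \<psi> x $ i\<bar>"
          by (simp add: abs_mult mult_right_mono)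
      qed
      show "AE x in lebesgue_on \<Omega>. (\<lambda>n. \<phi> n x * grad_on UNIV \<psi> x $ i) \<longlonglongrightarrow> v x * grad_on UNIV \<psi> x $ i"
        by (intro always_eventually allI tendsto_mult_right \<phi>lim)
    qed (use mv m\<psi> m\<phi>(1) in measurable)
    have 2: "(\<lambda>n. LINT x|lebesgue_on \<Omega>. ?G n x $ i * \<psi> x) \<longlonglongrightarrow> (LINT x|lebesgue_on \<Omega>. g x $ i * \<psi> x)"
    proof (rule integral_dominated_convergence[where w = "\<lambda>x. L * \<bar>\<psi> x\<bar>"])
      show "integrable (lebesgue_on \<Omega>) (\<lambda>x. L * \<bar>\<psi> x\<bar>)"
        using L2_integrable[OF \<Omega>l L\<psi>(1)] by simp
      show "AE x in lebesgue_on \<Omega>. norm (?G n x $ i * \<psi> x) \<le> L * \<bar>\<psi> x\<bar>" for n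
      proof (intro always_eventually allI)
        fix x
        have "\<bar>?G n x $ i\<bar> \<le> L" using Gb[of n x] component_le_norm_cart[of "?G n x" i] by linarith
        then show "norm (?G n x $ i * \<psi> x) \<le> L * \<bar>\<psi> x\<bar>"
          by (simp add: abs_mult mult_right_mono)
      qed
      show "AE x in lebesgue_on \<Omega>. (\<lambda>n. ?G n x $ i * \<psi> x) \<longlonglongrightarrow> g x $ i * \<psi> x"
        using Glim
        by (rule eventually_mono) (auto intro!: tendsto_eventually elim!: eventually_mono)
    qed (use gm m\<psi> m\<phi>(2) in measurable)
    have "(LINT x|lebesgue_on \<Omega>. \<phi> n x * grad_on UNIV \<psi> x $ i) = - (LINT x|lebesgue_on \<Omega>. ?G n x $ i * \<psi> x)" for n
      using is_weak_gradD(2)[OF is_weak_grad_test_function[OF \<Omega> \<phi>(1)] \<psi>] .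
    with 1 have "(\<lambda>n. - (LINT x|lebesgue_on \<Omega>. ?G n x $ i * \<psi> x)) \<longlonglongrightarrow> (LINT x|lebesgue_on \<Omega>. v x * grad_on UNIV \<psi> x $ i)"
      by simp
    from LIMSEQ_unique[OF this tendsto_minus[OF 2]]
    show "(LINT x|lebesgue_on \<Omega>. v x * grad_on UNIV \<psi> x $ i) = - (LINT x|lebesgue_on \<Omega>. g x $ i * \<psi> x)" .
  qed
  \<comment> \<open>The majorant 4 is the square of \<open>2 * d n\<close> at
    \<open>d n = 1\<close>; constants are integrable because \<Omega> has finite measure. For the
    gradients below, twice the Lipschitz constant plays the same part.\<close>
  have 3: "(\<lambda>n. LINT x|lebesgue_on \<Omega>. (v x - \<phi> n x)\<^sup>2) \<longlonglongrightarrow> (LINT x|lebesgue_on \<Omega>. (0::real))"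
  proof (rule integral_dominated_convergence[where w = "\<lambda>x. 4"])
    have mv: "v \<in> borel_measurable (lebesgue_on \<Omega>)" by (rule L2D[OF vL2])
    show "(\<lambda>x. (v x - \<phi> n x)\<^sup>2) \<in> borel_measurable (lebesgue_on \<Omega>)" for n
      using mv m\<phi>(1)[of n] by measurable
    show "AE x in lebesgue_on \<Omega>. norm ((v x - \<phi> n x)\<^sup>2) \<le> 4" for n
    proof (intro always_eventually allI)
      fix x
      have "d n \<le> 1" by (simp add: d_def)
      then have "\<bar>v x - \<phi> n x\<bar> \<le> 2" using \<phi>v[of n x] by linarith
      then have "\<bar>v x - \<phi> n x\<bar>\<^sup>2 \<le> 2\<^sup>2" by (intro power_mono) auto
      then show "norm ((v x - \<phi> n x)\<^sup>2) \<le> 4" by simp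
    qed
    show "AE x in lebesgue_on \<Omega>. (\<lambda>n. (v x - \<phi> n x)\<^sup>2) \<longlonglongrightarrow> 0"
    proof (intro always_eventually allI)
      fix x
      have "(\<lambda>n. (v x - \<phi> n x)\<^sup>2) \<longlonglongrightarrow> (v x - v x)\<^sup>2" by (intro tendsto_intros \<phi>lim)
      then show "(\<lambda>n. (v x - \<phi> n x)\<^sup>2) \<longlonglongrightarrow> 0" by simp
    qed
  qed auto
  have 4: "(\<lambda>n. LINT x|lebesgue_on \<Omega>. (norm (g x - ?G n x))\<^sup>2) \<longlonglongrightarrow> (LINT x|lebesgue_on \<Omega>. (0::real))"
  proof (rule integral_dominated_convergence[where w = "\<lambda>x. (2 * L)\<^sup>2"])
    show "(\<lambda>x. (norm (g x - ?G n x))\<^sup>2) \<in> borel_measurable (lebesgue_on \<Omega>)" for n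
      unfolding norm_power2_vec2 using gm m\<phi>(2)[of n] by (simp; measurable)
    show "AE x in lebesgue_on \<Omega>. norm ((norm (g x - ?G n x))\<^sup>2) \<le> (2 * L)\<^sup>2" for n
      using gb
    proof (rule eventually_mono)
      fix x assume "norm (g x) \<le> L"
      then have "norm (g x - ?G n x) \<le> 2 * L" using Gb[of n x] norm_triangle_ineq4[of "g x" "?G n x"] by linarith
      then have "(norm (g x - ?G n x))\<^sup>2 \<le> (2 * L)\<^sup>2" by (intro power_mono) auto
      then show "norm ((norm (g x - ?G n x))\<^sup>2) \<le> (2 * L)\<^sup>2" by simp
    qed
    show "AE x in lebesgue_on \<Omega>. (\<lambda>n. (norm (g x - ?G n x))\<^sup>2) \<longlonglongrightarrow> 0"
      using Glim
      by (rule eventually_mono) (auto intro!: tendsto_eventually elim!: eventually_mono)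
  qed auto
  have "(\<lambda>n. (norm_eps 1 \<Omega> (\<lambda>x. v x - \<phi> n x))\<^sup>2) \<longlonglongrightarrow> 0"
    unfolding norm_eps_1_diff_test[OF \<Omega> \<phi>(1) vL2 wg] L2_norm_sq_def
    using tendsto_add[OF 3 4] by simp
  then have lim: "(\<lambda>n. norm_eps 1 \<Omega> (\<lambda>x. v x - \<phi> n x)) \<longlonglongrightarrow> 0"
  proof -
    assume "(\<lambda>n. (norm_eps 1 \<Omega> (\<lambda>x. v x - \<phi> n x))\<^sup>2) \<longlonglongrightarrow> 0"
    from tendsto_real_sqrt[OF this] show ?thesis
      by (simp add: norm_eps_def L2_norm_sq_def)
  qed
  show "v \<in> H10 \<Omega>"
    unfolding H10_def
  proof (intro CollectI conjI allI impI)
    show "v \<in> H1 \<Omega>" using vL2 wg by (auto simp: H1_def)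
    fix e :: real assume "e > 0"
    from order_tendstoD(2)[OF lim this] obtain n where "norm_eps 1 \<Omega> (\<lambda>x. v x - \<phi> n x) < e"
      by (auto simp: eventually_sequentially)
    then show "\<exists>\<phi>\<in>test_functions \<Omega>. norm_eps 1 \<Omega> (\<lambda>x. v x - \<phi> x) < e" using \<phi>(1) by blast
  qed
qed

section \<open>Poincare inequality on balls\<close>

lemma nn_integral_translation:
  fixes f :: "'a::euclidean_space \<Rightarrow> ennreal"
  assumes "f \<in> borel_measurable borel"
  shows "(\<integral>\<^sup>+x. f (c + x) \<partial>lborel) = (\<integral>\<^sup>+x. f x \<partial>lborel)"
proof -
  have "(\<integral>\<^sup>+x. f x \<partial>lborel) = (\<integral>\<^sup>+x. f x \<partial>distr lborel borel ((+) c))"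
    by (simp add: lborel_distr_plus)
  also have "\<dots> = (\<integral>\<^sup>+x. f (c + x) \<partial>lborel)"
    using assms by (intro nn_integral_distr) auto
  finally show ?thesis ..
qed

lemma cball_measurable [measurable]: "cball (z :: 'a::euclidean_space) r \<in> sets borel"
  by simp

lemma nn_integral_lborel_swap:
  fixes f :: "'a::euclidean_space \<Rightarrow> 'b::euclidean_space \<Rightarrow> ennreal"
  assumes "(\<lambda>p. f (fst p) (snd p)) \<in> borel_measurable borel"
  shows "(\<integral>\<^sup>+x. \<integral>\<^sup>+y. f x y \<partial>lborel \<partial>lborel) = (\<integral>\<^sup>+y. \<integral>\<^sup>+x. f x y \<partial>lborel \<partial>lborel)"
proof -
  have "(case_prod f) \<in> borel_measurable (lborel \<Otimes>\<^sub>M lborel)"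
    using assms by (simp add: lborel_prod case_prod_unfold)
  from lborel_pair.Fubini'[OF this] show ?thesis by simp
qed

text \<open>The fundamental theorem of calculus along the segment and the Cauchy-Schwarz inequality
  on the unit interval. The bound is stated in \<open>ennreal\<close> over the whole line, ready for
  Tonelli.\<close>

lemma square_increment_bound:
  fixes \<phi> :: "real^2 \<Rightarrow> real"
  assumes \<phi>: "\<And>x. (\<phi> has_derivative (\<lambda>e. G x \<bullet> e)) (at x)" and G: "continuous_on UNIV G"
  shows "ennreal ((\<phi> (x + w) - \<phi> x)\<^sup>2) \<le>
    (\<integral>\<^sup>+t. indicator {0..1} t * ennreal ((norm w)\<^sup>2 * (norm (G (x + t *\<^sub>R w)))\<^sup>2) \<partial>lborel)"
proof -
  let ?f = "\<lambda>t. G (x + t *\<^sub>R w) \<bullet> w"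
  have cG: "continuous_on A (\<lambda>t. G (x + t *\<^sub>R w))" for A
    by (intro continuous_on_compose2[OF G] continuous_intros) auto
  have cf: "continuous_on A ?f" for A by (intro continuous_intros cG)
  have "(\<integral>t. ?f t * indicator {0..1} t \<partial>lborel) = \<phi> (x + 1 *\<^sub>R w) - \<phi> (x + 0 *\<^sub>R w)"
  proof (rule integral_FTC_Icc_real)
    fix t :: real
    have "((\<lambda>t. \<phi> (x + t *\<^sub>R w)) has_derivative (\<lambda>h. G (x + t *\<^sub>R w) \<bullet> (h *\<^sub>R w))) (at t)"
      by (rule has_derivative_compose[OF _ \<phi>]) (auto intro!: derivative_eq_intros)
    moreover have "(\<lambda>h. G (x + t *\<^sub>R w) \<bullet> (h *\<^sub>R w)) = (\<lambda>h. ?f t * h)" by (simp add: fun_eq_iff)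
    ultimately show "((\<lambda>t. \<phi> (x + t *\<^sub>R w)) has_real_derivative ?f t) (at t)"
      unfolding has_field_derivative_def by simp
    show "isCont ?f t" using cf[of UNIV] by (simp add: continuous_on_eq_continuous_at)
  qed simp
  then have "\<phi> (x + w) - \<phi> x = (LINT t|lebesgue_on {0..1}. ?f t)"
    using lebesgue_on_integral_lborel(1)[OF _ cf, of "{0..1}"] by (simp add: mult.commute)
  moreover have "\<bar>LINT t|lebesgue_on {0..1}. ?f t * 1\<bar> \<le>
    sqrt (LINT t|lebesgue_on {0..1}. (?f t)\<^sup>2) * sqrt (LINT t|lebesgue_on {0..1::real}. (1::real)\<^sup>2)"
    by (intro cauchy_schwarz_integral lebesgue_on_integral_lborel(2) continuous_intros cG
        continuous_imp_measurable_on_sets_lebesgue) auto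
  moreover have "(LINT t|lebesgue_on {0..1::real}. (1::real)\<^sup>2) = 1"
    by (simp add: measure_restrict_space)
  ultimately have "\<bar>\<phi> (x + w) - \<phi> x\<bar> \<le> sqrt (LINT t|lebesgue_on {0..1}. (?f t)\<^sup>2)" by simp
  then have "\<bar>\<phi> (x + w) - \<phi> x\<bar>\<^sup>2 \<le> (sqrt (LINT t|lebesgue_on {0..1}. (?f t)\<^sup>2))\<^sup>2"
    by (intro power_mono) auto
  then have "(\<phi> (x + w) - \<phi> x)\<^sup>2 \<le> (LINT t|lebesgue_on {0..1}. (?f t)\<^sup>2)" by simp
  also have "\<dots> \<le> (LINT t|lebesgue_on {0..1}. (norm w)\<^sup>2 * (norm (G (x + t *\<^sub>R w)))\<^sup>2)"
  proof (rule integral_mono)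
    fix t
    have "\<bar>?f t\<bar> \<le> norm (G (x + t *\<^sub>R w)) * norm w" by (rule Cauchy_Schwarz_ineq2)
    then have "\<bar>?f t\<bar>\<^sup>2 \<le> (norm (G (x + t *\<^sub>R w)) * norm w)\<^sup>2" by (intro power_mono) auto
    then show "(?f t)\<^sup>2 \<le> (norm w)\<^sup>2 * (norm (G (x + t *\<^sub>R w)))\<^sup>2"
      by (simp add: power_mult_distrib mult.commute)
  qed (intro lebesgue_on_integral_lborel(2) continuous_intros cG compact_Icc)+
  also have "\<dots> = (\<integral>t. indicator {0..1} t * ((norm w)\<^sup>2 * (norm (G (x + t *\<^sub>R w)))\<^sup>2) \<partial>lborel)"
    by (intro lebesgue_on_integral_lborel(1) continuous_intros cG compact_Icc)
  finally have "ennreal ((\<phi> (x + w) - \<phi> x)\<^sup>2) \<le> ennreal (\<integral>t. indicator {0..1} t * ((norm w)\<^sup>2 * (norm (G (x + t *\<^sub>R w)))\<^sup>2) \<partial>lborel)"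
    by (rule ennreal_leI)
  also have "\<dots> = (\<integral>\<^sup>+t. ennreal (indicator {0..1} t * ((norm w)\<^sup>2 * (norm (G (x + t *\<^sub>R w)))\<^sup>2)) \<partial>lborel)"
  proof (rule nn_integral_eq_integral[symmetric])
    have "integrable lborel (\<lambda>t. indicator {0..1} t *\<^sub>R ((norm w)\<^sup>2 * (norm (G (x + t *\<^sub>R w)))\<^sup>2))"
      by (intro borel_integrable_compact compact_Icc continuous_intros cG)
    then show "integrable lborel (\<lambda>t. indicator {0..1} t * ((norm w)\<^sup>2 * (norm (G (x + t *\<^sub>R w)))\<^sup>2))" by simp
  qed simp
  also have "\<dots> = (\<integral>\<^sup>+t. indicator {0..1} t * ennreal ((norm w)\<^sup>2 * (norm (G (x + t *\<^sub>R w)))\<^sup>2) \<partial>lborel)"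
    by (intro nn_integral_cong) (auto simp: indicator_def)
  finally show ?thesis .
qed

text \<open>Integrate the increment bound over the ball and exchange the integrals. For fixed
  \<open>t\<close> the translation by \<open>t *\<^sub>R w\<close> has length at most
  \<open>2 * h\<close>, so the translated ball lies in the one of radius
  \<open>3 * h\<close>.\<close>

lemma translation_estimate:
  fixes \<phi> :: "real^2 \<Rightarrow> real"
  assumes \<phi>: "\<And>x. (\<phi> has_derivative (\<lambda>e. G x \<bullet> e)) (at x)" and G: "continuous_on UNIV G"
    and w: "norm w \<le> 2 * h"
  shows "(\<integral>\<^sup>+x. indicator (cball z h) x * ennreal ((\<phi> (x + w) - \<phi> x)\<^sup>2) \<partial>lborel)
    \<le> ennreal (4 * h\<^sup>2) * (\<integral>\<^sup>+x. indicator (cball z (3 * h)) x * ennreal ((norm (G x))\<^sup>2) \<partial>lborel)"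
proof -
  define g where "g y = ennreal ((norm (G y))\<^sup>2)" for y
  define I where "I = (\<integral>\<^sup>+x. indicator (cball z (3 * h)) x * g x \<partial>lborel)"
  have Gm [measurable]: "G \<in> borel_measurable borel" by (rule borel_measurable_continuous_onI[OF G])
  have gm [measurable]: "g \<in> borel_measurable borel" unfolding g_def by measurable
  have "(\<integral>\<^sup>+x. indicator (cball z h) x * ennreal ((\<phi> (x + w) - \<phi> x)\<^sup>2) \<partial>lborel)
    \<le> (\<integral>\<^sup>+x. \<integral>\<^sup>+t. indicator (cball z h) x * (indicator {0..1} t * (ennreal ((norm w)\<^sup>2) * g (x + t *\<^sub>R w))) \<partial>lborel \<partial>lborel)"
    using square_increment_bound[OF \<phi> G, of _ w]
    by (intro nn_integral_mono) (auto simp: indicator_def g_def ennreal_mult)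
  also have "\<dots> = (\<integral>\<^sup>+t. \<integral>\<^sup>+x. indicator (cball z h) x * (indicator {0..1} t * (ennreal ((norm w)\<^sup>2) * g (x + t *\<^sub>R w))) \<partial>lborel \<partial>lborel)"
  proof (rule nn_integral_lborel_swap)
    have [measurable]: "(\<lambda>p. fst p + snd p *\<^sub>R w) \<in> borel_measurable ((borel :: (real^2) measure) \<Otimes>\<^sub>M (borel :: real measure))"
      unfolding borel_prod by (intro borel_measurable_continuous_onI continuous_intros)
    show "(\<lambda>p. indicator (cball z h) (fst p) * (indicator {0..1} (snd p) * (ennreal ((norm w)\<^sup>2) * g (fst p + snd p *\<^sub>R w))))
        \<in> borel_measurable (borel :: ((real^2) \<times> real) measure)"
      unfolding borel_prod[symmetric] by measurable
  qed
  also have "\<dots> \<le> (\<integral>\<^sup>+t. indicator {0..1::real} t * (ennreal (4 * h\<^sup>2) * I) \<partial>lborel)"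
  proof (rule nn_integral_mono)
    fix t :: real
    show "(\<integral>\<^sup>+x. indicator (cball z h) x * (indicator {0..1} t * (ennreal ((norm w)\<^sup>2) * g (x + t *\<^sub>R w))) \<partial>lborel)
      \<le> indicator {0..1} t * (ennreal (4 * h\<^sup>2) * I)"
    proof (cases "t \<in> {0..1}")
      case True
      have w2: "(norm w)\<^sup>2 \<le> 4 * h\<^sup>2" using power_mono[OF w, of 2] by (simp add: power_mult_distrib)
      have tw: "norm (t *\<^sub>R w) \<le> 2 * h" using True w by (simp add: mult_left_le_one_le order_trans[OF _ w])
      have "(\<integral>\<^sup>+x. indicator (cball z h) x * (indicator {0..1} t * (ennreal ((norm w)\<^sup>2) * g (x + t *\<^sub>R w))) \<partial>lborel)
        \<le> (\<integral>\<^sup>+x. ennreal (4 * h\<^sup>2) * (indicator (cball z (3 * h)) (t *\<^sub>R w + x) * g (t *\<^sub>R w + x)) \<partial>lborel)"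
      proof (rule nn_integral_mono)
        fix x
        show "indicator (cball z h) x * (indicator {0..1} t * (ennreal ((norm w)\<^sup>2) * g (x + t *\<^sub>R w)))
          \<le> ennreal (4 * h\<^sup>2) * (indicator (cball z (3 * h)) (t *\<^sub>R w + x) * g (t *\<^sub>R w + x))"
        proof (cases "x \<in> cball z h")
          case x: True
          have "dist z (t *\<^sub>R w + x) \<le> dist z x + norm (t *\<^sub>R w)"
            using norm_triangle_ineq4[of "z - x" "t *\<^sub>R w"] by (simp add: dist_norm algebra_simps)
          then have "t *\<^sub>R w + x \<in> cball z (3 * h)" using x tw by simp
          with x True w2 show ?thesis
            by (auto simp: add.commute intro!: mult_right_mono ennreal_leI)
        qed auto
      qed
      also have "\<dots> = ennreal (4 * h\<^sup>2) * (\<integral>\<^sup>+x. indicator (cball z (3 * h)) (t *\<^sub>R w + x) * g (t *\<^sub>R w + x) \<partial>lborel)"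
        by (intro nn_integral_cmult) measurable
      also have "(\<integral>\<^sup>+x. indicator (cball z (3 * h)) (t *\<^sub>R w + x) * g (t *\<^sub>R w + x) \<partial>lborel) = I"
        unfolding I_def
        by (rule nn_integral_translation[of "\<lambda>x. indicator (cball z (3 * h)) x * g x"]) measurable
      finally show ?thesis using True by simp
    qed simp
  qed
  also have "\<dots> = ennreal (4 * h\<^sup>2) * I"
    by (subst nn_integral_multc) auto
  finally show ?thesis by (simp add: I_def g_def)
qed

lemma nn_integral_compact:
  fixes f :: "real^2 \<Rightarrow> real"
  assumes "compact S" "continuous_on UNIV f" "\<And>x. 0 \<le> f x"
  shows "(\<integral>\<^sup>+x. indicator S x * ennreal (f x) \<partial>lborel) = ennreal (LINT x|lebesgue_on S. f x)"
proof -
  have c: "continuous_on S f" using continuous_on_subset[OF assms(2)] by auto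
  have "(\<integral>\<^sup>+x. indicator S x * ennreal (f x) \<partial>lborel) = (\<integral>\<^sup>+x. ennreal (indicator S x * f x) \<partial>lborel)"
    by (intro nn_integral_cong) (auto simp: indicator_def)
  also have "\<dots> = ennreal (\<integral>x. indicator S x * f x \<partial>lborel)"
    using borel_integrable_compact[OF assms(1) c] assms(3)
    by (intro nn_integral_eq_integral) auto
  finally show ?thesis using lebesgue_on_integral_lborel(1)[OF assms(1) c] by simp
qed

text \<open>Integrate the squared differences over \<open>x\<close> in the ball and \<open>y\<close>
  in \<open>A\<close>. With \<open>y = x + w\<close> all shifts satisfy
  \<open>norm w \<le> 2 * h\<close>, and \<open>translation_estimate\<close> bounds the contribution
  of each. Some \<open>y\<close> in \<open>A\<close> does no worse than the mean over
  \<open>A\<close>. Leaving \<open>A\<close> free is the point of this form: where \<phi> vanishes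
  on \<open>A\<close>, the constant \<open>\<phi> y\<close> is 0.\<close>

lemma poincare_ball:
  fixes \<phi> :: "real^2 \<Rightarrow> real"
  assumes \<phi>: "\<And>x. (\<phi> has_derivative (\<lambda>e. G x \<bullet> e)) (at x)" and G: "continuous_on UNIV G"
    and h: "h > 0" and A: "A \<subseteq> cball z h" "A \<in> sets borel"
    and \<kappa>: "\<kappa> > 0" "\<kappa> * h\<^sup>2 \<le> measure lborel A"
  shows "\<exists>y\<in>A. (LINT x|lebesgue_on (cball z h). (\<phi> x - \<phi> y)\<^sup>2)
    \<le> 16 * pi / \<kappa> * h\<^sup>2 * (LINT x|lebesgue_on (cball z (3 * h)). (norm (G x))\<^sup>2)"
proof -
  have c\<phi>: "continuous_on UNIV \<phi>" by (rule has_derivative_continuous_on_UNIV[OF \<phi>])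
  have [measurable]: "\<phi> \<in> borel_measurable borel" by (rule borel_measurable_continuous_onI[OF c\<phi>])
  have [measurable]: "A \<in> sets borel" by fact
  define I where "I = (LINT x|lebesgue_on (cball z (3 * h)). (norm (G x))\<^sup>2)"
  have I0: "I \<ge> 0" by (simp add: I_def)
  have Inn: "(\<integral>\<^sup>+x. indicator (cball z (3 * h)) x * ennreal ((norm (G x))\<^sup>2) \<partial>lborel) = ennreal I"
    unfolding I_def by (intro nn_integral_compact continuous_intros G) auto
  define F where "F y = (LINT x|lebesgue_on (cball z h). (\<phi> x - \<phi> y)\<^sup>2)" for y
  have Fnn: "(\<integral>\<^sup>+x. indicator (cball z h) x * ennreal ((\<phi> x - \<phi> y)\<^sup>2) \<partial>lborel) = ennreal (F y)" for y
    unfolding F_def by (intro nn_integral_compact continuous_intros c\<phi>) auto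
  define m where "m = measure lborel A"
  have m0: "m > 0" unfolding m_def using \<kappa> h by (intro less_le_trans[OF _ \<kappa>(2)]) simp
  have Afin: "emeasure lborel A < \<infinity>"
    using emeasure_mono[OF A(1), of lborel] emeasure_lborel_cball_finite[of z h]
    by (auto simp: less_top[symmetric] top_unique)
  have Am: "emeasure lborel A = ennreal m"
    unfolding m_def using Afin by (simp add: emeasure_eq_ennreal_measure less_top)
  have dm: "(\<lambda>p. \<phi> (fst p) - \<phi> (snd p)) \<in> borel_measurable (borel :: ((real^2) \<times> (real^2)) measure)"
    unfolding borel_prod[symmetric] by measurable
  have "(\<integral>\<^sup>+y. indicator A y * ennreal (F y) \<partial>lborel)
      = (\<integral>\<^sup>+y. \<integral>\<^sup>+x. indicator A y * (indicator (cball z h) x * ennreal ((\<phi> x - \<phi> y)\<^sup>2)) \<partial>lborel \<partial>lborel)"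
    unfolding Fnn[symmetric] by (intro nn_integral_cong nn_integral_cmult[symmetric]) measurable
  also have "\<dots> = (\<integral>\<^sup>+x. \<integral>\<^sup>+y. indicator A y * (indicator (cball z h) x * ennreal ((\<phi> x - \<phi> y)\<^sup>2)) \<partial>lborel \<partial>lborel)"
    by (rule nn_integral_lborel_swap) (unfold borel_prod[symmetric], measurable)
  also have "\<dots> \<le> (\<integral>\<^sup>+x. \<integral>\<^sup>+w. indicator (cball z h) x * (indicator (cball 0 (2 * h)) w * ennreal ((\<phi> (x + w) - \<phi> x)\<^sup>2)) \<partial>lborel \<partial>lborel)"
  proof (rule nn_integral_mono)
    fix x
    have "(\<integral>\<^sup>+y. indicator A y * (indicator (cball z h) x * ennreal ((\<phi> x - \<phi> y)\<^sup>2)) \<partial>lborel)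
      = (\<integral>\<^sup>+w. indicator A (x + w) * (indicator (cball z h) x * ennreal ((\<phi> x - \<phi> (x + w))\<^sup>2)) \<partial>lborel)"
      by (rule nn_integral_translation[symmetric]) measurable
    also have "\<dots> \<le> (\<integral>\<^sup>+w. indicator (cball z h) x * (indicator (cball 0 (2 * h)) w * ennreal ((\<phi> (x + w) - \<phi> x)\<^sup>2)) \<partial>lborel)"
    proof (rule nn_integral_mono)
      fix w
      show "indicator A (x + w) * (indicator (cball z h) x * ennreal ((\<phi> x - \<phi> (x + w))\<^sup>2))
        \<le> indicator (cball z h) x * (indicator (cball 0 (2 * h)) w * ennreal ((\<phi> (x + w) - \<phi> x)\<^sup>2))"
      proof (cases "x + w \<in> A \<and> x \<in> cball z h")
        case True
        then have "dist z (x + w) \<le> h" "dist z x \<le> h" using A(1) by auto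
        moreover have "norm w \<le> dist z (x + w) + dist z x"
          using norm_triangle_ineq4[of "z - x" "z - (x + w)"] by (simp add: dist_norm)
        ultimately have "norm w \<le> 2 * h" by linarith
        with True show ?thesis by (simp add: power2_commute)
      qed auto
    qed
    finally show "(\<integral>\<^sup>+y. indicator A y * (indicator (cball z h) x * ennreal ((\<phi> x - \<phi> y)\<^sup>2)) \<partial>lborel)
      \<le> (\<integral>\<^sup>+w. indicator (cball z h) x * (indicator (cball 0 (2 * h)) w * ennreal ((\<phi> (x + w) - \<phi> x)\<^sup>2)) \<partial>lborel)" .
  qed
  also have "\<dots> = (\<integral>\<^sup>+w. \<integral>\<^sup>+x. indicator (cball z h) x * (indicator (cball 0 (2 * h)) w * ennreal ((\<phi> (x + w) - \<phi> x)\<^sup>2)) \<partial>lborel \<partial>lborel)"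
  proof (rule nn_integral_lborel_swap)
    have [measurable]: "(\<lambda>p. fst p + snd p) \<in> borel_measurable ((borel :: (real^2) measure) \<Otimes>\<^sub>M (borel :: (real^2) measure))"
      unfolding borel_prod by (intro borel_measurable_continuous_onI continuous_intros)
    show "(\<lambda>p. indicator (cball z h) (fst p) * (indicator (cball 0 (2 * h)) (snd p) * ennreal ((\<phi> (fst p + snd p) - \<phi> (fst p))\<^sup>2)))
      \<in> borel_measurable (borel :: ((real^2) \<times> (real^2)) measure)"
      unfolding borel_prod[symmetric] by measurable
  qed
  also have "\<dots> \<le> (\<integral>\<^sup>+w. indicator (cball 0 (2 * h)) (w :: real^2) * ennreal (4 * h\<^sup>2 * I) \<partial>lborel)"
  proof (rule nn_integral_mono)
    fix w :: "real^2"
    show "(\<integral>\<^sup>+x. indicator (cball z h) x * (indicator (cball 0 (2 * h)) w * ennreal ((\<phi> (x + w) - \<phi> x)\<^sup>2)) \<partial>lborel)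
      \<le> indicator (cball 0 (2 * h)) w * ennreal (4 * h\<^sup>2 * I)"
    proof (cases "norm w \<le> 2 * h")
      case True
      then show ?thesis
        using translation_estimate[OF \<phi> G True, of z] unfolding Inn by (simp add: ennreal_mult' I0)
    qed simp
  qed
  also have "\<dots> = ennreal (16 * pi * h\<^sup>2 * h\<^sup>2 * I)"
  proof -
    have "emeasure lborel (cball (0::real^2) (2 * h)) = ennreal (pi * (2 * h)\<^sup>2)"
      using h by (simp add: emeasure_cball unit_ball_vol_2)
    then show ?thesis
      using h I0 by (subst nn_integral_multc) (auto simp: ennreal_mult'[symmetric] power_mult_distrib algebra_simps)
  qed
  finally have le: "(\<integral>\<^sup>+y. indicator A y * ennreal (F y) \<partial>lborel) \<le> ennreal (16 * pi * h\<^sup>2 * h\<^sup>2 * I)" .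
  \<comment> \<open>The mean over \<open>A\<close> of the bound just obtained. There the factor 16
    \<pi> arises as the area \<open>4 * pi * h\<^sup>2\<close> of the ball of shifts times the
    factor \<open>4 * h\<^sup>2\<close> of each shift.\<close>
  define c where "c = 16 * pi * h\<^sup>2 * h\<^sup>2 * I / m"
  have c0: "c \<ge> 0" using I0 m0 by (simp add: c_def)
  have "\<exists>y\<in>A. F y \<le> c"
  proof (rule ccontr)
    assume "\<not> (\<exists>y\<in>A. F y \<le> c)"
    then have gt: "F y > c" if "y \<in> A" for y using that by force
    have Fm: "(\<lambda>y. indicator A y * ennreal (F y)) \<in> borel_measurable lborel"
    proof -
      have "(\<lambda>y. \<integral>\<^sup>+x. indicator (cball z h) x * ennreal ((\<phi> x - \<phi> y)\<^sup>2) \<partial>lborel) \<in> borel_measurable lborel"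
        by measurable
      then show ?thesis unfolding Fnn by measurable
    qed
    have "(\<integral>\<^sup>+y. indicator A y * ennreal c \<partial>lborel) < (\<integral>\<^sup>+y. indicator A y * ennreal (F y) \<partial>lborel)"
    proof (rule nn_integral_less)
      show "(\<integral>\<^sup>+y. indicator A y * ennreal c \<partial>lborel) \<noteq> \<infinity>"
        using Am by (simp add: nn_integral_multc ennreal_mult_eq_top_iff)
      show "AE y in lborel. indicator A y * ennreal c \<le> indicator A y * ennreal (F y)"
        using less_imp_le[OF gt] by (intro always_eventually) (auto simp: indicator_def intro!: ennreal_leI)
      show "\<not> (AE y in lborel. indicator A y * ennreal (F y) \<le> indicator A y * ennreal c)"
      proof
        assume "AE y in lborel. indicator A y * ennreal (F y) \<le> indicator A y * ennreal c"
        then have "AE y in lborel. y \<notin> A"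
        proof (rule eventually_mono)
          fix y assume *: "indicator A y * ennreal (F y) \<le> indicator A y * ennreal c"
          show "y \<notin> A"
          proof
            assume "y \<in> A"
            with * gt[of y] c0 show False by (simp add: ennreal_le_iff)
          qed
        qed
        then have "A \<in> null_sets lborel" using AE_iff_null_sets[of A lborel] A(2) by simp
        then have "emeasure lborel A = 0" by (rule null_setsD1)
        with Am m0 show False by simp
      qed
    qed (use Fm in auto)
    also have "\<dots> \<le> ennreal (16 * pi * h\<^sup>2 * h\<^sup>2 * I)" by (rule le)
    also have "(\<integral>\<^sup>+y. indicator A y * ennreal c \<partial>lborel) = ennreal (m * c)"
      using Am m0 by (simp add: nn_integral_multc ennreal_mult')
    also have "m * c = 16 * pi * h\<^sup>2 * h\<^sup>2 * I" using m0 by (simp add: c_def)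
    finally show False by simp
  qed
  then obtain y where y: "y \<in> A" "F y \<le> c" by blast
  have "c \<le> 16 * pi / \<kappa> * h\<^sup>2 * I"
  proof -
    have "c \<le> 16 * pi * h\<^sup>2 * h\<^sup>2 * I / (\<kappa> * h\<^sup>2)"
      unfolding c_def using \<kappa> I0 h by (intro divide_left_mono) (auto simp: m_def m0[unfolded m_def])
    also have "\<dots> = 16 * pi / \<kappa> * h\<^sup>2 * I" using h by (simp add: field_simps power2_eq_square power4_eq_xxxx)
    finally show ?thesis .
  qed
  with y show ?thesis unfolding F_def I_def by force
qed

section \<open>Lipschitz domains\<close>

text \<open>Below a boundary point, in the coordinates of the graph, lies an exterior cone whose
  opening depends on \<open>L\<close>; a ball of radius proportional to \<open>h\<close> fits into
  it at distance about \<open>h\<close>. The same \<kappa> serves all boundary points near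
  \<open>x\<close> because \<gamma> has one Lipschitz constant.\<close>

lemma lipschitz_domain_exterior_ball_local:
  assumes \<Omega>: "lipschitz_domain \<Omega>" and x: "x \<in> frontier \<Omega>"
  shows "\<exists>r>0. \<exists>\<kappa>>0. \<forall>y\<in>frontier \<Omega> \<inter> ball x r. \<forall>h. 0 < h \<longrightarrow> h < 1 \<longrightarrow>
    (\<exists>q. cball q (\<kappa> * h) \<subseteq> cball y h - \<Omega>)"
proof -
  have "\<exists>r>0. \<exists>Q :: point \<Rightarrow> point. \<exists>L. \<exists>\<gamma> :: real \<Rightarrow> real.
        orthogonal_transformation Q \<and> L-lipschitz_on UNIV \<gamma> \<and>
        \<Omega> \<inter> ball x r = {y \<in> ball x r. Q (y - x) $ 2 > \<gamma> (Q (y - x) $ 1)}"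
    using \<Omega> x by (simp only: lipschitz_domain_def)
  then obtain r and Q :: "point \<Rightarrow> point" and L and \<gamma> :: "real \<Rightarrow> real" where r: "r > 0" and Q: "orthogonal_transformation Q" and L: "L-lipschitz_on UNIV \<gamma>"
    and eq: "\<Omega> \<inter> ball x r = {y \<in> ball x r. Q (y - x) $ 2 > \<gamma> (Q (y - x) $ 1)}"
    by (elim exE conjE)
  have op: "open \<Omega>" using \<Omega> by (simp add: lipschitz_domain_def)
  have L0: "L \<ge> 0" using L lipschitz_on_nonneg by blast
  have lin: "linear Q" using Q orthogonal_transformation_linear by blast
  have nQ: "norm (Q v) = norm v" for v using Q orthogonal_transformation_norm by blast
  \<comment> \<open>The unit direction that points straight below the graph.\<close>
  obtain d where d: "Q d = - axis 2 1"
    using orthogonal_transformation_surj[OF Q] by (metis surjE)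
  have nd: "norm d = 1" using nQ[of d] d by (simp add: norm_axis_1)
  \<comment> \<open>The bound \<open>r / 2\<close> keeps the ball attached to \<open>y\<close>
    inside the chart around \<open>x\<close>, since \<open>y\<close> is within \<open>r / 2\<close>
    of \<open>x\<close>; the bound 1 keeps it within distance \<open>h\<close> of
    \<open>y\<close>.\<close>
  define s0 where "s0 = min 1 (r / 2)"
  \<comment> \<open>Over a ball of radius \<open>k * s\<close> the graph and the vertical coordinate
    together vary by at most \<open>(L + 1) * k * s = s / 4\<close>, less than the vertical drop
    \<open>s / 2\<close> of the centre.\<close>
  define k where "k = 1 / (4 * (L + 1))"
  have s0: "s0 > 0" "s0 \<le> 1" "s0 \<le> r / 2" using r by (auto simp: s0_def)
  have k: "k > 0" "k \<le> 1 / 4" "(L + 1) * k = 1 / 4" using L0 by (auto simp: k_def field_simps)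
  have "\<exists>q. cball q (k * s0 * h) \<subseteq> cball y h - \<Omega>"
    if y: "y \<in> frontier \<Omega>" "y \<in> ball x (r / 2)" and h: "0 < h" "h < 1" for y h
  proof (intro exI[of _ "y + (h * s0 / 2) *\<^sub>R d"] subsetI)
    define s where "s = h * s0"
    have s: "s > 0" "s \<le> h" "s \<le> r / 2"
      using s0 h mult_mono[of h 1 s0 "r/2"] by (auto simp: s_def mult_left_le)
    fix p assume "p \<in> cball (y + (h * s0 / 2) *\<^sub>R d) (k * s0 * h)"
    then have pe: "norm (p - y - (s / 2) *\<^sub>R d) \<le> k * s"
      by (simp add: s_def dist_norm norm_minus_commute algebra_simps)
    define e where "e = p - y - (s / 2) *\<^sub>R d"
    have p: "p = y + (s / 2) *\<^sub>R d + e" by (simp add: e_def)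
    have ks: "k * s \<le> s / 4" using k(2) s(1) by (simp add: mult_right_mono[of k "1/4" s, simplified])
    have ne: "norm e \<le> k * s" using pe by (simp add: e_def)
    have py: "norm (p - y) \<le> s / 2 + k * s"
      using norm_triangle_ineq[of "(s/2) *\<^sub>R d" e] ne nd s(1) by (simp add: p)
    then have "norm (p - y) \<le> s" using ks s(1) by linarith
    then have "dist y p \<le> s" by (simp add: dist_norm norm_minus_commute)
    moreover have "p \<notin> \<Omega>"
    proof
      assume p\<Omega>: "p \<in> \<Omega>"
      have "dist x p \<le> dist x y + dist y p" by (rule dist_triangle)
      also have "\<dots> < r / 2 + s" using y(2) \<open>dist y p \<le> s\<close> by simp
      finally have px: "p \<in> ball x r" using s(3) by simp
      have "y \<in> ball x r" using y(2) r by simp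
      moreover have "y \<notin> \<Omega>" using y(1) op by (simp add: frontier_def interior_open)
      ultimately have 1: "Q (y - x) $ 2 \<le> \<gamma> (Q (y - x) $ 1)" using eq by force
      have 2: "Q (p - x) $ 2 > \<gamma> (Q (p - x) $ 1)" using eq p\<Omega> px by blast
      have "p - x = (y - x) + (s / 2) *\<^sub>R d + e" by (simp add: p)
      then have Qp: "Q (p - x) = Q (y - x) + (s / 2) *\<^sub>R (- axis 2 1) + Q e"
        by (simp only: linear_add[OF lin] linear_cmul[OF lin] d)
      have c1: "Q (p - x) $ 1 = Q (y - x) $ 1 + Q e $ 1" unfolding Qp by (simp add: axis_def)
      have c2: "Q (p - x) $ 2 = Q (y - x) $ 2 - s / 2 + Q e $ 2" unfolding Qp by (simp add: axis_def)
      have Qe: "\<bar>Q e $ 1\<bar> \<le> k * s" "\<bar>Q e $ 2\<bar> \<le> k * s"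
        using component_le_norm_cart[of "Q e"] nQ[of e] ne by (metis order_trans)+
      have "\<bar>\<gamma> (Q (y - x) $ 1) - \<gamma> (Q (p - x) $ 1)\<bar> \<le> L * \<bar>Q e $ 1\<bar>"
        using lipschitz_onD[OF L, of "Q (y - x) $ 1" "Q (p - x) $ 1"] by (simp add: dist_real_def c1)
      also have "\<dots> \<le> L * (k * s)" using Qe(1) L0 by (rule mult_left_mono)
      finally have "Q (p - x) $ 2 \<le> \<gamma> (Q (p - x) $ 1) + L * (k * s) + k * s - s / 2"
        using 1 c2 Qe(2) by linarith
      also have "L * (k * s) + k * s = (L + 1) * k * s" by (simp add: algebra_simps)
      then have "\<gamma> (Q (p - x) $ 1) + L * (k * s) + k * s - s / 2 \<le> \<gamma> (Q (p - x) $ 1)" using k(3) s(1) by simp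
      finally show False using 2 by simp
    qed
    ultimately show "p \<in> cball y h - \<Omega>" using s(2) by simp
  qed
  moreover have "r / 2 > 0" "k * s0 > 0" using r k s0 by auto
  ultimately show ?thesis by (metis IntE)
qed

lemma lipschitz_domain_exterior_ball:
  assumes \<Omega>: "lipschitz_domain \<Omega>" "bounded \<Omega>"
  obtains \<kappa> where "\<kappa> > 0" "\<And>y h. y \<in> frontier \<Omega> \<Longrightarrow> 0 < h \<Longrightarrow> h < 1 \<Longrightarrow> \<exists>q. cball q (\<kappa> * h) \<subseteq> cball y h - \<Omega>"
proof -
  have "\<forall>x\<in>frontier \<Omega>. \<exists>r \<kappa>. r > 0 \<and> \<kappa> > 0 \<and> (\<forall>y\<in>frontier \<Omega> \<inter> ball x r. \<forall>h. 0 < h \<longrightarrow> h < 1 \<longrightarrow>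
    (\<exists>q. cball q (\<kappa> * h) \<subseteq> cball y h - \<Omega>))"
    using lipschitz_domain_exterior_ball_local[OF \<Omega>(1)] by meson
  then obtain r \<kappa> where r\<kappa>: "\<And>x. x \<in> frontier \<Omega> \<Longrightarrow> r x > 0" "\<And>x. x \<in> frontier \<Omega> \<Longrightarrow> \<kappa> x > 0"
    "\<And>x y h. x \<in> frontier \<Omega> \<Longrightarrow> y \<in> frontier \<Omega> \<inter> ball x (r x) \<Longrightarrow> 0 < h \<Longrightarrow> h < 1 \<Longrightarrow>
    (\<exists>q. cball q (\<kappa> x * h) \<subseteq> cball y h - \<Omega>)"
    by metis
  have comp: "compact (frontier \<Omega>)" using compact_frontier_bounded[OF \<Omega>(2)] .
  obtain D where D: "D \<subseteq> frontier \<Omega>" "finite D" "frontier \<Omega> \<subseteq> (\<Union>x\<in>D. ball x (r x))"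
    by (rule compactE_image[OF comp, of "frontier \<Omega>" "\<lambda>x. ball x (r x)"]) (use r\<kappa>(1) in \<open>auto intro: centre_in_ball[THEN iffD2]\<close>)
  \<comment> \<open>A minimum over finitely many charts, by compactness of the frontier; the extra 1
    keeps it defined for an empty cover.\<close>
  define k where "k = Min (insert 1 (\<kappa> ` D))"
  have kpos: "k > 0" unfolding k_def using D r\<kappa>(2) by (subst Min_gr_iff) auto
  show ?thesis
  proof (rule that[OF kpos])
    fix y h assume y: "y \<in> frontier \<Omega>" and h: "0 < h" "h < (1::real)"
    obtain x where x: "x \<in> D" "y \<in> ball x (r x)" using D(3) y by blast
    obtain q where q: "cball q (\<kappa> x * h) \<subseteq> cball y h - \<Omega>" using r\<kappa>(3)[of x y h] x y h D(1) by blast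
    have "k \<le> \<kappa> x" unfolding k_def using D(2) x(1) by (intro Min_le) auto
    then have "k * h \<le> \<kappa> x * h" using h by (intro mult_right_mono) auto
    then have "cball q (k * h) \<subseteq> cball q (\<kappa> x * h)" by (simp add: subset_cball)
    then show "\<exists>q. cball q (k * h) \<subseteq> cball y h - \<Omega>" using q by blast
  qed
qed

text \<open>An exterior ball at each boundary point excludes slits and punctures. This is needed
  since the mesh fixes only the closure of \<Omega>, whereas integration and interior edges refer to
  \<Omega> itself.\<close>

lemma lipschitz_domain_interior_closure:
  assumes \<Omega>: "lipschitz_domain \<Omega>"
  shows "interior (closure \<Omega>) = \<Omega>"
proof
  have op: "open \<Omega>" using \<Omega> by (simp add: lipschitz_domain_def)
  show "\<Omega> \<subseteq> interior (closure \<Omega>)" by (rule interior_maximal[OF closure_subset op])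
  show "interior (closure \<Omega>) \<subseteq> \<Omega>"
  proof
    fix x assume x: "x \<in> interior (closure \<Omega>)"
    show "x \<in> \<Omega>"
    proof (rule ccontr)
      assume "x \<notin> \<Omega>"
      then have fx: "x \<in> frontier \<Omega>" using x op interior_subset by (auto simp: frontier_def interior_open)
      obtain r \<kappa> where rk: "r > 0" "\<kappa> > 0" "\<And>y h. y\<in>frontier \<Omega> \<inter> ball x r \<Longrightarrow> 0 < h \<Longrightarrow> h < 1 \<Longrightarrow>
        (\<exists>q. cball q (\<kappa> * h) \<subseteq> cball y h - \<Omega>)"
        using lipschitz_domain_exterior_ball_local[OF \<Omega> fx] by meson
      obtain e where e: "e > 0" "cball x e \<subseteq> closure \<Omega>" using x by (auto simp: mem_interior_cball)
      define h where "h = min e (1 / 2)"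
      have h: "0 < h" "h < 1" "h \<le> e" using e by (auto simp: h_def)
      obtain q where q: "cball q (\<kappa> * h) \<subseteq> cball x h - \<Omega>" using rk(3)[of x h] rk(1) fx h by auto
      have q0: "q \<in> ball q (\<kappa> * h)" using rk(2) h by simp
      have "ball q (\<kappa> * h) \<inter> \<Omega> = {}" using q ball_subset_cball[of q "\<kappa> * h"] by blast
      then have "ball q (\<kappa> * h) \<inter> closure \<Omega> = {}" using open_Int_closure_eq_empty[OF open_ball] by blast
      moreover have "q \<in> cball x e" using subsetD[OF q, of q] rk(2) h by simp
      ultimately show False using e(2) q0 by blast
    qed
  qed
qed

section \<open>Triangles\<close>

text \<open>The clockwise rotation: on a positively oriented triangle the rotated edge vectors point
  outwards.\<close>

definition rot90 :: "real^2 \<Rightarrow> real^2" where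
  "rot90 v = vector [v$2, - (v$1)]"

lemma cross2_rot90: "cross2 w v = w \<bullet> rot90 v"
  by (simp add: cross2_def rot90_def inner_vec_def sum_2 vector_2)

lemma norm_rot90: "norm (rot90 v) = norm v"
  by (simp add: norm_eq_sqrt_inner rot90_def inner_vec_def sum_2 vector_2 add.commute)

lemma cross2_zero_parallel:
  assumes "cross2 u v = 0" "u \<noteq> 0"
  shows "\<exists>k. v = k *\<^sub>R u"
proof (cases "u$1 = 0")
  case True
  with assms(2) have "u$2 \<noteq> 0" by (auto simp: vec_eq_iff forall_2)
  with True assms(1) show ?thesis
    by (intro exI[of _ "v$2 / u$2"]) (auto simp: vec_eq_iff forall_2 cross2_def)
next
  case False
  with assms(1) show ?thesis
    by (intro exI[of _ "v$1 / u$1"]) (auto simp: vec_eq_iff forall_2 cross2_def field_simps)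
qed

lemma orthogonal_parallel_rot90:
  assumes "\<nu> \<bullet> v = 0" "v \<noteq> 0"
  shows "\<exists>k. \<nu> = k *\<^sub>R rot90 v"
proof -
  have "cross2 (rot90 v) \<nu> = 0"
    using assms(1) by (simp add: cross2_def rot90_def inner_vec_def sum_2 vector_2 algebra_simps)
  moreover have "rot90 v \<noteq> 0" using norm_rot90[of v] assms(2) by auto
  ultimately show ?thesis by (rule cross2_zero_parallel)
qed

lemma collinear_iff_cross2: "collinear {a, b, c} \<longleftrightarrow> cross2 (b - a) (c - a) = 0"
proof
  assume "collinear {a, b, c}"
  then obtain u v where "\<forall>x\<in>{a, b, c}. \<exists>k. x = u + k *\<^sub>R v" unfolding collinear_alt by auto
  then obtain k1 k2 k3 where "a = u + k1 *\<^sub>R v" "b = u + k2 *\<^sub>R v" "c = u + k3 *\<^sub>R v" by auto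
  then show "cross2 (b - a) (c - a) = 0" by (simp add: cross2_def algebra_simps)
next
  assume z: "cross2 (b - a) (c - a) = 0"
  show "collinear {a, b, c}"
  proof (cases "b = a")
    case False
    then obtain k where k: "c - a = k *\<^sub>R (b - a)" using cross2_zero_parallel[OF z] by auto
    have "c = a + k *\<^sub>R (b - a)" using k by (simp add: algebra_simps)
    then have "\<forall>x\<in>{a, b, c}. \<exists>k. x = a + k *\<^sub>R (b - a)"
      by (auto intro: exI[of _ 0] exI[of _ 1] exI[of _ k])
    then show ?thesis unfolding collinear_alt by blast
  qed simp
qed

lemma affine_independent_iff_cross2:
  "\<not> affine_dependent {a, b, c} \<and> a \<noteq> b \<and> a \<noteq> c \<and> b \<noteq> c \<longleftrightarrow> cross2 (b - a) (c - a) \<noteq> 0"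
  using collinear_3_eq_affine_dependent[of a b c] collinear_iff_cross2[of a b c] by blast

section \<open>Faces of a triangle, its shape near an edge, and outer normals\<close>

lemma two_simplex_triangle:
  assumes "2 simplex T"
  obtains a b c where "T = convex hull {a, b, c}" "cross2 (b - a) (c - a) \<noteq> 0"
proof -
  obtain C where C: "\<not> affine_dependent C" "card C = 3" "T = convex hull C"
    using assms by (auto simp: simplex_def)
  obtain a b c where abc: "C = {a, b, c}" "a \<noteq> b" "a \<noteq> c" "b \<noteq> c"
    using C(2) by (auto simp: card_3_iff)
  show ?thesis
    using that[of a b c] C abc affine_independent_iff_cross2[of a b c] by auto
qed

lemma cross2_cyclic: "cross2 (c - b) (a - b) = cross2 (b - a) (c - a)"
  by (simp add: cross2_def algebra_simps)

lemma face_of_triangle: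
  assumes "cross2 (b - a) (c - a) \<noteq> 0"
  shows "F face_of convex hull {a, b, c} \<longleftrightarrow> (\<exists>S. S \<subseteq> {a, b, c} \<and> F = convex hull S)"
  using assms affine_independent_iff_cross2[of a b c] by (intro face_of_convex_hull_affine_independent) auto

lemma vertex_of_triangle:
  assumes "cross2 (b - a) (c - a) \<noteq> 0"
  shows "{z} face_of convex hull {a, b, c} \<longleftrightarrow> z \<in> {a, b, c}"
proof
  assume "{z} face_of convex hull {a, b, c}"
  then obtain S where S: "S \<subseteq> {a, b, c}" "{z} = convex hull S" using face_of_triangle[OF assms] by blast
  then have "S \<noteq> {}" "S \<subseteq> {z}" using hull_subset[of S convex] by auto
  then have "S = {z}" by auto
  then show "z \<in> {a, b, c}" using S by auto
next
  assume "z \<in> {a, b, c}"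
  then show "{z} face_of convex hull {a, b, c}"
    using face_of_triangle[OF assms] by (intro iffD2[OF face_of_triangle[OF assms]] exI[of _ "{z}"]) auto
qed

lemma edge_of_triangle_iff:
  assumes D: "cross2 (b - a) (c - a) \<noteq> 0"
  shows "E edge_of convex hull {a, b, c} \<longleftrightarrow> E \<in> {closed_segment a b, closed_segment b c, closed_segment c a}"
proof
  have ind: "\<not> affine_dependent {a, b, c}" "a \<noteq> b" "a \<noteq> c" "b \<noteq> c"
    using D affine_independent_iff_cross2[of a b c] by auto
  assume "E edge_of convex hull {a, b, c}"
  then obtain S where S: "S \<subseteq> {a, b, c}" "E = convex hull S" and ad: "aff_dim E = 1"
    using face_of_triangle[OF D] by (auto simp: edge_of_def)
  have "\<not> affine_dependent S" using S(1) ind(1) affine_dependent_subset by blast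
  then have "aff_dim S = int (card S) - 1" by (simp add: affine_independent_iff_card)
  then have "card S = 2" using ad S(2) by (simp add: aff_dim_convex_hull)
  then obtain p q where pq: "S = {p, q}" "p \<noteq> q" by (auto simp: card_2_iff)
  then have "E = closed_segment p q" using S(2) by (simp add: segment_convex_hull)
  moreover have "p \<in> {a, b, c}" "q \<in> {a, b, c}" using pq S(1) by auto
  ultimately show "E \<in> {closed_segment a b, closed_segment b c, closed_segment c a}"
    using pq(2) by (auto simp: closed_segment_commute)
next
  have ne: "a \<noteq> b" "c \<noteq> a" "b \<noteq> c" using D affine_independent_iff_cross2[of a b c] by auto
  assume "E \<in> {closed_segment a b, closed_segment b c, closed_segment c a}"
  moreover have "closed_segment p q edge_of convex hull {a, b, c}"
    if pq: "p \<in> {a, b, c}" "q \<in> {a, b, c}" "p \<noteq> q" for p q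
  proof -
    have "closed_segment p q face_of convex hull {a, b, c}"
      unfolding face_of_triangle[OF D] segment_convex_hull using pq(1,2) by (intro exI[of _ "{p, q}"]) simp
    moreover have "aff_dim (closed_segment p q) = 1"
      using pq(3) by (simp add: segment_convex_hull aff_dim_convex_hull aff_dim_2)
    ultimately show ?thesis by (simp add: edge_of_def)
  qed
  ultimately show "E edge_of convex hull {a, b, c}"
    using ne by (elim insertE emptyE) simp_all
qed

lemma edge_of_triangle:
  assumes T: "2 simplex T" and E: "E edge_of T"
  obtains a b c where "T = convex hull {a, b, c}" "cross2 (b - a) (c - a) \<noteq> 0" "E = closed_segment b c"
proof -
  obtain a b c where abc: "T = convex hull {a, b, c}" "cross2 (b - a) (c - a) \<noteq> 0"
    using two_simplex_triangle[OF T] .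
  consider "E = closed_segment b c" | "E = closed_segment a b" | "E = closed_segment c a"
    using E edge_of_triangle_iff[OF abc(2)] abc(1) by auto
  then show ?thesis
  proof cases
    case 1
    with abc show ?thesis by (intro that)
  next
    case 2
    have "{c, a, b} = {a, b, c}" by auto
    with 2 abc show ?thesis using cross2_cyclic[of b a c] cross2_cyclic[of a c b] by (intro that[of c a b]) auto
  next
    case 3
    have "{b, c, a} = {a, b, c}" by auto
    with 3 abc show ?thesis using cross2_cyclic[of c b a] by (intro that[of b c a]) auto
  qed
qed

text \<open>The three quotients are the barycentric coordinates of \<open>y\<close> for
  \<open>a\<close>, \<open>b\<close> and \<open>c\<close>, as ratios of signed areas.\<close>

lemma triangle_cross_iff:
  fixes a b c y :: "real^2"
  assumes D: "cross2 (b - a) (c - a) \<noteq> 0"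
  shows "y \<in> convex hull {a, b, c} \<longleftrightarrow>
    0 \<le> cross2 (c - b) (y - b) / cross2 (b - a) (c - a) \<and>
    0 \<le> cross2 (y - a) (c - a) / cross2 (b - a) (c - a) \<and>
    0 \<le> cross2 (b - a) (y - a) / cross2 (b - a) (c - a)"
proof -
  let ?D = "cross2 (b - a) (c - a)"
  define s t where "s = cross2 (y - a) (c - a) / ?D" and "t = cross2 (b - a) (y - a) / ?D"
  have sD: "s * ?D = cross2 (y - a) (c - a)" and tD: "t * ?D = cross2 (b - a) (y - a)"
    using D by (auto simp: s_def t_def)
  have "?D *\<^sub>R (y - a) = (s * ?D) *\<^sub>R (b - a) + (t * ?D) *\<^sub>R (c - a)"
    unfolding sD tD by (simp add: vec_eq_iff forall_2 cross2_def algebra_simps)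
  also have "\<dots> = ?D *\<^sub>R (s *\<^sub>R (b - a) + t *\<^sub>R (c - a))" by (simp add: scaleR_add_right mult.commute)
  finally have "y - a = s *\<^sub>R (b - a) + t *\<^sub>R (c - a)" using D by simp
  then have y: "y = a + s *\<^sub>R (b - a) + t *\<^sub>R (c - a)" by (simp add: algebra_simps)
  have "cross2 (c - b) (y - b) = ?D - cross2 (y - a) (c - a) - cross2 (b - a) (y - a)"
    by (simp add: cross2_def algebra_simps)
  then have 1: "cross2 (c - b) (y - b) / ?D = 1 - s - t"
    using D by (simp add: s_def t_def diff_divide_distrib)
  have "y \<in> convex hull {a, b, c} \<longleftrightarrow> 0 \<le> s \<and> 0 \<le> t \<and> s + t \<le> 1"
    by (subst y) (rule triangle_coords[OF D])
  then show ?thesis unfolding 1 s_def[symmetric] t_def[symmetric] by auto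
qed

text \<open>In the relative interior of an edge the weights of its two end points are positive, and
  they remain so nearby. Only the sign of the weight of \<open>a\<close> is left: locally the
  triangle is a half plane.\<close>

lemma triangle_near_edge:
  assumes D: "cross2 (b - a) (c - a) \<noteq> 0" and x: "x \<in> open_segment b c"
  obtains r where "r > 0" "\<And>y. y \<in> ball x r \<Longrightarrow>
    y \<in> convex hull {a, b, c} \<longleftrightarrow> 0 \<le> cross2 (c - b) (y - b) / cross2 (b - a) (c - a)"
proof -
  let ?D = "cross2 (b - a) (c - a)"
  obtain u where u: "0 < u" "u < 1" "x = (1 - u) *\<^sub>R b + u *\<^sub>R c" using x by (auto simp: in_segment)
  have xb: "cross2 (x - a) (c - a) / ?D = 1 - u" "cross2 (b - a) (x - a) / ?D = u"
  proof -
    have "cross2 (x - a) (c - a) = (1 - u) * ?D" "cross2 (b - a) (x - a) = u * ?D"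
      unfolding u(3) by (simp_all add: cross2_def algebra_simps)
    then show "cross2 (x - a) (c - a) / ?D = 1 - u" "cross2 (b - a) (x - a) / ?D = u" using D by auto
  qed
  define U where "U = {y. 0 < cross2 (y - a) (c - a) / ?D \<and> 0 < cross2 (b - a) (y - a) / ?D}"
  have "continuous_on UNIV (\<lambda>y. cross2 (y - a) (c - a) * inverse ?D)" "continuous_on UNIV (\<lambda>y. cross2 (b - a) (y - a) * inverse ?D)"
    unfolding cross2_def by (intro continuous_intros)+
  then have "open U" unfolding U_def divide_inverse
    by (intro open_Collect_conj open_Collect_less continuous_on_const)
  moreover have "x \<in> U" unfolding U_def using xb u by simp
  ultimately obtain r where r: "r > 0" "ball x r \<subseteq> U" using open_contains_ball by blast
  show ?thesis
  proof (rule that[OF r(1)])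
    fix y assume "y \<in> ball x r"
    then have "y \<in> U" using r(2) by blast
    then show "y \<in> convex hull {a, b, c} \<longleftrightarrow> 0 \<le> cross2 (c - b) (y - b) / ?D"
      unfolding triangle_cross_iff[OF D] U_def by auto
  qed
qed

text \<open>Uniqueness behind the definite description: testing with both end points of the edge
  forces orthogonality, so the vector is a multiple of the rotated edge; the length fixes the
  modulus of the factor and the opposite vertex its sign.\<close>

lemma outer_normal_triangle:
  assumes D: "cross2 (b - a) (c - a) \<noteq> 0"
  shows "outer_normal (convex hull {a, b, c}) (closed_segment b c)
    = (sgn (cross2 (b - a) (c - a)) / norm (c - b)) *\<^sub>R rot90 (c - b)"
  unfolding outer_normal_def
proof (rule the_equality)
  let ?D = "cross2 (b - a) (c - a)" and ?T = "convex hull {a, b, c}"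
  let ?n = "(sgn ?D / norm (c - b)) *\<^sub>R rot90 (c - b)"
  have bc: "b \<noteq> c" using D by (auto simp: cross2_def algebra_simps)
  then have nz: "norm (c - b) > 0" by simp
  have abcT: "a \<in> ?T" "b \<in> ?T" "c \<in> ?T" by (auto intro: hull_inc)
  show "norm ?n = 1 \<and> (\<forall>x\<in>closed_segment b c. \<forall>y\<in>?T. ?n \<bullet> (y - x) \<le> 0)"
  proof (intro conjI ballI)
    show "norm ?n = 1" using D nz by (simp add: norm_rot90 abs_sgn_eq)
    fix x y assume x: "x \<in> closed_segment b c" and y: "y \<in> ?T"
    obtain u where u: "x = (1 - u) *\<^sub>R b + u *\<^sub>R c" using x by (auto simp: in_segment)
    have "?n \<bullet> (y - x) = sgn ?D / norm (c - b) * cross2 (y - x) (c - b)"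
      by (simp add: cross2_rot90 inner_commute)
    also have "cross2 (y - x) (c - b) = - cross2 (c - b) (y - b)"
      unfolding u by (simp add: cross2_def algebra_simps)
    also have "sgn ?D / norm (c - b) * (- cross2 (c - b) (y - b)) = - (cross2 (c - b) (y - b) / ?D) * (\<bar>?D\<bar> / norm (c - b))"
      using D by (simp add: sgn_if)
    also have "\<dots> \<le> 0"
      using y nz unfolding triangle_cross_iff[OF D] by (intro mult_nonpos_nonneg) auto
    finally show "?n \<bullet> (y - x) \<le> 0" .
  qed
  fix \<nu> assume \<nu>: "norm \<nu> = 1 \<and> (\<forall>x\<in>closed_segment b c. \<forall>y\<in>?T. \<nu> \<bullet> (y - x) \<le> 0)"
  have "\<nu> \<bullet> (c - b) \<le> 0" "\<nu> \<bullet> (b - c) \<le> 0" using \<nu> abcT by auto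
  then have "\<nu> \<bullet> (c - b) = 0" by (simp add: inner_diff_right)
  from orthogonal_parallel_rot90[OF this] bc obtain k where k: "\<nu> = k *\<^sub>R rot90 (c - b)" by auto
  have kn: "\<bar>k\<bar> * norm (c - b) = 1" using \<nu> k by (simp add: norm_rot90)
  have "\<nu> \<bullet> (a - b) \<le> 0" using \<nu> abcT by auto
  then have "k * cross2 (a - b) (c - b) \<le> 0" unfolding k by (simp add: cross2_rot90 inner_commute)
  moreover have "cross2 (a - b) (c - b) = - ?D" by (simp add: cross2_def algebra_simps)
  ultimately have kD: "k * ?D \<ge> 0" by simp
  have "k \<noteq> 0" using kn by auto
  then have "sgn k = sgn ?D" using kD D by (auto simp: sgn_if zero_le_mult_iff)
  then have "k = sgn ?D * \<bar>k\<bar>" by (metis abs_sgn mult.commute mult_sgn_abs)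
  also have "\<bar>k\<bar> = 1 / norm (c - b)" using kn nz by (simp add: field_simps)
  finally show "\<nu> = ?n" unfolding k by simp
qed

text \<open>Turns the oriented boundary density of \<open>ibp_triangle\<close> into a normal flux
  times the length of the edge, so the orientation disappears.\<close>

lemma outer_normal_cross2:
  assumes "cross2 (b - a) (c - a) \<noteq> 0"
  shows "sgn (cross2 (b - a) (c - a)) * cross2 w (c - b)
    = dist b c * (w \<bullet> outer_normal (convex hull {a, b, c}) (closed_segment b c))"
proof -
  have "b \<noteq> c" using assms by (auto simp: cross2_def algebra_simps)
  then show ?thesis
    unfolding outer_normal_triangle[OF assms] by (simp add: cross2_rot90 dist_norm norm_minus_commute)
qed

text \<open>With equal orientations both triangles would fill the same half plane near the midpoint
  of the edge, and a small step from there towards \<open>a\<close> would stay in both while leaving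
  the edge.\<close>

lemma triangles_opposite_sides:
  assumes D: "cross2 (b - a) (c - a) \<noteq> 0" and D': "cross2 (b - a') (c - a') \<noteq> 0"
    and int: "convex hull {a, b, c} \<inter> convex hull {a', b, c} = closed_segment b c"
  shows "sgn (cross2 (b - a') (c - a')) = - sgn (cross2 (b - a) (c - a))"
proof (rule ccontr)
  let ?D = "cross2 (b - a) (c - a)" and ?D' = "cross2 (b - a') (c - a')"
  assume "sgn ?D' \<noteq> - sgn ?D"
  then have same: "?D / ?D' > 0" using D D' by (auto simp: sgn_if zero_less_divide_iff split: if_splits)
  have bc: "b \<noteq> c" using D by (auto simp: cross2_def algebra_simps)
  define x where "x = midpoint b c"
  have x: "x \<in> open_segment b c" using bc by (simp add: x_def)
  obtain r where r: "r > 0" "\<And>y. y \<in> ball x r \<Longrightarrow> y \<in> convex hull {a, b, c} \<longleftrightarrow> 0 \<le> cross2 (c - b) (y - b) / ?D"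
    using triangle_near_edge[OF D x] by metis
  obtain r' where r': "r' > 0" "\<And>y. y \<in> ball x r' \<Longrightarrow> y \<in> convex hull {a', b, c} \<longleftrightarrow> 0 \<le> cross2 (c - b) (y - b) / ?D'"
    using triangle_near_edge[OF D' x] by metis
  \<comment> \<open>Small enough that the step stays in both neighbourhoods; the summand 1 makes the
    denominator visibly positive.\<close>
  define e where "e = min r r' / 2 / (norm (a - x) + 1)"
  have np: "norm (a - x) + 1 > 0" using norm_ge_zero[of "a - x"] by linarith
  have e0: "e > 0" using r(1) r'(1) np by (simp add: e_def)
  have en: "e * norm (a - x) < min r r'"
  proof -
    have "e * norm (a - x) \<le> e * (norm (a - x) + 1)" using e0 by simp
    also have "\<dots> = min r r' / 2"
      unfolding e_def by (rule nonzero_eq_divide_eq[THEN iffD1, OF _ refl]) (use np in simp)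
    also have "\<dots> < min r r'" using r(1) r'(1) by auto
    finally show ?thesis .
  qed
  define y where "y = x + e *\<^sub>R (a - x)"
  have yb: "y \<in> ball x r" "y \<in> ball x r'" using en e0 by (auto simp: y_def dist_norm)
  have cy: "cross2 (c - b) (y - b) = e * ?D"
    by (simp add: y_def x_def midpoint_def cross2_def field_simps)
  have "y \<in> convex hull {a, b, c}" using r(2)[OF yb(1)] D e0 by (simp add: cy)
  moreover have "y \<in> convex hull {a', b, c}"
  proof -
    have "0 \<le> e * (?D / ?D')" using same e0 by (intro mult_nonneg_nonneg) simp_all
    then show ?thesis using r'(2)[OF yb(2)] by (simp add: cy)
  qed
  ultimately have "y \<in> closed_segment b c" using int by blast
  then obtain u where "y = (1 - u) *\<^sub>R b + u *\<^sub>R c" by (auto simp: in_segment)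
  then have "y - b = u *\<^sub>R (c - b)" by (simp add: algebra_simps)
  then have "cross2 (c - b) (y - b) = 0" by (simp add: cross2_def)
  then show False using cy e0 D by simp
qed

text \<open>Near the relative interior of the common edge the triangles are the two complementary
  closed half planes.\<close>

lemma triangles_opposite_cover:
  assumes D: "cross2 (b - a) (c - a) \<noteq> 0" and D': "cross2 (b - a') (c - a') \<noteq> 0"
    and opp: "sgn (cross2 (b - a') (c - a')) = - sgn (cross2 (b - a) (c - a))"
    and x: "x \<in> open_segment b c"
  shows "x \<in> interior (convex hull {a, b, c} \<union> convex hull {a', b, c})"
proof -
  let ?D = "cross2 (b - a) (c - a)" and ?D' = "cross2 (b - a') (c - a')"
  obtain r where r: "r > 0" "\<And>y. y \<in> ball x r \<Longrightarrow> y \<in> convex hull {a, b, c} \<longleftrightarrow> 0 \<le> cross2 (c - b) (y - b) / ?D"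
    using triangle_near_edge[OF D x] by metis
  obtain r' where r': "r' > 0" "\<And>y. y \<in> ball x r' \<Longrightarrow> y \<in> convex hull {a', b, c} \<longleftrightarrow> 0 \<le> cross2 (c - b) (y - b) / ?D'"
    using triangle_near_edge[OF D' x] by metis
  have "ball x (min r r') \<subseteq> convex hull {a, b, c} \<union> convex hull {a', b, c}"
  proof
    fix y assume "y \<in> ball x (min r r')"
    then have y: "y \<in> ball x r" "y \<in> ball x r'" by auto
    have "0 \<le> cross2 (c - b) (y - b) / ?D \<or> 0 \<le> cross2 (c - b) (y - b) / ?D'"
      using opp D D' by (auto simp: sgn_if zero_le_divide_iff split: if_splits)
    then show "y \<in> convex hull {a, b, c} \<union> convex hull {a', b, c}" using r(2)[OF y(1)] r'(2)[OF y(2)] by blast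
  qed
  moreover have "x \<in> ball x (min r r')" using r(1) r'(1) by simp
  ultimately show ?thesis unfolding mem_interior using r(1) r'(1) by (intro exI[of _ "min r r'"]) auto
qed

text \<open>The divergence theorem for \<open>x - a\<close> with weight 1: the divergence is 2, and
  only the edge opposite to \<open>a\<close> contributes.\<close>

lemma triangle_area:
  assumes D: "cross2 (b - a) (c - a) \<noteq> 0"
  shows "measure lebesgue (convex hull {a, b, c}) = \<bar>cross2 (b - a) (c - a)\<bar> / 2"
proof -
  let ?D = "cross2 (b - a) (c - a)" and ?T = "convex hull {a, b, c}"
  have "(LINT x|lebesgue_on ?T. (x - a) \<bullet> 0 + (\<Sum>i\<in>UNIV. (axis i (1::real) :: real^2) $ i) * 1) =
    sgn ?D *
      (seg_integral (\<lambda>x. cross2 (x - a) (b - a) * 1) a b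
       + seg_integral (\<lambda>x. cross2 (x - a) (c - b) * 1) b c
       + seg_integral (\<lambda>x. cross2 (x - a) (a - c) * 1) c a)"
    by (rule ibp_triangle[OF D, where A' = "\<lambda>x e. e"]) (auto intro!: derivative_eq_intros)
  also have "seg_integral (\<lambda>x. cross2 (x - a) (b - a) * 1) a b = 0"
    by (rule seg_integral_zero) (auto simp: in_segment cross2_def, simp add: algebra_simps)
  also have "seg_integral (\<lambda>x. cross2 (x - a) (a - c) * 1) c a = 0"
    by (rule seg_integral_zero) (auto simp: in_segment cross2_def, simp add: algebra_simps)
  also have "seg_integral (\<lambda>x. cross2 (x - a) (c - b) * 1) b c = seg_integral (\<lambda>x. ?D) b c"
    by (rule seg_integral_cong) (clarsimp simp: in_segment cross2_def, simp add: algebra_simps)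
  also have "seg_integral (\<lambda>x. ?D) b c = ?D"
    by (simp add: seg_integral_def measure_restrict_space)
  finally have "2 * measure (lebesgue_on ?T) ?T = \<bar>?D\<bar>"
    by (simp add: sum_2 axis_def abs_sgn mult.commute)
  moreover have "measure (lebesgue_on ?T) ?T = measure lebesgue ?T"
    by (intro measure_restrict_space) (auto intro!: borel_closed compact_imp_closed compact_convex_hull sets_completionI_sets)
  ultimately show ?thesis by simp
qed

lemma triangle_interior_nonempty:
  assumes D: "cross2 (b - a) (c - a) \<noteq> 0"
  shows "interior (convex hull {a, b, c}) \<noteq> {}"
proof
  assume "interior (convex hull {a, b, c}) = {}"
  then have "negligible (convex hull {a, b, c})" using negligible_convex_interior convex_convex_hull by blast
  then have "measure lebesgue (convex hull {a, b, c}) = 0"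
    by (simp add: measure_eq_0_null_sets negligible_iff_null_sets)
  then show False using triangle_area[OF D] D by simp
qed

lemma triangle_affine_interpolation:
  assumes D: "cross2 (b - a) (c - a) \<noteq> 0"
  shows "\<exists>\<alpha> \<beta>. \<forall>z\<in>{a, b, c}. \<alpha> + \<beta> \<bullet> z = f z"
proof -
  let ?D = "cross2 (b - a) (c - a)"
  \<comment> \<open>Cramer's rule for the linear form with prescribed increments along the two edges
    at \<open>a\<close>.\<close>
  define l where "l x = (cross2 x (c - a) * (f b - f a) + cross2 (b - a) x * (f c - f a)) / ?D" for x
  have "linear l"
    by (rule linearI) (simp_all add: l_def cross2_def add_divide_distrib[symmetric], simp_all add: algebra_simps)
  from linear_eq_inner_axis[OF this] obtain \<beta> where \<beta>: "\<And>x. l x = \<beta> \<bullet> x" by blast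
  have "l (b - a) = f b - f a" "l (c - a) = f c - f a"
    using D by (simp_all add: l_def) (simp_all add: cross2_def)
  then have "\<beta> \<bullet> (b - a) = f b - f a" "\<beta> \<bullet> (c - a) = f c - f a" by (simp_all add: \<beta>)
  then show ?thesis
    by (intro exI[of _ "f a - \<beta> \<bullet> a"] exI[of _ \<beta>]) (auto simp: inner_diff_right)
qed

text \<open>Gives meaning to one-sided derivatives at every point of a closed triangle, corners
  included. Along each segment from \<open>x\<close> into \<open>S\<close> the derivative is
  determined, and since \<open>S\<close> contains a ball, differences of such directions give all
  directions.\<close>

lemma has_derivative_within_unique_convex:
  fixes S :: "'a::euclidean_space set" and f' :: "'a \<Rightarrow> 'b::real_normed_vector"
  assumes S: "convex S" "interior S \<noteq> {}" "x \<in> S"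
    and f: "(f has_derivative f') (at x within S)" "(f has_derivative f'') (at x within S)"
  shows "f' = f''"
proof -
  have dir: "f' (y - x) = f'' (y - x)" if y: "y \<in> S" for y
  proof -
    let ?p = "\<lambda>t. x + t *\<^sub>R (y - x)"
    have pS: "?p ` {0..1} \<subseteq> S"
      using S(1,3) y by (auto simp: convex_alt algebra_simps)
    have "(?p has_derivative (\<lambda>t. t *\<^sub>R (y - x))) (at 0 within {0..1})"
      by (auto intro!: derivative_eq_intros)
    then have "((\<lambda>t. f (?p t)) has_derivative (\<lambda>t. g (t *\<^sub>R (y - x)))) (at 0 within {0..1})"
      if "(f has_derivative g) (at x within S)" for g
    proof -
      have "(f has_derivative g) (at (?p 0) within ?p ` {0..1})"
        using has_derivative_subset[OF that pS] by simp
      from has_derivative_in_compose[OF \<open>(?p has_derivative (\<lambda>t. t *\<^sub>R (y - x))) (at 0 within {0..1})\<close> this]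
      show ?thesis .
    qed
    from this[OF f(1)] this[OF f(2)]
    have v: "((\<lambda>t. f (?p t)) has_vector_derivative f' (y - x)) (at 0 within {0..1})"
       "((\<lambda>t. f (?p t)) has_vector_derivative f'' (y - x)) (at 0 within {0..1})"
      unfolding has_vector_derivative_def
      using linear_cmul[OF has_derivative_linear[OF f(1)]] linear_cmul[OF has_derivative_linear[OF f(2)]] by simp_all
    show ?thesis
      using vector_derivative_unique_within_closed_interval[of 0 1 0] v by (auto simp: cbox_interval)
  qed
  obtain z r where zr: "r > 0" "ball z r \<subseteq> S" using S(2) by (auto simp: mem_interior)
  have l: "linear f'" "linear f''" using f has_derivative_linear by auto
  show ?thesis
  proof
    fix e
    show "f' e = f'' e"
    proof (cases "e = 0")
      case True
      then show ?thesis using l linear_0 by metis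
    next
      case False
      define t where "t = r / 2 / norm e"
      have t: "t > 0" "norm (t *\<^sub>R e) < r" using zr(1) False by (auto simp: t_def)
      have "z \<in> S" "z + t *\<^sub>R e \<in> S" using zr t by (auto simp: subset_iff dist_norm)
      from dir[OF this(2)] dir[OF this(1)]
      have "f' (z + t *\<^sub>R e - x) - f' (z - x) = f'' (z + t *\<^sub>R e - x) - f'' (z - x)" by simp
      then have "f' (t *\<^sub>R e) = f'' (t *\<^sub>R e)"
        by (simp add: linear_diff[OF l(1), symmetric] linear_diff[OF l(2), symmetric])
      then show ?thesis using t(1) linear_cmul[OF l(1)] linear_cmul[OF l(2)] by simp
    qed
  qed
qed

lemma frechet_derivative_within_convex:
  fixes S :: "'a::euclidean_space set"
  assumes "convex S" "interior S \<noteq> {}" "x \<in> S" "(f has_derivative f') (at x within S)"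
  shows "frechet_derivative f (at x within S) = f'"
proof -
  have "f differentiable (at x within S)" using assms(4) by (rule differentiableI)
  then have "(f has_derivative frechet_derivative f (at x within S)) (at x within S)"
    by (simp add: frechet_derivative_works)
  then show ?thesis using has_derivative_within_unique_convex[OF assms(1-3) _ assms(4)] by blast
qed

lemma grad_on_affine:
  assumes S: "convex S" "interior S \<noteq> {}" "x \<in> S" and u: "\<And>y. y \<in> S \<Longrightarrow> u y = \<alpha> + \<beta> \<bullet> y"
  shows "grad_on S u x = \<beta>"
proof -
  have "((\<lambda>y. \<alpha> + \<beta> \<bullet> y) has_derivative (\<lambda>e. \<beta> \<bullet> e)) (at x within S)"
    by (auto intro!: derivative_eq_intros)
  then have "(u has_derivative (\<lambda>e. \<beta> \<bullet> e)) (at x within S)"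
    by (rule has_derivative_transform[rotated 2]) (use S(3) u in auto)
  then show ?thesis
    unfolding grad_on_def frechet_derivative_within_convex[OF S \<open>(u has_derivative (\<lambda>e. \<beta> \<bullet> e)) (at x within S)\<close>]
    by (simp add: inner_axis vec_eq_iff)
qed

lemma div_on_affine:
  assumes S: "convex S" "interior S \<noteq> {}" "x \<in> S"
    and p: "\<And>y. y \<in> S \<Longrightarrow> p y = \<alpha> + \<beta> \<bullet> y" and u: "\<And>y. y \<in> S \<Longrightarrow> u y = \<alpha>' + \<gamma> \<bullet> y"
  shows "div_on S (\<lambda>y. p y *\<^sub>R grad_on S u y) x = \<beta> \<bullet> \<gamma>"
proof -
  have "((\<lambda>y. (\<alpha> + \<beta> \<bullet> y) *\<^sub>R \<gamma>) has_derivative (\<lambda>e. (\<beta> \<bullet> e) *\<^sub>R \<gamma>)) (at x within S)"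
    by (auto intro!: derivative_eq_intros)
  then have d: "((\<lambda>y. p y *\<^sub>R grad_on S u y) has_derivative (\<lambda>e. (\<beta> \<bullet> e) *\<^sub>R \<gamma>)) (at x within S)"
    by (rule has_derivative_transform[rotated 2])
      (use S p grad_on_affine[OF S(1,2) _ u] in auto)
  show ?thesis
    unfolding div_on_def frechet_derivative_within_convex[OF S d]
    by (simp add: sum_2 inner_vec_def axis_def)
qed

text \<open>A closed mesh triangle may touch the frontier of the open domain, so facts about the
  domain restrict only to its interior. The frontier of a convex set is null, and the facts extend
  back to the closed triangle.\<close>

lemma measurable_interior_convex:
  fixes F :: "'a::euclidean_space \<Rightarrow> real"
  assumes T: "convex T" "closed T" and F: "F \<in> borel_measurable (lebesgue_on (interior T))"
  shows "F \<in> borel_measurable (lebesgue_on T)"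
proof -
  have Ts: "T \<in> sets lebesgue" using T(2) by auto
  have n: "negligible (T - interior T)"
    using negligible_convex_frontier[OF T(1)] T(2) by (simp add: frontier_def)
  have "T - interior T \<in> null_sets (lebesgue_on T)"
    using n Ts by (subst null_sets_restrict_space) (auto simp: negligible_iff_null_sets)
  from borel_measurable_diff_null[OF this Ts, of F] show ?thesis
    using F interior_subset[of T] by (simp add: double_diff)
qed

lemma integral_interior_convex:
  fixes F :: "'a::euclidean_space \<Rightarrow> real"
  assumes T: "convex T" "closed T" and F: "integrable (lebesgue_on (interior T)) F"
  shows "integrable (lebesgue_on T) F" "(LINT x|lebesgue_on T. F x) = (LINT x|lebesgue_on (interior T). F x)"
proof -
  have Ts: "T \<in> sets lebesgue" using T(2) by auto
  have n: "T - interior T \<in> null_sets lebesgue"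
    using negligible_convex_frontier[OF T(1)] T(2) by (simp add: frontier_def negligible_iff_null_sets)
  have Fm: "F \<in> borel_measurable (lebesgue_on (interior T))" using F by simp
  have m: "(\<lambda>x. indicator T x *\<^sub>R F x) \<in> borel_measurable lebesgue"
    using measurable_interior_convex[OF T Fm] Ts by (simp add: borel_measurable_restrict_space_iff)
  have i: "integrable lebesgue (\<lambda>x. indicator (interior T) x *\<^sub>R F x)"
    using F by (simp add: integrable_restrict_space)
  have ae: "AE x in lebesgue. indicator (interior T) x *\<^sub>R F x = indicator T x *\<^sub>R F x"
    using AE_not_in[OF n] by (rule eventually_mono) (use interior_subset[of T] in \<open>auto simp: indicator_def\<close>)
  have "integrable lebesgue (\<lambda>x. indicator T x *\<^sub>R F x)"
    using integrable_cong_AE_imp[OF i m ae] .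
  then show "integrable (lebesgue_on T) F" using Ts by (simp add: integrable_restrict_space)
  have "(LINT x|lebesgue. indicator (interior T) x *\<^sub>R F x) = (LINT x|lebesgue. indicator T x *\<^sub>R F x)"
    using i m ae by (intro integral_cong_AE) auto
  then show "(LINT x|lebesgue_on T. F x) = (LINT x|lebesgue_on (interior T). F x)"
    using Ts by (simp add: integral_restrict_space)
qed

section \<open>Triangulations\<close>

locale triangulated_domain =
  fixes \<Omega> :: "point set" and \<T> :: "point set set"
  assumes bounded: "bounded \<Omega>" and lip: "lipschitz_domain \<Omega>" and mesh: "mesh_of \<Omega> \<T>"
begin

lemma open_domain: "open \<Omega>"
  using lip by (simp add: lipschitz_domain_def)

lemma domain_sets: "\<Omega> \<in> sets lebesgue" and domain_lmeasurable: "\<Omega> \<in> lmeasurable"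
  using open_domain bounded by (auto intro: lmeasurable_open)

lemma finite_mesh: "finite \<T>"
  using mesh by (simp add: mesh_of_def triangulation_def)

lemma mesh_simplex: "T \<in> \<T> \<Longrightarrow> 2 simplex T"
  using mesh by (simp add: mesh_of_def)

lemma mesh_Union: "\<Union>\<T> = closure \<Omega>"
  using mesh by (simp add: mesh_of_def)

lemma mesh_face: "T \<in> \<T> \<Longrightarrow> T' \<in> \<T> \<Longrightarrow> T \<inter> T' face_of T"
  using mesh by (simp add: mesh_of_def triangulation_def)

lemma mesh_face': "T \<in> \<T> \<Longrightarrow> T' \<in> \<T> \<Longrightarrow> T \<inter> T' face_of T'"
  using mesh_face[of T' T] by (simp add: Int_commute)

lemma mesh_triangle:
  assumes "T \<in> \<T>"
  shows "convex T" "compact T" "closed T" "T \<in> sets lebesgue" "T \<in> lmeasurable" "interior T \<noteq> {}" "aff_dim T = 2"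
proof -
  obtain a b c where abc: "T = convex hull {a, b, c}" "cross2 (b - a) (c - a) \<noteq> 0"
    using two_simplex_triangle[OF mesh_simplex[OF assms]] .
  show "convex T" "compact T" using abc(1) by (auto intro: compact_convex_hull)
  then show "closed T" by (simp add: compact_imp_closed)
  then show "T \<in> sets lebesgue" by auto
  show "T \<in> lmeasurable" using \<open>compact T\<close> by (rule lmeasurable_compact)
  show "interior T \<noteq> {}" unfolding abc(1) by (rule triangle_interior_nonempty[OF abc(2)])
  show "aff_dim T = 2" using aff_dim_simplex[OF mesh_simplex[OF assms]] .
qed

lemma mesh_interior_subset: "T \<in> \<T> \<Longrightarrow> interior T \<subseteq> \<Omega>"
  using mesh_Union interior_mono[of T "closure \<Omega>"] lipschitz_domain_interior_closure[OF lip] by blast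

text \<open>A triangle contained in another one would be a proper face of it, hence of smaller
  dimension.\<close>

lemma mesh_Int_proper:
  assumes "T \<in> \<T>" "T' \<in> \<T>" "T \<noteq> T'"
  shows "T \<inter> T' \<noteq> T"
proof
  assume e: "T \<inter> T' = T"
  then have "T face_of T'" using mesh_face'[OF assms(1,2)] by simp
  then have "aff_dim T < aff_dim T'"
    using face_of_aff_dim_lt[OF mesh_triangle(1)[OF assms(2)]] assms(3) by blast
  then show False using mesh_triangle(7) assms by simp
qed

lemma mesh_Int_interior:
  assumes "T \<in> \<T>" "T' \<in> \<T>" "T \<noteq> T'"
  shows "T' \<inter> interior T = {}"
  using face_of_disjoint_interior[OF mesh_face[OF assms(1,2)] mesh_Int_proper[OF assms]] interior_subset[of T] by blast

lemma mesh_Int_negligible: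
  assumes "T \<in> \<T>" "T' \<in> \<T>" "T \<noteq> T'"
  shows "negligible (T \<inter> T')"
proof (rule negligible_subset[OF negligible_convex_frontier[OF mesh_triangle(1)[OF assms(1)]]])
  show "T \<inter> T' \<subseteq> frontier T"
    using mesh_Int_interior[OF assms] mesh_triangle(3)[OF assms(1)] by (auto simp: frontier_def)
qed

text \<open>Off the union of the triangle frontiers, a null set, every point of \<Omega> lies in the
  interior of exactly one triangle.\<close>

lemma mesh_integral:
  assumes F: "integrable (lebesgue_on \<Omega>) F"
  shows "\<And>T. T \<in> \<T> \<Longrightarrow> integrable (lebesgue_on T) F"
    and "(LINT x|lebesgue_on \<Omega>. F x) = (\<Sum>T\<in>\<T>. (LINT x|lebesgue_on T. F x :: real))"
proof -
  have F': "integrable lebesgue (\<lambda>x. indicator \<Omega> x *\<^sub>R F x)"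
    using F domain_sets by (simp add: integrable_restrict_space)
  have i: "integrable lebesgue (\<lambda>x. indicator (interior T) x *\<^sub>R F x)" if "T \<in> \<T>" for T
  proof -
    have "(\<lambda>x. indicator (interior T) x *\<^sub>R (indicator \<Omega> x *\<^sub>R F x)) = (\<lambda>x. indicator (interior T) x *\<^sub>R F x)"
      using mesh_interior_subset[OF that] by (auto simp: fun_eq_iff indicator_def)
    then show ?thesis using integrable_mult_indicator[OF _ F', of "interior T"] by simp
  qed
  then have iT: "integrable (lebesgue_on (interior T)) F" if "T \<in> \<T>" for T
    using that by (simp add: integrable_restrict_space)
  show "integrable (lebesgue_on T) F" if "T \<in> \<T>" for T
    by (rule integral_interior_convex(1)[OF mesh_triangle(1)[OF that] mesh_triangle(3)[OF that] iT[OF that]])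
  have n: "(\<Union>T\<in>\<T>. frontier T) \<in> null_sets lebesgue"
    using finite_mesh negligible_convex_frontier mesh_triangle(1)
    by (intro null_sets_UN') (auto simp: negligible_iff_null_sets countable_finite)
  have "(LINT x|lebesgue_on \<Omega>. F x) = (LINT x|lebesgue. indicator \<Omega> x *\<^sub>R F x)"
    using domain_sets by (simp add: integral_restrict_space)
  also have "\<dots> = (LINT x|lebesgue. (\<Sum>T\<in>\<T>. indicator (interior T) x *\<^sub>R F x))"
  proof (rule integral_cong_AE)
    show "AE x in lebesgue. indicator \<Omega> x *\<^sub>R F x = (\<Sum>T\<in>\<T>. indicator (interior T) x *\<^sub>R F x)"
      using AE_not_in[OF n]
    proof (rule eventually_mono)
      fix x assume x: "x \<notin> (\<Union>T\<in>\<T>. frontier T)"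
      show "indicator \<Omega> x *\<^sub>R F x = (\<Sum>T\<in>\<T>. indicator (interior T) x *\<^sub>R F x)"
      proof (cases "\<exists>T\<in>\<T>. x \<in> T")
        case True
        then obtain T where T: "T \<in> \<T>" "x \<in> T" by blast
        have "closure T = T" using mesh_triangle(3)[OF T(1)] by simp
        then have xi: "x \<in> interior T" using x T by (auto simp: frontier_def)
        then have x\<Omega>: "x \<in> \<Omega>" using mesh_interior_subset[OF T(1)] by blast
        have "indicator (interior T') x = (0::real)" if "T' \<in> \<T> - {T}" for T'
          using mesh_Int_interior[OF T(1), of T'] xi that interior_subset[of T'] by (auto simp: indicator_def)
        then have "(\<Sum>T\<in>\<T>. indicator (interior T) x *\<^sub>R F x) = (\<Sum>T'\<in>{T}. indicator (interior T') x *\<^sub>R F x)"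
          using finite_mesh T(1) by (intro sum.mono_neutral_right) auto
        then show ?thesis using xi x\<Omega> by simp
      next
        case False
        then have "x \<notin> \<Omega>" using mesh_Union closure_subset[of \<Omega>] by blast
        moreover have "indicator (interior T) x = (0::real)" if "T \<in> \<T>" for T
          using False that interior_subset[of T] by (auto simp: indicator_def)
        ultimately show ?thesis by simp
      qed
    qed
  qed (use i F' in auto)
  also have "\<dots> = (\<Sum>T\<in>\<T>. LINT x|lebesgue. indicator (interior T) x *\<^sub>R F x)"
    using i by (rule Bochner_Integration.integral_sum)
  also have "\<dots> = (\<Sum>T\<in>\<T>. LINT x|lebesgue_on T. F x)"
  proof (rule sum.cong[OF refl])
    fix T assume T: "T \<in> \<T>"
    show "(LINT x|lebesgue. indicator (interior T) x *\<^sub>R F x) = (LINT x|lebesgue_on T. F x)"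
      using integral_interior_convex(2)[OF mesh_triangle(1)[OF T] mesh_triangle(3)[OF T] iT[OF T]]
      by (simp add: integral_restrict_space)
  qed
  finally show "(LINT x|lebesgue_on \<Omega>. F x) = (\<Sum>T\<in>\<T>. (LINT x|lebesgue_on T. F x))" .
qed

lemma mesh_L2:
  assumes u: "u \<in> L2 \<Omega>" and T: "T \<in> \<T>"
  shows "u \<in> L2 T"
proof -
  have "u \<in> borel_measurable (lebesgue_on (interior T))"
    by (rule measurable_lebesgue_on_subset[OF _ domain_sets mesh_interior_subset[OF T] L2D(1)[OF u]]) auto
  then have "u \<in> borel_measurable (lebesgue_on T)"
    by (rule measurable_interior_convex[OF mesh_triangle(1)[OF T] mesh_triangle(3)[OF T]])
  with mesh_integral(1)[OF L2D(2)[OF u] T] show ?thesis unfolding L2_def by blast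
qed

lemma mesh_AE_interior:
  assumes T: "T \<in> \<T>" and P: "AE x in lebesgue_on (interior T). P x"
  shows "AE x in lebesgue_on T. P x"
proof -
  have n: "frontier T \<in> null_sets lebesgue"
    using negligible_convex_frontier[OF mesh_triangle(1)[OF T]] by (simp add: negligible_iff_null_sets)
  have "AE x in lebesgue. x \<in> interior T \<longrightarrow> P x"
    using P by (simp add: AE_restrict_space_iff)
  then have "AE x in lebesgue. x \<in> T \<longrightarrow> P x"
    using AE_not_in[OF n] by eventually_elim (use mesh_triangle(3)[OF T] in \<open>auto simp: frontier_def\<close>)
  then show ?thesis using mesh_triangle(4)[OF T] by (simp add: AE_restrict_space_iff)
qed

text \<open>The intersection is a face of dimension below 2 that contains the one-dimensional
  \<open>E\<close>, and \<open>E\<close> is a face of it; equality follows by dimension.\<close>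

lemma edge_Int:
  assumes "T \<in> \<T>" "T' \<in> \<T>" "T \<noteq> T'" and E: "E edge_of T" "E \<subseteq> T'"
  shows "T \<inter> T' = E"
proof -
  let ?F = "T \<inter> T'"
  have F: "?F face_of T" by (rule mesh_face[OF assms(1,2)])
  have lt: "aff_dim ?F < 2"
    using face_of_aff_dim_lt[OF mesh_triangle(1)[OF assms(1)] F mesh_Int_proper[OF assms(1-3)]] mesh_triangle(7)[OF assms(1)] by simp
  have Ef: "E face_of T" and ad: "aff_dim E = 1" using E(1) by (auto simp: edge_of_def)
  have EF: "E \<subseteq> ?F" using E edge_of_imp_subset[OF E(1)] by blast
  have "E face_of ?F" using face_of_subset[OF Ef EF] by blast
  moreover have "convex ?F" using F face_of_imp_convex by blast
  ultimately show ?thesis using face_of_aff_dim_lt[of ?F E] lt ad by fastforce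
qed

lemma edge_of_other:
  assumes "T \<in> \<T>" "T' \<in> \<T>" and E: "E edge_of T" "E \<subseteq> T'"
  shows "E edge_of T'"
proof (cases "T = T'")
  case False
  then have "E face_of T'" using edge_Int[OF assms(1,2) False E] mesh_face'[OF assms(1,2)] by simp
  then show ?thesis using E(1) by (simp add: edge_of_def)
qed (use E in simp)

text \<open>The intersection of the two triangles is a face, and a face that meets the relative
  interior of an edge contains the whole edge.\<close>

lemma edge_open_segment_subset:
  assumes "T \<in> \<T>" "T' \<in> \<T>" and E: "closed_segment b c edge_of T" and x: "x \<in> open_segment b c" "x \<in> T'"
  shows "closed_segment b c \<subseteq> T'"
proof -
  have "b \<noteq> c" using x by auto
  then have "x \<in> rel_interior (closed_segment b c)" using x by (simp add: rel_interior_closed_segment)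
  moreover have "x \<in> T" using x edge_of_imp_subset[OF E] open_closed_segment by blast
  ultimately have "(T \<inter> T') \<inter> rel_interior (closed_segment b c) \<noteq> {}" using x by blast
  from subset_of_face_of[OF mesh_face[OF assms(1,2)] edge_of_imp_subset[OF E] this] show ?thesis by blast
qed

text \<open>From a point of the open edge inside \<Omega>, step slightly away from the opposite
  vertex. The new point has left \<open>T\<close> but not \<Omega>, and a triangle that contains it
  must also contain \<open>E\<close>.\<close>

lemma interior_edge_neighbour:
  assumes T: "T \<in> \<T>" and E: "E edge_of T" and ne: "\<not> E \<subseteq> frontier \<Omega>"
  shows "\<exists>T'\<in>\<T>. T' \<noteq> T \<and> T \<inter> T' = E"
proof -
  obtain a b c where abc: "T = convex hull {a, b, c}" "cross2 (b - a) (c - a) \<noteq> 0" "E = closed_segment b c"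
    using edge_of_triangle[OF mesh_simplex[OF T] E] .
  let ?D = "cross2 (b - a) (c - a)"
  have bc: "b \<noteq> c" using abc(2) by (auto simp: cross2_def algebra_simps)
  have "E \<subseteq> closure \<Omega>" using edge_of_imp_subset[OF E] T mesh_Union by blast
  then obtain y where y: "y \<in> E" "y \<in> \<Omega>" using ne open_domain by (auto simp: frontier_def interior_open)
  have "y \<in> closure (open_segment b c)" using y(1) bc abc(3) by simp
  then obtain x where x: "x \<in> open_segment b c" "x \<in> \<Omega>"
    using open_Int_closure_eq_empty[OF open_domain, of "open_segment b c"] y(2) by blast
  obtain r where r: "r > 0" "\<And>y. y \<in> ball x r \<Longrightarrow> y \<in> T \<longleftrightarrow> 0 \<le> cross2 (c - b) (y - b) / ?D"
    using triangle_near_edge[OF abc(2) x(1)] unfolding abc(1) by metis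
  \<comment> \<open>Removing the finitely many closed triangles that miss \<open>x\<close> leaves an
    open neighbourhood of \<open>x\<close>; a triangle that meets it contains
    \<open>x\<close>.\<close>
  have fin: "finite {T'\<in>\<T>. x \<notin> T'}" using finite_mesh by simp
  have "closed (\<Union>{T'\<in>\<T>. x \<notin> T'})" using fin mesh_triangle(3) by (intro closed_Union) auto
  then have op: "open (\<Omega> - \<Union>{T'\<in>\<T>. x \<notin> T'})" using open_domain by (rule open_Diff[rotated])
  have "x \<in> \<Omega> - \<Union>{T'\<in>\<T>. x \<notin> T'}" using x(2) by blast
  then obtain s where s: "s > 0" "ball x s \<subseteq> \<Omega> - \<Union>{T'\<in>\<T>. x \<notin> T'}"
    using op open_contains_ball by blast
  define e where "e = min r s / 2 / (norm (a - x) + 1)"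
  have np: "norm (a - x) + 1 > 0" using norm_ge_zero[of "a - x"] by linarith
  have e0: "e > 0" using r(1) s(1) np by (simp add: e_def)
  have en: "e * norm (a - x) < min r s"
  proof -
    have "e * norm (a - x) \<le> e * (norm (a - x) + 1)" using e0 by simp
    also have "\<dots> = min r s / 2"
      unfolding e_def by (rule nonzero_eq_divide_eq[THEN iffD1, OF _ refl]) (use np in simp)
    also have "\<dots> < min r s" using r(1) s(1) by auto
    finally show ?thesis .
  qed
  define y' where "y' = x - e *\<^sub>R (a - x)"
  have yb: "y' \<in> ball x r" "y' \<in> ball x s" using en e0 by (auto simp: y'_def dist_norm)
  obtain u where u: "x = (1 - u) *\<^sub>R b + u *\<^sub>R c" using x(1) by (auto simp: in_segment)
  have "cross2 (c - b) (y' - b) = - e * ?D"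
    unfolding y'_def u by (simp add: cross2_def algebra_simps)
  then have "y' \<notin> T" using r(2)[OF yb(1)] abc(2) e0 by simp
  have "y' \<in> \<Union>\<T>" using yb(2) s(2) closure_subset[of \<Omega>] mesh_Union by blast
  then obtain T' where T': "T' \<in> \<T>" "y' \<in> T'" by blast
  then have "x \<in> T'" using yb(2) s(2) by blast
  then have "E \<subseteq> T'" using edge_open_segment_subset[OF T T'(1) _ x(1)] E abc(3) by simp
  moreover have "T \<noteq> T'" using T' \<open>y' \<notin> T\<close> by blast
  ultimately show ?thesis using edge_Int[OF T T'(1) _ E] T'(1) by blast
qed

lemma edge_pair:
  assumes "T \<in> \<T>" "T' \<in> \<T>" "T \<noteq> T'" and E: "E edge_of T" "E edge_of T'"
  obtains a a' b c where "T = convex hull {a, b, c}" "T' = convex hull {a', b, c}" "E = closed_segment b c"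
    "cross2 (b - a) (c - a) \<noteq> 0" "cross2 (b - a') (c - a') \<noteq> 0"
    "sgn (cross2 (b - a') (c - a')) = - sgn (cross2 (b - a) (c - a))"
proof -
  obtain a b c where abc: "T = convex hull {a, b, c}" "cross2 (b - a) (c - a) \<noteq> 0" "E = closed_segment b c"
    using edge_of_triangle[OF mesh_simplex[OF assms(1)] E(1)] .
  obtain a' b' c' where abc': "T' = convex hull {a', b', c'}" "cross2 (b' - a') (c' - a') \<noteq> 0" "E = closed_segment b' c'"
    using edge_of_triangle[OF mesh_simplex[OF assms(2)] E(2)] .
  have "{b', c'} = {b, c}" using abc(3) abc'(3) by simp
  then have T': "T' = convex hull {a', b, c}" using abc'(1) by (metis insert_is_Un)
  have D': "cross2 (b - a') (c - a') \<noteq> 0"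
    using \<open>{b', c'} = {b, c}\<close> abc'(2) by (auto simp: doubleton_eq_iff cross2_def algebra_simps)
  have "convex hull {a, b, c} \<inter> convex hull {a', b, c} = closed_segment b c"
    using edge_Int[OF assms(1-3) E(1) edge_of_imp_subset[OF E(2)]] abc T' by simp
  from triangles_opposite_sides[OF abc(2) D' this] show ?thesis
    using that abc T' D' by blast
qed

text \<open>Three triangles at one edge would have pairwise opposite orientations, but there are
  only two signs.\<close>

lemma edge_at_most_two:
  assumes T: "T1 \<in> \<T>" "T2 \<in> \<T>" "T3 \<in> \<T>" "T1 \<noteq> T2" "T1 \<noteq> T3" "T2 \<noteq> T3"
    and E: "E edge_of T1" "E edge_of T2" "E edge_of T3"
  shows False
proof -
  obtain a1 a2 b c where 1: "T1 = convex hull {a1, b, c}" "T2 = convex hull {a2, b, c}" "E = closed_segment b c"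
    "cross2 (b - a1) (c - a1) \<noteq> 0" "cross2 (b - a2) (c - a2) \<noteq> 0"
    "sgn (cross2 (b - a2) (c - a2)) = - sgn (cross2 (b - a1) (c - a1))"
    using edge_pair[OF T(1,2,4) E(1,2)] .
  obtain a3 b' c' where abc': "T3 = convex hull {a3, b', c'}" "cross2 (b' - a3) (c' - a3) \<noteq> 0" "E = closed_segment b' c'"
    using edge_of_triangle[OF mesh_simplex[OF T(3)] E(3)] .
  have "{b', c'} = {b, c}" using 1(3) abc'(3) by simp
  then have T3: "T3 = convex hull {a3, b, c}" using abc'(1) by (metis insert_is_Un)
  have D3: "cross2 (b - a3) (c - a3) \<noteq> 0"
    using \<open>{b', c'} = {b, c}\<close> abc'(2) by (auto simp: doubleton_eq_iff cross2_def algebra_simps)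
  have "convex hull {a1, b, c} \<inter> convex hull {a3, b, c} = closed_segment b c"
    using edge_Int[OF T(1,3,5) E(1) edge_of_imp_subset[OF E(3)]] 1 T3 by simp
  from triangles_opposite_sides[OF 1(4) D3 this]
  have s1: "sgn (cross2 (b - a3) (c - a3)) = - sgn (cross2 (b - a1) (c - a1))" .
  have "convex hull {a2, b, c} \<inter> convex hull {a3, b, c} = closed_segment b c"
    using edge_Int[OF T(2,3,6) E(2) edge_of_imp_subset[OF E(3)]] 1 T3 by simp
  from triangles_opposite_sides[OF 1(5) D3 this] s1 1(4,6) show False
    by (simp add: sgn_if split: if_splits)
qed

lemma edge_normals_opposite:
  assumes "T \<in> \<T>" "T' \<in> \<T>" "T \<noteq> T'" "E edge_of T" "E edge_of T'"
  shows "outer_normal T' E = - outer_normal T E"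
proof -
  obtain a a' b c where e: "T = convex hull {a, b, c}" "T' = convex hull {a', b, c}" "E = closed_segment b c"
    "cross2 (b - a) (c - a) \<noteq> 0" "cross2 (b - a') (c - a') \<noteq> 0"
    "sgn (cross2 (b - a') (c - a')) = - sgn (cross2 (b - a) (c - a))"
    using edge_pair[OF assms] .
  show ?thesis
    unfolding e(1-3) outer_normal_triangle[OF e(4)] outer_normal_triangle[OF e(5)] e(6) by simp
qed

text \<open>The two triangles at the edge cover a neighbourhood of \<open>x\<close>, which places
  \<open>x\<close> in the interior of the closure of \<Omega>, that is, in \<Omega>. So an interior
  edge can meet the boundary only at its end points.\<close>

lemma interior_edge_open_segment:
  assumes T: "T \<in> \<T>" and E: "E edge_of T" "\<not> E \<subseteq> frontier \<Omega>"
    and x: "E = closed_segment p q" "x \<in> open_segment p q"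
  shows "x \<in> \<Omega>"
proof -
  obtain T' where T': "T' \<in> \<T>" "T' \<noteq> T" "T \<inter> T' = E" using interior_edge_neighbour[OF T E] by blast
  have E': "E edge_of T'" using edge_of_other[OF T T'(1) E(1)] T'(3) by blast
  obtain a a' b c where e: "T = convex hull {a, b, c}" "T' = convex hull {a', b, c}" "E = closed_segment b c"
    "cross2 (b - a) (c - a) \<noteq> 0" "cross2 (b - a') (c - a') \<noteq> 0"
    "sgn (cross2 (b - a') (c - a')) = - sgn (cross2 (b - a) (c - a))"
    using edge_pair[OF T T'(1) T'(2)[symmetric] E(1) E'] .
  have "{p, q} = {b, c}" using e(3) x(1) by simp
  then have "x \<in> open_segment b c" using x(2) by (auto simp: doubleton_eq_iff open_segment_commute)
  from triangles_opposite_cover[OF e(4-6) this] have "x \<in> interior (T \<union> T')" using e by simp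
  moreover have "T \<union> T' \<subseteq> closure \<Omega>" using T T'(1) mesh_Union by blast
  ultimately show ?thesis using interior_mono[of "T \<union> T'" "closure \<Omega>"] lipschitz_domain_interior_closure[OF lip] by blast
qed

end

section \<open>Continuous piecewise linear functions with zero boundary values\<close>

context triangulated_domain begin

lemma vertex_of_other:
  assumes "T \<in> \<T>" "T' \<in> \<T>" "{z} face_of T" "z \<in> T'"
  shows "{z} face_of T'"
proof -
  have "z \<in> T" using assms(3) face_of_imp_subset by blast
  then have "{z} face_of T \<inter> T'" using face_of_subset[OF assms(3), of "T \<inter> T'"] assms(4) by blast
  then show ?thesis using mesh_face'[OF assms(1,2)] by (rule face_of_trans)
qed

text \<open>Such a point lies on an edge. Either the whole edge is in the frontier, and the affine
  function vanishes at both of its ends, or the point is itself an end of the edge, since open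
  interior edges lie in \<Omega>.\<close>

lemma affine_vanishes_on_frontier:
  assumes T: "T \<in> \<T>" and x: "x \<in> T" "x \<in> frontier \<Omega>"
    and l: "\<And>z. {z} face_of T \<Longrightarrow> z \<in> frontier \<Omega> \<Longrightarrow> \<alpha> + \<beta> \<bullet> z = 0"
  shows "\<alpha> + \<beta> \<bullet> x = 0"
proof -
  obtain a b c where abc: "T = convex hull {a, b, c}" "cross2 (b - a) (c - a) \<noteq> 0"
    using two_simplex_triangle[OF mesh_simplex[OF T]] .
  have "x \<notin> \<Omega>" using x(2) open_domain by (simp add: frontier_def interior_open)
  then have "x \<notin> interior T" using mesh_interior_subset[OF T] by blast
  then have "x \<in> frontier T" using x(1) closure_subset by (auto simp: frontier_def)
  then have "x \<in> closed_segment a b \<union> closed_segment b c \<union> closed_segment c a"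
    unfolding abc(1) by (subst (asm) frontier_of_triangle) (auto simp: abc)
  then obtain p q where pq: "p \<in> {a, b, c}" "q \<in> {a, b, c}" "x \<in> closed_segment p q" "closed_segment p q edge_of T"
    using edge_of_triangle_iff[OF abc(2)] unfolding abc(1) by blast
  have v: "{p} face_of T" "{q} face_of T" using pq(1,2) vertex_of_triangle[OF abc(2)] unfolding abc(1) by auto
  show ?thesis
  proof (cases "closed_segment p q \<subseteq> frontier \<Omega>")
    case True
    then have z: "\<alpha> + \<beta> \<bullet> p = 0" "\<alpha> + \<beta> \<bullet> q = 0" using l v by auto
    obtain u where "x = (1 - u) *\<^sub>R p + u *\<^sub>R q" using pq(3) by (auto simp: in_segment)
    then have "\<beta> \<bullet> x = (1 - u) * (\<beta> \<bullet> p) + u * (\<beta> \<bullet> q)" by (simp add: inner_add_right)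
    then have "\<alpha> + \<beta> \<bullet> x = (1 - u) * (\<alpha> + \<beta> \<bullet> p) + u * (\<alpha> + \<beta> \<bullet> q)"
      by (simp add: algebra_simps)
    then show ?thesis using z by simp
  next
    case False
    then have "x \<notin> open_segment p q"
      using interior_edge_open_segment[OF T pq(4) False refl] \<open>x \<notin> \<Omega>\<close> by blast
    then have "x = p \<or> x = q" using pq(3) by (auto simp: open_segment_def)
    then show ?thesis using l v x(2) by blast
  qed
qed

lemma interpolant:
  assumes c0: "\<And>z. z \<in> frontier \<Omega> \<Longrightarrow> c z = 0"
  obtains v \<alpha> \<beta> where "v \<in> V_h \<Omega> \<T>" "\<And>T x. T \<in> \<T> \<Longrightarrow> x \<in> T \<Longrightarrow> v x = \<alpha> T + \<beta> T \<bullet> x"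
    "\<And>T z. T \<in> \<T> \<Longrightarrow> {z} face_of T \<Longrightarrow> v z = c z" "\<And>x. x \<notin> \<Omega> \<Longrightarrow> v x = 0"
proof -
  have "\<exists>\<alpha> \<beta>. \<forall>z. {z} face_of T \<longrightarrow> \<alpha> + \<beta> \<bullet> z = c z" if T: "T \<in> \<T>" for T
  proof -
    obtain p q r where pqr: "T = convex hull {p, q, r}" "cross2 (q - p) (r - p) \<noteq> 0"
      using two_simplex_triangle[OF mesh_simplex[OF T]] .
    show ?thesis
      using triangle_affine_interpolation[OF pqr(2), of c] unfolding pqr(1) vertex_of_triangle[OF pqr(2)] by blast
  qed
  then obtain \<alpha> \<beta> where ab: "\<And>T z. T \<in> \<T> \<Longrightarrow> {z} face_of T \<Longrightarrow> \<alpha> T + \<beta> T \<bullet> z = c z"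
    by metis
  \<comment> \<open>The common part is the convex hull of vertices of \<open>T\<close> that are also
    vertices of \<open>T'\<close>; two affine functions that agree at these agree on their
    hull.\<close>
  have consistent: "\<alpha> T + \<beta> T \<bullet> x = \<alpha> T' + \<beta> T' \<bullet> x" if T: "T \<in> \<T>" "T' \<in> \<T>" and x: "x \<in> T" "x \<in> T'" for T T' x
  proof -
    obtain p q r where pqr: "T = convex hull {p, q, r}" "cross2 (q - p) (r - p) \<noteq> 0"
      using two_simplex_triangle[OF mesh_simplex[OF T(1)]] .
    obtain S where S: "S \<subseteq> {p, q, r}" "T \<inter> T' = convex hull S"
      using mesh_face[OF T] face_of_triangle[OF pqr(2)] pqr(1) by auto
    have "\<alpha> T + \<beta> T \<bullet> z = \<alpha> T' + \<beta> T' \<bullet> z" if "z \<in> S" for z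
    proof -
      have f: "{z} face_of T" using that S(1) vertex_of_triangle[OF pqr(2), of z] pqr(1) by blast
      have "z \<in> T'" using that S(2) hull_subset[of S convex] by blast
      then have f': "{z} face_of T'" by (rule vertex_of_other[OF T f])
      show ?thesis using ab[OF T(1) f] ab[OF T(2) f'] by simp
    qed
    then have "S \<subseteq> {x. (\<beta> T - \<beta> T') \<bullet> x = \<alpha> T' - \<alpha> T}" by (auto simp: inner_diff_left algebra_simps)
    then have "convex hull S \<subseteq> {x. (\<beta> T - \<beta> T') \<bullet> x = \<alpha> T' - \<alpha> T}"
      by (rule hull_minimal) (rule convex_hyperplane)
    then have "(\<beta> T - \<beta> T') \<bullet> x = \<alpha> T' - \<alpha> T" using x S(2) by blast
    then show ?thesis by (simp add: inner_diff_left)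
  qed
  \<comment> \<open>Where triangles overlap the choice does not matter, by
    \<open>consistent\<close>.\<close>
  define sel where "sel x = (SOME T. T \<in> \<T> \<and> x \<in> T)" for x
  define v where "v x = (if \<exists>T\<in>\<T>. x \<in> T then \<alpha> (sel x) + \<beta> (sel x) \<bullet> x else 0)" for x
  have veq: "v x = \<alpha> T + \<beta> T \<bullet> x" if T: "T \<in> \<T>" "x \<in> T" for T x
  proof -
    have "sel x \<in> \<T> \<and> x \<in> sel x" unfolding sel_def by (rule someI[of _ T]) (use T in blast)
    then have "\<alpha> (sel x) + \<beta> (sel x) \<bullet> x = \<alpha> T + \<beta> T \<bullet> x" using consistent T by blast
    then show ?thesis using T by (auto simp: v_def)
  qed
  have v0: "v x = 0" if "x \<notin> \<Omega>" for x
  proof (cases "\<exists>T\<in>\<T>. x \<in> T")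
    case True
    then obtain T where T: "T \<in> \<T>" "x \<in> T" by blast
    then have "x \<in> closure \<Omega>" using mesh_Union by blast
    then have "x \<in> frontier \<Omega>" using that open_domain by (simp add: frontier_def interior_open)
    have "\<alpha> T + \<beta> T \<bullet> x = 0"
      by (rule affine_vanishes_on_frontier[OF T \<open>x \<in> frontier \<Omega>\<close>]) (use ab[OF T(1)] c0 in simp)
    then show ?thesis using veq[OF T] by simp
  qed (simp add: v_def)
  define M where "M = (\<Sum>T\<in>\<T>. norm (\<beta> T))"
  have M0: "M \<ge> 0" unfolding M_def by (simp add: sum_nonneg)
  have \<beta>M: "norm (\<beta> T) \<le> M" if "T \<in> \<T>" for T
    unfolding M_def using finite_mesh that by (intro member_le_sum) auto
  \<comment> \<open>\<Omega> need not be convex, so the segment from \<open>x\<close> to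
    \<open>y\<close> may leave it. The segment is therefore cut into finitely many closed pieces, by
    the triangles and by the complement of \<Omega>, where \<open>v\<close> is zero; the index
    \<open>None\<close> stands for the complement.\<close>
  have lip_v: "M-lipschitz_on UNIV v"
  proof (rule lipschitz_onI[OF _ M0])
    fix x y :: "real^2"
    define P where "P t = x + t *\<^sub>R (y - x)" for t
    have contP: "continuous_on UNIV P" unfolding P_def by (intro continuous_intros)
    define U where "U i = (case i of None \<Rightarrow> P -` (- \<Omega>) | Some T \<Rightarrow> P -` T)" for i
    have "(M * norm (y - x))-lipschitz_on {0..1} (\<lambda>t. v (P t))"
    proof (rule lipschitz_on_closed_Union[where I = "insert None (Some ` \<T>)" and U = U])
      show "finite (insert None (Some ` \<T>))" using finite_mesh by simp
      show "0 \<le> M * norm (y - x)" using M0 by simp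
      show "closed (U i)" if "i \<in> insert None (Some ` \<T>)" for i
        using that open_domain mesh_triangle(3) contP by (auto simp: U_def intro!: closed_vimage)
      show "{0..1} \<subseteq> (\<Union>i\<in>insert None (Some ` \<T>). U i)"
      proof
        fix t
        show "t \<in> (\<Union>i\<in>insert None (Some ` \<T>). U i)"
        proof (cases "P t \<in> \<Omega>")
          case True
          then have "P t \<in> \<Union>\<T>" using mesh_Union closure_subset[of \<Omega>] by blast
          then show ?thesis by (auto simp: U_def)
        qed (auto simp: U_def)
      qed
      show "(M * norm (y - x))-lipschitz_on (U i) (\<lambda>t. v (P t))" if i: "i \<in> insert None (Some ` \<T>)" for i
      proof (rule lipschitz_onI)
        show "0 \<le> M * norm (y - x)" using M0 by simp
        fix s t assume st: "s \<in> U i" "t \<in> U i"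
        show "dist (v (P s)) (v (P t)) \<le> M * norm (y - x) * dist s t"
        proof (cases i)
          case None
          then have "v (P s) = 0" "v (P t) = 0" using st v0 by (auto simp: U_def)
          then show ?thesis using M0 by simp
        next
          case (Some T)
          then have T: "T \<in> \<T>" using i by auto
          have "P s \<in> T" "P t \<in> T" using st Some by (auto simp: U_def)
          then have "v (P s) - v (P t) = \<beta> T \<bullet> (P s - P t)" using veq[OF T] by (simp add: inner_diff_right)
          also have "P s - P t = (s - t) *\<^sub>R (y - x)" by (simp add: P_def algebra_simps)
          finally have "\<bar>v (P s) - v (P t)\<bar> = \<bar>s - t\<bar> * \<bar>\<beta> T \<bullet> (y - x)\<bar>" by (simp add: abs_mult)
          also have "\<bar>\<beta> T \<bullet> (y - x)\<bar> \<le> M * norm (y - x)"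
            using Cauchy_Schwarz_ineq2[of "\<beta> T" "y - x"] mult_right_mono[OF \<beta>M[OF T], of "norm (y - x)"] by simp
          then have "\<bar>s - t\<bar> * \<bar>\<beta> T \<bullet> (y - x)\<bar> \<le> \<bar>s - t\<bar> * (M * norm (y - x))" by (rule mult_left_mono) simp
          finally show ?thesis by (simp add: dist_real_def mult.commute mult.left_commute)
        qed
      qed
    qed
    from lipschitz_onD[OF this, of 0 1] show "dist (v x) (v y) \<le> M * dist x y"
      by (simp add: P_def dist_norm norm_minus_commute dist_commute)
  qed
  define g where "g x = (\<Sum>T\<in>\<T>. indicator (interior T) x *\<^sub>R \<beta> T)" for x
  have gT: "g x = \<beta> T" if T: "T \<in> \<T>" "x \<in> interior T" for T x
  proof -
    have "indicator (interior T') x *\<^sub>R \<beta> T' = 0" if "T' \<in> \<T> - {T}" for T'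
      using mesh_Int_interior[OF T(1), of T'] T(2) that interior_subset[of T'] by (auto simp: indicator_def)
    then have "g x = (\<Sum>T'\<in>{T}. indicator (interior T') x *\<^sub>R \<beta> T')"
      unfolding g_def using finite_mesh T(1) by (intro sum.mono_neutral_right) auto
    then show ?thesis using T(2) by simp
  qed
  have gm: "(\<lambda>x. g x $ i) \<in> borel_measurable (lebesgue_on \<Omega>)" for i
  proof -
    have "interior T \<in> sets (lebesgue_on \<Omega>)" if "T \<in> \<T>" for T
      using domain_sets mesh_interior_subset[OF that] by (simp add: sets_restrict_space_iff)
    then have "(\<lambda>x. \<Sum>T\<in>\<T>. indicator (interior T) x * \<beta> T $ i) \<in> borel_measurable (lebesgue_on \<Omega>)"
      by (intro borel_measurable_sum borel_measurable_times borel_measurable_indicator) auto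
    then show ?thesis by (simp add: g_def sum_component)
  qed
  \<comment> \<open>The exceptional null set for \<open>lipschitz_in_H10\<close>: besides the
    frontiers of the triangles it contains the zero lines of the nonconstant affine pieces, on which
    \<open>v\<close> vanishes with nonzero gradient.\<close>
  define N where "N = (\<Union>T\<in>\<T>. frontier T) \<union> (\<Union>T\<in>{T\<in>\<T>. \<beta> T \<noteq> 0}. {x. \<beta> T \<bullet> x = - \<alpha> T})"
  have "negligible N"
    unfolding N_def using finite_mesh negligible_convex_frontier[OF mesh_triangle(1)] negligible_hyperplane
    by (intro negligible_Un negligible_Union) auto
  then have Nn: "N \<in> null_sets lebesgue" by (simp add: negligible_iff_null_sets)
  have aff: "AE x in lebesgue_on \<Omega>. (\<exists>s>0. \<forall>y\<in>ball x s. v y = v x + g x \<bullet> (y - x)) \<and> (v x \<noteq> 0 \<or> g x = 0)"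
  proof -
    have "AE x in lebesgue. x \<in> \<Omega> \<longrightarrow> (\<exists>s>0. \<forall>y\<in>ball x s. v y = v x + g x \<bullet> (y - x)) \<and> (v x \<noteq> 0 \<or> g x = 0)"
      using AE_not_in[OF Nn]
    proof (rule eventually_mono, intro impI)
      fix x assume xN: "x \<notin> N" and x\<Omega>: "x \<in> \<Omega>"
      then have "x \<in> \<Union>\<T>" using mesh_Union closure_subset[of \<Omega>] by blast
      then obtain T where T: "T \<in> \<T>" "x \<in> T" by blast
      have xi: "x \<in> interior T" using xN T mesh_triangle(3)[OF T(1)] by (auto simp: N_def frontier_def)
      obtain s where s: "s > 0" "ball x s \<subseteq> T" using xi by (auto simp: mem_interior)
      have "\<forall>y\<in>ball x s. v y = v x + g x \<bullet> (y - x)"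
      proof
        fix y assume "y \<in> ball x s"
        then have "y \<in> T" using s(2) by blast
        then show "v y = v x + g x \<bullet> (y - x)"
          using veq[OF T(1)] T(2) gT[OF T(1) xi] by (simp add: inner_diff_right)
      qed
      moreover have "v x \<noteq> 0 \<or> g x = 0"
      proof (cases "\<beta> T = 0")
        case False
        then have "\<beta> T \<bullet> x \<noteq> - \<alpha> T" using xN T(1) by (auto simp: N_def)
        then show ?thesis using veq[OF T] by auto
      qed (use gT[OF T(1) xi] in simp)
      ultimately show "(\<exists>s>0. \<forall>y\<in>ball x s. v y = v x + g x \<bullet> (y - x)) \<and> (v x \<noteq> 0 \<or> g x = 0)"
        using s(1) by blast
    qed
    then show ?thesis using domain_sets by (subst AE_restrict_space_iff) auto
  qed
  have "v \<in> H10 \<Omega>" by (rule lipschitz_in_H10(1)[OF open_domain bounded lip_v v0 gm aff])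
  moreover have "piecewise_P1 \<T> v" using veq by (auto simp: piecewise_P1_def)
  ultimately have "v \<in> V_h \<Omega> \<T>" by (simp add: V_h_def)
  then show ?thesis
  proof (rule that[OF _ veq])
    show "v z = c z" if "T \<in> \<T>" "{z} face_of T" for T z
      using veq[OF that(1), of z] ab[OF that] face_of_imp_subset[OF that(2)] by simp
  qed (use v0 in auto)
qed

lemma weak_grad_mesh:
  assumes u: "u \<in> H1 \<Omega>" and T: "T \<in> \<T>" and aff: "\<And>x. x \<in> T \<Longrightarrow> u x = \<alpha> + \<beta> \<bullet> x"
  shows "AE x in lebesgue_on T. weak_grad \<Omega> u x = \<beta>"
proof (rule mesh_AE_interior[OF T])
  show "AE x in lebesgue_on (interior T). weak_grad \<Omega> u x = \<beta>"
    by (rule weak_grad_affine[OF open_domain bounded open_interior mesh_interior_subset[OF T] u])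
      (use aff interior_subset[of T] in blast)
qed

section \<open>Diameters, areas and overlap\<close>

lemma mesh_diameter:
  assumes "T \<in> \<T>" "x \<in> T" "y \<in> T"
  shows "dist x y \<le> mesh_size \<T>"
proof -
  have "dist x y \<le> diameter T"
    using diameter_bounded_bound[OF compact_imp_bounded[OF mesh_triangle(2)[OF assms(1)]] assms(2,3)] .
  also have "\<dots> \<le> mesh_size \<T>" unfolding mesh_size_def using finite_mesh assms(1) by (intro Max_ge) auto
  finally show ?thesis .
qed

text \<open>Quasi-uniformity bounds \<open>h\<close> by the diameter and shape regularity bounds the
  diameter by the inscribed ball. So each triangle contains a ball of radius proportional to
  \<open>h\<close>, whose area is the lower bound.\<close>

lemma mesh_inball:
  assumes T: "T \<in> \<T>" and s: "shape_regular \<sigma> \<T>" and q: "quasi_uniform \<tau> \<T>" and h: "0 < mesh_size \<T>"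
  shows "\<sigma> > 0" "\<tau> > 0" "pi * (mesh_size \<T> / (4 * \<sigma> * \<tau>))\<^sup>2 \<le> measure lebesgue T"
proof -
  let ?h = "mesh_size \<T>"
  define S where "S = {r. \<exists>x. cball x r \<subseteq> T}"
  have bT: "bounded T" using mesh_triangle(2)[OF T] compact_imp_bounded by blast
  have d0: "0 \<le> diameter T" using bT diameter_ge_0 by blast
  have q': "?h \<le> \<tau> * diameter T" using q T by (simp add: quasi_uniform_def)
  then have "\<tau> * diameter T > 0" using h by simp
  then show \<tau>: "\<tau> > 0" using d0 by (auto simp: zero_less_mult_iff)
  have dpos: "diameter T > 0" using \<open>\<tau> * diameter T > 0\<close> \<tau> by (simp add: zero_less_mult_iff)
  have s': "diameter T \<le> \<sigma> * (2 * Sup S)" using s T by (simp add: shape_regular_def inball_diameter_def S_def)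
  have bdd: "bdd_above S"
  proof (rule bdd_aboveI[of _ "diameter T"])
    fix r assume "r \<in> S"
    then obtain x where x: "cball x r \<subseteq> T" by (auto simp: S_def)
    show "r \<le> diameter T"
      using diameter_subset[OF x bT] d0 by (auto simp: diameter_cball split: if_splits)
  qed
  obtain x where x: "x \<in> T" using mesh_triangle(6)[OF T] interior_subset by blast
  then have "0 \<in> S" by (auto simp: S_def)
  then have S0: "0 \<le> Sup S" using bdd by (rule cSup_upper)
  have "\<sigma> * (2 * Sup S) > 0" using s' dpos by simp
  then show \<sigma>: "\<sigma> > 0" using S0 by (auto simp: zero_less_mult_iff)
  \<comment> \<open>Half of the lower bound \<open>h / (2 \<sigma> \<tau>)\<close> for the supremum
    of the radii. Being strictly below the supremum, it is exceeded by a radius that actually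
    occurs.\<close>
  define r0 where "r0 = ?h / (4 * \<sigma> * \<tau>)"
  have r0: "r0 > 0" using h \<sigma> \<tau> by (simp add: r0_def)
  have "?h \<le> \<tau> * (\<sigma> * (2 * Sup S))"
    using q' mult_left_mono[OF s', of \<tau>] \<tau> by linarith
  then have "?h / (2 * \<sigma> * \<tau>) \<le> Sup S" using \<sigma> \<tau> by (simp add: divide_le_eq mult_ac)
  moreover have "?h / (2 * \<sigma> * \<tau>) = 2 * r0" by (simp add: r0_def)
  ultimately have "r0 < Sup S" using r0 by linarith
  then obtain r where r: "r \<in> S" "r0 < r" using less_cSup_iff[of S r0] bdd \<open>0 \<in> S\<close> by blast
  then obtain y where "cball y r \<subseteq> T" by (auto simp: S_def)
  then have sub: "cball y r0 \<subseteq> T" using r(2) by (meson less_imp_le order_trans subset_cball)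
  have "pi * r0\<^sup>2 = measure lebesgue (cball y r0)"
    using r0 by (simp add: content_cball unit_ball_vol_2)
  also have "\<dots> \<le> measure lebesgue T"
    using sub mesh_triangle(5)[OF T] by (intro measure_mono_fmeasurable) auto
  finally show "pi * (?h / (4 * \<sigma> * \<tau>))\<^sup>2 \<le> measure lebesgue T" by (simp add: r0_def)
qed

text \<open>Packing: the triangles in question have pairwise null intersections, have area at least
  \<open>A\<close>, and lie in one ball of radius \<open>4 * h\<close>, namely \<open>3 * h\<close>
  plus a diameter.\<close>

lemma mesh_overlap:
  assumes A: "A > 0" "\<And>T. T \<in> \<T> \<Longrightarrow> A \<le> measure lebesgue T"
  shows "real (card {T \<in> \<T>. \<exists>z\<in>T. dist z x \<le> 3 * mesh_size \<T>}) * A \<le> 16 * pi * (mesh_size \<T>)\<^sup>2"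
proof (cases "\<T> = {}")
  case False
  let ?h = "mesh_size \<T>"
  let ?S = "{T \<in> \<T>. \<exists>z\<in>T. dist z x \<le> 3 * ?h}"
  have fin: "finite ?S" using finite_mesh by simp
  obtain T0 where T0: "T0 \<in> \<T>" using False by blast
  obtain z0 where "z0 \<in> T0" using mesh_triangle(6)[OF T0] interior_subset by blast
  from mesh_diameter[OF T0 this this] have h0: "?h \<ge> 0" by simp
  have "real (card ?S) * A = (\<Sum>T\<in>?S. A)" by simp
  also have "\<dots> \<le> (\<Sum>T\<in>?S. measure lebesgue T)" by (intro sum_mono A(2)) simp
  also have "\<dots> = measure lebesgue (\<Union>?S)"
    using mesh_triangle(5) mesh_Int_negligible fin
    by (intro measure_negligible_finite_Union[symmetric]) (auto simp: pairwise_def)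
  also have "\<dots> \<le> measure lebesgue (cball x (4 * ?h))"
  proof (rule measure_mono_fmeasurable)
    show "\<Union>?S \<subseteq> cball x (4 * ?h)"
    proof
      fix y assume "y \<in> \<Union>?S"
      then obtain T z where T: "T \<in> \<T>" "y \<in> T" "z \<in> T" "dist z x \<le> 3 * ?h" by blast
      have "dist x y \<le> dist z x + dist z y" by (metis dist_commute dist_triangle)
      then show "y \<in> cball x (4 * ?h)" using mesh_diameter[OF T(1) T(3,2)] T(4) by simp
    qed
    show "\<Union>?S \<in> sets lebesgue" using fin mesh_triangle(4) by (intro sets.finite_Union) auto
  qed auto
  also have "\<dots> = 16 * pi * ?h\<^sup>2" using h0 by (simp add: content_cball unit_ball_vol_2 power_mult_distrib)
  finally show ?thesis .
qed simp

end

text \<open>The convention of \<open>edge_norm_sq\<close> for integrands that are not squares, so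
  that a jump times a test function is integrated in the same parametrisation.\<close>

definition edge_integral :: "point set \<Rightarrow> scalar_field \<Rightarrow> real" where
  "edge_integral E u =
     (let (a, b) = (SOME (a, b). E = closed_segment a b) in dist a b * seg_integral u a b)"

lemma edge_integral_segment:
  "edge_integral (closed_segment a b) u = dist a b * seg_integral u a b"
proof -
  define P where "P = (\<lambda>(p, q). closed_segment a b = closed_segment p q)"
  obtain p q where pq: "(SOME z. P z) = (p, q)" by (cases "SOME z. P z")
  have "P (SOME z. P z)" by (rule someI[of P "(a, b)"]) (simp add: P_def)
  then have "closed_segment a b = closed_segment p q" unfolding pq unfolding P_def by simp
  then have "(p = a \<and> q = b) \<or> (p = b \<and> q = a)" by (auto simp: doubleton_eq_iff)
  then have "dist p q * seg_integral u p q = dist a b * seg_integral u a b"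
    using seg_integral_swap by (auto simp: dist_commute)
  then show ?thesis
    unfolding edge_integral_def P_def[symmetric] pq by simp
qed

lemma edge_norm_sq_eq: "edge_norm_sq E u = edge_integral E (\<lambda>x. (u x)\<^sup>2)"
  by (simp add: edge_norm_sq_def edge_integral_def seg_integral_def)

lemma edge_term:
  assumes "cross2 (b - a) (c - a) \<noteq> 0"
  shows "sgn (cross2 (b - a) (c - a)) * seg_integral (\<lambda>x. cross2 (A x) (c - b) * w x) b c =
    edge_integral (closed_segment b c)
      (\<lambda>x. (A x \<bullet> outer_normal (convex hull {a, b, c}) (closed_segment b c)) * w x)"
proof -
  let ?s = "sgn (cross2 (b - a) (c - a))"
  let ?n = "outer_normal (convex hull {a, b, c}) (closed_segment b c)"
  have "?s * seg_integral (\<lambda>x. cross2 (A x) (c - b) * w x) b c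
      = seg_integral (\<lambda>x. ?s * (cross2 (A x) (c - b) * w x)) b c"
    by (simp only: seg_integral_cmult)
  also have "\<dots> = seg_integral (\<lambda>x. dist b c * ((A x \<bullet> ?n) * w x)) b c"
    by (rule seg_integral_cong) (simp only: mult.assoc[symmetric] outer_normal_cross2[OF assms])
  also have "\<dots> = dist b c * seg_integral (\<lambda>x. (A x \<bullet> ?n) * w x) b c"
    by (simp only: seg_integral_cmult)
  finally show ?thesis unfolding edge_integral_segment .
qed

lemma triangle_edges_distinct:
  assumes "cross2 (b - a) (c - a) \<noteq> 0"
  shows "closed_segment a b \<noteq> closed_segment b c" "closed_segment a b \<noteq> closed_segment c a"
    "closed_segment b c \<noteq> closed_segment c a"
  using assms affine_independent_iff_cross2[of a b c] by (auto simp: doubleton_eq_iff)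

lemma finite_triangle_edges:
  fixes T :: "point set"
  assumes "2 simplex T"
  shows "finite {E. E edge_of T}" "card {E. E edge_of T} \<le> 3"
proof -
  obtain a b c where abc: "T = convex hull {a, b, c}" "cross2 (b - a) (c - a) \<noteq> 0"
    using two_simplex_triangle[OF assms] .
  have e: "{E. E edge_of T} = {closed_segment a b, closed_segment b c, closed_segment c a}"
    unfolding abc(1) edge_of_triangle_iff[OF abc(2)] by blast
  show "finite {E. E edge_of T}" unfolding e by simp
  have "card {closed_segment a b, closed_segment b c, closed_segment c a} \<le> 3" by (rule card_insert_le_m1; simp)+ 
  then show "card {E. E edge_of T} \<le> 3" unfolding e .
qed

text \<open>Removes the vertex names from \<open>ibp_triangle\<close>: a cyclic relabelling leaves
  the determinant unchanged and presents each edge as the one opposite to the first vertex, as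
  \<open>edge_term\<close> expects.\<close>

lemma ibp_triangle_edges:
  assumes T: "2 simplex T"
    and w: "\<And>x. (w has_derivative (\<lambda>e. G x \<bullet> e)) (at x)" and G: "continuous_on UNIV G"
    and A: "\<And>x. (A has_derivative A' x) (at x)" and A': "\<And>e. continuous_on UNIV (\<lambda>x. A' x e)"
  shows "(LINT x|lebesgue_on T. A x \<bullet> G x + (\<Sum>i\<in>UNIV. A' x (axis i 1) $ i) * w x) =
    (\<Sum>E | E edge_of T. edge_integral E (\<lambda>x. (A x \<bullet> outer_normal T E) * w x))"
proof -
  obtain a b c where abc: "T = convex hull {a, b, c}" "cross2 (b - a) (c - a) \<noteq> 0"
    using two_simplex_triangle[OF T] .
  let ?D = "cross2 (b - a) (c - a)"
  let ?I = "\<lambda>E. edge_integral E (\<lambda>x. (A x \<bullet> outer_normal T E) * w x)"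
  have D1: "cross2 (a - c) (b - c) = ?D" using cross2_cyclic[of b a c] by (simp add: cross2_def algebra_simps)
  have D2: "cross2 (c - b) (a - b) = ?D" using cross2_cyclic[of c b a] by (simp add: cross2_def algebra_simps)
  have p1: "{c, a, b} = {a, b, c}" and p2: "{b, c, a} = {a, b, c}" by auto
  have 1: "sgn ?D * seg_integral (\<lambda>x. cross2 (A x) (c - b) * w x) b c = ?I (closed_segment b c)"
    using edge_term[OF abc(2), of A w] unfolding abc(1) .
  have 2: "sgn ?D * seg_integral (\<lambda>x. cross2 (A x) (b - a) * w x) a b = ?I (closed_segment a b)"
    using edge_term[of a c b A w] abc(2) unfolding D1 abc(1) p1 by simp
  have 3: "sgn ?D * seg_integral (\<lambda>x. cross2 (A x) (a - c) * w x) c a = ?I (closed_segment c a)"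
    using edge_term[of c b a A w] abc(2) unfolding D2 abc(1) p2 by simp
  have e: "{E. E edge_of T} = {closed_segment a b, closed_segment b c, closed_segment c a}"
    unfolding abc(1) edge_of_triangle_iff[OF abc(2)] by blast
  have "(\<Sum>E | E edge_of T. ?I E) = ?I (closed_segment a b) + ?I (closed_segment b c) + ?I (closed_segment c a)"
    unfolding e using triangle_edges_distinct[OF abc(2)] by simp
  also have "\<dots> = sgn ?D *
      (seg_integral (\<lambda>x. cross2 (A x) (b - a) * w x) a b
       + seg_integral (\<lambda>x. cross2 (A x) (c - b) * w x) b c
       + seg_integral (\<lambda>x. cross2 (A x) (a - c) * w x) c a)"
    unfolding 1[symmetric] 2[symmetric] 3[symmetric] by (simp only: distrib_left)
  also have "\<dots> = (LINT x|lebesgue_on T. A x \<bullet> G x + (\<Sum>i\<in>UNIV. A' x (axis i 1) $ i) * w x)"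
    unfolding abc(1) by (rule ibp_triangle[OF abc(2) w G A A', symmetric])
  finally show ?thesis ..
qed

lemma edge_integral_cong:
  assumes "E edge_of T" "2 simplex T" "\<And>x. x \<in> E \<Longrightarrow> f x = g x"
  shows "edge_integral E f = edge_integral E g"
proof -
  obtain a b c where "E = closed_segment b c" using edge_of_triangle[OF assms(2,1)] by blast
  then show ?thesis using seg_integral_cong[of b c f g] assms(3) by (simp add: edge_integral_segment)
qed

lemma edge_integral_add:
  assumes "E edge_of T" "2 simplex T" "continuous_on UNIV f" "continuous_on UNIV g"
  shows "edge_integral E (\<lambda>x. f x + g x) = edge_integral E f + edge_integral E g"
proof -
  obtain a b c where "E = closed_segment b c" using edge_of_triangle[OF assms(2,1)] by blast
  then show ?thesis using seg_integral_add[OF assms(3,4), of b c] by (simp add: edge_integral_segment distrib_left)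
qed

section \<open>Jumps across interior edges\<close>

context triangulated_domain begin

text \<open>The very choice made inside \<open>jump\<close>, given a name so that the two one-sided
  values can be addressed.\<close>

definition edge_triangles :: "point set \<Rightarrow> point set \<times> point set" where
  "edge_triangles E = (SOME (T, T'). T \<in> \<T> \<and> T' \<in> \<T> \<and> T \<noteq> T' \<and> E = T \<inter> T')"

lemma jump_eq:
  "jump \<T> E w x = w (fst (edge_triangles E)) x \<bullet> outer_normal (fst (edge_triangles E)) E
    - w (snd (edge_triangles E)) x \<bullet> outer_normal (fst (edge_triangles E)) E"
  unfolding jump_def edge_triangles_def by (simp add: case_prod_unfold Let_def)

lemma interior_edge_triangles:
  assumes E: "E \<in> interior_edges \<Omega> \<T>" and PQ: "edge_triangles E = (P, Q)"
  shows "P \<in> \<T>" "Q \<in> \<T>" "P \<noteq> Q" "E edge_of P" "E edge_of Q" "{T \<in> \<T>. E edge_of T} = {P, Q}"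
proof -
  obtain T where T: "T \<in> \<T>" "E edge_of T" "\<not> E \<subseteq> frontier \<Omega>"
    using E by (auto simp: interior_edges_def)
  obtain T' where T': "T' \<in> \<T>" "T' \<noteq> T" "T \<inter> T' = E" using interior_edge_neighbour[OF T] by blast
  define R where "R = (\<lambda>(T, T'). T \<in> \<T> \<and> T' \<in> \<T> \<and> T \<noteq> T' \<and> E = T \<inter> T')"
  have "R (T, T')" using T T' by (auto simp: R_def)
  then have "R (SOME z. R z)" by (rule someI)
  moreover have "(SOME z. R z) = (P, Q)" using PQ by (simp add: edge_triangles_def R_def)
  ultimately have R: "P \<in> \<T>" "Q \<in> \<T>" "P \<noteq> Q" "E = P \<inter> Q" unfolding R_def by auto
  show "P \<in> \<T>" "Q \<in> \<T>" "P \<noteq> Q" by fact+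
  show EP: "E edge_of P" by (rule edge_of_other[OF T(1) R(1) T(2)]) (use R(4) in blast)
  show EQ: "E edge_of Q" by (rule edge_of_other[OF T(1) R(2) T(2)]) (use R(4) in blast)
  show "{T \<in> \<T>. E edge_of T} = {P, Q}"
    using R EP EQ edge_at_most_two[OF R(1,2)] by blast
qed

lemma finite_mesh_edges: "finite {E. \<exists>T\<in>\<T>. E edge_of T}"
proof -
  have "{E. \<exists>T\<in>\<T>. E edge_of T} = (\<Union>T\<in>\<T>. {E. E edge_of T})" by blast
  then show ?thesis using finite_mesh finite_triangle_edges(1)[OF mesh_simplex] by simp
qed

lemma finite_interior_edges: "finite (interior_edges \<Omega> \<T>)"
  by (rule finite_subset[OF _ finite_mesh_edges]) (auto simp: interior_edges_def)

text \<open>Exchange the sums over triangles and edges. Boundary edges drop out as \<open>w\<close>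
  vanishes there; an interior edge has exactly two triangles with opposite normals, and the two
  fluxes combine to the jump. The extensions \<open>wT\<close> and \<open>A T\<close> to the plane
  are continuous, which the piecewise objects need not be.\<close>

lemma sum_edges_jump:
  assumes w: "\<And>T. T \<in> \<T> \<Longrightarrow> continuous_on UNIV (wT T)" "\<And>T x. T \<in> \<T> \<Longrightarrow> x \<in> T \<Longrightarrow> wT T x = w x"
    and w0: "\<And>x. x \<in> frontier \<Omega> \<Longrightarrow> w x = 0"
    and A: "\<And>T. T \<in> \<T> \<Longrightarrow> continuous_on UNIV (A T)"
  shows "(\<Sum>T\<in>\<T>. \<Sum>E | E edge_of T. edge_integral E (\<lambda>x. (A T x \<bullet> outer_normal T E) * wT T x))
    = (\<Sum>E\<in>interior_edges \<Omega> \<T>. edge_integral E (\<lambda>x. jump \<T> E A x * w x))"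
proof -
  let ?E = "{E. \<exists>T\<in>\<T>. E edge_of T}"
  let ?I = "\<lambda>T E. edge_integral E (\<lambda>x. (A T x \<bullet> outer_normal T E) * wT T x)"
  have "(\<Sum>T\<in>\<T>. \<Sum>E | E edge_of T. ?I T E) = (\<Sum>T\<in>\<T>. \<Sum>E | E \<in> ?E \<and> E edge_of T. ?I T E)"
    by (intro sum.cong refl) blast
  also have "\<dots> = (\<Sum>E\<in>?E. \<Sum>T | T \<in> \<T> \<and> E edge_of T. ?I T E)"
    by (rule sum.swap_restrict[OF finite_mesh finite_mesh_edges])
  also have "\<dots> = (\<Sum>E\<in>interior_edges \<Omega> \<T>. \<Sum>T | T \<in> \<T> \<and> E edge_of T. ?I T E)"
  proof (rule sum.mono_neutral_right[OF finite_mesh_edges])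
    show "interior_edges \<Omega> \<T> \<subseteq> ?E" by (auto simp: interior_edges_def)
    show "\<forall>E\<in>?E - interior_edges \<Omega> \<T>. (\<Sum>T | T \<in> \<T> \<and> E edge_of T. ?I T E) = 0"
    proof
      fix E assume E: "E \<in> ?E - interior_edges \<Omega> \<T>"
      then have fr: "E \<subseteq> frontier \<Omega>" by (auto simp: interior_edges_def)
      have "?I T E = 0" if T: "T \<in> \<T>" "E edge_of T" for T
      proof -
        have "?I T E = edge_integral E (\<lambda>x. 0)"
        proof (rule edge_integral_cong[OF T(2) mesh_simplex[OF T(1)]])
          fix x assume x: "x \<in> E"
          then have "x \<in> T" "x \<in> frontier \<Omega>" using fr edge_of_imp_subset[OF T(2)] by blast+
          then have "wT T x = 0" by (simp only: w(2)[OF T(1)] w0)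
          then show "(A T x \<bullet> outer_normal T E) * wT T x = 0" by simp
        qed
        also have "\<dots> = 0" by (simp add: edge_integral_def seg_integral_def case_prod_unfold)
        finally show ?thesis .
      qed
      then show "(\<Sum>T | T \<in> \<T> \<and> E edge_of T. ?I T E) = 0" by (intro sum.neutral) blast
    qed
  qed
  also have "\<dots> = (\<Sum>E\<in>interior_edges \<Omega> \<T>. edge_integral E (\<lambda>x. jump \<T> E A x * w x))"
  proof (rule sum.cong[OF refl])
    fix E assume E: "E \<in> interior_edges \<Omega> \<T>"
    obtain P Q where PQ: "edge_triangles E = (P, Q)" by (cases "edge_triangles E")
    note t = interior_edge_triangles[OF E PQ]
    have nQ: "outer_normal Q E = - outer_normal P E" by (rule edge_normals_opposite[OF t(1-5)])
    let ?n = "outer_normal P E"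
    obtain a b c where bc: "E = closed_segment b c" using edge_of_triangle[OF mesh_simplex[OF t(1)] t(4)] by blast
    have inP: "x \<in> P" "x \<in> Q" if "x \<in> E" for x
      using that edge_of_imp_subset[OF t(4)] edge_of_imp_subset[OF t(5)] by auto
    have cont: "continuous_on UNIV (\<lambda>x. (A P x \<bullet> ?n) * wT P x)" "continuous_on UNIV (\<lambda>x. - (A Q x \<bullet> ?n) * wT P x)"
      by (intro continuous_intros A w(1) t(1) t(2))+
    have Qe: "?I Q E = edge_integral E (\<lambda>x. - (A Q x \<bullet> ?n) * wT P x)"
      by (rule edge_integral_cong[OF t(4) mesh_simplex[OF t(1)]])
        (simp add: nQ w(2)[OF t(1)] w(2)[OF t(2)] inP)
    have "(\<Sum>T | T \<in> \<T> \<and> E edge_of T. ?I T E) = ?I P E + ?I Q E"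
      unfolding t(6) using t(3) by simp
    also have "\<dots> = edge_integral E (\<lambda>x. (A P x \<bullet> ?n) * wT P x + - (A Q x \<bullet> ?n) * wT P x)"
      unfolding Qe by (rule edge_integral_add[OF t(4) mesh_simplex[OF t(1)] cont, symmetric])
    also have "\<dots> = edge_integral E (\<lambda>x. jump \<T> E A x * w x)"
    proof (rule edge_integral_cong[OF t(4) mesh_simplex[OF t(1)]])
      fix x assume "x \<in> E"
      then show "(A P x \<bullet> ?n) * wT P x + - (A Q x \<bullet> ?n) * wT P x = jump \<T> E A x * w x"
        by (simp add: jump_eq PQ w(2)[OF t(1)] inP algebra_simps)
    qed
    finally show "(\<Sum>T | T \<in> \<T> \<and> E edge_of T. ?I T E) = edge_integral E (\<lambda>x. jump \<T> E A x * w x)" .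
  qed
  finally show ?thesis .
qed

end

section \<open>Quasi-interpolation\<close>

lemma edge_integral_cauchy_schwarz:
  assumes E: "E edge_of T" "2 simplex T"
    and f: "continuous_on UNIV f'" "\<And>x. x \<in> E \<Longrightarrow> f x = f' x"
    and g: "continuous_on UNIV g'" "\<And>x. x \<in> E \<Longrightarrow> g x = g' x"
  shows "\<bar>edge_integral E (\<lambda>x. f x * g x)\<bar>
    \<le> sqrt (edge_integral E (\<lambda>x. (f x)\<^sup>2)) * sqrt (edge_integral E (\<lambda>x. (g x)\<^sup>2))"
proof -
  obtain a b c where bc: "E = closed_segment b c" using edge_of_triangle[OF E(2,1)] by blast
  have m: "(\<lambda>t. u (linepath b c t)) \<in> borel_measurable (lebesgue_on {0..1})" if "continuous_on UNIV u" for u :: "point \<Rightarrow> real"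
    using seg_integral_integrable[OF that] by (rule borel_measurable_integrable)
  have "\<bar>seg_integral (\<lambda>x. f' x * g' x) b c\<bar> \<le> sqrt (seg_integral (\<lambda>x. (f' x)\<^sup>2) b c) * sqrt (seg_integral (\<lambda>x. (g' x)\<^sup>2) b c)"
    unfolding seg_integral_def
    by (rule cauchy_schwarz_integral) (intro m f(1) g(1) seg_integral_integrable[of "\<lambda>x. (f' x)\<^sup>2"] seg_integral_integrable[of "\<lambda>x. (g' x)\<^sup>2"] continuous_intros)+
  then have "dist b c * \<bar>seg_integral (\<lambda>x. f' x * g' x) b c\<bar>
    \<le> dist b c * (sqrt (seg_integral (\<lambda>x. (f' x)\<^sup>2) b c) * sqrt (seg_integral (\<lambda>x. (g' x)\<^sup>2) b c))"
    by (rule mult_left_mono) simp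
  also have "\<dots> = (sqrt (dist b c) * sqrt (dist b c)) * (sqrt (seg_integral (\<lambda>x. (f' x)\<^sup>2) b c) * sqrt (seg_integral (\<lambda>x. (g' x)\<^sup>2) b c))"
    by (simp only: real_sqrt_mult_self abs_of_nonneg[OF zero_le_dist])
  also have "\<dots> = sqrt (edge_integral E (\<lambda>x. (f' x)\<^sup>2)) * sqrt (edge_integral E (\<lambda>x. (g' x)\<^sup>2))"
    unfolding bc edge_integral_segment real_sqrt_mult by (simp only: mult_ac)
  finally have *: "\<bar>edge_integral E (\<lambda>x. f' x * g' x)\<bar>
    \<le> sqrt (edge_integral E (\<lambda>x. (f' x)\<^sup>2)) * sqrt (edge_integral E (\<lambda>x. (g' x)\<^sup>2))"
    unfolding bc edge_integral_segment by (simp add: abs_mult)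
  have e: "edge_integral E (\<lambda>x. f x * g x) = edge_integral E (\<lambda>x. f' x * g' x)"
    "edge_integral E (\<lambda>x. (f x)\<^sup>2) = edge_integral E (\<lambda>x. (f' x)\<^sup>2)"
    "edge_integral E (\<lambda>x. (g x)\<^sup>2) = edge_integral E (\<lambda>x. (g' x)\<^sup>2)"
    by (rule edge_integral_cong[OF E]; simp add: f(2) g(2))+
  show ?thesis unfolding e by (rule *)
qed

lemma seg_integral_mono:
  assumes "continuous_on UNIV f'" "continuous_on UNIV g'"
    and "\<And>x. x \<in> closed_segment a b \<Longrightarrow> f x = f' x" "\<And>x. x \<in> closed_segment a b \<Longrightarrow> f x \<le> g' x"
  shows "seg_integral f a b \<le> seg_integral g' a b"
proof -
  have "seg_integral f a b = seg_integral f' a b" by (rule seg_integral_cong) (rule assms(3))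
  also have "\<dots> \<le> seg_integral g' a b"
    unfolding seg_integral_def
  proof (rule integral_mono)
    fix t assume "t \<in> space (lebesgue_on {0..1::real})"
    then have "linepath a b t \<in> closed_segment a b" by (intro linepath_in_path) simp
    then show "f' (linepath a b t) \<le> g' (linepath a b t)" using assms(3,4) by fastforce
  qed (rule seg_integral_integrable assms(1) assms(2))+
  finally show ?thesis .
qed

lemma diameter_closed_segment: "diameter (closed_segment a b) = dist a (b :: 'a::euclidean_space)"
proof (rule antisym)
  show "diameter (closed_segment a b) \<le> dist a b"
  proof (rule diameter_le)
    fix x y assume "x \<in> closed_segment a b" "y \<in> closed_segment a b"
    then obtain u v where u: "0 \<le> u" "u \<le> 1" "x = (1 - u) *\<^sub>R a + u *\<^sub>R b"
      and v: "0 \<le> v" "v \<le> 1" "y = (1 - v) *\<^sub>R a + v *\<^sub>R b" by (auto simp: in_segment)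
    have "x - y = (v - u) *\<^sub>R (a - b)" unfolding u(3) v(3) by (simp add: algebra_simps)
    then have "norm (x - y) = \<bar>v - u\<bar> * norm (a - b)" by simp
    also have "\<dots> \<le> 1 * norm (a - b)" using u v by (intro mult_right_mono) auto
    finally show "norm (x - y) \<le> dist a b" by (simp add: dist_norm)
  qed auto
  show "dist a b \<le> diameter (closed_segment a b)"
    by (rule diameter_bounded_bound) (auto simp: bounded_closed_segment)
qed

lemma integral_mono_set:
  fixes f :: "real^2 \<Rightarrow> real"
  assumes "compact S" "compact T" "S \<subseteq> T" "continuous_on UNIV f" "\<And>x. 0 \<le> f x"
  shows "(LINT x|lebesgue_on S. f x) \<le> (LINT x|lebesgue_on T. f x)"
proof -
  have c: "continuous_on A f" for A using assms(4) continuous_on_subset by blast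
  have i: "integrable lborel (\<lambda>x. indicator A x * f x)" if "compact A" for A
    using borel_integrable_compact[OF that c] by simp
  show ?thesis
    unfolding lebesgue_on_integral_lborel(1)[OF assms(1) c] lebesgue_on_integral_lborel(1)[OF assms(2) c]
    using assms(3,5) by (intro integral_mono i assms) (auto simp: indicator_def)
qed

text \<open>The square of a mean is at most the mean of the squares, by the variance identity in
  terms of pairwise differences; then the weights are bounded by 1.\<close>

lemma convex_combination_square_le:
  fixes a b c s t :: real
  assumes "0 \<le> s" "0 \<le> t" "s + t \<le> 1"
  shows "((1 - s - t) * a + s * b + t * c)\<^sup>2 \<le> a\<^sup>2 + b\<^sup>2 + c\<^sup>2"
proof -
  define r where "r = 1 - s - t"
  have r: "0 \<le> r" "r \<le> 1" "s \<le> 1" "t \<le> 1" "r + s + t = 1" using assms by (auto simp: r_def)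
  have "r * a\<^sup>2 + s * b\<^sup>2 + t * c\<^sup>2 - (r * a + s * b + t * c)\<^sup>2
      = r * a\<^sup>2 * (1 - r) + s * b\<^sup>2 * (1 - s) + t * c\<^sup>2 * (1 - t) - 2 * r * s * a * b - 2 * r * t * a * c - 2 * s * t * b * c"
    by (simp add: power2_eq_square algebra_simps)
  also have "1 - r = s + t" using r(5) by simp
  also have "1 - s = r + t" using r(5) by simp
  also have "1 - t = r + s" using r(5) by simp
  also have "r * a\<^sup>2 * (s + t) + s * b\<^sup>2 * (r + t) + t * c\<^sup>2 * (r + s) - 2 * r * s * a * b - 2 * r * t * a * c - 2 * s * t * b * c
      = r * s * (a - b)\<^sup>2 + r * t * (a - c)\<^sup>2 + s * t * (b - c)\<^sup>2"
    by (simp add: power2_eq_square algebra_simps)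
  also have "\<dots> \<ge> 0" using r assms by simp
  finally have "(r * a + s * b + t * c)\<^sup>2 \<le> r * a\<^sup>2 + s * b\<^sup>2 + t * c\<^sup>2" by simp
  also have "\<dots> \<le> 1 * a\<^sup>2 + 1 * b\<^sup>2 + 1 * c\<^sup>2"
    using r by (intro add_mono mult_right_mono) auto
  finally show ?thesis by (simp add: r_def)
qed

text \<open>The exterior ball property is a locale assumption with its own parameter \<kappa>, so
  that every constant below is a function of \<sigma>, \<tau> and \<kappa> and is shared by all
  meshes on the domain.\<close>

locale regular_mesh = triangulated_domain +
  fixes \<sigma> \<tau> \<kappa> :: real
  assumes shape: "shape_regular \<sigma> \<T>" and quasi: "quasi_uniform \<tau> \<T>"
    and mesh_size_pos: "0 < mesh_size \<T>" and mesh_size_less: "mesh_size \<T> < 1"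
    and \<kappa>_pos: "\<kappa> > 0"
    and exterior: "\<And>y h. y \<in> frontier \<Omega> \<Longrightarrow> 0 < h \<Longrightarrow> h < 1 \<Longrightarrow> \<exists>q. cball q (\<kappa> * h) \<subseteq> cball y h - \<Omega>"
begin

abbreviation "h \<equiv> mesh_size \<T>"

text \<open>The area of the ball from \<open>mesh_inball\<close>, in units of
  \<open>h\<^sup>2\<close>.\<close>

definition area_const :: real where "area_const = pi * (1 / (4 * \<sigma> * \<tau>))\<^sup>2"
text \<open>The constant of \<open>poincare_ball\<close> for a set \<open>A\<close> of area at least
  \<open>pi * (min 1 \<kappa>)\<^sup>2 * h\<^sup>2\<close>, which covers both the whole ball and the
  exterior ball.\<close>

definition poincare_const :: real where "poincare_const = 16 * pi / (pi * (min 1 \<kappa>)\<^sup>2)"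
text \<open>The coefficients of \<open>trace_triangle\<close> with the Poincare bound inserted,
  divided by the determinant, that is, by twice the area.\<close>

definition trace_const :: real where "trace_const = (3 * poincare_const + 1) / (2 * area_const)"
text \<open>Three vertices per triangle times the packing number from
  \<open>mesh_overlap\<close>.\<close>

definition overlap_const :: real where "overlap_const = 3 * (16 * pi / area_const)"

lemma mesh_nonempty: "\<T> \<noteq> {}"
proof -
  have "\<Omega> \<noteq> {}" using lip by (simp add: lipschitz_domain_def)
  then show ?thesis using mesh_Union closure_subset[of \<Omega>] by auto
qed

lemma \<sigma>_pos: "\<sigma> > 0" and \<tau>_pos: "\<tau> > 0"
  using mesh_nonempty mesh_inball(1,2)[OF _ shape quasi mesh_size_pos] by auto

lemma area_bound: "T \<in> \<T> \<Longrightarrow> area_const * h\<^sup>2 \<le> measure lebesgue T"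
  using mesh_inball(3)[OF _ shape quasi mesh_size_pos, of T]
  by (simp add: area_const_def power_divide power_mult_distrib)

lemma area_const_pos: "area_const > 0"
  using \<sigma>_pos \<tau>_pos by (simp add: area_const_def)

lemma const_nonneg: "poincare_const > 0" "trace_const > 0" "overlap_const > 0"
proof -
  show "poincare_const > 0" using \<kappa>_pos by (simp add: poincare_const_def)
  then show "trace_const > 0" using area_const_pos by (simp add: trace_const_def)
  show "overlap_const > 0" using area_const_pos by (simp add: overlap_const_def)
qed

definition verts :: "point set \<Rightarrow> point set" where "verts T = {z. {z} face_of T}"

lemma verts_triangle:
  assumes "T = convex hull {a, b, c}" "cross2 (b - a) (c - a) \<noteq> 0"
  shows "verts T = {a, b, c}" "a \<noteq> b" "a \<noteq> c" "b \<noteq> c"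
  using vertex_of_triangle[OF assms(2)] assms(1) affine_independent_iff_cross2[of a b c] assms(2)
  by (auto simp: verts_def)

lemma verts_mesh:
  assumes "T \<in> \<T>"
  shows "finite (verts T)" "card (verts T) \<le> 3" "verts T \<subseteq> T"
proof -
  obtain a b c where abc: "T = convex hull {a, b, c}" "cross2 (b - a) (c - a) \<noteq> 0"
    using two_simplex_triangle[OF mesh_simplex[OF assms]] .
  note v = verts_triangle[OF abc]
  show "finite (verts T)" "card (verts T) \<le> 3" unfolding v(1) using v(2-) by auto
  show "verts T \<subseteq> T" using v(1) hull_subset[of "{a, b, c}" convex] abc(1) by simp
qed

lemma mesh_subset_cball: "T \<in> \<T> \<Longrightarrow> z \<in> T \<Longrightarrow> T \<subseteq> cball z h"
  using mesh_diameter by auto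

definition local_energy :: "vector_field \<Rightarrow> point \<Rightarrow> real" where
  "local_energy G z = (LINT x|lebesgue_on (cball z (3 * h)). (norm (G x))\<^sup>2)"

lemma local_energy_nonneg: "0 \<le> local_energy G z"
  by (simp add: local_energy_def)

text \<open>Both cases are \<open>poincare_ball\<close>: at a boundary point with \<open>A\<close>
  the exterior ball, elsewhere with \<open>A\<close> the whole ball. The minimum in the constant
  makes one bound serve both.\<close>

lemma nodal_constant:
  assumes \<phi>: "\<phi> \<in> test_functions \<Omega>"
  shows "\<exists>c. (z \<in> frontier \<Omega> \<longrightarrow> c = 0) \<and>
    (LINT x|lebesgue_on (cball z h). (\<phi> x - c)\<^sup>2) \<le> poincare_const * h\<^sup>2 * local_energy (grad_on UNIV \<phi>) z"
proof (cases "z \<in> frontier \<Omega>")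
  case True
  obtain q where q: "cball q (\<kappa> * h) \<subseteq> cball z h - \<Omega>" using exterior[OF True mesh_size_pos mesh_size_less] by blast
  have k: "pi * (min 1 \<kappa>)\<^sup>2 > 0" using \<kappa>_pos by simp
  have "(min 1 \<kappa>)\<^sup>2 \<le> \<kappa>\<^sup>2" using \<kappa>_pos by (intro power_mono) auto
  then have "pi * (min 1 \<kappa>)\<^sup>2 * h\<^sup>2 \<le> measure lborel (cball q (\<kappa> * h))"
    using \<kappa>_pos mesh_size_pos by (simp add: content_cball unit_ball_vol_2 power_mult_distrib)
  moreover have "cball q (\<kappa> * h) \<subseteq> cball z h" using q by blast
  ultimately have "\<exists>y\<in>cball q (\<kappa> * h). (LINT x|lebesgue_on (cball z h). (\<phi> x - \<phi> y)\<^sup>2)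
    \<le> 16 * pi / (pi * (min 1 \<kappa>)\<^sup>2) * h\<^sup>2 * (LINT x|lebesgue_on (cball z (3 * h)). (norm (grad_on UNIV \<phi> x))\<^sup>2)"
    by (intro poincare_ball[OF test_functionD(4)[OF \<phi>] test_functionD(6)[OF \<phi>] mesh_size_pos _ cball_measurable k])
  then obtain y where y: "y \<in> cball q (\<kappa> * h)" "(LINT x|lebesgue_on (cball z h). (\<phi> x - \<phi> y)\<^sup>2)
    \<le> 16 * pi / (pi * (min 1 \<kappa>)\<^sup>2) * h\<^sup>2 * (LINT x|lebesgue_on (cball z (3 * h)). (norm (grad_on UNIV \<phi> x))\<^sup>2)"
    by blast
  have "\<phi> y = 0" using test_functionD(2)[OF \<phi>, of y] q y(1) by blast
  then show ?thesis using y(2) by (intro exI[of _ 0]) (simp add: poincare_const_def local_energy_def)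
next
  case False
  have k: "pi * (min 1 \<kappa>)\<^sup>2 > 0" using \<kappa>_pos by simp
  have "(min 1 \<kappa>)\<^sup>2 \<le> 1\<^sup>2" using \<kappa>_pos by (intro power_mono) auto
  then have "pi * (min 1 \<kappa>)\<^sup>2 * h\<^sup>2 \<le> measure lborel (cball z h)"
    using mesh_size_pos by (simp add: content_cball unit_ball_vol_2 mult_right_mono)
  then obtain y where "(LINT x|lebesgue_on (cball z h). (\<phi> x - \<phi> y)\<^sup>2)
    \<le> 16 * pi / (pi * (min 1 \<kappa>)\<^sup>2) * h\<^sup>2 * (LINT x|lebesgue_on (cball z (3 * h)). (norm (grad_on UNIV \<phi> x))\<^sup>2)"
    using poincare_ball[OF test_functionD(4)[OF \<phi>] test_functionD(6)[OF \<phi>] mesh_size_pos _ _ k, of "cball z h" z] by auto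
  then show ?thesis using False by (intro exI[of _ "\<phi> y"]) (simp add: poincare_const_def local_energy_def)
qed

text \<open>With barycentric weights, \<open>\<phi> - v\<close> at a point is the same convex
  combination of the differences \<open>\<phi> - c z\<close> over the vertices, so its square is at
  most the sum of their squares. On an edge only its two end points take part. Each single
  difference is controlled by \<open>nodal_constant\<close> and, on edges, by
  \<open>trace_triangle\<close>; subtracting a constant leaves the gradient alone.\<close>

lemma interpolation_estimate:
  assumes \<phi>: "\<phi> \<in> test_functions \<Omega>"
  obtains v \<alpha> \<beta> where "v \<in> V_h \<Omega> \<T>" "\<And>T x. T \<in> \<T> \<Longrightarrow> x \<in> T \<Longrightarrow> v x = \<alpha> T + \<beta> T \<bullet> x" "\<And>x. x \<notin> \<Omega> \<Longrightarrow> v x = 0"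
    "\<And>T. T \<in> \<T> \<Longrightarrow> (LINT x|lebesgue_on T. (\<phi> x - v x)\<^sup>2)
      \<le> poincare_const * h\<^sup>2 * (\<Sum>z\<in>verts T. local_energy (grad_on UNIV \<phi>) z)"
    "\<And>T b c. T \<in> \<T> \<Longrightarrow> closed_segment b c edge_of T \<Longrightarrow> seg_integral (\<lambda>x. (\<phi> x - v x)\<^sup>2) b c
      \<le> trace_const * (\<Sum>z\<in>verts T. local_energy (grad_on UNIV \<phi>) z)"
proof -
  let ?G = "grad_on UNIV \<phi>"
  let ?D = "local_energy ?G"
  note t = test_functionD[OF \<phi>]
  obtain c where c: "\<And>z. z \<in> frontier \<Omega> \<Longrightarrow> c z = 0"
    "\<And>z. (LINT x|lebesgue_on (cball z h). (\<phi> x - c z)\<^sup>2) \<le> poincare_const * h\<^sup>2 * ?D z"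
    using nodal_constant[OF \<phi>] by metis
  show ?thesis
  proof (rule interpolant[OF c(1)])
  fix v \<alpha> \<beta>
  assume v: "v \<in> V_h \<Omega> \<T>" "\<And>T x. T \<in> \<T> \<Longrightarrow> x \<in> T \<Longrightarrow> v x = \<alpha> T + \<beta> T \<bullet> x"
    "\<And>T z. T \<in> \<T> \<Longrightarrow> {z} face_of T \<Longrightarrow> v z = c z" "\<And>x. x \<notin> \<Omega> \<Longrightarrow> v x = 0"
  have contc: "continuous_on A (\<lambda>x. (\<phi> x - c z)\<^sup>2)" for A z by (intro continuous_intros t)
  have nodal: "(LINT x|lebesgue_on T. (\<phi> x - c z)\<^sup>2) \<le> poincare_const * h\<^sup>2 * ?D z" if T: "T \<in> \<T>" and z: "z \<in> verts T" for T z
  proof -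
    have "z \<in> T" using z verts_mesh(3)[OF T] by blast
    have "(LINT x|lebesgue_on T. (\<phi> x - c z)\<^sup>2) \<le> (LINT x|lebesgue_on (cball z h). (\<phi> x - c z)\<^sup>2)"
      by (rule integral_mono_set[OF mesh_triangle(2)[OF T] compact_cball mesh_subset_cball[OF T \<open>z \<in> T\<close>] contc]) simp
    then show ?thesis using c(2)[of z] by linarith
  qed
  have grad: "(LINT x|lebesgue_on T. (norm (?G x))\<^sup>2) \<le> ?D z" if T: "T \<in> \<T>" and z: "z \<in> verts T" for T z
  proof -
    have "z \<in> T" using z verts_mesh(3)[OF T] by blast
    then have "T \<subseteq> cball z (3 * h)" using mesh_subset_cball[OF T] mesh_size_pos by fastforce
    then show ?thesis unfolding local_energy_def
      by (intro integral_mono_set mesh_triangle(2)[OF T] compact_cball continuous_intros t) auto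
  qed
  show ?thesis
  proof (rule that[OF v(1) v(2) v(4)])
    fix T assume T: "T \<in> \<T>"
    obtain p q r where pqr: "T = convex hull {p, q, r}" "cross2 (q - p) (r - p) \<noteq> 0"
      using two_simplex_triangle[OF mesh_simplex[OF T]] .
    note vt = verts_triangle[OF pqr]
    have vz: "v z = c z" if "z \<in> {p, q, r}" for z
      using v(3)[OF T, of z] that vt(1) by (auto simp: verts_def)
    have zT: "z \<in> T" if "z \<in> {p, q, r}" for z using that verts_mesh(3)[OF T] vt(1) by blast
    have "(LINT x|lebesgue_on T. (\<phi> x - v x)\<^sup>2) = (LINT x|lebesgue_on T. (\<phi> x - (\<alpha> T + \<beta> T \<bullet> x))\<^sup>2)"
      by (intro Bochner_Integration.integral_cong refl) (simp add: v(2)[OF T])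
    also have "\<dots> \<le> (LINT x|lebesgue_on T. (\<Sum>z\<in>verts T. (\<phi> x - c z)\<^sup>2))"
    proof (rule integral_mono)
      fix x assume "x \<in> space (lebesgue_on T)"
      then have x: "x \<in> T" by simp
      then obtain s t where st: "0 \<le> s" "0 \<le> t" "s + t \<le> 1" "x = p + s *\<^sub>R (q - p) + t *\<^sub>R (r - p)"
        unfolding pqr(1) convex_hull_3_alt by auto
      have l: "\<alpha> T + \<beta> T \<bullet> p = c p" "\<alpha> T + \<beta> T \<bullet> q = c q" "\<alpha> T + \<beta> T \<bullet> r = c r"
        using v(2)[OF T zT, symmetric] vz by auto
      have "\<beta> T \<bullet> x = \<beta> T \<bullet> p + s * (\<beta> T \<bullet> q - \<beta> T \<bullet> p) + t * (\<beta> T \<bullet> r - \<beta> T \<bullet> p)"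
        unfolding st(4) by (simp add: inner_add_right inner_diff_right)
      also have "\<beta> T \<bullet> q - \<beta> T \<bullet> p = c q - c p" using l by simp
      also have "\<beta> T \<bullet> r - \<beta> T \<bullet> p = c r - c p" using l by simp
      also have "\<beta> T \<bullet> p = c p - \<alpha> T" using l by simp
      finally have "\<phi> x - (\<alpha> T + \<beta> T \<bullet> x) = (1 - s - t) * (\<phi> x - c p) + s * (\<phi> x - c q) + t * (\<phi> x - c r)"
        by (simp add: algebra_simps)
      then show "(\<phi> x - (\<alpha> T + \<beta> T \<bullet> x))\<^sup>2 \<le> (\<Sum>z\<in>verts T. (\<phi> x - c z)\<^sup>2)"
        using convex_combination_square_le[OF st(1-3), of "\<phi> x - c p" "\<phi> x - c q" "\<phi> x - c r"] vt by simp
    qed (intro lebesgue_on_integral_lborel(2) mesh_triangle(2)[OF T] continuous_intros t)+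
    also have "\<dots> = (\<Sum>z\<in>verts T. LINT x|lebesgue_on T. (\<phi> x - c z)\<^sup>2)"
      by (intro Bochner_Integration.integral_sum lebesgue_on_integral_lborel(2) mesh_triangle(2)[OF T] contc)
    also have "\<dots> \<le> (\<Sum>z\<in>verts T. poincare_const * h\<^sup>2 * ?D z)" by (intro sum_mono nodal T)
    finally show "(LINT x|lebesgue_on T. (\<phi> x - v x)\<^sup>2) \<le> poincare_const * h\<^sup>2 * (\<Sum>z\<in>verts T. ?D z)"
      by (simp add: sum_distrib_left)
  next
    fix T b c' assume T: "T \<in> \<T>" and E: "closed_segment b c' edge_of T"
    obtain p q r where pqr: "T = convex hull {p, q, r}" "cross2 (q - p) (r - p) \<noteq> 0" "closed_segment b c' = closed_segment q r"
      using edge_of_triangle[OF mesh_simplex[OF T] E] .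
    note vt = verts_triangle[OF pqr(1,2)]
    have vz: "v z = c z" if "z \<in> {p, q, r}" for z
      using v(3)[OF T, of z] that vt(1) by (auto simp: verts_def)
    have zT: "z \<in> T" if "z \<in> {p, q, r}" for z using that verts_mesh(3)[OF T] vt(1) by blast
    have side: "seg_integral (\<lambda>x. (\<phi> x - c z)\<^sup>2) q r \<le> trace_const * ?D z" if z: "z \<in> verts T" for z
    proof -
      have d: "((\<lambda>x. \<phi> x - c z) has_derivative (\<lambda>e. ?G x \<bullet> e)) (at x)" for x
        by (auto intro!: derivative_eq_intros t)
      have "\<bar>cross2 (q - p) (r - p)\<bar> * seg_integral (\<lambda>x. (\<phi> x - c z)\<^sup>2) q r
        \<le> 3 * (LINT x|lebesgue_on T. (\<phi> x - c z)\<^sup>2) + h\<^sup>2 * (LINT x|lebesgue_on T. (norm (?G x))\<^sup>2)"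
        unfolding pqr(1)
        by (rule trace_triangle[OF pqr(2) d t(6)]) (use mesh_diameter[OF T] zT[of p] pqr(1) in auto)
      also have "\<dots> \<le> 3 * (poincare_const * h\<^sup>2 * ?D z) + h\<^sup>2 * ?D z"
        using nodal[OF T z] grad[OF T z] by (intro add_mono mult_left_mono) auto
      also have "\<dots> = (3 * poincare_const + 1) * ?D z * h\<^sup>2" by (simp add: algebra_simps)
      finally have 1: "\<bar>cross2 (q - p) (r - p)\<bar> * seg_integral (\<lambda>x. (\<phi> x - c z)\<^sup>2) q r \<le> (3 * poincare_const + 1) * ?D z * h\<^sup>2" .
      have s0: "0 \<le> seg_integral (\<lambda>x. (\<phi> x - c z)\<^sup>2) q r" by (simp add: seg_integral_def)
      \<comment> \<open>The determinant is twice the area and thus of order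
        \<open>h\<^sup>2\<close>. The same power stands on the other side and cancels, so the edge
        estimate carries no power of \<open>h\<close>.\<close>
      have "2 * area_const * h\<^sup>2 \<le> \<bar>cross2 (q - p) (r - p)\<bar>"
        using area_bound[OF T] triangle_area[OF pqr(2)] pqr(1) by simp
      from mult_right_mono[OF this s0] 1
      have "2 * area_const * h\<^sup>2 * seg_integral (\<lambda>x. (\<phi> x - c z)\<^sup>2) q r \<le> (3 * poincare_const + 1) * ?D z * h\<^sup>2" by linarith
      then have "h\<^sup>2 * (2 * area_const * seg_integral (\<lambda>x. (\<phi> x - c z)\<^sup>2) q r) \<le> h\<^sup>2 * ((3 * poincare_const + 1) * ?D z)"
        by (simp only: mult_ac)
      then have "2 * area_const * seg_integral (\<lambda>x. (\<phi> x - c z)\<^sup>2) q r \<le> (3 * poincare_const + 1) * ?D z"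
        using mesh_size_pos by (simp add: mult_le_cancel_left)
      then show ?thesis using area_const_pos by (simp add: trace_const_def field_simps)
    qed
    have "seg_integral (\<lambda>x. (\<phi> x - v x)\<^sup>2) b c' = seg_integral (\<lambda>x. (\<phi> x - v x)\<^sup>2) q r"
      using pqr(3) seg_integral_swap by (auto simp: doubleton_eq_iff)
    also have "\<dots> \<le> seg_integral (\<lambda>x. (\<phi> x - c q)\<^sup>2 + (\<phi> x - c r)\<^sup>2) q r"
    proof (rule seg_integral_mono[where f' = "\<lambda>x. (\<phi> x - (\<alpha> T + \<beta> T \<bullet> x))\<^sup>2"])
      fix x assume x: "x \<in> closed_segment q r"
      have "closed_segment q r \<subseteq> T" using edge_of_imp_subset[OF E] pqr(3) by simp
      then have xT: "x \<in> T" using x by blast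
      then show "(\<phi> x - v x)\<^sup>2 = (\<phi> x - (\<alpha> T + \<beta> T \<bullet> x))\<^sup>2" using v(2)[OF T] by simp
      obtain u where u: "0 \<le> u" "u \<le> 1" "x = (1 - u) *\<^sub>R q + u *\<^sub>R r" using x by (auto simp: in_segment)
      have l: "\<alpha> T + \<beta> T \<bullet> q = c q" "\<alpha> T + \<beta> T \<bullet> r = c r"
        using v(2)[OF T zT, symmetric] vz by auto
      have "\<beta> T \<bullet> x = (1 - u) * (\<beta> T \<bullet> q) + u * (\<beta> T \<bullet> r)" unfolding u(3) by (simp add: inner_add_right)
      also have "\<beta> T \<bullet> q = c q - \<alpha> T" using l by simp
      also have "\<beta> T \<bullet> r = c r - \<alpha> T" using l by simp
      finally have "v x = (1 - u) * c q + u * c r" using v(2)[OF T xT] by (simp add: algebra_simps)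
      then have "\<phi> x - v x = (1 - u - 0) * (\<phi> x - c q) + u * (\<phi> x - c r) + 0 * 0" by (simp add: algebra_simps)
      then show "(\<phi> x - v x)\<^sup>2 \<le> (\<phi> x - c q)\<^sup>2 + (\<phi> x - c r)\<^sup>2"
        using convex_combination_square_le[of u 0 "\<phi> x - c q" "\<phi> x - c r" 0] u by simp
    qed (intro continuous_intros t)+
    also have "\<dots> = seg_integral (\<lambda>x. (\<phi> x - c q)\<^sup>2) q r + seg_integral (\<lambda>x. (\<phi> x - c r)\<^sup>2) q r"
      by (rule seg_integral_add[OF contc contc])
    also have "\<dots> \<le> trace_const * ?D q + trace_const * ?D r"
      by (intro add_mono side) (auto simp: vt(1))
    also have "\<dots> \<le> trace_const * (\<Sum>z\<in>verts T. ?D z)"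
      using vt local_energy_nonneg[of ?G p] const_nonneg(2) by (simp add: distrib_left)
    finally show "seg_integral (\<lambda>x. (\<phi> x - v x)\<^sup>2) b c' \<le> trace_const * (\<Sum>z\<in>verts T. ?D z)" .
  qed
  qed
qed

text \<open>Interchange sums and integral: a point \<open>x\<close> is counted by a vertex only if
  that vertex, hence its triangle, comes within \<open>3 * h\<close> of \<open>x\<close>. The
  integrals run over the plane because the balls may leave \<Omega>, where the gradient of \<phi> is
  zero.\<close>

lemma overlap_estimate:
  assumes \<phi>: "\<phi> \<in> test_functions \<Omega>"
  shows "(\<Sum>T\<in>\<T>. \<Sum>z\<in>verts T. local_energy (grad_on UNIV \<phi>) z)
    \<le> overlap_const * (LINT x|lebesgue_on \<Omega>. (norm (grad_on UNIV \<phi> x))\<^sup>2)"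
proof -
  let ?g = "\<lambda>x. (norm (grad_on UNIV \<phi> x))\<^sup>2"
  note t = test_functionD[OF \<phi>]
  have cg: "continuous_on A ?g" for A by (intro continuous_intros t)
  have i: "integrable lborel (\<lambda>x. indicator (cball z (3 * h)) x * ?g x)" for z
    using borel_integrable_compact[OF compact_cball cg] by simp
  have gm: "?g \<in> borel_measurable borel" by (rule borel_measurable_continuous_onI[OF cg])
  have g0: "?g x = 0" if "x \<notin> \<Omega>" for x using t(3) that by simp
  have gi: "integrable lborel ?g"
    using lebesgue_on_integral_eq_lborel(2)[OF domain_sets gm g0]
      L2_norm_vec_integrable[of "grad_on UNIV \<phi>" \<Omega>] test_function_L2(2)[OF \<phi> domain_sets bounded] by blast
  have "(\<Sum>T\<in>\<T>. \<Sum>z\<in>verts T. local_energy (grad_on UNIV \<phi>) z)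
    = (\<Sum>T\<in>\<T>. \<Sum>z\<in>verts T. \<integral>x. indicator (cball z (3 * h)) x * ?g x \<partial>lborel)"
    unfolding local_energy_def using lebesgue_on_integral_lborel(1)[OF compact_cball cg] by simp
  also have "\<dots> = (\<integral>x. (\<Sum>T\<in>\<T>. \<Sum>z\<in>verts T. indicator (cball z (3 * h)) x * ?g x) \<partial>lborel)"
    using i by (simp add: Bochner_Integration.integral_sum)
  also have "\<dots> \<le> (\<integral>x. overlap_const * ?g x \<partial>lborel)"
  proof (rule integral_mono)
    show "integrable lborel (\<lambda>x. \<Sum>T\<in>\<T>. \<Sum>z\<in>verts T. indicator (cball z (3 * h)) x * ?g x)"
      by (intro Bochner_Integration.integrable_sum i)
    show "integrable lborel (\<lambda>x. overlap_const * ?g x)" using gi by simp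
    fix x
    let ?S = "{T \<in> \<T>. \<exists>z\<in>T. dist z x \<le> 3 * h}"
    have "(\<Sum>T\<in>\<T>. \<Sum>z\<in>verts T. indicator (cball z (3 * h)) x * ?g x)
        = (\<Sum>T\<in>\<T>. \<Sum>z\<in>verts T. indicator (cball z (3 * h)) x) * ?g x"
      by (simp add: sum_distrib_right)
    also have "(\<Sum>T\<in>\<T>. \<Sum>z\<in>verts T. indicator (cball z (3 * h)) x) \<le> (\<Sum>T\<in>\<T>. if T \<in> ?S then 3 else (0::real))"
    proof (rule sum_mono)
      fix T assume T: "T \<in> \<T>"
      show "(\<Sum>z\<in>verts T. indicator (cball z (3 * h)) x) \<le> (if T \<in> ?S then 3 else (0::real))"
      proof (cases "T \<in> ?S")
        case True
        have "(\<Sum>z\<in>verts T. indicator (cball z (3 * h)) x) \<le> (\<Sum>z\<in>verts T. (1::real))"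
          by (intro sum_mono) (auto simp: indicator_def)
        also have "\<dots> \<le> 3" using verts_mesh(2)[OF T] by simp
        finally show ?thesis using True by simp
      next
        case False
        then have "indicator (cball z (3 * h)) x = (0::real)" if "z \<in> verts T" for z
          using that verts_mesh(3)[OF T] T by (auto simp: indicator_def)
        then show ?thesis using False by simp
      qed
    qed
    also have "(\<Sum>T\<in>\<T>. if T \<in> ?S then 3 else (0::real)) = 3 * real (card ?S)"
      using finite_mesh by (simp add: sum.If_cases Int_def)
    also have "real (card ?S) * (area_const * h\<^sup>2) \<le> 16 * pi * h\<^sup>2"
      by (rule mesh_overlap[OF _ area_bound]) (use area_const_pos mesh_size_pos in auto)
    then have "real (card ?S) * area_const \<le> 16 * pi" using mesh_size_pos by (simp add: mult.assoc[symmetric])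
    then have "3 * real (card ?S) \<le> overlap_const"
      using area_const_pos by (simp add: overlap_const_def field_simps)
    finally show "(\<Sum>T\<in>\<T>. \<Sum>z\<in>verts T. indicator (cball z (3 * h)) x * ?g x) \<le> overlap_const * ?g x"
      by (simp add: mult_right_mono)
  qed
  also have "\<dots> = overlap_const * (LINT x|lebesgue_on \<Omega>. ?g x)"
    using lebesgue_on_integral_eq_lborel(1)[OF domain_sets gm g0] by simp
  finally show ?thesis .
qed

end

section \<open>Residual estimates\<close>

lemma L2_inner_integrable:
  fixes F G :: vector_field
  assumes "\<And>i. (\<lambda>x. F x $ i) \<in> L2 \<Omega>" "\<And>i. (\<lambda>x. G x $ i) \<in> L2 \<Omega>"
  shows "integrable (lebesgue_on \<Omega>) (\<lambda>x. F x \<bullet> G x)"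
  unfolding inner_vec_def inner_real_def sum_2
  by (intro Bochner_Integration.integrable_add L2_mult_integrable assms)

lemma L2_norm_vec:
  fixes F :: vector_field
  assumes "\<And>i. (\<lambda>x. F x $ i) \<in> L2 \<Omega>"
  shows "(\<lambda>x. norm (F x)) \<in> L2 \<Omega>"
proof -
  have "(\<lambda>x. sqrt ((F x $ 1)\<^sup>2 + (F x $ 2)\<^sup>2)) \<in> borel_measurable (lebesgue_on \<Omega>)"
    using L2D(1)[OF assms] by measurable
  then have "(\<lambda>x. norm (F x)) \<in> borel_measurable (lebesgue_on \<Omega>)"
    by (simp add: norm_power2_vec2[symmetric])
  then show ?thesis using L2_norm_vec_integrable[OF assms] by (simp add: L2_def)
qed

lemma cauchy_schwarz_vec:
  fixes F G :: vector_field
  assumes F: "\<And>i. (\<lambda>x. F x $ i) \<in> L2 \<Omega>" and G: "\<And>i. (\<lambda>x. G x $ i) \<in> L2 \<Omega>"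
  shows "\<bar>LINT x|lebesgue_on \<Omega>. F x \<bullet> G x\<bar>
    \<le> sqrt (LINT x|lebesgue_on \<Omega>. (norm (F x))\<^sup>2) * sqrt (LINT x|lebesgue_on \<Omega>. (norm (G x))\<^sup>2)"
proof -
  note nF = L2_norm_vec[OF F] and nG = L2_norm_vec[OF G]
  have "\<bar>LINT x|lebesgue_on \<Omega>. F x \<bullet> G x\<bar> \<le> (LINT x|lebesgue_on \<Omega>. norm (F x) * norm (G x))"
    by (rule order_trans[OF integral_abs_bound integral_mono])
      (use L2_inner_integrable[OF F G] L2_mult_integrable[OF nF nG] in \<open>auto simp: Cauchy_Schwarz_ineq2\<close>)
  also have "\<dots> \<le> \<bar>LINT x|lebesgue_on \<Omega>. norm (F x) * norm (G x)\<bar>" by simp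
  also have "\<dots> \<le> sqrt (LINT x|lebesgue_on \<Omega>. (norm (F x))\<^sup>2) * sqrt (LINT x|lebesgue_on \<Omega>. (norm (G x))\<^sup>2)"
    by (rule cauchy_schwarz_integral[OF L2D(1)[OF nF] L2D(1)[OF nG] L2D(2)[OF nF] L2D(2)[OF nG]])
  finally show ?thesis .
qed

lemma L2_vec_triangle:
  fixes F G :: vector_field
  assumes F: "\<And>i. (\<lambda>x. F x $ i) \<in> L2 \<Omega>" and G: "\<And>i. (\<lambda>x. G x $ i) \<in> L2 \<Omega>"
  shows "sqrt (LINT x|lebesgue_on \<Omega>. (norm (G x))\<^sup>2)
    \<le> sqrt (LINT x|lebesgue_on \<Omega>. (norm (F x))\<^sup>2) + sqrt (LINT x|lebesgue_on \<Omega>. (norm (F x - G x))\<^sup>2)"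
proof -
  have D: "(\<lambda>x. (F x - G x) $ i) \<in> L2 \<Omega>" for i using L2_diff[OF F[of i] G[of i]] by simp
  note nF = L2_norm_vec[OF F] and nG = L2_norm_vec[OF G] and nD = L2_norm_vec[OF D]
  define a b where "a = sqrt (LINT x|lebesgue_on \<Omega>. (norm (F x))\<^sup>2)" and "b = sqrt (LINT x|lebesgue_on \<Omega>. (norm (F x - G x))\<^sup>2)"
  have a2: "(LINT x|lebesgue_on \<Omega>. (norm (F x))\<^sup>2) = a\<^sup>2" and b2: "(LINT x|lebesgue_on \<Omega>. (norm (F x - G x))\<^sup>2) = b\<^sup>2"
    by (simp_all add: a_def b_def)
  have ab: "a \<ge> 0" "b \<ge> 0" by (simp_all add: a_def b_def)
  have "(LINT x|lebesgue_on \<Omega>. norm (F x) * norm (F x - G x)) \<le> a * b"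
    using cauchy_schwarz_integral[OF L2D(1)[OF nF] L2D(1)[OF nD] L2D(2)[OF nF] L2D(2)[OF nD]]
    unfolding a_def b_def by linarith
  moreover have "(LINT x|lebesgue_on \<Omega>. (norm (G x))\<^sup>2)
    \<le> (LINT x|lebesgue_on \<Omega>. (norm (F x))\<^sup>2 + 2 * (norm (F x) * norm (F x - G x)) + (norm (F x - G x))\<^sup>2)"
  proof (rule integral_mono)
    fix x
    have "norm (G x) \<le> norm (F x) + norm (F x - G x)" using norm_triangle_ineq4[of "F x" "F x - G x"] by simp
    then have "(norm (G x))\<^sup>2 \<le> (norm (F x) + norm (F x - G x))\<^sup>2" by (intro power_mono) auto
    then show "(norm (G x))\<^sup>2 \<le> (norm (F x))\<^sup>2 + 2 * (norm (F x) * norm (F x - G x)) + (norm (F x - G x))\<^sup>2"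
      by (simp add: power2_sum algebra_simps)
  qed (use L2D(2)[OF nG] L2D(2)[OF nF] L2D(2)[OF nD] L2_mult_integrable[OF nF nD] in auto)
  moreover have "(LINT x|lebesgue_on \<Omega>. (norm (F x))\<^sup>2 + 2 * (norm (F x) * norm (F x - G x)) + (norm (F x - G x))\<^sup>2)
    = a\<^sup>2 + 2 * (LINT x|lebesgue_on \<Omega>. norm (F x) * norm (F x - G x)) + b\<^sup>2"
    using L2D(2)[OF nF] L2D(2)[OF nD] L2_mult_integrable[OF nF nD] by (simp add: a2 b2)
  ultimately have "(LINT x|lebesgue_on \<Omega>. (norm (G x))\<^sup>2) \<le> (a + b)\<^sup>2" by (simp add: power2_sum algebra_simps)
  then have "sqrt (LINT x|lebesgue_on \<Omega>. (norm (G x))\<^sup>2) \<le> a + b" using ab by (intro real_le_lsqrt) auto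
  then show ?thesis by (simp add: a_def b_def)
qed

text \<open>Discrete Cauchy-Schwarz with free splitting: a power of the local diameter goes into
  \<open>X\<close> and its inverse into \<open>Y\<close>.\<close>

lemma sum_cauchy_schwarz:
  fixes f :: "'a \<Rightarrow> real"
  assumes "\<And>i. i \<in> S \<Longrightarrow> \<bar>f i\<bar> \<le> X i * Y i" "\<And>i. i \<in> S \<Longrightarrow> 0 \<le> X i" "\<And>i. i \<in> S \<Longrightarrow> 0 \<le> Y i"
    and "(\<Sum>i\<in>S. (X i)\<^sup>2) \<le> P" "(\<Sum>i\<in>S. (Y i)\<^sup>2) \<le> Q"
  shows "\<bar>\<Sum>i\<in>S. f i\<bar> \<le> sqrt P * sqrt Q"
proof -
  have "\<bar>\<Sum>i\<in>S. f i\<bar> \<le> (\<Sum>i\<in>S. \<bar>f i\<bar>)" by (rule sum_abs)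
  also have "\<dots> \<le> (\<Sum>i\<in>S. \<bar>X i\<bar> * \<bar>Y i\<bar>)" using assms(1-3) by (intro sum_mono) simp
  also have "\<dots> \<le> L2_set X S * L2_set Y S" by (rule L2_set_mult_ineq)
  also have "\<dots> \<le> sqrt P * sqrt Q"
    unfolding L2_set_def using assms(4,5) order_trans[OF sum_nonneg assms(4)]
    by (intro mult_mono) (auto simp: sum_nonneg)
  finally show ?thesis .
qed

context regular_mesh begin

text \<open>The common scalar form of the three equations: \<open>A\<close> is the flux tested with
  the gradient, \<open>B\<close> the remaining term.\<close>

definition residual :: "vector_field \<Rightarrow> scalar_field \<Rightarrow> scalar_field \<Rightarrow> real" where
  "residual A B v = (LINT x|lebesgue_on \<Omega>. A x \<bullet> weak_grad \<Omega> v x + B x * v x)"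

text \<open>\<open>d T\<close> stands for the divergence of the flux on \<open>T\<close>, a constant
  for affine fluxes. The weight has no factor \<open>inverse \<epsilon>\<close>; that enters only
  when the three equations are assembled.\<close>

definition element_part :: "(point set \<Rightarrow> real) \<Rightarrow> scalar_field \<Rightarrow> real" where
  "element_part d B = (\<Sum>T\<in>\<T>. (diameter T)\<^sup>2 * L2_norm_sq T (\<lambda>x. B x - d T))"

definition edge_part :: "(point set \<Rightarrow> vector_field) \<Rightarrow> real" where
  "edge_part A = (\<Sum>E\<in>interior_edges \<Omega> \<T>. diameter E * edge_norm_sq E (jump \<T> E A))"

text \<open>The first summand belongs to the elements, where \<tau> exchanges the global
  \<open>h\<close> for the local diameter. The second belongs to the edges, where 3 counts the edges
  of a triangle.\<close>

definition residual_const :: real where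
  "residual_const = sqrt (poincare_const * \<tau>\<^sup>2 * overlap_const) + sqrt (3 * trace_const * overlap_const)"

lemma edge_integral_nonneg: "(\<And>x. 0 \<le> u x) \<Longrightarrow> 0 \<le> edge_integral E u"
  unfolding edge_integral_def seg_integral_def by (simp add: case_prod_unfold Let_def)

lemma parts_nonneg: "0 \<le> element_part d B" "0 \<le> edge_part A"
proof -
  show "0 \<le> element_part d B" by (simp add: element_part_def L2_norm_sq_def sum_nonneg)
  have "0 \<le> diameter E" if E: "E \<in> interior_edges \<Omega> \<T>" for E
  proof -
    obtain T where T: "T \<in> \<T>" "E edge_of T" using E by (auto simp: interior_edges_def)
    then have "bounded E"
      using edge_of_imp_subset[OF T(2)] bounded_subset[OF compact_imp_bounded[OF mesh_triangle(2)[OF T(1)]]] by blast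
    then show ?thesis by (rule diameter_ge_0)
  qed
  then show "0 \<le> edge_part A" unfolding edge_part_def edge_norm_sq_eq
    by (intro sum_nonneg mult_nonneg_nonneg edge_integral_nonneg) auto
qed

lemma residual_const_pos: "residual_const > 0"
  unfolding residual_const_def using const_nonneg \<tau>_pos by (intro add_pos_pos) auto

lemma mesh_diameter_pos: "T \<in> \<T> \<Longrightarrow> 0 < diameter T" and mesh_size_le: "T \<in> \<T> \<Longrightarrow> h \<le> \<tau> * diameter T"
proof -
  assume T: "T \<in> \<T>"
  show "h \<le> \<tau> * diameter T" using quasi T by (simp add: quasi_uniform_def)
  then have "0 < \<tau> * diameter T" using mesh_size_pos by linarith
  then show "0 < diameter T" using \<tau>_pos by (simp add: zero_less_mult_iff)
qed

text \<open>Galerkin orthogonality allows subtracting a discrete function; the remainder is integrated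
  by parts triangle by triangle.\<close>

lemma residual_representation:
  assumes AT: "\<And>T x. T \<in> \<T> \<Longrightarrow> (AT T has_derivative AT' T) (at x)"
    and A: "\<And>T. T \<in> \<T> \<Longrightarrow> AE x in lebesgue_on T. A x = AT T x" "\<And>i. (\<lambda>x. A x $ i) \<in> L2 \<Omega>"
    and B: "B \<in> L2 \<Omega>" and \<phi>: "\<phi> \<in> test_functions \<Omega>"
    and v: "v \<in> V_h \<Omega> \<T>" "residual A B v = 0" "\<And>T x. T \<in> \<T> \<Longrightarrow> x \<in> T \<Longrightarrow> v x = \<alpha> T + \<beta> T \<bullet> x"
      "\<And>x. x \<notin> \<Omega> \<Longrightarrow> v x = 0"
    and d: "\<And>T. T \<in> \<T> \<Longrightarrow> d T = (\<Sum>i\<in>UNIV. AT' T (axis i 1) $ i)"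
  shows "(LINT x|lebesgue_on \<Omega>. A x \<bullet> grad_on UNIV \<phi> x + B x * \<phi> x) =
    (\<Sum>T\<in>\<T>. LINT x|lebesgue_on T. (B x - d T) * (\<phi> x - v x)) +
    (\<Sum>E\<in>interior_edges \<Omega> \<T>. edge_integral E (\<lambda>x. jump \<T> E AT x * (\<phi> x - v x)))"
proof -
  note t = test_functionD[OF \<phi>]
  note t2 = test_function_L2[OF \<phi> domain_sets bounded]
  have v1: "v \<in> H1 \<Omega>" using v(1) by (simp add: V_h_def H10_def)
  then have vL: "v \<in> L2 \<Omega>" by (simp add: H1_def)
  note gL = is_weak_gradD(1)[OF H1_is_weak_grad[OF v1]]
  define wT where "wT T x = \<phi> x - (\<alpha> T + \<beta> T \<bullet> x)" for T x
  define GT where "GT T x = grad_on UNIV \<phi> x - \<beta> T" for T x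
  have wTe: "wT T x = \<phi> x - v x" if "T \<in> \<T>" "x \<in> T" for T x using v(3)[OF that] by (simp add: wT_def)
  have wTd: "(wT T has_derivative (\<lambda>e. GT T x \<bullet> e)) (at x)" for T x
    unfolding wT_def GT_def by (auto intro!: derivative_eq_intros t simp: inner_diff_left)
  have cw: "continuous_on S (wT T)" for S T unfolding wT_def by (intro continuous_intros t)
  have cG: "continuous_on S (GT T)" for S T unfolding GT_def by (intro continuous_intros t)
  have cA: "continuous_on S (AT T)" if "T \<in> \<T>" for S T
    by (rule has_derivative_continuous_on_UNIV[OF AT[OF that]])
  let ?f = "\<lambda>x. A x \<bullet> (grad_on UNIV \<phi> x - weak_grad \<Omega> v x) + B x * (\<phi> x - v x)"
  have i1: "integrable (lebesgue_on \<Omega>) (\<lambda>x. A x \<bullet> grad_on UNIV \<phi> x + B x * \<phi> x)"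
    by (intro Bochner_Integration.integrable_add L2_inner_integrable A(2) t2 L2_mult_integrable B)
  have i2: "integrable (lebesgue_on \<Omega>) (\<lambda>x. A x \<bullet> weak_grad \<Omega> v x + B x * v x)"
    by (intro Bochner_Integration.integrable_add L2_inner_integrable A(2) gL L2_mult_integrable B vL)
  have fe: "?f = (\<lambda>x. (A x \<bullet> grad_on UNIV \<phi> x + B x * \<phi> x) - (A x \<bullet> weak_grad \<Omega> v x + B x * v x))"
    by (simp add: fun_eq_iff inner_diff_right algebra_simps)
  have fi: "integrable (lebesgue_on \<Omega>) ?f" unfolding fe by (rule Bochner_Integration.integrable_diff[OF i1 i2])
  have "(LINT x|lebesgue_on \<Omega>. A x \<bullet> grad_on UNIV \<phi> x + B x * \<phi> x) = (LINT x|lebesgue_on \<Omega>. ?f x)"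
    unfolding fe Bochner_Integration.integral_diff[OF i1 i2] using v(2) by (simp add: residual_def)
  also have "\<dots> = (\<Sum>T\<in>\<T>. LINT x|lebesgue_on T. ?f x)" by (rule mesh_integral(2)[OF fi])
  also have "\<dots> = (\<Sum>T\<in>\<T>. (LINT x|lebesgue_on T. (B x - d T) * (\<phi> x - v x))
      + (\<Sum>E | E edge_of T. edge_integral E (\<lambda>x. (AT T x \<bullet> outer_normal T E) * wT T x)))"
  proof (rule sum.cong[OF refl])
    fix T assume T: "T \<in> \<T>"
    \<comment> \<open>Adding and subtracting the divergence \<open>d T\<close> separates a smooth
      part, which integration by parts turns into edge terms, from the element residual.\<close>
    let ?g1 = "\<lambda>x. AT T x \<bullet> GT T x + d T * wT T x" and ?g2 = "\<lambda>x. (B x - d T) * wT T x"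
    have g1: "integrable (lebesgue_on T) ?g1"
      by (intro lebesgue_on_integral_lborel(2) mesh_triangle(2)[OF T] continuous_intros cA[OF T] cG cw)
    have bT: "Elementary_Metric_Spaces.bounded T" using mesh_triangle(2)[OF T] compact_imp_bounded by blast
    have g2: "integrable (lebesgue_on T) ?g2"
      by (intro L2_mult_integrable L2_diff mesh_L2[OF B T] L2_continuous[OF bT mesh_triangle(4)[OF T]] cw continuous_on_const)
    have wg: "AE x in lebesgue_on T. weak_grad \<Omega> v x = \<beta> T"
      by (rule weak_grad_mesh[OF v1 T]) (rule v(3)[OF T])
    have "(LINT x|lebesgue_on T. ?f x) = (LINT x|lebesgue_on T. ?g1 x + ?g2 x)"
    proof (rule integral_cong_AE)
      show "AE x in lebesgue_on T. ?f x = ?g1 x + ?g2 x"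
      proof (rule AE_mp[OF AE_conjI[OF A(1)[OF T] wg]], rule AE_I2, rule impI)
        fix x assume "x \<in> space (lebesgue_on T)" and elim: "A x = AT T x \<and> weak_grad \<Omega> v x = \<beta> T"
        then have "x \<in> T" by simp
        have "?f x = AT T x \<bullet> GT T x + B x * wT T x"
          by (simp only: elim[THEN conjunct1] elim[THEN conjunct2] GT_def wTe[OF T \<open>x \<in> T\<close>])
        then show "?f x = ?g1 x + ?g2 x" by (simp add: algebra_simps)
      qed
      show "?f \<in> borel_measurable (lebesgue_on T)" using mesh_integral(1)[OF fi T] by simp
      show "(\<lambda>x. ?g1 x + ?g2 x) \<in> borel_measurable (lebesgue_on T)" using g1 g2 by simp
    qed
    also have "\<dots> = (LINT x|lebesgue_on T. ?g1 x) + (LINT x|lebesgue_on T. ?g2 x)"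
      by (rule Bochner_Integration.integral_add[OF g1 g2])
    also have "(LINT x|lebesgue_on T. ?g1 x) = (\<Sum>E | E edge_of T. edge_integral E (\<lambda>x. (AT T x \<bullet> outer_normal T E) * wT T x))"
      unfolding d[OF T] by (rule ibp_triangle_edges[OF mesh_simplex[OF T] wTd cG AT[OF T] continuous_on_const])
    also have "(LINT x|lebesgue_on T. ?g2 x) = (LINT x|lebesgue_on T. (B x - d T) * (\<phi> x - v x))"
      by (intro Bochner_Integration.integral_cong refl) (simp add: wTe[OF T])
    finally show "(LINT x|lebesgue_on T. ?f x) = (LINT x|lebesgue_on T. (B x - d T) * (\<phi> x - v x))
      + (\<Sum>E | E edge_of T. edge_integral E (\<lambda>x. (AT T x \<bullet> outer_normal T E) * wT T x))" by simp
  qed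
  also have "\<dots> = (\<Sum>T\<in>\<T>. LINT x|lebesgue_on T. (B x - d T) * (\<phi> x - v x))
    + (\<Sum>T\<in>\<T>. \<Sum>E | E edge_of T. edge_integral E (\<lambda>x. (AT T x \<bullet> outer_normal T E) * wT T x))"
    by (rule sum.distrib)
  also have "(\<Sum>T\<in>\<T>. \<Sum>E | E edge_of T. edge_integral E (\<lambda>x. (AT T x \<bullet> outer_normal T E) * wT T x))
    = (\<Sum>E\<in>interior_edges \<Omega> \<T>. edge_integral E (\<lambda>x. jump \<T> E AT x * (\<phi> x - v x)))"
  proof (rule sum_edges_jump[OF cw wTe])
    fix x assume "x \<in> frontier \<Omega>"
    then have "x \<notin> \<Omega>" using open_domain by (simp add: frontier_def interior_open)
    then show "\<phi> x - v x = 0" using t(2) v(4) by simp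
  qed (use cA in auto)
  finally show ?thesis .
qed

text \<open>Local Cauchy-Schwarz inequalities with weights balanced so that the test function enters
  through \<open>\<phi> - v\<close> divided by the diameter on elements and by its square root on
  edges; these are the quantities that \<open>interpolation_estimate\<close> and
  \<open>overlap_estimate\<close> bound by the gradient.\<close>

lemma residual_test:
  assumes AT: "\<And>T x. T \<in> \<T> \<Longrightarrow> (AT T has_derivative AT' T) (at x)"
    and A: "\<And>T. T \<in> \<T> \<Longrightarrow> AE x in lebesgue_on T. A x = AT T x" "\<And>i. (\<lambda>x. A x $ i) \<in> L2 \<Omega>"
    and B: "B \<in> L2 \<Omega>" and \<phi>: "\<phi> \<in> test_functions \<Omega>"
    and orth: "\<And>v. v \<in> V_h \<Omega> \<T> \<Longrightarrow> residual A B v = 0"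
    and d: "\<And>T. T \<in> \<T> \<Longrightarrow> d T = (\<Sum>i\<in>UNIV. AT' T (axis i 1) $ i)"
  shows "\<bar>LINT x|lebesgue_on \<Omega>. A x \<bullet> grad_on UNIV \<phi> x + B x * \<phi> x\<bar> \<le>
    residual_const * (sqrt (element_part d B) + sqrt (edge_part AT)) *
    sqrt (LINT x|lebesgue_on \<Omega>. (norm (grad_on UNIV \<phi> x))\<^sup>2)"
proof (rule interpolation_estimate[OF \<phi>])
  fix v \<alpha> \<beta>
  let ?S = "\<lambda>T. \<Sum>z\<in>verts T. local_energy (grad_on UNIV \<phi>) z"
  let ?I = "LINT x|lebesgue_on \<Omega>. (norm (grad_on UNIV \<phi> x))\<^sup>2"
  assume v: "v \<in> V_h \<Omega> \<T>" "\<And>T x. T \<in> \<T> \<Longrightarrow> x \<in> T \<Longrightarrow> v x = \<alpha> T + \<beta> T \<bullet> x" "\<And>x. x \<notin> \<Omega> \<Longrightarrow> v x = 0"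
    and vT: "\<And>T. T \<in> \<T> \<Longrightarrow> (LINT x|lebesgue_on T. (\<phi> x - v x)\<^sup>2) \<le> poincare_const * h\<^sup>2 * ?S T"
    and vE: "\<And>T b c. T \<in> \<T> \<Longrightarrow> closed_segment b c edge_of T \<Longrightarrow> seg_integral (\<lambda>x. (\<phi> x - v x)\<^sup>2) b c \<le> trace_const * ?S T"
  note t = test_functionD[OF \<phi>]
  have S0: "0 \<le> ?S T" for T by (intro sum_nonneg local_energy_nonneg)
  note over = overlap_estimate[OF \<phi>]
  define wT where "wT T x = \<phi> x - (\<alpha> T + \<beta> T \<bullet> x)" for T x
  have wTe: "\<phi> x - v x = wT T x" if "T \<in> \<T>" "x \<in> T" for T x using v(2)[OF that] by (simp add: wT_def)
  have cw: "continuous_on S (wT T)" for S T unfolding wT_def by (intro continuous_intros t)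
  have cA: "continuous_on S (AT T)" if "T \<in> \<T>" for S T
    by (rule has_derivative_continuous_on_UNIV[OF AT[OF that]])
  have elements: "\<bar>\<Sum>T\<in>\<T>. LINT x|lebesgue_on T. (B x - d T) * (\<phi> x - v x)\<bar>
    \<le> sqrt (element_part d B) * sqrt (poincare_const * \<tau>\<^sup>2 * overlap_const * ?I)"
  proof (rule sum_cauchy_schwarz[where X = "\<lambda>T. diameter T * sqrt (L2_norm_sq T (\<lambda>x. B x - d T))"
        and Y = "\<lambda>T. sqrt (LINT x|lebesgue_on T. (\<phi> x - v x)\<^sup>2) / diameter T"])
    fix T assume T: "T \<in> \<T>"
    note dT = mesh_diameter_pos[OF T]
    have bT: "Elementary_Metric_Spaces.bounded T" using mesh_triangle(2)[OF T] compact_imp_bounded by blast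
    have L1: "(\<lambda>x. B x - d T) \<in> L2 T"
      by (intro L2_diff mesh_L2[OF B T] L2_continuous[OF bT mesh_triangle(4)[OF T]] continuous_on_const)
    have L2': "wT T \<in> L2 T" by (intro L2_continuous[OF bT mesh_triangle(4)[OF T]] cw)
    have e1: "(LINT x|lebesgue_on T. (B x - d T) * (\<phi> x - v x)) = (LINT x|lebesgue_on T. (B x - d T) * wT T x)"
      by (intro Bochner_Integration.integral_cong refl) (simp add: wTe[OF T])
    have e2: "(LINT x|lebesgue_on T. (\<phi> x - v x)\<^sup>2) = (LINT x|lebesgue_on T. (wT T x)\<^sup>2)"
      by (intro Bochner_Integration.integral_cong refl) (simp add: wTe[OF T])
    show "\<bar>LINT x|lebesgue_on T. (B x - d T) * (\<phi> x - v x)\<bar>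
      \<le> diameter T * sqrt (L2_norm_sq T (\<lambda>x. B x - d T)) * (sqrt (LINT x|lebesgue_on T. (\<phi> x - v x)\<^sup>2) / diameter T)"
      using cauchy_schwarz_integral[OF L2D(1)[OF L1] L2D(1)[OF L2'] L2D(2)[OF L1] L2D(2)[OF L2']] dT
      unfolding e1 e2 L2_norm_sq_def by simp
    show "0 \<le> diameter T * sqrt (L2_norm_sq T (\<lambda>x. B x - d T))" using dT by (simp add: L2_norm_sq_def)
    show "0 \<le> sqrt (LINT x|lebesgue_on T. (\<phi> x - v x)\<^sup>2) / diameter T" using dT by simp
  next
    show "(\<Sum>T\<in>\<T>. (diameter T * sqrt (L2_norm_sq T (\<lambda>x. B x - d T)))\<^sup>2) \<le> element_part d B"
      unfolding element_part_def by (intro sum_mono) (simp add: power_mult_distrib L2_norm_sq_def)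
    have "(\<Sum>T\<in>\<T>. (sqrt (LINT x|lebesgue_on T. (\<phi> x - v x)\<^sup>2) / diameter T)\<^sup>2) \<le> (\<Sum>T\<in>\<T>. poincare_const * \<tau>\<^sup>2 * ?S T)"
    proof (rule sum_mono)
      fix T assume T: "T \<in> \<T>"
      note dT = mesh_diameter_pos[OF T]
      have "h\<^sup>2 \<le> (\<tau> * diameter T)\<^sup>2" using mesh_size_le[OF T] mesh_size_pos by (intro power_mono) auto
      then have "poincare_const * h\<^sup>2 * ?S T \<le> poincare_const * (\<tau> * diameter T)\<^sup>2 * ?S T"
        using const_nonneg(1) S0[of T] by (intro mult_right_mono mult_left_mono) auto
      with vT[OF T] have "(LINT x|lebesgue_on T. (\<phi> x - v x)\<^sup>2) \<le> poincare_const * \<tau>\<^sup>2 * ?S T * (diameter T)\<^sup>2"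
        by (simp add: power_mult_distrib mult_ac)
      then show "(sqrt (LINT x|lebesgue_on T. (\<phi> x - v x)\<^sup>2) / diameter T)\<^sup>2 \<le> poincare_const * \<tau>\<^sup>2 * ?S T"
        using dT by (simp add: power_divide pos_divide_le_eq)
    qed
    also have "\<dots> = poincare_const * \<tau>\<^sup>2 * (\<Sum>T\<in>\<T>. ?S T)" by (simp add: sum_distrib_left)
    also have "\<dots> \<le> poincare_const * \<tau>\<^sup>2 * (overlap_const * ?I)"
      using over const_nonneg(1) by (intro mult_left_mono) auto
    finally show "(\<Sum>T\<in>\<T>. (sqrt (LINT x|lebesgue_on T. (\<phi> x - v x)\<^sup>2) / diameter T)\<^sup>2) \<le> poincare_const * \<tau>\<^sup>2 * overlap_const * ?I"
      by (simp add: mult.assoc)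
  qed
  let ?IE = "interior_edges \<Omega> \<T>"
  have edges: "\<bar>\<Sum>E\<in>?IE. edge_integral E (\<lambda>x. jump \<T> E AT x * (\<phi> x - v x))\<bar>
    \<le> sqrt (edge_part AT) * sqrt (3 * trace_const * overlap_const * ?I)"
  proof (rule sum_cauchy_schwarz[where X = "\<lambda>E. sqrt (diameter E * edge_norm_sq E (jump \<T> E AT))"
        and Y = "\<lambda>E. sqrt (edge_integral E (\<lambda>x. (\<phi> x - v x)\<^sup>2) / diameter E)"])
    fix E assume E: "E \<in> ?IE"
    obtain P Q where PQ: "edge_triangles E = (P, Q)" by (cases "edge_triangles E")
    note e = interior_edge_triangles[OF E PQ]
    obtain a b c where abc: "P = convex hull {a, b, c}" "cross2 (b - a) (c - a) \<noteq> 0" "E = closed_segment b c"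
      using edge_of_triangle[OF mesh_simplex[OF e(1)] e(4)] .
    note bc = abc(3,2)
    have "b \<noteq> c" using bc(2) by (auto simp: cross2_def algebra_simps)
    then have dE: "diameter E > 0" unfolding bc(1) diameter_closed_segment by simp
    have EP: "x \<in> P" if "x \<in> E" for x using that edge_of_imp_subset[OF e(4)] by blast
    have cj: "continuous_on UNIV (jump \<T> E AT)"
      unfolding jump_eq[abs_def] PQ fst_conv snd_conv by (intro continuous_intros cA e)
    have n: "0 \<le> edge_integral E (\<lambda>x. (jump \<T> E AT x)\<^sup>2)" "0 \<le> edge_integral E (\<lambda>x. (\<phi> x - v x)\<^sup>2)"
      by (intro edge_integral_nonneg; simp)+
    have "\<bar>edge_integral E (\<lambda>x. jump \<T> E AT x * (\<phi> x - v x))\<bar>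
      \<le> sqrt (edge_integral E (\<lambda>x. (jump \<T> E AT x)\<^sup>2)) * sqrt (edge_integral E (\<lambda>x. (\<phi> x - v x)\<^sup>2))"
      by (rule edge_integral_cauchy_schwarz[OF e(4) mesh_simplex[OF e(1)] cj refl cw]) (rule wTe[OF e(1) EP])
    also have "\<dots> = sqrt (diameter E * edge_norm_sq E (jump \<T> E AT)) * sqrt (edge_integral E (\<lambda>x. (\<phi> x - v x)\<^sup>2) / diameter E)"
      unfolding edge_norm_sq_eq real_sqrt_mult[symmetric] using dE by simp
    finally show "\<bar>edge_integral E (\<lambda>x. jump \<T> E AT x * (\<phi> x - v x))\<bar>
      \<le> sqrt (diameter E * edge_norm_sq E (jump \<T> E AT)) * sqrt (edge_integral E (\<lambda>x. (\<phi> x - v x)\<^sup>2) / diameter E)" .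
    show "0 \<le> sqrt (diameter E * edge_norm_sq E (jump \<T> E AT))" using dE n(1) by (simp add: edge_norm_sq_eq)
    show "0 \<le> sqrt (edge_integral E (\<lambda>x. (\<phi> x - v x)\<^sup>2) / diameter E)" using dE n(2) by simp
  next
    have dnn: "0 \<le> diameter E * edge_norm_sq E (jump \<T> E AT)" if E: "E \<in> ?IE" for E
    proof -
      obtain T where T: "T \<in> \<T>" "E edge_of T" using E by (auto simp: interior_edges_def)
      have "Elementary_Metric_Spaces.bounded E"
        by (rule bounded_subset[OF compact_imp_bounded[OF mesh_triangle(2)[OF T(1)]] edge_of_imp_subset[OF T(2)]])
      then show ?thesis using diameter_ge_0 by (auto simp: edge_norm_sq_eq intro!: mult_nonneg_nonneg edge_integral_nonneg)
    qed
    show "(\<Sum>E\<in>?IE. (sqrt (diameter E * edge_norm_sq E (jump \<T> E AT)))\<^sup>2) \<le> edge_part AT"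
      unfolding edge_part_def by (intro sum_mono) (simp add: dnn)
    \<comment> \<open>The length factor of \<open>edge_integral\<close> cancels the diameter of the
      edge. One adjacent triangle would suffice for the bound; summing over all of them allows the
      order of summation to be exchanged, and then each triangle is counted at most three
      times.\<close>
    have "(\<Sum>E\<in>?IE. (sqrt (edge_integral E (\<lambda>x. (\<phi> x - v x)\<^sup>2) / diameter E))\<^sup>2)
      \<le> (\<Sum>E\<in>?IE. \<Sum>T | T \<in> \<T> \<and> E edge_of T. trace_const * ?S T)"
    proof (rule sum_mono)
      fix E assume E: "E \<in> ?IE"
      obtain P Q where PQ: "edge_triangles E = (P, Q)" by (cases "edge_triangles E")
      note e = interior_edge_triangles[OF E PQ]
      obtain a b c where abc: "P = convex hull {a, b, c}" "cross2 (b - a) (c - a) \<noteq> 0" "E = closed_segment b c"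
        using edge_of_triangle[OF mesh_simplex[OF e(1)] e(4)] .
      note bc = abc(3,2)
      have "b \<noteq> c" using bc(2) by (auto simp: cross2_def algebra_simps)
      then have dE: "dist b c > 0" by simp
      have "(sqrt (edge_integral E (\<lambda>x. (\<phi> x - v x)\<^sup>2) / diameter E))\<^sup>2 = seg_integral (\<lambda>x. (\<phi> x - v x)\<^sup>2) b c"
        unfolding bc(1) edge_integral_segment diameter_closed_segment using dE by (simp add: seg_integral_def)
      also have "\<dots> \<le> trace_const * ?S P" by (rule vE[OF e(1)]) (use e(4) bc(1) in simp)
      also have "\<dots> \<le> (\<Sum>T | T \<in> \<T> \<and> E edge_of T. trace_const * ?S T)"
        using e(1,4) finite_mesh const_nonneg(2) S0
        by (intro member_le_sum[where f = "\<lambda>T. trace_const * ?S T"]) auto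
      finally show "(sqrt (edge_integral E (\<lambda>x. (\<phi> x - v x)\<^sup>2) / diameter E))\<^sup>2
        \<le> (\<Sum>T | T \<in> \<T> \<and> E edge_of T. trace_const * ?S T)" .
    qed
    also have "\<dots> = (\<Sum>T\<in>\<T>. \<Sum>E | E \<in> ?IE \<and> E edge_of T. trace_const * ?S T)"
      by (rule sum.swap_restrict[OF finite_interior_edges finite_mesh])
    also have "\<dots> \<le> (\<Sum>T\<in>\<T>. 3 * (trace_const * ?S T))"
    proof (rule sum_mono)
      fix T assume T: "T \<in> \<T>"
      have "card {E. E \<in> ?IE \<and> E edge_of T} \<le> card {E. E edge_of T}"
        by (intro card_mono finite_triangle_edges mesh_simplex T) auto
      then have "card {E. E \<in> ?IE \<and> E edge_of T} \<le> 3" using finite_triangle_edges(2)[OF mesh_simplex[OF T]] by linarith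
      then have "real (card {E. E \<in> ?IE \<and> E edge_of T}) * (trace_const * ?S T) \<le> 3 * (trace_const * ?S T)"
        using const_nonneg(2) S0[of T] by (intro mult_right_mono) auto
      then show "(\<Sum>E | E \<in> ?IE \<and> E edge_of T. trace_const * ?S T) \<le> 3 * (trace_const * ?S T)" by simp
    qed
    also have "\<dots> = 3 * trace_const * (\<Sum>T\<in>\<T>. ?S T)" by (simp add: sum_distrib_left mult.assoc)
    also have "\<dots> \<le> 3 * trace_const * (overlap_const * ?I)"
      using over const_nonneg(2) by (intro mult_left_mono) auto
    finally show "(\<Sum>E\<in>?IE. (sqrt (edge_integral E (\<lambda>x. (\<phi> x - v x)\<^sup>2) / diameter E))\<^sup>2) \<le> 3 * trace_const * overlap_const * ?I"
      by (simp add: mult.assoc)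
  qed
  have rep: "(LINT x|lebesgue_on \<Omega>. A x \<bullet> grad_on UNIV \<phi> x + B x * \<phi> x) =
    (\<Sum>T\<in>\<T>. LINT x|lebesgue_on T. (B x - d T) * (\<phi> x - v x)) +
    (\<Sum>E\<in>?IE. edge_integral E (\<lambda>x. jump \<T> E AT x * (\<phi> x - v x)))"
    by (rule residual_representation[OF AT A B \<phi> v(1) orth[OF v(1)] v(2,3) d])
  define c1 c2 where "c1 = sqrt (poincare_const * \<tau>\<^sup>2 * overlap_const)" and "c2 = sqrt (3 * trace_const * overlap_const)"
  define s1 s2 where "s1 = sqrt (element_part d B)" and "s2 = sqrt (edge_part AT)"
  have nn: "0 \<le> c1" "0 \<le> c2" "0 \<le> s1" "0 \<le> s2"
    using const_nonneg parts_nonneg by (simp_all add: c1_def c2_def s1_def s2_def)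
  have "\<bar>LINT x|lebesgue_on \<Omega>. A x \<bullet> grad_on UNIV \<phi> x + B x * \<phi> x\<bar> \<le> s1 * (c1 * sqrt ?I) + s2 * (c2 * sqrt ?I)"
    unfolding rep c1_def c2_def s1_def s2_def real_sqrt_mult[symmetric]
    using elements edges unfolding real_sqrt_mult[symmetric] by linarith
  also have "\<dots> = (s1 * c1 + s2 * c2) * sqrt ?I" by (simp add: algebra_simps)
  also have "\<dots> \<le> ((c1 + c2) * (s1 + s2)) * sqrt ?I"
  proof (rule mult_right_mono)
    have "0 \<le> s1 * c2 + s2 * c1" using nn by simp
    then show "s1 * c1 + s2 * c2 \<le> (c1 + c2) * (s1 + s2)" by (simp add: algebra_simps)
  qed simp
  finally show "\<bar>LINT x|lebesgue_on \<Omega>. A x \<bullet> grad_on UNIV \<phi> x + B x * \<phi> x\<bar> \<le>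
    residual_const * (sqrt (element_part d B) + sqrt (edge_part AT)) * sqrt ?I"
    by (simp add: residual_const_def c1_def c2_def s1_def s2_def)
qed

text \<open>The residual is continuous in the \<open>H1\<close> norm, since \<open>A\<close> and
  \<open>B\<close> are square integrable. Approximation of \<open>v\<close> up to \<open>t\<close>
  costs a term linear in \<open>t\<close> with finite coefficient, and \<open>t\<close> is
  arbitrary; the norms of \<open>A\<close> and \<open>B\<close> do not survive in the bound.\<close>

lemma residual_bound:
  assumes AT: "\<And>T x. T \<in> \<T> \<Longrightarrow> (AT T has_derivative AT' T) (at x)"
    and A: "\<And>T. T \<in> \<T> \<Longrightarrow> AE x in lebesgue_on T. A x = AT T x" "\<And>i. (\<lambda>x. A x $ i) \<in> L2 \<Omega>"
    and B: "B \<in> L2 \<Omega>"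
    and orth: "\<And>v. v \<in> V_h \<Omega> \<T> \<Longrightarrow> residual A B v = 0"
    and d: "\<And>T. T \<in> \<T> \<Longrightarrow> d T = (\<Sum>i\<in>UNIV. AT' T (axis i 1) $ i)"
    and v: "v \<in> H10 \<Omega>"
  shows "\<bar>residual A B v\<bar> \<le>
    residual_const * (sqrt (element_part d B) + sqrt (edge_part AT)) *
    sqrt (LINT x|lebesgue_on \<Omega>. (norm (weak_grad \<Omega> v x))\<^sup>2)"
proof -
  define K where "K = residual_const * (sqrt (element_part d B) + sqrt (edge_part AT))"
  have K0: "K \<ge> 0" unfolding K_def using residual_const_pos parts_nonneg by (intro mult_nonneg_nonneg add_nonneg_nonneg) auto
  let ?g = "weak_grad \<Omega> v"
  define n where "n = sqrt (LINT x|lebesgue_on \<Omega>. (norm (?g x))\<^sup>2)"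
  define a where "a = sqrt (LINT x|lebesgue_on \<Omega>. (norm (A x))\<^sup>2)"
  define b where "b = sqrt (LINT x|lebesgue_on \<Omega>. (B x)\<^sup>2)"
  have ab: "a \<ge> 0" "b \<ge> 0" by (simp_all add: a_def b_def)
  have v1: "v \<in> H1 \<Omega>" using v by (simp add: H10_def)
  then have vL: "v \<in> L2 \<Omega>" by (simp add: H1_def)
  note gL = is_weak_gradD(1)[OF H1_is_weak_grad[OF v1]]
  have step: "\<bar>residual A B v\<bar> \<le> K * n + (K + a + b) * t" if t: "t > 0" for t
  proof -
    have "t\<^sup>2 > 0" using t by simp
    from H10_approx[OF open_domain bounded v this] obtain \<phi> where \<phi>: "\<phi> \<in> test_functions \<Omega>"
      "L2_norm_sq \<Omega> (\<lambda>x. v x - \<phi> x) < t\<^sup>2" "(LINT x|lebesgue_on \<Omega>. (norm (?g x - grad_on UNIV \<phi> x))\<^sup>2) < t\<^sup>2" .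
    note t2 = test_function_L2[OF \<phi>(1) domain_sets bounded]
    have Dg: "(\<lambda>x. (?g x - grad_on UNIV \<phi> x) $ i) \<in> L2 \<Omega>" for i using L2_diff[OF gL[of i] t2(2)[of i]] by simp
    have Dv: "(\<lambda>x. v x - \<phi> x) \<in> L2 \<Omega>" by (rule L2_diff[OF vL t2(1)])
    have s1: "sqrt (LINT x|lebesgue_on \<Omega>. (norm (?g x - grad_on UNIV \<phi> x))\<^sup>2) \<le> t"
      using \<phi>(3) t by (intro real_le_lsqrt) auto
    have s2: "sqrt (LINT x|lebesgue_on \<Omega>. (v x - \<phi> x)\<^sup>2) \<le> t"
      using \<phi>(2) t by (intro real_le_lsqrt) (auto simp: L2_norm_sq_def)
    let ?R = "LINT x|lebesgue_on \<Omega>. A x \<bullet> grad_on UNIV \<phi> x + B x * \<phi> x"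
    have i1: "integrable (lebesgue_on \<Omega>) (\<lambda>x. A x \<bullet> (?g x - grad_on UNIV \<phi> x))"
      by (rule L2_inner_integrable[OF A(2) Dg])
    have i2: "integrable (lebesgue_on \<Omega>) (\<lambda>x. B x * (v x - \<phi> x))" by (rule L2_mult_integrable[OF B Dv])
    have i3: "integrable (lebesgue_on \<Omega>) (\<lambda>x. A x \<bullet> grad_on UNIV \<phi> x + B x * \<phi> x)"
      by (intro Bochner_Integration.integrable_add L2_inner_integrable A(2) t2 L2_mult_integrable B)
    have "residual A B v = (LINT x|lebesgue_on \<Omega>. (A x \<bullet> grad_on UNIV \<phi> x + B x * \<phi> x)
        + (A x \<bullet> (?g x - grad_on UNIV \<phi> x) + B x * (v x - \<phi> x)))"
      unfolding residual_def by (intro Bochner_Integration.integral_cong refl) (simp add: inner_diff_right algebra_simps)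
    also have "\<dots> = ?R + ((LINT x|lebesgue_on \<Omega>. A x \<bullet> (?g x - grad_on UNIV \<phi> x)) + (LINT x|lebesgue_on \<Omega>. B x * (v x - \<phi> x)))"
      using i1 i2 i3 by (simp only: Bochner_Integration.integral_add Bochner_Integration.integrable_add)
    finally have split: "residual A B v = \<dots>" .
    have "\<bar>?R\<bar> \<le> K * sqrt (LINT x|lebesgue_on \<Omega>. (norm (grad_on UNIV \<phi> x))\<^sup>2)"
      unfolding K_def by (rule residual_test[OF AT A B \<phi>(1) orth d])
    also have "\<dots> \<le> K * (n + t)"
      using L2_vec_triangle[OF gL t2(2)] s1 K0 unfolding n_def by (intro mult_left_mono) linarith+
    finally have 1: "\<bar>?R\<bar> \<le> K * (n + t)" .
    have "\<bar>LINT x|lebesgue_on \<Omega>. A x \<bullet> (?g x - grad_on UNIV \<phi> x)\<bar> \<le> a * sqrt (LINT x|lebesgue_on \<Omega>. (norm (?g x - grad_on UNIV \<phi> x))\<^sup>2)"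
      unfolding a_def by (rule cauchy_schwarz_vec[OF A(2) Dg])
    also have "\<dots> \<le> a * t" using s1 ab(1) by (rule mult_left_mono)
    finally have 2: "\<bar>LINT x|lebesgue_on \<Omega>. A x \<bullet> (?g x - grad_on UNIV \<phi> x)\<bar> \<le> a * t" .
    have "\<bar>LINT x|lebesgue_on \<Omega>. B x * (v x - \<phi> x)\<bar> \<le> b * sqrt (LINT x|lebesgue_on \<Omega>. (v x - \<phi> x)\<^sup>2)"
      unfolding b_def by (rule cauchy_schwarz_integral[OF L2D(1)[OF B] L2D(1)[OF Dv] L2D(2)[OF B] L2D(2)[OF Dv]])
    also have "\<dots> \<le> b * t" using s2 ab(2) by (rule mult_left_mono)
    finally have 3: "\<bar>LINT x|lebesgue_on \<Omega>. B x * (v x - \<phi> x)\<bar> \<le> b * t" .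
    have "\<bar>residual A B v\<bar> \<le> K * (n + t) + (a * t + b * t)"
      unfolding split using 1 2 3 by linarith
    then show ?thesis by (simp add: algebra_simps)
  qed
  have "\<bar>residual A B v\<bar> \<le> K * n"
  proof (rule field_le_epsilon)
    fix e :: real assume e: "e > 0"
    have p: "K + a + b + 1 > 0" using K0 ab by simp
    have "(K + a + b) * (e / (K + a + b + 1)) \<le> e" using K0 ab e by (simp add: field_simps)
    then show "\<bar>residual A B v\<bar> \<le> K * n + e" using step[of "e / (K + a + b + 1)"] e p by simp
  qed
  then show ?thesis by (simp add: K_def n_def)
qed

end

text \<open>Used to replace the data by their means: the error of this replacement is the
  oscillation.\<close>

lemma L2_norm_sq_le_two:
  assumes a: "a \<in> L2 T" and b: "b \<in> L2 T" and w: "w \<in> L2 T" "\<And>x. x \<in> T \<Longrightarrow> \<bar>w x\<bar> \<le> \<bar>a x\<bar> + \<bar>b x\<bar>"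
  shows "L2_norm_sq T w \<le> 2 * L2_norm_sq T a + 2 * L2_norm_sq T b"
proof -
  have "(LINT x|lebesgue_on T. (w x)\<^sup>2) \<le> (LINT x|lebesgue_on T. 2 * (a x)\<^sup>2 + 2 * (b x)\<^sup>2)"
  proof (rule integral_mono)
    fix x assume "x \<in> space (lebesgue_on T)"
    then have "\<bar>w x\<bar>\<^sup>2 \<le> (\<bar>a x\<bar> + \<bar>b x\<bar>)\<^sup>2" using w(2) by (intro power_mono) auto
    moreover have "0 \<le> (\<bar>a x\<bar> - \<bar>b x\<bar>)\<^sup>2" by simp
    ultimately show "(w x)\<^sup>2 \<le> 2 * (a x)\<^sup>2 + 2 * (b x)\<^sup>2" by (simp add: power2_sum power2_diff)
  qed (use L2D(2)[OF a] L2D(2)[OF b] L2D(2)[OF w(1)] in auto)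
  also have "\<dots> = 2 * L2_norm_sq T a + 2 * L2_norm_sq T b"
    using L2D(2)[OF a] L2D(2)[OF b] by (simp add: L2_norm_sq_def)
  finally show ?thesis by (simp add: L2_norm_sq_def)
qed

lemma L2_norm_sq_cong: "(\<And>x. x \<in> T \<Longrightarrow> u x = w x) \<Longrightarrow> L2_norm_sq T u = L2_norm_sq T w"
  unfolding L2_norm_sq_def by (rule Bochner_Integration.integral_cong) auto

section \<open>From scalar residuals to the Poisson-Nernst-Planck operator\<close>

context regular_mesh begin

lemma mesh_AE:
  assumes "\<And>T. T \<in> \<T> \<Longrightarrow> AE x in lebesgue_on T. P x"
  shows "AE x in lebesgue_on \<Omega>. P x"
proof -
  have "AE x in lebesgue. x \<in> T \<longrightarrow> P x" if "T \<in> \<T>" for T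
    using assms[OF that] mesh_triangle(4)[OF that] by (simp add: AE_restrict_space_iff)
  then have "AE x in lebesgue. \<forall>T\<in>\<T>. x \<in> T \<longrightarrow> P x"
    using finite_mesh by (intro AE_finite_allI) auto
  then have "AE x in lebesgue. x \<in> \<Omega> \<longrightarrow> P x"
  proof (rule eventually_mono, intro impI)
    fix x assume "\<forall>T\<in>\<T>. x \<in> T \<longrightarrow> P x" "x \<in> \<Omega>"
    moreover have "x \<in> \<Union>\<T>" using \<open>x \<in> \<Omega>\<close> mesh_Union closure_subset[of \<Omega>] by blast
    ultimately show "P x" by blast
  qed
  then show ?thesis using domain_sets by (subst AE_restrict_space_iff) auto
qed

text \<open>Products of discrete functions and their gradients are bounded on each of the finitely
  many compact triangles. For the drift flux this supplies the integrability that fails for general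
  functions in \<open>H1\<close>.\<close>

lemma piecewise_continuous_L2:
  assumes u: "u \<in> borel_measurable (lebesgue_on \<Omega>)"
    and uT: "\<And>T. T \<in> \<T> \<Longrightarrow> AE x in lebesgue_on T. u x = uT T x" "\<And>T. T \<in> \<T> \<Longrightarrow> continuous_on UNIV (uT T)"
  shows "u \<in> L2 \<Omega>"
proof -
  have "\<exists>M. \<forall>x\<in>T. \<bar>uT T x\<bar> \<le> M" if "T \<in> \<T>" for T
  proof -
    have "compact (uT T ` T)"
      by (rule compact_continuous_image[OF continuous_on_subset[OF uT(2)[OF that]] mesh_triangle(2)[OF that]]) simp
    then have "Elementary_Metric_Spaces.bounded (uT T ` T)" by (rule compact_imp_bounded)
    then show ?thesis by (auto simp: bounded_iff)
  qed
  then obtain M where M: "\<And>T x. T \<in> \<T> \<Longrightarrow> x \<in> T \<Longrightarrow> \<bar>uT T x\<bar> \<le> M T" by metis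
  have "AE x in lebesgue_on \<Omega>. \<bar>u x\<bar> \<le> (\<Sum>T\<in>\<T>. \<bar>M T\<bar>)"
  proof (rule mesh_AE)
    fix T assume T: "T \<in> \<T>"
    show "AE x in lebesgue_on T. \<bar>u x\<bar> \<le> (\<Sum>T\<in>\<T>. \<bar>M T\<bar>)"
    proof (rule AE_mp[OF uT(1)[OF T]], rule AE_I2, rule impI)
      fix x assume x: "x \<in> space (lebesgue_on T)" and e: "u x = uT T x"
      have "\<bar>u x\<bar> \<le> \<bar>M T\<bar>" using M[OF T, of x] x e by simp
      also have "\<dots> \<le> (\<Sum>T\<in>\<T>. \<bar>M T\<bar>)" using finite_mesh T by (intro member_le_sum) auto
      finally show "\<bar>u x\<bar> \<le> (\<Sum>T\<in>\<T>. \<bar>M T\<bar>)" .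
    qed
  qed
  then show ?thesis by (rule L2_bounded[OF domain_lmeasurable u])
qed

lemma zero_H10: "(\<lambda>x. 0) \<in> H10 \<Omega>" and zero_weak_grad: "is_weak_grad \<Omega> (\<lambda>x. 0) (\<lambda>x. 0)"
proof -
  have "0-lipschitz_on UNIV (\<lambda>x::point. 0::real)" by (rule lipschitz_onI) auto
  note * = lipschitz_in_H10[OF open_domain bounded this, of "\<lambda>x. 0"]
  show "(\<lambda>x. 0) \<in> H10 \<Omega>" by (rule *(1)) (auto intro!: exI[of _ 1])
  show "is_weak_grad \<Omega> (\<lambda>x. 0) (\<lambda>x. 0)" by (rule *(2)) (auto intro!: exI[of _ 1])
qed

text \<open>Testing the coupled system with two zero components isolates one scalar Galerkin
  equation.\<close>

lemma zero_V_h: "(\<lambda>x. 0) \<in> V_h \<Omega> \<T>"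
proof -
  have "piecewise_P1 \<T> (\<lambda>x. 0)"
    unfolding piecewise_P1_def by (intro ballI exI[of _ 0]) simp
  then show ?thesis using zero_H10 by (simp add: V_h_def)
qed

text \<open>Not immediate from the definition: the chosen weak gradient of the zero function
  vanishes only almost everywhere.\<close>

lemma residual_zero: "residual A B (\<lambda>x. 0) = 0"
proof -
  have "AE x in lebesgue_on \<Omega>. weak_grad \<Omega> (\<lambda>x. 0) x = 0"
    by (rule weak_grad_eq_AE[OF open_domain bounded zero_weak_grad])
  then have "AE x in lebesgue_on \<Omega>. A x \<bullet> weak_grad \<Omega> (\<lambda>x. 0) x + B x * 0 = 0"
    by (rule eventually_mono) simp
  then show ?thesis unfolding residual_def by (rule integral_eq_zero_AE)
qed

text \<open>Both parts carry a factor \<epsilon>, whose square root turns the gradient norm of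
  \<open>v\<close> into a part of \<open>norm_eps\<close>. The constant 3 is 2 from the elements,
  where 2 is enlarged to 4 before the root is taken, plus 1 from the edges.\<close>

lemma residual_norm_eps:
  assumes AT: "\<And>T x. T \<in> \<T> \<Longrightarrow> (AT T has_derivative AT' T) (at x)"
    and A: "\<And>T. T \<in> \<T> \<Longrightarrow> AE x in lebesgue_on T. A x = AT T x" "\<And>i. (\<lambda>x. A x $ i) \<in> L2 \<Omega>"
    and B: "B \<in> L2 \<Omega>"
    and orth: "\<And>v. v \<in> V_h \<Omega> \<T> \<Longrightarrow> residual A B v = 0"
    and d: "\<And>T. T \<in> \<T> \<Longrightarrow> d T = (\<Sum>i\<in>UNIV. AT' T (axis i 1) $ i)"
    and v: "v \<in> H10 \<Omega>" and \<epsilon>: "0 < \<epsilon>" and XY: "0 \<le> X" "0 \<le> Y"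
    and el: "element_part d B \<le> 2 * \<epsilon> * (X\<^sup>2 + Y\<^sup>2)" and ed: "edge_part AT \<le> \<epsilon> * X\<^sup>2"
  shows "\<bar>residual A B v\<bar> \<le> 3 * residual_const * (X + Y) * norm_eps \<epsilon> \<Omega> v"
proof -
  let ?n = "sqrt (LINT x|lebesgue_on \<Omega>. (norm (weak_grad \<Omega> v x))\<^sup>2)"
  have "X\<^sup>2 + Y\<^sup>2 \<le> (X + Y)\<^sup>2" using XY by (simp add: power2_sum)
  then have "2 * \<epsilon> * (X\<^sup>2 + Y\<^sup>2) \<le> 2 * \<epsilon> * (X + Y)\<^sup>2" using \<epsilon> by (intro mult_left_mono) auto
  also have "\<dots> \<le> 4 * (\<epsilon> * (X + Y)\<^sup>2)" using \<epsilon> by simp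
  finally have "element_part d B \<le> 4 * (\<epsilon> * (X + Y)\<^sup>2)" using el by linarith
  then have "sqrt (element_part d B) \<le> sqrt (4 * (\<epsilon> * (X + Y)\<^sup>2))" by (rule real_sqrt_le_mono)
  also have "\<dots> = 2 * (sqrt \<epsilon> * (X + Y))" using XY by (simp add: real_sqrt_mult)
  finally have 1: "sqrt (element_part d B) \<le> 2 * (sqrt \<epsilon> * (X + Y))" .
  have "sqrt (edge_part AT) \<le> sqrt (\<epsilon> * X\<^sup>2)" using ed by (rule real_sqrt_le_mono)
  also have "\<dots> = sqrt \<epsilon> * X" using XY by (simp add: real_sqrt_mult)
  also have "\<dots> \<le> sqrt \<epsilon> * (X + Y)" using XY \<epsilon> by (intro mult_left_mono) auto
  finally have 2: "sqrt (element_part d B) + sqrt (edge_part AT) \<le> 3 * (sqrt \<epsilon> * (X + Y))" using 1 by simp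
  have "\<bar>residual A B v\<bar> \<le> residual_const * (sqrt (element_part d B) + sqrt (edge_part AT)) * ?n"
    by (rule residual_bound[OF AT A B orth d v])
  also have "\<dots> \<le> residual_const * (3 * (sqrt \<epsilon> * (X + Y))) * ?n"
    using 2 residual_const_pos by (intro mult_right_mono mult_left_mono) auto
  also have "\<dots> = 3 * residual_const * (X + Y) * (sqrt \<epsilon> * ?n)" by simp
  also have "sqrt \<epsilon> * ?n \<le> norm_eps \<epsilon> \<Omega> v"
    unfolding norm_eps_def real_sqrt_mult[symmetric] L2_norm_sq_def by (intro real_sqrt_le_mono) simp
  then have "3 * residual_const * (X + Y) * (sqrt \<epsilon> * ?n) \<le> 3 * residual_const * (X + Y) * norm_eps \<epsilon> \<Omega> v"
    using residual_const_pos XY by (intro mult_left_mono) auto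
  finally show ?thesis .
qed

lemma L2_mean: "f \<in> L2 \<Omega> \<Longrightarrow> T \<in> \<T> \<Longrightarrow> (\<lambda>x. f x - c) \<in> L2 T" "T \<in> \<T> \<Longrightarrow> (\<lambda>x. c) \<in> L2 T"
proof -
  show c: "(\<lambda>x. c) \<in> L2 T" if "T \<in> \<T>"
    by (rule L2_continuous[OF compact_imp_bounded[OF mesh_triangle(2)[OF that]] mesh_triangle(4)[OF that]]) simp
  show "(\<lambda>x. f x - c) \<in> L2 T" if "f \<in> L2 \<Omega>" "T \<in> \<T>"
    by (rule L2_diff[OF mesh_L2[OF that] c[OF that(2)]])
qed

lemma edge_norm_sq_interior_cong:
  assumes E: "E \<in> interior_edges \<Omega> \<T>"
    and e: "\<And>P Q x. P \<in> \<T> \<Longrightarrow> Q \<in> \<T> \<Longrightarrow> edge_triangles E = (P, Q) \<Longrightarrow> x \<in> E \<Longrightarrow> x \<in> P \<Longrightarrow> x \<in> Q \<Longrightarrow> f x = g x"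
  shows "edge_norm_sq E f = edge_norm_sq E g"
proof -
  obtain P Q where PQ: "edge_triangles E = (P, Q)" by (cases "edge_triangles E")
  note t = interior_edge_triangles[OF E PQ]
  show ?thesis unfolding edge_norm_sq_eq
  proof (rule edge_integral_cong[OF t(4) mesh_simplex[OF t(1)]])
    fix x assume "x \<in> E"
    then show "(f x)\<^sup>2 = (g x)\<^sup>2"
      using e[OF t(1,2) PQ, of x] edge_of_imp_subset[OF t(4)] edge_of_imp_subset[OF t(5)] by (simp add: subset_iff)
  qed
qed

lemma L2_norm_sq_nonneg: "0 \<le> L2_norm_sq S u" and edge_norm_sq_nonneg: "0 \<le> edge_norm_sq E u"
  unfolding edge_norm_sq_eq by (simp_all add: L2_norm_sq_def edge_integral_nonneg)

lemma interior_edge_diameter: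
  assumes "E \<in> interior_edges \<Omega> \<T>"
  shows "0 \<le> diameter E"
proof -
  obtain T where T: "T \<in> \<T>" "E edge_of T" using assms by (auto simp: interior_edges_def)
  show ?thesis
    by (rule diameter_ge_0[OF bounded_subset[OF compact_imp_bounded[OF mesh_triangle(2)[OF T(1)]] edge_of_imp_subset[OF T(2)]]])
qed

lemma S_h_affine:
  assumes "u \<in> S_h \<Omega> \<T>"
  obtains a b where "\<forall>T\<in>\<T>. \<forall>x\<in>T. u x = a T + b T \<bullet> x"
proof -
  have "\<forall>T\<in>\<T>. \<exists>ab. \<forall>x\<in>T. u x = fst ab + snd ab \<bullet> x"
    using assms by (simp add: S_h_def piecewise_P1_def)
  from bchoice[OF this] obtain ab where ab: "\<forall>T\<in>\<T>. \<forall>x\<in>T. u x = fst (ab T) + snd (ab T) \<bullet> x" ..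
  show thesis by (rule that[of "\<lambda>T. fst (ab T)" "\<lambda>T. snd (ab T)"]) (rule ab)
qed

text \<open>The operator is the sum of three scalar residuals, each bounded by
  \<open>residual_norm_eps\<close>. Every component norm is at most the norm of the triple, so the
  factor 9 is three equations times the constant 3.\<close>

lemma pnp_bound:
  assumes \<epsilon>: "0 < \<epsilon>" "\<epsilon> \<le> 1" and f: "f1 \<in> L2 \<Omega>" "f2 \<in> L2 \<Omega>" "f3 \<in> L2 \<Omega>"
    and S: "p \<in> S_h \<Omega> \<T>" "n \<in> S_h \<Omega> \<T>" "\<psi> \<in> S_h \<Omega> \<T>"
    and galerkin: "\<And>v1 v2 v3. v1 \<in> V_h \<Omega> \<T> \<Longrightarrow> v2 \<in> V_h \<Omega> \<T> \<Longrightarrow> v3 \<in> V_h \<Omega> \<T> \<Longrightarrow>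
      pnp_operator \<epsilon> \<Omega> (f1, f2, f3) (p, n, \<psi>) (v1, v2, v3) = 0"
    and v: "v1 \<in> H10 \<Omega>" "v2 \<in> H10 \<Omega>" "v3 \<in> H10 \<Omega>"
  shows "\<bar>pnp_operator \<epsilon> \<Omega> (f1, f2, f3) (p, n, \<psi>) (v1, v2, v3)\<bar> \<le>
    9 * residual_const * (estimator \<epsilon> \<Omega> \<T> (f1, f2, f3) (p, n, \<psi>) + oscillation \<epsilon> \<T> (f1, f2, f3))
    * norm_eps3 \<epsilon> \<Omega> (v1, v2, v3)"
proof -
  let ?W = "weak_grad \<Omega>"
  define X where "X = estimator \<epsilon> \<Omega> \<T> (f1, f2, f3) (p, n, \<psi>)"
  define Y where "Y = oscillation \<epsilon> \<T> (f1, f2, f3)"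
  have H: "p \<in> H1 \<Omega>" "n \<in> H1 \<Omega>" "\<psi> \<in> H1 \<Omega>" using S by (auto simp: S_h_def)
  then have L: "p \<in> L2 \<Omega>" "n \<in> L2 \<Omega>" "\<psi> \<in> L2 \<Omega>" by (auto simp: H1_def)
  obtain ap bp where "\<forall>T\<in>\<T>. \<forall>x\<in>T. p x = ap T + bp T \<bullet> x" by (rule S_h_affine[OF S(1)])
  note P = this[rule_format]
  obtain an bn where "\<forall>T\<in>\<T>. \<forall>x\<in>T. n x = an T + bn T \<bullet> x" by (rule S_h_affine[OF S(2)])
  note N = this[rule_format]
  obtain aps bs where "\<forall>T\<in>\<T>. \<forall>x\<in>T. \<psi> x = aps T + bs T \<bullet> x" by (rule S_h_affine[OF S(3)])
  note \<Psi> = this[rule_format]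
  have W: "AE x in lebesgue_on T. ?W p x = bp T \<and> ?W n x = bn T \<and> ?W \<psi> x = bs T" if T: "T \<in> \<T>" for T
  proof -
    have "AE x in lebesgue_on T. ?W p x = bp T" by (rule weak_grad_mesh[OF H(1) T]) (rule P[OF T])
    moreover have "AE x in lebesgue_on T. ?W n x = bn T" by (rule weak_grad_mesh[OF H(2) T]) (rule N[OF T])
    moreover have "AE x in lebesgue_on T. ?W \<psi> x = bs T" by (rule weak_grad_mesh[OF H(3) T]) (rule \<Psi>[OF T])
    ultimately show ?thesis by (intro eventually_conj)
  qed
  have WL: "(\<lambda>x. ?W p x $ i) \<in> L2 \<Omega>" "(\<lambda>x. ?W n x $ i) \<in> L2 \<Omega>" "(\<lambda>x. ?W \<psi> x $ i) \<in> L2 \<Omega>" for i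
    by (rule is_weak_gradD(1)[OF H1_is_weak_grad], rule H)+
  define A1 where "A1 x = ?W p x + p x *\<^sub>R ?W \<psi> x" for x
  define A2 where "A2 x = ?W n x - n x *\<^sub>R ?W \<psi> x" for x
  define A3 where "A3 x = \<epsilon> *\<^sub>R ?W \<psi> x" for x
  \<comment> \<open>Affine fields on the whole plane that agree with the fluxes almost everywhere on
    \<open>T\<close>. Their divergences contain only the drift, because the gradients of the
    discrete functions are constant on \<open>T\<close>.\<close>
  define D1 where "D1 T x = bp T + (ap T + bp T \<bullet> x) *\<^sub>R bs T" for T x
  define D2 where "D2 T x = bn T - (an T + bn T \<bullet> x) *\<^sub>R bs T" for T x
  define D3 where "D3 T x = \<epsilon> *\<^sub>R bs T" for T and x :: point
  define B3 where "B3 x = n x - p x - f3 x" for x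
  have d1: "(D1 T has_derivative (\<lambda>e. (bp T \<bullet> e) *\<^sub>R bs T)) (at x)" for T x
    unfolding D1_def[abs_def] by (auto intro!: derivative_eq_intros)
  have d2: "(D2 T has_derivative (\<lambda>e. - ((bn T \<bullet> e) *\<^sub>R bs T))) (at x)" for T x
    unfolding D2_def[abs_def] by (auto intro!: derivative_eq_intros)
  have d3: "(D3 T has_derivative (\<lambda>e. 0)) (at x)" for T x
    unfolding D3_def[abs_def] by (rule has_derivative_const)
  have dv1: "bp T \<bullet> bs T = (\<Sum>i\<in>UNIV. ((bp T \<bullet> axis i 1) *\<^sub>R bs T) $ i)" for T
    by (simp add: inner_axis inner_vec_def[of "bp T" "bs T"])
  have dv2: "- (bn T \<bullet> bs T) = (\<Sum>i\<in>UNIV. (- ((bn T \<bullet> axis i 1) *\<^sub>R bs T)) $ i)" for T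
    by (simp add: inner_axis inner_vec_def[of "bn T" "bs T"] sum_negf)
  have dv3: "0 = (\<Sum>i\<in>UNIV. (0::point) $ i)"
    by (rule sum.neutral[symmetric]) simp
  have A1T: "AE x in lebesgue_on T. A1 x = D1 T x" if T: "T \<in> \<T>" for T
    by (rule AE_mp[OF W[OF T]], rule AE_I2) (simp add: A1_def D1_def P[OF T])
  have A2T: "AE x in lebesgue_on T. A2 x = D2 T x" if T: "T \<in> \<T>" for T
    by (rule AE_mp[OF W[OF T]], rule AE_I2) (simp add: A2_def D2_def N[OF T])
  have A3T: "AE x in lebesgue_on T. A3 x = D3 T x" if T: "T \<in> \<T>" for T
    by (rule AE_mp[OF W[OF T]], rule AE_I2) (simp add: A3_def D3_def)
  have m: "p \<in> borel_measurable (lebesgue_on \<Omega>)" "n \<in> borel_measurable (lebesgue_on \<Omega>)"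
    "(\<lambda>x. ?W p x $ i) \<in> borel_measurable (lebesgue_on \<Omega>)" "(\<lambda>x. ?W n x $ i) \<in> borel_measurable (lebesgue_on \<Omega>)"
    "(\<lambda>x. ?W \<psi> x $ i) \<in> borel_measurable (lebesgue_on \<Omega>)" for i
    using L2D(1)[OF L(1)] L2D(1)[OF L(2)] L2D(1)[OF WL(1)] L2D(1)[OF WL(2)] L2D(1)[OF WL(3)] by auto
  have A1L: "(\<lambda>x. A1 x $ i) \<in> L2 \<Omega>" for i
  proof (rule piecewise_continuous_L2[where uT = "\<lambda>T x. D1 T x $ i"])
    show "(\<lambda>x. A1 x $ i) \<in> borel_measurable (lebesgue_on \<Omega>)"
      unfolding A1_def using m by simp
    show "AE x in lebesgue_on T. A1 x $ i = D1 T x $ i" if "T \<in> \<T>" for T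
      using A1T[OF that] by (rule eventually_mono) simp
    show "continuous_on UNIV (\<lambda>x. D1 T x $ i)" for T unfolding D1_def by (intro continuous_intros)
  qed
  have A2L: "(\<lambda>x. A2 x $ i) \<in> L2 \<Omega>" for i
  proof (rule piecewise_continuous_L2[where uT = "\<lambda>T x. D2 T x $ i"])
    show "(\<lambda>x. A2 x $ i) \<in> borel_measurable (lebesgue_on \<Omega>)"
      unfolding A2_def using m by simp
    show "AE x in lebesgue_on T. A2 x $ i = D2 T x $ i" if "T \<in> \<T>" for T
      using A2T[OF that] by (rule eventually_mono) simp
    show "continuous_on UNIV (\<lambda>x. D2 T x $ i)" for T unfolding D2_def by (intro continuous_intros)
  qed
  have A3L: "(\<lambda>x. A3 x $ i) \<in> L2 \<Omega>" for i
    unfolding A3_def using L2_cmult[OF WL(3)] by simp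
  have BL: "(\<lambda>x. - f1 x) \<in> L2 \<Omega>" "(\<lambda>x. - f2 x) \<in> L2 \<Omega>" "B3 \<in> L2 \<Omega>"
    using L2_cmult[OF f(1), of "-1"] L2_cmult[OF f(2), of "-1"] L2_diff[OF L2_diff[OF L(2,1)] f(3)]
    by (simp_all add: B3_def[abs_def])
  have split: "pnp_operator \<epsilon> \<Omega> (f1, f2, f3) (p, n, \<psi>) (w1, w2, w3)
    = residual A1 (\<lambda>x. - f1 x) w1 + residual A2 (\<lambda>x. - f2 x) w2 + residual A3 B3 w3"
    if w: "w1 \<in> H1 \<Omega>" "w2 \<in> H1 \<Omega>" "w3 \<in> H1 \<Omega>" for w1 w2 w3
  proof -
    have i: "integrable (lebesgue_on \<Omega>) (\<lambda>x. A x \<bullet> ?W w x + B x * w x)"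
      if "\<And>i. (\<lambda>x. A x $ i) \<in> L2 \<Omega>" "B \<in> L2 \<Omega>" "w \<in> H1 \<Omega>" for A B w
    proof -
      have "w \<in> L2 \<Omega>" using that(3) by (simp add: H1_def)
      then show ?thesis
        by (intro Bochner_Integration.integrable_add L2_inner_integrable L2_mult_integrable that
            is_weak_gradD(1)[OF H1_is_weak_grad[OF that(3)]])
    qed
    have "pnp_integrand \<epsilon> \<Omega> (f1, f2, f3) (p, n, \<psi>) (w1, w2, w3) x =
      (A1 x \<bullet> ?W w1 x + - f1 x * w1 x) + (A2 x \<bullet> ?W w2 x + - f2 x * w2 x) + (A3 x \<bullet> ?W w3 x + B3 x * w3 x)" for x
      by (simp add: A1_def A2_def A3_def B3_def inner_add_left inner_diff_left algebra_simps)
    then have "pnp_integrand \<epsilon> \<Omega> (f1, f2, f3) (p, n, \<psi>) (w1, w2, w3) = (\<lambda>x.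
      (A1 x \<bullet> ?W w1 x + - f1 x * w1 x) + (A2 x \<bullet> ?W w2 x + - f2 x * w2 x) + (A3 x \<bullet> ?W w3 x + B3 x * w3 x))"
      by (rule ext)
    then show ?thesis
      unfolding pnp_operator_def residual_def
      using i[OF A1L BL(1) w(1)] i[OF A2L BL(2) w(2)] i[OF A3L BL(3) w(3)]
      by (simp only: Bochner_Integration.integral_add Bochner_Integration.integrable_add)
  qed
  have VH: "w \<in> H1 \<Omega>" if "w \<in> V_h \<Omega> \<T>" for w using that by (simp add: V_h_def H10_def)
  have o1: "residual A1 (\<lambda>x. - f1 x) w = 0" if "w \<in> V_h \<Omega> \<T>" for w
    using galerkin[OF that zero_V_h zero_V_h] split[OF VH[OF that] VH[OF zero_V_h] VH[OF zero_V_h]]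
    by (simp add: residual_zero)
  have o2: "residual A2 (\<lambda>x. - f2 x) w = 0" if "w \<in> V_h \<Omega> \<T>" for w
    using galerkin[OF zero_V_h that zero_V_h] split[OF VH[OF zero_V_h] VH[OF that] VH[OF zero_V_h]]
    by (simp add: residual_zero)
  have o3: "residual A3 B3 w = 0" if "w \<in> V_h \<Omega> \<T>" for w
    using galerkin[OF zero_V_h zero_V_h that] split[OF VH[OF zero_V_h] VH[OF zero_V_h] VH[OF that]]
    by (simp add: residual_zero)
  let ?et = "eta_elem_sq \<epsilon> (f1, f2, f3) (p, n, \<psi>)" and ?ee = "eta_edge_sq \<epsilon> \<T> (p, n, \<psi>)"
    and ?os = "osc_elem_sq \<epsilon> (f1, f2, f3)" and ?IE = "interior_edges \<Omega> \<T>"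
  have et0: "0 \<le> ?et T" for T using \<epsilon> by (simp add: L2_norm_sq_nonneg)
  have os0: "0 \<le> ?os T" for T using \<epsilon> by (simp add: L2_norm_sq_nonneg)
  have ee0: "0 \<le> ?ee E" if "E \<in> ?IE" for E
    using \<epsilon> interior_edge_diameter[OF that] by (simp add: edge_norm_sq_nonneg)
  have st: "0 \<le> (\<Sum>T\<in>\<T>. ?et T)" "0 \<le> (\<Sum>E\<in>?IE. ?ee E)" "0 \<le> (\<Sum>T\<in>\<T>. ?os T)"
    by (intro sum_nonneg et0 ee0 os0; assumption)+
  have X2: "X\<^sup>2 = (\<Sum>T\<in>\<T>. ?et T) + (\<Sum>E\<in>?IE. ?ee E)" and Y2: "Y\<^sup>2 = (\<Sum>T\<in>\<T>. ?os T)"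
    unfolding X_def Y_def estimator_def oscillation_def using st by simp_all
  have XY: "0 \<le> X" "0 \<le> Y"
    unfolding X_def Y_def estimator_def oscillation_def using st by simp_all
  have grads: "grad_on T p x = bp T" "grad_on T n x = bn T" "grad_on T \<psi> x = bs T" if T: "T \<in> \<T>" "x \<in> T" for T x
  proof -
    note g = grad_on_affine[OF mesh_triangle(1)[OF T(1)] mesh_triangle(6)[OF T(1)] T(2)]
    show "grad_on T p x = bp T" by (rule g) (rule P[OF T(1)])
    show "grad_on T n x = bn T" by (rule g) (rule N[OF T(1)])
    show "grad_on T \<psi> x = bs T" by (rule g) (rule \<Psi>[OF T(1)])
  qed
  have divs: "div_on T (\<lambda>y. p y *\<^sub>R grad_on T \<psi> y) x = bp T \<bullet> bs T" "div_on T (\<lambda>y. n y *\<^sub>R grad_on T \<psi> y) x = bn T \<bullet> bs T"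
    if T: "T \<in> \<T>" "x \<in> T" for T x
  proof -
    note g = div_on_affine[OF mesh_triangle(1)[OF T(1)] mesh_triangle(6)[OF T(1)] T(2)]
    show "div_on T (\<lambda>y. p y *\<^sub>R grad_on T \<psi> y) x = bp T \<bullet> bs T"
      by (rule g) (erule P[OF T(1)], erule \<Psi>[OF T(1)])
    show "div_on T (\<lambda>y. n y *\<^sub>R grad_on T \<psi> y) x = bn T \<bullet> bs T"
      by (rule g) (erule N[OF T(1)], erule \<Psi>[OF T(1)])
  qed
  have parts: "element_part d B \<le> 2 * \<epsilon> * (X\<^sup>2 + Y\<^sup>2)"
    if "\<And>T. T \<in> \<T> \<Longrightarrow> (diameter T)\<^sup>2 * L2_norm_sq T (\<lambda>x. B x - d T) \<le> 2 * \<epsilon> * (?et T + ?os T)" for d B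
  proof -
    have "element_part d B \<le> (\<Sum>T\<in>\<T>. 2 * \<epsilon> * (?et T + ?os T))"
      unfolding element_part_def by (intro sum_mono that)
    also have "\<dots> = 2 * \<epsilon> * ((\<Sum>T\<in>\<T>. ?et T) + (\<Sum>T\<in>\<T>. ?os T))"
      by (simp only: sum_distrib_left[symmetric] sum.distrib)
    also have "\<dots> \<le> 2 * \<epsilon> * (X\<^sup>2 + Y\<^sup>2)"
      unfolding X2 Y2 using st(2) \<epsilon>(1) by (intro mult_left_mono) auto
    finally show ?thesis .
  qed
  \<comment> \<open>Undoes the factor \<open>inverse \<epsilon>\<close> in the indicators and embeds
    one equation into the sum over all three; the factor 2 comes from splitting the data into mean
    and oscillation.\<close>
  have scale: "D\<^sup>2 * w \<le> 2 * \<epsilon> * (D\<^sup>2 * inverse \<epsilon> * (a + b + c) + D\<^sup>2 * inverse \<epsilon> * (a' + b' + c'))"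
    if "w \<le> 2 * e + 2 * e'" "e \<le> a + b + c" "e' \<le> a' + b' + c'" for D w a b c a' b' c' e e' :: real
  proof -
    have "D\<^sup>2 * w \<le> D\<^sup>2 * (2 * (a + b + c) + 2 * (a' + b' + c'))" using that by (intro mult_left_mono) auto
    also have "\<dots> = 2 * \<epsilon> * (D\<^sup>2 * inverse \<epsilon> * (a + b + c) + D\<^sup>2 * inverse \<epsilon> * (a' + b' + c'))"
      using \<epsilon>(1) by (simp add: field_simps)
    finally show ?thesis .
  qed
  note nn = L2_norm_sq_nonneg
  have el1: "element_part (\<lambda>T. bp T \<bullet> bs T) (\<lambda>x. - f1 x) \<le> 2 * \<epsilon> * (X\<^sup>2 + Y\<^sup>2)"
  proof (rule parts)
    fix T assume T: "T \<in> \<T>"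
    \<comment> \<open>Up to sign, the element residual is the computable residual with the mean of
      the data plus the deviation of the data from this mean.\<close>
    have "L2_norm_sq T (\<lambda>x. - f1 x - bp T \<bullet> bs T) \<le> 2 * L2_norm_sq T (\<lambda>x. bp T \<bullet> bs T + mean_on T f1) + 2 * L2_norm_sq T (\<lambda>x. f1 x - mean_on T f1)"
      by (rule L2_norm_sq_le_two[OF L2_mean(2)[OF T] L2_mean(1)[OF f(1) T] L2_mean(1)[OF BL(1) T]]) linarith
    also have "L2_norm_sq T (\<lambda>x. bp T \<bullet> bs T + mean_on T f1) = L2_norm_sq T (\<lambda>x. div_on T (\<lambda>y. p y *\<^sub>R grad_on T \<psi> y) x + mean_on T f1)"
      by (rule L2_norm_sq_cong) (simp add: divs[OF T])
    finally show "(diameter T)\<^sup>2 * L2_norm_sq T (\<lambda>x. - f1 x - bp T \<bullet> bs T) \<le> 2 * \<epsilon> * (?et T + ?os T)"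
      unfolding eta_elem_sq.simps osc_elem_sq.simps by (rule scale) (simp_all add: nn)
  qed
  have el2: "element_part (\<lambda>T. - (bn T \<bullet> bs T)) (\<lambda>x. - f2 x) \<le> 2 * \<epsilon> * (X\<^sup>2 + Y\<^sup>2)"
  proof (rule parts)
    fix T assume T: "T \<in> \<T>"
    have "L2_norm_sq T (\<lambda>x. - f2 x - - (bn T \<bullet> bs T)) \<le> 2 * L2_norm_sq T (\<lambda>x. bn T \<bullet> bs T - mean_on T f2) + 2 * L2_norm_sq T (\<lambda>x. f2 x - mean_on T f2)"
      by (rule L2_norm_sq_le_two[OF L2_mean(2)[OF T] L2_mean(1)[OF f(2) T] L2_mean(1)[OF BL(2) T]]) linarith
    also have "L2_norm_sq T (\<lambda>x. bn T \<bullet> bs T - mean_on T f2) = L2_norm_sq T (\<lambda>x. div_on T (\<lambda>y. n y *\<^sub>R grad_on T \<psi> y) x - mean_on T f2)"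
      by (rule L2_norm_sq_cong) (simp add: divs[OF T])
    finally show "(diameter T)\<^sup>2 * L2_norm_sq T (\<lambda>x. - f2 x - - (bn T \<bullet> bs T)) \<le> 2 * \<epsilon> * (?et T + ?os T)"
      unfolding eta_elem_sq.simps osc_elem_sq.simps by (rule scale) (simp_all add: nn)
  qed
  have el3: "element_part (\<lambda>T. 0) B3 \<le> 2 * \<epsilon> * (X\<^sup>2 + Y\<^sup>2)"
  proof (rule parts)
    fix T assume T: "T \<in> \<T>"
    have "L2_norm_sq T (\<lambda>x. B3 x - 0) \<le> 2 * L2_norm_sq T (\<lambda>x. n x - p x - mean_on T f3) + 2 * L2_norm_sq T (\<lambda>x. f3 x - mean_on T f3)"
      by (rule L2_norm_sq_le_two[OF L2_mean(1)[OF L2_diff[OF L(2,1)] T] L2_mean(1)[OF f(3) T] L2_mean(1)[OF BL(3) T]])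
        (simp add: B3_def)
    then show "(diameter T)\<^sup>2 * L2_norm_sq T (\<lambda>x. B3 x - 0) \<le> 2 * \<epsilon> * (?et T + ?os T)"
      unfolding eta_elem_sq.simps osc_elem_sq.simps by (rule scale) (simp_all add: nn)
  qed
  have edges: "edge_part D \<le> \<epsilon> * X\<^sup>2"
    if "\<And>E. E \<in> ?IE \<Longrightarrow> diameter E * edge_norm_sq E (jump \<T> E D) \<le> \<epsilon> * ?ee E" for D
  proof -
    have "edge_part D \<le> (\<Sum>E\<in>?IE. \<epsilon> * ?ee E)" unfolding edge_part_def by (intro sum_mono that)
    also have "\<dots> = \<epsilon> * (\<Sum>E\<in>?IE. ?ee E)" by (simp only: sum_distrib_left)
    also have "\<dots> \<le> \<epsilon> * X\<^sup>2" unfolding X2 using st(1) \<epsilon>(1) by (intro mult_left_mono) auto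
    finally show ?thesis .
  qed
  have escale: "D * w \<le> \<epsilon> * (D * inverse \<epsilon> * (a + b + c))" if "0 \<le> D" "w \<le> a + b + c" for D w a b c :: real
  proof -
    have "D * w \<le> D * (a + b + c)" using that by (intro mult_left_mono) auto
    also have "\<dots> = \<epsilon> * (D * inverse \<epsilon> * (a + b + c))" using \<epsilon>(1) by (simp add: field_simps)
    finally show ?thesis .
  qed
  have ed1: "edge_part D1 \<le> \<epsilon> * X\<^sup>2"
  proof (rule edges)
    fix E assume E: "E \<in> ?IE"
    have "edge_norm_sq E (jump \<T> E D1) = edge_norm_sq E (\<lambda>x. jump \<T> E (\<lambda>T. grad_on T p) x + jump \<T> E (\<lambda>T y. p y *\<^sub>R grad_on T \<psi> y) x)"
      by (rule edge_norm_sq_interior_cong[OF E])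
        (simp add: jump_eq grads D1_def P[symmetric] inner_add_left)
    then show "diameter E * edge_norm_sq E (jump \<T> E D1) \<le> \<epsilon> * ?ee E"
      unfolding eta_edge_sq.simps using interior_edge_diameter[OF E]
      by (intro escale) (simp_all add: edge_norm_sq_nonneg)
  qed
  have ed2: "edge_part D2 \<le> \<epsilon> * X\<^sup>2"
  proof (rule edges)
    fix E assume E: "E \<in> ?IE"
    have "edge_norm_sq E (jump \<T> E D2) = edge_norm_sq E (\<lambda>x. jump \<T> E (\<lambda>T. grad_on T n) x - jump \<T> E (\<lambda>T y. n y *\<^sub>R grad_on T \<psi> y) x)"
      by (rule edge_norm_sq_interior_cong[OF E])
        (simp add: jump_eq grads D2_def N[symmetric] inner_diff_left)
    then show "diameter E * edge_norm_sq E (jump \<T> E D2) \<le> \<epsilon> * ?ee E"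
      unfolding eta_edge_sq.simps using interior_edge_diameter[OF E]
      by (intro escale) (simp_all add: edge_norm_sq_nonneg)
  qed
  have ed3: "edge_part D3 \<le> \<epsilon> * X\<^sup>2"
  proof (rule edges)
    fix E assume E: "E \<in> ?IE"
    let ?j = "jump \<T> E (\<lambda>T. grad_on T \<psi>)"
    \<comment> \<open>The flux of the third equation carries \<epsilon>, while the third jump in the
      estimator does not. The surplus factor is the square of \<epsilon> and is discarded by
      \<open>\<epsilon> \<le> 1\<close>.\<close>
    have "edge_norm_sq E (jump \<T> E D3) = edge_norm_sq E (\<lambda>x. \<epsilon> * ?j x)"
      by (rule edge_norm_sq_interior_cong[OF E]) (simp add: jump_eq grads D3_def right_diff_distrib)
    also have "\<dots> = \<epsilon>\<^sup>2 * edge_norm_sq E ?j"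
      by (simp add: edge_norm_sq_def power_mult_distrib case_prod_unfold Let_def)
    also have "\<dots> \<le> 1 * edge_norm_sq E ?j"
      using \<epsilon> by (intro mult_right_mono edge_norm_sq_nonneg) (simp add: power_le_one)
    finally have "edge_norm_sq E (jump \<T> E D3) \<le> edge_norm_sq E ?j" by simp
    then show "diameter E * edge_norm_sq E (jump \<T> E D3) \<le> \<epsilon> * ?ee E"
      unfolding eta_edge_sq.simps using interior_edge_diameter[OF E]
        edge_norm_sq_nonneg[of E "\<lambda>x. jump \<T> E (\<lambda>T. grad_on T p) x + jump \<T> E (\<lambda>T y. p y *\<^sub>R grad_on T \<psi> y) x"]
        edge_norm_sq_nonneg[of E "\<lambda>x. jump \<T> E (\<lambda>T. grad_on T n) x - jump \<T> E (\<lambda>T y. n y *\<^sub>R grad_on T \<psi> y) x"]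
      by (intro escale) simp_all
  qed
  have r1: "\<bar>residual A1 (\<lambda>x. - f1 x) v1\<bar> \<le> 3 * residual_const * (X + Y) * norm_eps \<epsilon> \<Omega> v1"
    by (rule residual_norm_eps[OF d1 A1T A1L BL(1) o1 dv1 v(1) \<epsilon>(1) XY el1 ed1])
  have r2: "\<bar>residual A2 (\<lambda>x. - f2 x) v2\<bar> \<le> 3 * residual_const * (X + Y) * norm_eps \<epsilon> \<Omega> v2"
    by (rule residual_norm_eps[OF d2 A2T A2L BL(2) o2 dv2 v(2) \<epsilon>(1) XY el2 ed2])
  have r3: "\<bar>residual A3 B3 v3\<bar> \<le> 3 * residual_const * (X + Y) * norm_eps \<epsilon> \<Omega> v3"
    by (rule residual_norm_eps[OF d3 A3T A3L BL(3) o3 dv3 v(3) \<epsilon>(1) XY el3 ed3])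
  let ?C = "3 * residual_const * (X + Y)" and ?n = "norm_eps3 \<epsilon> \<Omega> (v1, v2, v3)"
  have C0: "?C \<ge> 0" using residual_const_pos XY by simp
  have n0: "0 \<le> norm_eps \<epsilon> \<Omega> w" for w unfolding norm_eps_def L2_norm_sq_def using \<epsilon>(1) by simp
  have le: "norm_eps \<epsilon> \<Omega> v1 \<le> ?n" "norm_eps \<epsilon> \<Omega> v2 \<le> ?n" "norm_eps \<epsilon> \<Omega> v3 \<le> ?n"
    by (auto intro!: real_le_rsqrt)
  have H1v: "v1 \<in> H1 \<Omega>" "v2 \<in> H1 \<Omega>" "v3 \<in> H1 \<Omega>" using v by (auto simp: H10_def)
  have "\<bar>pnp_operator \<epsilon> \<Omega> (f1, f2, f3) (p, n, \<psi>) (v1, v2, v3)\<bar>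
    \<le> ?C * norm_eps \<epsilon> \<Omega> v1 + ?C * norm_eps \<epsilon> \<Omega> v2 + ?C * norm_eps \<epsilon> \<Omega> v3"
    unfolding split[OF H1v] using r1 r2 r3 by linarith
  also have "\<dots> \<le> ?C * ?n + ?C * ?n + ?C * ?n"
    using C0 le by (intro add_mono mult_left_mono) auto
  also have "\<dots> = 9 * residual_const * (X + Y) * ?n" by (simp add: algebra_simps)
  finally show ?thesis by (simp only: X_def Y_def)
qed

end

theorem theorem2:
  fixes \<Omega> :: "(real ^ 2) set" and \<sigma> \<tau> :: real
  assumes "bounded \<Omega>" and "lipschitz_domain \<Omega>"
  shows "\<exists>C\<^sub>7>0. \<forall>\<T> \<epsilon> f g u u\<^sub>h.
    mesh_of \<Omega> \<T> \<longrightarrow> shape_regular \<sigma> \<T> \<longrightarrow> quasi_uniform \<tau> \<T> \<longrightarrow>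
    0 < mesh_size \<T> \<longrightarrow> mesh_size \<T> < 1 \<longrightarrow>
    0 < \<epsilon> \<longrightarrow> \<epsilon> \<le> 1 \<longrightarrow>
    f \<in> L2 \<Omega> \<times> L2 \<Omega> \<times> L2 \<Omega> \<longrightarrow> g \<in> H1 \<Omega> \<times> H1 \<Omega> \<times> H1 \<Omega> \<longrightarrow>
    pnp_weak_solution \<epsilon> \<Omega> f g u \<longrightarrow> pnp_fem_solution \<epsilon> \<Omega> \<T> f g u\<^sub>h \<longrightarrow>
    dual_norm_eps \<epsilon> \<Omega> (pnp_operator \<epsilon> \<Omega> f u\<^sub>h)
      \<le> ereal (C\<^sub>7 * (estimator \<epsilon> \<Omega> \<T> f u\<^sub>h + oscillation \<epsilon> \<T> f))"
proof -
  obtain \<kappa> where \<kappa>: "\<kappa> > 0"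
    "\<And>y h. y \<in> frontier \<Omega> \<Longrightarrow> 0 < h \<Longrightarrow> h < 1 \<Longrightarrow> \<exists>q. cball q (\<kappa> * h) \<subseteq> cball y h - \<Omega>"
  proof (rule lipschitz_domain_exterior_ball[OF assms(2,1)])
    fix k
    assume "0 < k" "\<And>y h. y \<in> frontier \<Omega> \<Longrightarrow> 0 < h \<Longrightarrow> h < 1 \<Longrightarrow> \<exists>q. cball q (k * h) \<subseteq> cball y h - \<Omega>"
    then show thesis by (rule that)
  qed
  \<comment> \<open>Outside its locale the constant takes only \<sigma>, \<tau> and \<kappa> as
    arguments, so it can be fixed before any mesh is given.\<close>
  define C where "C = 9 * regular_mesh.residual_const \<sigma> \<tau> \<kappa>"
  show ?thesis
  proof (intro exI[of _ "if C > 0 then C else 1"] conjI allI impI)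
    \<comment> \<open>Positivity of \<open>C\<close> is available only once a mesh interprets the
      locale; the alternative 1 keeps the witness positive beforehand.\<close>
    show "0 < (if C > 0 then C else 1)" by simp
    fix \<T> \<epsilon> f g u u\<^sub>h
    assume m: "mesh_of \<Omega> \<T>" "shape_regular \<sigma> \<T>" "quasi_uniform \<tau> \<T>" "0 < mesh_size \<T>" "mesh_size \<T> < 1"
      and \<epsilon>: "0 < \<epsilon>" "\<epsilon> \<le> (1::real)" and f: "f \<in> L2 \<Omega> \<times> L2 \<Omega> \<times> L2 \<Omega>"
      and fem: "pnp_fem_solution \<epsilon> \<Omega> \<T> f g u\<^sub>h"
    interpret regular_mesh \<Omega> \<T> \<sigma> \<tau> \<kappa>
      by unfold_locales (use assms m \<kappa> in auto)
    have C: "C > 0" "C = 9 * residual_const" using residual_const_pos by (simp_all add: C_def)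
    obtain f1 f2 f3 where f': "f = (f1, f2, f3)" by (cases f)
    obtain p n \<psi> where u': "u\<^sub>h = (p, n, \<psi>)" by (cases u\<^sub>h)
    have S: "p \<in> S_h \<Omega> \<T>" "n \<in> S_h \<Omega> \<T>" "\<psi> \<in> S_h \<Omega> \<T>"
      using fem unfolding pnp_fem_solution_def u' by auto
    have gal: "pnp_operator \<epsilon> \<Omega> (f1, f2, f3) (p, n, \<psi>) (v1, v2, v3) = 0"
      if "v1 \<in> V_h \<Omega> \<T>" "v2 \<in> V_h \<Omega> \<T>" "v3 \<in> V_h \<Omega> \<T>" for v1 v2 v3
      using fem that unfolding pnp_fem_solution_def u' f' by blast
    let ?R = "C * (estimator \<epsilon> \<Omega> \<T> f u\<^sub>h + oscillation \<epsilon> \<T> f)"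
    have "dual_norm_eps \<epsilon> \<Omega> (pnp_operator \<epsilon> \<Omega> f u\<^sub>h) \<le> ereal ?R"
      unfolding dual_norm_eps_def
    proof (rule SUP_least)
      fix v assume "v \<in> {v \<in> H10 \<Omega> \<times> H10 \<Omega> \<times> H10 \<Omega>. \<not> is_zero3 \<Omega> v}"
      then obtain v1 v2 v3 where v: "v = (v1, v2, v3)" "v1 \<in> H10 \<Omega>" "v2 \<in> H10 \<Omega>" "v3 \<in> H10 \<Omega>" by auto
      have b: "\<bar>pnp_operator \<epsilon> \<Omega> f u\<^sub>h v\<bar> \<le> ?R * norm_eps3 \<epsilon> \<Omega> v"
        unfolding C(2) f' u' v(1)
        using f by (intro pnp_bound \<epsilon> S gal v(2-)) (auto simp: f')
      have st: "0 \<le> eta_elem_sq \<epsilon> f u\<^sub>h T" "0 \<le> osc_elem_sq \<epsilon> f T" for T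
        using \<epsilon>(1) unfolding f' u' by (simp_all add: L2_norm_sq_nonneg)
      have se: "0 \<le> eta_edge_sq \<epsilon> \<T> u\<^sub>h E" if "E \<in> interior_edges \<Omega> \<T>" for E
        using \<epsilon>(1) interior_edge_diameter[OF that] unfolding u' by (simp add: edge_norm_sq_nonneg)
      have "0 \<le> estimator \<epsilon> \<Omega> \<T> f u\<^sub>h" "0 \<le> oscillation \<epsilon> \<T> f"
        unfolding estimator_def oscillation_def
        by (intro real_sqrt_ge_zero add_nonneg_nonneg sum_nonneg st se; assumption)+
      then have R0: "0 \<le> ?R" using C(1) by simp
      have n0: "0 \<le> norm_eps3 \<epsilon> \<Omega> v" unfolding v(1) by simp
      \<comment> \<open>If the norm of \<open>v\<close> is 0, the quotient is 0 by the convention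
        for division, and nonnegativity of the bound suffices.\<close>
      have "\<bar>pnp_operator \<epsilon> \<Omega> f u\<^sub>h v\<bar> / norm_eps3 \<epsilon> \<Omega> v \<le> ?R"
        using b R0 n0 by (cases "norm_eps3 \<epsilon> \<Omega> v = 0") (auto simp: divide_le_eq)
      then show "ereal (\<bar>pnp_operator \<epsilon> \<Omega> f u\<^sub>h v\<bar> / norm_eps3 \<epsilon> \<Omega> v) \<le> ereal ?R" by simp
    qed
    then show "dual_norm_eps \<epsilon> \<Omega> (pnp_operator \<epsilon> \<Omega> f u\<^sub>h)
      \<le> ereal ((if C > 0 then C else 1) * (estimator \<epsilon> \<Omega> \<T> f u\<^sub>h + oscillation \<epsilon> \<T> f))"
      using C(1) by simp
  qed
qed

end
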